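(* Let $K$ be an algebraically closed field of characteristic zero, let $G$ be a finite abelian group and let $n\ge 1$. Then the representation ring of the wreath product $S_n(G)=G^n\rtimes S_n$ over $K$ is generated as a ring by the classes of: the reflection representation of $S_n$ (regarded as a representation of $S_n(G)$ with $G^n$ acting trivially) and its exterior powers; and the $n$-dimensional representations $$\mathrm{Ind}_{G\times S_{n-1}(G)}^{S_n(G)}(\chi\boxtimes \mathbf{1}_{S_{n-1}(G)}),$$ for nontrivial characters $\chi:G\to K^\times$, and their exterior powers.
   Context: The representation ring of a finite group is the Grothendieck ring (with $\mathbb{Z}$ coefficients, unital) of its category of finite-dimensional $K$-representations, with multiplication given by tensor product over $K$. $S_m(G)=G\wr S_m=G^m\rtimes S_m$ is the wreath product, $G\times S_{n-1}(G)=S_1(G)\times S_{n-1}(G)\subset S_n(G)$ is the natural subgroup, and $\mathbf{1}_H$ is the trivial representation of $H$. The reflection representation of $S_n$ is the $(n-1)$-dimensional irreducible representation corresponding to the partition $(n-1,1)$, i.e. the quotient of the permutation representation $K^n$ by the trivial representation. *)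

theory Defs
  imports
    "HOL-Algebra.Algebra"
    "HOL-Algebra.Algebraic_Closure_Type"
    "HOL-Combinatorics.Permutations"
    "Jordan_Normal_Form.Matrix_Kernel"
begin

section \<open>Matrix representations\<close>

text \<open>
  A representation of \<open>H\<close> on \<open>K\<^sup>d\<close>, acting on column vectors.  Representations are functions on
  the whole type of group elements; two that agree on \<open>carrier H\<close> are isomorphic and hence have
  the same class in the representation ring below.
\<close>

definition is_rep :: "('h, 'm) monoid_scheme \<Rightarrow> nat \<Rightarrow> ('h \<Rightarrow> 'k::field mat) \<Rightarrow> bool" where
  "is_rep H d \<rho> \<longleftrightarrow> \<rho> \<in> hom H (units_of (ring_mat TYPE('k) d ()))"

definition reps :: "('h, 'm) monoid_scheme \<Rightarrow> ('h \<Rightarrow> 'k::field mat) set" where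
  "reps H = {\<rho>. \<exists>d. is_rep H d \<rho>}"

definition intertwiner ::
  "('h, 'm) monoid_scheme \<Rightarrow> ('h \<Rightarrow> 'k::field mat) \<Rightarrow> ('h \<Rightarrow> 'k mat) \<Rightarrow> 'k mat \<Rightarrow> bool" where
  "intertwiner H \<rho> \<sigma> A \<longleftrightarrow>
     A \<in> carrier_mat (dim_row (\<sigma> \<one>\<^bsub>H\<^esub>)) (dim_row (\<rho> \<one>\<^bsub>H\<^esub>)) \<and>
     (\<forall>g\<in>carrier H. A * \<rho> g = \<sigma> g * A)"

text \<open>Existence of an exact sequence \<open>0 \<rightarrow> \<rho> \<rightarrow> \<sigma> \<rightarrow> \<tau> \<rightarrow> 0\<close> of representations.\<close>

definition short_exact_reps ::
  "('h, 'm) monoid_scheme \<Rightarrow> ('h \<Rightarrow> 'k::field mat) \<Rightarrow> ('h \<Rightarrow> 'k mat) \<Rightarrow> ('h \<Rightarrow> 'k mat) \<Rightarrow> bool" where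
  "short_exact_reps H \<rho> \<sigma> \<tau> \<longleftrightarrow>
     \<rho> \<in> reps H \<and> \<sigma> \<in> reps H \<and> \<tau> \<in> reps H \<and>
     (\<exists>A B. intertwiner H \<rho> \<sigma> A \<and> intertwiner H \<sigma> \<tau> B \<and>
        inj_on ((*\<^sub>v) A) (carrier_vec (dim_col A)) \<and>
        (*\<^sub>v) A ` carrier_vec (dim_col A) = mat_kernel B \<and>
        (*\<^sub>v) B ` carrier_vec (dim_col B) = carrier_vec (dim_row B))"

definition triv_rep :: "'h \<Rightarrow> 'k::field mat" where
  "triv_rep = (\<lambda>_. 1\<^sub>m 1)"

text \<open>The matrix of \<open>A \<otimes> B\<close> in the basis \<open>e\<^sub>i \<otimes> f\<^sub>j\<close>, ordered lexicographically.\<close>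

definition kronecker_prod :: "'k::semiring_0 mat \<Rightarrow> 'k mat \<Rightarrow> 'k mat" where
  "kronecker_prod A B = mat (dim_row A * dim_row B) (dim_col A * dim_col B)
     (\<lambda>(i, j). A $$ (i div dim_row B, j div dim_col B) * B $$ (i mod dim_row B, j mod dim_col B))"

definition tensor_rep :: "('h \<Rightarrow> 'k::field mat) \<Rightarrow> ('h \<Rightarrow> 'k mat) \<Rightarrow> 'h \<Rightarrow> 'k mat" where
  "tensor_rep \<rho> \<sigma> g = kronecker_prod (\<rho> g) (\<sigma> g)"

text \<open>The external tensor product, a representation of \<open>H\<^sub>1 \<times>\<times> H\<^sub>2\<close>.\<close>

definition box_rep :: "('h1 \<Rightarrow> 'k::field mat) \<Rightarrow> ('h2 \<Rightarrow> 'k mat) \<Rightarrow> 'h1 \<times> 'h2 \<Rightarrow> 'k mat" where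
  "box_rep \<rho> \<sigma> = (\<lambda>(g, h). kronecker_prod (\<rho> g) (\<sigma> h))"

text \<open>
  The matrix of the \<open>k\<close>-th exterior power of \<open>A\<close>, in the basis of the
  \<open>e\<^bsub>S ! 0\<^esub> \<and> \<dots> \<and> e\<^bsub>S ! (k-1)\<^esub>\<close> for the strictly increasing lists \<open>S\<close> of length \<open>k\<close>: its entries are
  the \<open>k \<times> k\<close> minors of \<open>A\<close>.
\<close>

definition increasing_lists :: "nat \<Rightarrow> nat \<Rightarrow> nat list list" where
  "increasing_lists d k = filter (\<lambda>S. length S = k) (subseqs [0..<d])"

definition exterior_power_mat :: "nat \<Rightarrow> 'k::comm_ring_1 mat \<Rightarrow> 'k mat" where
  "exterior_power_mat k A =
     (let R = increasing_lists (dim_row A) k; C = increasing_lists (dim_col A) k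
      in mat (length R) (length C) (\<lambda>(a, b). det (mat k k (\<lambda>(i, j). A $$ (R ! a ! i, C ! b ! j)))))"

definition exterior_power_rep :: "nat \<Rightarrow> ('h \<Rightarrow> 'k::field mat) \<Rightarrow> 'h \<Rightarrow> 'k mat" where
  "exterior_power_rep k \<rho> g = exterior_power_mat k (\<rho> g)"

text \<open>
  The representation of \<open>H\<close> induced from a representation \<open>\<rho>\<close> of a subgroup \<open>L\<close> of finite index:
  with \<open>t\<^sub>0, \<dots>, t\<^bsub>m-1\<^esub>\<close> representatives of the left cosets of \<open>L\<close>, the matrix of \<open>g\<close> in the basis
  \<open>t\<^sub>i \<otimes> e\<^sub>a\<close> of \<open>K[H] \<otimes>\<^bsub>K[L]\<^esub> K\<^sup>d\<close> consists of the blocks \<open>\<rho> (t\<^sub>i\<^sup>-\<^sup>1 g t\<^sub>j)\<close>, read as \<open>0\<close> where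
  \<open>t\<^sub>i\<^sup>-\<^sup>1 g t\<^sub>j\<close> is not in \<open>L\<close>.  Its isomorphism class does not depend on the representatives.
\<close>

definition left_transversal :: "('h, 'm) monoid_scheme \<Rightarrow> 'h set \<Rightarrow> 'h list \<Rightarrow> bool" where
  "left_transversal H L ts \<longleftrightarrow>
     distinct ts \<and> set ts \<subseteq> carrier H \<and> (\<forall>x\<in>carrier H. \<exists>!t. t \<in> set ts \<and> x \<in> t <#\<^bsub>H\<^esub> L)"

definition induced_rep ::
  "('h, 'm) monoid_scheme \<Rightarrow> 'h set \<Rightarrow> ('h \<Rightarrow> 'k::field mat) \<Rightarrow> 'h \<Rightarrow> 'k mat" where
  "induced_rep H L \<rho> g =
     (let ts = (SOME ts. left_transversal H L ts);
          d = dim_row (\<rho> \<one>\<^bsub>H\<^esub>)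
      in mat (length ts * d) (length ts * d)
           (\<lambda>(i, j). let x = inv\<^bsub>H\<^esub> (ts ! (i div d)) \<otimes>\<^bsub>H\<^esub> g \<otimes>\<^bsub>H\<^esub> (ts ! (j div d))
                     in if x \<in> L then \<rho> x $$ (i mod d, j mod d) else 0))"


section \<open>The representation ring\<close>

text \<open>
  The free abelian group on the representations, with the tensor product extended bilinearly.
  The representation ring is its quotient by the subgroup of relations \<open>[\<sigma>] = [\<rho>] + [\<tau>]\<close> for the
  exact sequences \<open>0 \<rightarrow> \<rho> \<rightarrow> \<sigma> \<rightarrow> \<tau> \<rightarrow> 0\<close>.
\<close>

definition free_rep_ring ::
  "'k::field itself \<Rightarrow> ('h, 'm) monoid_scheme \<Rightarrow> (('h \<Rightarrow> 'k mat) \<Rightarrow>\<^sub>0 int) ring" where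
  "free_rep_ring _ H =
     \<lparr>carrier = carrier (free_Abelian_group (reps H)),
      monoid.mult = (\<lambda>x y. frag_extend (\<lambda>\<rho>. frag_extend (\<lambda>\<sigma>. frag_of (tensor_rep \<rho> \<sigma>)) y) x),
      one = frag_of triv_rep, ring.zero = 0, ring.add = (+)\<rparr>"

definition rep_relations ::
  "'k::field itself \<Rightarrow> ('h, 'm) monoid_scheme \<Rightarrow> (('h \<Rightarrow> 'k mat) \<Rightarrow>\<^sub>0 int) set" where
  "rep_relations _ H =
     generate (free_Abelian_group (reps H))
       {frag_of \<sigma> - frag_of \<rho> - frag_of \<tau> | \<rho> \<sigma> \<tau>. short_exact_reps H \<rho> \<sigma> \<tau>}"

definition rep_ring ::
  "'k::field itself \<Rightarrow> ('h, 'm) monoid_scheme \<Rightarrow> (('h \<Rightarrow> 'k mat) \<Rightarrow>\<^sub>0 int) set ring" where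
  "rep_ring K H = free_rep_ring K H Quot rep_relations K H"

definition rep_class ::
  "('h, 'm) monoid_scheme \<Rightarrow> ('h \<Rightarrow> 'k::field mat) \<Rightarrow> (('h \<Rightarrow> 'k mat) \<Rightarrow>\<^sub>0 int) set" where
  "rep_class H \<rho> = rep_relations TYPE('k) H +>\<^bsub>free_rep_ring TYPE('k) H\<^esub> frag_of \<rho>"

definition classes_of_exterior_powers ::
  "('h, 'm) monoid_scheme \<Rightarrow> ('h \<Rightarrow> 'k::field mat) \<Rightarrow> (('h \<Rightarrow> 'k mat) \<Rightarrow>\<^sub>0 int) set set" where
  "classes_of_exterior_powers H \<rho> =
     insert (rep_class H \<rho>) {rep_class H (exterior_power_rep k \<rho>) | k. True}"


section \<open>Wreath products\<close>

definition sym_group_on :: "nat set \<Rightarrow> (nat \<Rightarrow> nat) monoid" where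
  "sym_group_on I = \<lparr>carrier = {\<sigma>. \<sigma> permutes I}, monoid.mult = (\<circ>), one = id\<rparr>"

text \<open>
  The group \<open>G\<^sup>I \<rtimes> Sym(I)\<close>, where \<open>\<sigma>\<close> acts on \<open>G\<^sup>I\<close> by \<open>(\<sigma> \<cdot> f) i = f (\<sigma>\<^sup>-\<^sup>1 i)\<close>.
  The group \<open>S\<^sub>n(G)\<close> is obtained for \<open>I = {..<n}\<close>.
\<close>

definition wreath ::
  "('g, 'm) monoid_scheme \<Rightarrow> nat set \<Rightarrow> ((nat \<Rightarrow> 'g) \<times> (nat \<Rightarrow> nat)) monoid" where
  "wreath G I =
     \<lparr>carrier = (I \<rightarrow>\<^sub>E carrier G) \<times> carrier (sym_group_on I),
      monoid.mult = (\<lambda>(f, \<sigma>) (g, \<tau>).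
        ((\<lambda>i\<in>I. f i \<otimes>\<^bsub>G\<^esub> g (Hilbert_Choice.inv \<sigma> i)), \<sigma> \<otimes>\<^bsub>sym_group_on I\<^esub> \<tau>)),
      one = ((\<lambda>i\<in>I. \<one>\<^bsub>G\<^esub>), \<one>\<^bsub>sym_group_on I\<^esub>)\<rparr>"

text \<open>
  The embedding of \<open>G \<times> S\<^bsub>n-1\<^esub>(G)\<close> into \<open>S\<^sub>n(G)\<close>, with \<open>G\<close> as the coordinate \<open>0\<close> and
  \<open>S\<^bsub>n-1\<^esub>(G)\<close> realised on the remaining letters \<open>{1..<n}\<close>.
\<close>

definition wreath_embed ::
  "'g \<times> ((nat \<Rightarrow> 'g) \<times> (nat \<Rightarrow> nat)) \<Rightarrow> (nat \<Rightarrow> 'g) \<times> (nat \<Rightarrow> nat)" where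
  "wreath_embed = (\<lambda>(a, f, \<sigma>). (f(0 := a), \<sigma>))"

text \<open>
  The quotient of the permutation representation by the line through \<open>e\<^sub>0 + \<dots> + e\<^bsub>n-1\<^esub>\<close>, in the
  basis formed by the images of \<open>e\<^sub>0, \<dots>, e\<^bsub>n-2\<^esub>\<close>.
\<close>

definition permutation_rep :: "nat \<Rightarrow> (nat \<Rightarrow> nat) \<Rightarrow> 'k::field mat" where
  "permutation_rep n \<sigma> = mat n n (\<lambda>(i, j). if \<sigma> j = i then 1 else 0)"

definition reflection_rep :: "nat \<Rightarrow> (nat \<Rightarrow> nat) \<Rightarrow> 'k::field mat" where
  "reflection_rep n \<sigma> =
     mat (n - 1) (n - 1) (\<lambda>(i, j). if \<sigma> j = n - 1 then - 1 else if \<sigma> j = i then 1 else 0)"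

text \<open>Characters \<open>G \<rightarrow> K\<^sup>\<times>\<close>.\<close>

definition characters :: "('g, 'm) monoid_scheme \<Rightarrow> ('g \<Rightarrow> 'k::field) set" where
  "characters G = hom G (units_of (ring_of_type_algebra :: 'k ring))"

definition character_rep :: "('g \<Rightarrow> 'k::field) \<Rightarrow> 'g \<Rightarrow> 'k mat" where
  "character_rep \<chi> a = mat 1 1 (\<lambda>_. \<chi> a)"

definition wreath_induced_rep ::
  "('g, 'm) monoid_scheme \<Rightarrow> nat \<Rightarrow> ('g \<Rightarrow> 'k::field) \<Rightarrow> (nat \<Rightarrow> 'g) \<times> (nat \<Rightarrow> nat) \<Rightarrow> 'k mat" where
  "wreath_induced_rep G n \<chi> =
     (let L = carrier (G \<times>\<times> wreath G {1..<n})
      in induced_rep (wreath G {..<n}) (wreath_embed ` L)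
           (box_rep (character_rep \<chi>) triv_rep \<circ> inv_into L wreath_embed))"

section \<open>The reflection representation as a quotient\<close>

text \<open>
  \<^const>\<open>reflection_rep\<close> is given by explicit matrices; the last lemma of this section shows that
  it is a representation of \<open>S\<^sub>n\<close>, namely the quotient of the permutation representation by the
  trivial one.
\<close>

lemma is_repI:
  fixes \<rho> :: "'h \<Rightarrow> 'k::field mat"
  assumes "group H" and "\<And>g. g \<in> carrier H \<Longrightarrow> \<rho> g \<in> carrier_mat d d"
    and "\<And>g h. g \<in> carrier H \<Longrightarrow> h \<in> carrier H \<Longrightarrow> \<rho> (g \<otimes>\<^bsub>H\<^esub> h) = \<rho> g * \<rho> h"
    and "\<rho> \<one>\<^bsub>H\<^esub> = 1\<^sub>m d"
  shows "is_rep H d \<rho>"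
proof -
  interpret group H by fact
  have "\<rho> g \<in> Units (ring_mat TYPE('k) d ())" if g: "g \<in> carrier H" for g
  proof -
    have "\<rho> (inv\<^bsub>H\<^esub> g) * \<rho> g = 1\<^sub>m d" "\<rho> g * \<rho> (inv\<^bsub>H\<^esub> g) = 1\<^sub>m d"
      using assms(3)[of "inv\<^bsub>H\<^esub> g" g] assms(3)[of g "inv\<^bsub>H\<^esub> g"] assms(4) g by auto
    then show ?thesis
      using assms(2)[OF g] assms(2)[of "inv\<^bsub>H\<^esub> g"] g by (auto simp: Units_def ring_mat_def)
  qed
  then show ?thesis
    using assms(3) by (auto simp: is_rep_def hom_def units_of_def ring_mat_def)
qed

lemma group_sym_group: "group (sym_group_on I)"
proof (rule groupI)
  show "\<exists>y\<in>carrier (sym_group_on I). y \<otimes>\<^bsub>sym_group_on I\<^esub> x = \<one>\<^bsub>sym_group_on I\<^esub>" if "x \<in> carrier (sym_group_on I)" for x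
    by (rule bexI[of _ "Hilbert_Choice.inv x"])
      (use that in \<open>auto simp: sym_group_on_def permutes_inv_o permutes_inv\<close>)
qed (auto simp: sym_group_on_def permutes_compose permutes_id comp_assoc)

lemma permutation_rep_mult:
  assumes "\<sigma> permutes {..<n}" "\<tau> permutes {..<n}"
  shows "permutation_rep n (\<sigma> \<circ> \<tau>) = (permutation_rep n \<sigma> * permutation_rep n \<tau> :: 'k::field mat)"
proof (rule eq_matI)
  fix i j assume "i < dim_row (permutation_rep n \<sigma> * permutation_rep n \<tau> :: 'k mat)"
    "j < dim_col (permutation_rep n \<sigma> * permutation_rep n \<tau> :: 'k mat)"
  then have ij: "i < n" "j < n" by (auto simp: permutation_rep_def)
  have t: "\<tau> j < n" using permutes_in_image[OF assms(2), of j] ij by auto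
  have "(permutation_rep n \<sigma> * permutation_rep n \<tau> :: 'k mat) $$ (i, j) =
        (\<Sum>k<n. (if \<sigma> k = i then 1 else 0) * (if \<tau> j = k then 1 else 0))"
    using ij by (simp add: permutation_rep_def times_mat_def scalar_prod_def lessThan_atLeast0)
  also have "\<dots> = (\<Sum>k<n. if k = \<tau> j then (if \<sigma> (\<tau> j) = i then 1 else 0) else 0)"
    by (rule sum.cong) auto
  also have "\<dots> = (if \<sigma> (\<tau> j) = i then 1 else 0)"
    using t by simp
  finally show "permutation_rep n (\<sigma> \<circ> \<tau>) $$ (i, j) = (permutation_rep n \<sigma> * permutation_rep n \<tau> :: 'k mat) $$ (i, j)"
    using ij by (simp add: permutation_rep_def)
qed (auto simp: permutation_rep_def)

lemma reflection_rep_quotient: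
  assumes "n \<ge> 1"
  shows "short_exact_reps (sym_group_on {..<n}) triv_rep (permutation_rep n :: _ \<Rightarrow> 'k::field mat) (reflection_rep n)"
proof -
  define A :: "'k mat" where "A = mat n 1 (\<lambda>_. 1)"
  define B :: "'k mat" where
    "B = mat (n - 1) n (\<lambda>(i, j). if j = n - 1 then - 1 else if j = i then 1 else 0)"
  define C :: "'k mat" where "C = mat n (n - 1) (\<lambda>(i, j). if i = j then 1 else 0)"
  have dims [simp]: "A \<in> carrier_mat n 1" "B \<in> carrier_mat (n - 1) n" "C \<in> carrier_mat n (n - 1)"
    "permutation_rep n \<sigma> \<in> (carrier_mat n n :: 'k mat set)"
    "reflection_rep n \<sigma> \<in> (carrier_mat (n - 1) (n - 1) :: 'k mat set)" for \<sigma>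
    by (simp_all add: A_def B_def C_def permutation_rep_def reflection_rep_def)
  interpret S: group "sym_group_on {..<n}" by (rule group_sym_group)
  have BC: "B * C = 1\<^sub>m (n - 1)"
  proof (rule eq_matI)
    fix i j assume "i < dim_row (1\<^sub>m (n - 1) :: 'k mat)" "j < dim_col (1\<^sub>m (n - 1) :: 'k mat)"
    then have ij: "i < n - 1" "j < n - 1" by auto
    have "(B * C) $$ (i, j) =
        (\<Sum>k<n. (if k = n - 1 then - 1 else if k = i then 1 else 0) * (if k = j then 1 else 0))"
      using ij by (simp add: B_def C_def times_mat_def scalar_prod_def lessThan_atLeast0)
    also have "\<dots> = (\<Sum>k<n. if k = j then (if j = i then 1 else 0) else 0)"
      using ij by (intro sum.cong) auto
    also have "\<dots> = (1\<^sub>m (n - 1) :: 'k mat) $$ (i, j)"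
      using ij by auto
    finally show "(B * C) $$ (i, j) = (1\<^sub>m (n - 1) :: 'k mat) $$ (i, j)" .
  qed (auto simp: B_def C_def)
  have BP: "B * permutation_rep n \<sigma> = reflection_rep n \<sigma> * B" if \<sigma>: "\<sigma> permutes {..<n}" for \<sigma>
  proof (rule eq_matI)
    fix i j assume "i < dim_row (reflection_rep n \<sigma> * B)" "j < dim_col (reflection_rep n \<sigma> * B)"
    then have ij: "i < n - 1" "j < n" by (auto simp: B_def reflection_rep_def)
    let ?b = "\<lambda>k. if k = n - 1 then - 1 else if k = i then 1 else (0 :: 'k)"
    have s: "\<sigma> j < n" using permutes_in_image[OF \<sigma>, of j] ij by auto
    have L: "(B * permutation_rep n \<sigma>) $$ (i, j) = ?b (\<sigma> j)"
    proof -
      have "(B * permutation_rep n \<sigma>) $$ (i, j) = (\<Sum>k<n. ?b k * (if \<sigma> j = k then 1 else 0))"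
        using ij by (simp add: B_def permutation_rep_def times_mat_def scalar_prod_def lessThan_atLeast0)
      also have "\<dots> = (\<Sum>k<n. if k = \<sigma> j then ?b (\<sigma> j) else 0)"
        by (intro sum.cong) auto
      finally have "(B * permutation_rep n \<sigma>) $$ (i, j) = (\<Sum>k<n. if k = \<sigma> j then ?b (\<sigma> j) else 0)" .
      then show ?thesis using s by simp
    qed
    have sumb: "(\<Sum>k<n. ?b (\<sigma> k)) = 0"
    proof -
      have "(\<Sum>k<n. ?b (\<sigma> k)) = (\<Sum>k<n. ?b k)"
        using sum.permute[OF \<sigma>, of ?b] by (simp add: comp_def)
      also have "\<dots> = (\<Sum>k<n. (if k = n - 1 then - 1 else 0) + (if k = i then 1 else 0))"
        using ij by (intro sum.cong) auto
      also have "\<dots> = 0" using ij by (subst sum.distrib) simp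
      finally show ?thesis .
    qed
    have R: "(reflection_rep n \<sigma> * B) $$ (i, j) = ?b (\<sigma> j)"
    proof -
      have "(reflection_rep n \<sigma> * B) $$ (i, j) =
          (\<Sum>k<n-1. ?b (\<sigma> k) * (if j = n - 1 then - 1 else if j = k then 1 else 0))"
        using ij by (simp add: B_def reflection_rep_def times_mat_def scalar_prod_def lessThan_atLeast0)
      also have "\<dots> = ?b (\<sigma> j)"
      proof (cases "j = n - 1")
        case True
        have "(\<Sum>k<n. ?b (\<sigma> k)) = (\<Sum>k<n-1. ?b (\<sigma> k)) + ?b (\<sigma> (n - 1))"
          using assms by (cases n) simp_all
        then have "(\<Sum>k<n-1. ?b (\<sigma> k)) + ?b (\<sigma> (n - 1)) = 0"
          unfolding sumb by (rule sym)
        then have "(\<Sum>k<n-1. ?b (\<sigma> k)) = - ?b (\<sigma> j)"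
          unfolding True by (rule eq_neg_iff_add_eq_0[THEN iffD2])
        moreover have "(\<Sum>k<n-1. ?b (\<sigma> k) * (if j = n - 1 then - 1 else if j = k then 1 else 0)) = - (\<Sum>k<n-1. ?b (\<sigma> k))"
          unfolding sum_negf[symmetric] using True by (intro sum.cong) auto
        ultimately show ?thesis by (simp only: minus_minus)
      next
        case False
        have "(\<Sum>k<n-1. ?b (\<sigma> k) * (if j = n - 1 then - 1 else if j = k then 1 else 0)) =
            (\<Sum>k<n-1. if k = j then ?b (\<sigma> j) else 0)"
          using False by (intro sum.cong) auto
        moreover have "j < n - 1" using False ij by linarith
        ultimately show ?thesis by simp
      qed
      finally show ?thesis .
    qed
    show "(B * permutation_rep n \<sigma>) $$ (i, j) = (reflection_rep n \<sigma> * B) $$ (i, j)"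
      using L R by simp
  qed (auto simp: B_def reflection_rep_def permutation_rep_def)
  have Rmult: "reflection_rep n (\<sigma> \<circ> \<tau>) = (reflection_rep n \<sigma> * reflection_rep n \<tau> :: 'k mat)"
    if s: "\<sigma> permutes {..<n}" "\<tau> permutes {..<n}" for \<sigma> \<tau>
  proof -
    let ?P = "permutation_rep n :: _ \<Rightarrow> 'k mat" and ?R = "reflection_rep n :: _ \<Rightarrow> 'k mat"
    have st: "\<sigma> \<circ> \<tau> permutes {..<n}" using s by (simp add: permutes_compose)
    have "?R (\<sigma> \<circ> \<tau>) = ?R (\<sigma> \<circ> \<tau>) * (B * C)"
      unfolding BC by (rule right_mult_one_mat[OF dims(5), symmetric])
    also have "\<dots> = ?R (\<sigma> \<circ> \<tau>) * B * C"
      by (rule assoc_mult_mat[symmetric, OF dims(5) dims(2) dims(3)])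
    also have "\<dots> = B * (?P \<sigma> * ?P \<tau>) * C"
      unfolding BP[OF st, symmetric] permutation_rep_mult[OF s] ..
    also have "\<dots> = B * ?P \<sigma> * ?P \<tau> * C"
      using assoc_mult_mat[OF dims(2) dims(4) dims(4)] by simp
    also have "\<dots> = ?R \<sigma> * B * ?P \<tau> * C"
      unfolding BP[OF s(1)] ..
    also have "\<dots> = ?R \<sigma> * (B * ?P \<tau>) * C"
      using assoc_mult_mat[OF dims(5) dims(2) dims(4)] by simp
    also have "\<dots> = ?R \<sigma> * (?R \<tau> * B) * C"
      unfolding BP[OF s(2)] ..
    also have "\<dots> = ?R \<sigma> * ?R \<tau> * B * C"
      using assoc_mult_mat[OF dims(5) dims(5) dims(2)] by simp
    also have "\<dots> = ?R \<sigma> * ?R \<tau> * (B * C)"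
      by (rule assoc_mult_mat[OF mult_carrier_mat[OF dims(5) dims(5)] dims(2) dims(3)])
    also have "\<dots> = ?R \<sigma> * ?R \<tau>"
      unfolding BC by (rule right_mult_one_mat[OF mult_carrier_mat[OF dims(5) dims(5)]])
    finally show ?thesis .
  qed
  have P1: "permutation_rep n id = (1\<^sub>m n :: 'k mat)" and R1: "reflection_rep n id = (1\<^sub>m (n - 1) :: 'k mat)"
    by (auto simp: permutation_rep_def reflection_rep_def intro!: eq_matI)
  have "is_rep (sym_group_on {..<n}) 1 (triv_rep :: _ \<Rightarrow> 'k mat)"
    by (rule is_repI) (auto simp: triv_rep_def S.group_axioms)
  moreover have "is_rep (sym_group_on {..<n}) n (permutation_rep n :: _ \<Rightarrow> 'k mat)"
    by (rule is_repI) (rule S.group_axioms, rule dims, auto simp: sym_group_on_def permutation_rep_mult P1)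
  moreover have "is_rep (sym_group_on {..<n}) (n - 1) (reflection_rep n :: _ \<Rightarrow> 'k mat)"
    by (rule is_repI) (rule S.group_axioms, rule dims, auto simp: sym_group_on_def Rmult R1 simp del: One_nat_def)
  moreover have "intertwiner (sym_group_on {..<n}) triv_rep (permutation_rep n) A"
  proof -
    have "A * 1\<^sub>m 1 = permutation_rep n \<sigma> * A" if \<sigma>: "\<sigma> permutes {..<n}" for \<sigma>
    proof (rule eq_matI)
      fix i j assume "i < dim_row (permutation_rep n \<sigma> * A)" "j < dim_col (permutation_rep n \<sigma> * A)"
      then have ij: "i < n" "j < 1" by (auto simp: A_def permutation_rep_def)
      have "(permutation_rep n \<sigma> * A) $$ (i, j) = (\<Sum>k<n. if \<sigma> k = i then 1 else 0)"
        using ij by (simp add: A_def permutation_rep_def times_mat_def scalar_prod_def lessThan_atLeast0)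
      also have "\<dots> = (\<Sum>k<n. if k = i then 1 else 0)"
        using sum.permute[OF \<sigma>, of "\<lambda>k. if k = i then 1 else (0::'k)"] by (simp add: comp_def)
      also have "\<dots> = (A * 1\<^sub>m 1) $$ (i, j)"
        using ij right_mult_one_mat[OF dims(1)] by (simp add: A_def)
      finally show "(A * 1\<^sub>m 1) $$ (i, j) = (permutation_rep n \<sigma> * A) $$ (i, j)" by simp
    qed (auto simp: A_def permutation_rep_def)
    then show ?thesis
      by (auto simp: intertwiner_def sym_group_on_def triv_rep_def P1 simp del: One_nat_def)
  qed
  moreover have "intertwiner (sym_group_on {..<n}) (permutation_rep n) (reflection_rep n) B"
    using BP by (auto simp: intertwiner_def sym_group_on_def P1 R1 simp del: One_nat_def)
  moreover have "inj_on ((*\<^sub>v) A) (carrier_vec (dim_col A))"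
  proof (rule inj_onI)
    fix x y :: "'k vec" assume x: "x \<in> carrier_vec (dim_col A)" and y: "y \<in> carrier_vec (dim_col A)"
      and eq: "A *\<^sub>v x = A *\<^sub>v y"
    have d: "dim_vec x = 1" "dim_vec y = 1" using x y by (auto simp: A_def)
    have "(A *\<^sub>v x) $ 0 = (A *\<^sub>v y) $ 0" using eq by simp
    then have "x $ 0 = y $ 0" using assms d by (simp add: A_def scalar_prod_def)
    then show "x = y" using d by (auto intro!: eq_vecI)
  qed
  moreover have "(*\<^sub>v) B ` carrier_vec (dim_col B) = carrier_vec (dim_row B)"
  proof (intro equalityI subsetI)
    fix w :: "'k vec" assume "w \<in> carrier_vec (dim_row B)"
    then have w: "w \<in> carrier_vec (n - 1)" by (simp add: B_def)
    have "B *\<^sub>v (C *\<^sub>v w) = w"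
      using assoc_mult_mat_vec[OF dims(2) dims(3) w] by (simp only: BC one_mult_mat_vec[OF w])
    moreover have "C *\<^sub>v w \<in> carrier_vec (dim_col B)" using mult_mat_vec_carrier[OF dims(3) w] by (simp add: B_def)
    ultimately show "w \<in> (*\<^sub>v) B ` carrier_vec (dim_col B)" by (metis imageI)
  qed (use dims(2) in \<open>auto simp: B_def intro!: mult_mat_vec_carrier\<close>)
  moreover have "(*\<^sub>v) A ` carrier_vec (dim_col A) = mat_kernel B"
  proof -
    have Bv: "(B *\<^sub>v v) $ i = v $ i - v $ (n - 1)" if v: "v \<in> carrier_vec n" and i: "i < n - 1" for v :: "'k vec" and i
    proof -
      have "(B *\<^sub>v v) $ i = (\<Sum>k<n. (if k = n - 1 then - 1 else if k = i then 1 else 0) * v $ k)"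
        using v i by (simp add: B_def scalar_prod_def lessThan_atLeast0)
      also have "\<dots> = (\<Sum>k<n. (if k = n - 1 then - v $ (n - 1) else 0) + (if k = i then v $ i else 0))"
        using i by (intro sum.cong) auto
      also have "\<dots> = v $ i - v $ (n - 1)"
        using i assms by (subst sum.distrib) simp
      finally show ?thesis .
    qed
    have Av: "A *\<^sub>v u = vec n (\<lambda>_. u $ 0)" if "u \<in> carrier_vec 1" for u :: "'k vec"
      using that by (auto simp: A_def scalar_prod_def intro!: eq_vecI)
    have ker: "v \<in> mat_kernel B \<longleftrightarrow> v \<in> carrier_vec n \<and> (\<forall>i<n - 1. v $ i = v $ (n - 1))" for v :: "'k vec"
    proof -
      have "B *\<^sub>v v = 0\<^sub>v (n - 1) \<longleftrightarrow> (\<forall>i<n - 1. (B *\<^sub>v v) $ i = 0)"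
      proof
        assume "\<forall>i<n - 1. (B *\<^sub>v v) $ i = 0"
        then show "B *\<^sub>v v = 0\<^sub>v (n - 1)" by (intro eq_vecI) (auto simp: B_def)
      qed simp
      moreover have "dim_row B = n - 1" "dim_col B = n" by (simp_all add: B_def)
      then have "v \<in> mat_kernel B \<longleftrightarrow> v \<in> carrier_vec n \<and> B *\<^sub>v v = 0\<^sub>v (n - 1)"
        by (simp only: mat_kernel_def mem_Collect_eq)
      moreover have "(B *\<^sub>v v) $ i = 0 \<longleftrightarrow> v $ i = v $ (n - 1)" if "v \<in> carrier_vec n" "i < n - 1" for i
        by (simp only: Bv[OF that] right_minus_eq)
      ultimately show ?thesis by blast
    qed
    have dA: "dim_col A = 1" by (simp add: A_def)
    show ?thesis
    proof (intro equalityI subsetI)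
      fix v :: "'k vec" assume "v \<in> (*\<^sub>v) A ` carrier_vec (dim_col A)"
      then obtain u where u: "u \<in> carrier_vec 1" "v = A *\<^sub>v u" by (auto simp: dA)
      show "v \<in> mat_kernel B" unfolding ker u(2) Av[OF u(1)] using assms by simp
    next
      fix v :: "'k vec" assume "v \<in> mat_kernel B"
      then have v: "v \<in> carrier_vec n" "\<forall>i<n - 1. v $ i = v $ (n - 1)" unfolding ker by blast+
      have const: "v $ i = v $ (n - 1)" if "i < n" for i
      proof (cases "i = n - 1")
        case False
        then have "i < n - 1" using that by linarith
        then show ?thesis using v(2) by blast
      qed (simp only:)
      have "v = vec n (\<lambda>_. v $ (n - 1))"
      proof (rule eq_vecI)
        fix i assume "i < dim_vec (vec n (\<lambda>_. v $ (n - 1)))"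
        then have i: "i < n" by (simp only: dim_vec)
        show "v $ i = vec n (\<lambda>_. v $ (n - 1)) $ i"
          unfolding index_vec[OF i] by (rule const[OF i])
      qed (use v(1) in simp)
      then have "v = A *\<^sub>v vec 1 (\<lambda>_. v $ (n - 1))"
        by (simp only: Av vec_carrier index_vec zero_less_one)
      then show "v \<in> (*\<^sub>v) A ` carrier_vec (dim_col A)" unfolding dA by (rule image_eqI) simp
    qed
  qed
  ultimately show ?thesis
    unfolding short_exact_reps_def reps_def by blast
qed

end

theory Submission
  imports Defs "HOL-Combinatorics.Cycles" "HOL-Library.Nat_Bijection"
begin

text \<open>
  In characteristic zero two representations of a finite group \<open>H\<close> with the same character have the
  same class: if the characters agree then averaging produces a nonzero intertwiner, a full rank
  factorization of it splits a common constituent off both, and one inducts on the dimension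
  (\<open>rep_relations_iff_character\<close>).  The representation ring is therefore the ring of virtual
  characters, and a set of classes generates it as soon as every subring of virtual characters that
  contains the corresponding characters contains all characters (\<open>rep_ring_generated\<close>).

  Write an element of \<open>S\<^sub>n(G)\<close> as \<open>(f, \<sigma>)\<close>.  The representation induced from \<open>\<chi>\<close> is monomial, so the
  character of its \<open>d\<close>-th exterior power is the sum, over the \<open>\<sigma>\<close>-invariant \<open>d\<close>-subsets \<open>S\<close> of the letters, of
  the sign of \<open>\<sigma>\<close> on \<open>S\<close> times the product of the \<open>\<chi> (f x)\<close> with \<open>x \<in> S\<close>.  For trivial \<open>\<chi>\<close> this is the
  character of an exterior power of the permutation representation, which is the sum of two consecutive
  exterior powers of the reflection representation.  These sums are the elementary symmetric functions of the
  subject.  More generally, colour the letters, let every colour carry a character of \<open>G\<close> and a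
  parity, and sum over all colourings with prescribed numbers of letters of each colour that \<open>\<sigma>\<close> fixes; the
  odd colours contribute signs.  These are the orbit characters.

  All orbit characters are polynomials in the odd one-colour sums (\<open>orbit_chars_generated\<close>).  The product of
  the one-colour sums of the colours involved is the orbit character plus contributions of families of
  overlapping subsets; recording which subsets contain a letter turns the latter into orbit characters with
  fewer coloured letters, because characters of \<open>G\<close> multiply to characters of \<open>G\<close>.  An even one-colour
  sum is reached from odd ones by the alternating identity between elementary and complete symmetric functions.

  It remains to see that the orbit characters span over the integers.  A labelling \<open>r\<close> of the letters by rows,
  each row carrying a character of \<open>G\<close>, defines a subgroup of \<open>S\<^sub>n(G)\<close> with a linear character, and the
  multiplicity of the latter is an integer-valued functional \<open>pairing G n r\<close> on virtual characters.
  These functionals separate class functions (\<open>pairings_separate\<close>).  To \<open>r\<close> belongs also the orbit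
  character in which all colours are odd and the letters of a row are coloured by their position,
  so that the colours are the columns of a family of Young diagrams.  As for the permutation and sign-twisted
  permutation characters of the symmetric groups, the matrix of pairings is unitriangular for the
  dominance order (\<open>pairing_triangular\<close>, \<open>card_aligned_self\<close>), and Gaussian elimination over the integers
  writes every character as a combination of orbit characters (\<open>virtual_characters_generated\<close>).
\<close>

section \<open>Traces and factorizations of matrices\<close>

definition mat_trace :: "'k::comm_monoid_add mat \<Rightarrow> 'k" where
  "mat_trace A = (\<Sum>i<dim_row A. A $$ (i, i))"

lemma mat_mult_index:
  assumes "A \<in> carrier_mat m n" "B \<in> carrier_mat n p" "i < m" "j < p"
  shows "(A * B) $$ (i, j) = (\<Sum>k<n. A $$ (i, k) * B $$ (k, j))"
  using assms by (simp add: times_mat_def scalar_prod_def lessThan_atLeast0)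

lemma mat_trace_mult_commute:
  assumes "A \<in> carrier_mat m n" "B \<in> carrier_mat n m"
  shows "mat_trace (A * B) = mat_trace (B * A :: 'k::comm_semiring_0 mat)"
proof -
  have "mat_trace (A * B) = (\<Sum>i<m. \<Sum>k<n. A $$ (i, k) * B $$ (k, i))"
    using assms by (simp add: mat_trace_def mat_mult_index[OF assms] del: index_mult_mat(1))
  also have "\<dots> = (\<Sum>k<n. \<Sum>i<m. B $$ (k, i) * A $$ (i, k))"
    by (subst sum.swap) (simp add: mult.commute)
  also have "\<dots> = mat_trace (B * A)"
    using assms by (simp add: mat_trace_def mat_mult_index[OF assms(2,1)] del: index_mult_mat(1))
  finally show ?thesis .
qed

lemma mat_trace_add:
  assumes "A \<in> carrier_mat n n" "B \<in> carrier_mat n n"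
  shows "mat_trace (A + B) = mat_trace A + mat_trace (B :: 'k::comm_monoid_add mat)"
  using assms by (simp add: mat_trace_def sum.distrib)

lemma mat_trace_one: "mat_trace (1\<^sub>m n :: 'k::{comm_monoid_add,semiring_1} mat) = of_nat n"
  by (simp add: mat_trace_def)

text \<open>
  Wedderburn's rank reduction: subtracting from a matrix the rank one matrix built from the row
  and the column of a nonzero entry kills that row and that column. Collecting these rank one
  matrices gives the factorization together with one-sided inverses of its factors, without any
  theory of rank.
\<close>

lemma full_rank_factorization_entries:
  fixes a :: "nat \<Rightarrow> nat \<Rightarrow> 'k::field"
  shows "\<exists>(r::nat) (x::nat \<Rightarrow> nat \<Rightarrow> 'k) (x'::nat \<Rightarrow> nat \<Rightarrow> 'k) (y::nat \<Rightarrow> nat \<Rightarrow> 'k) (y'::nat \<Rightarrow> nat \<Rightarrow> 'k). (\<forall>i<m. \<forall>j<n. a i j = (\<Sum>k<r. x i k * y k j)) \<and>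
     (\<forall>k<r. \<forall>l<r. (\<Sum>i<m. x' k i * x i l) = (if k = l then 1 else 0)) \<and>
     (\<forall>k<r. \<forall>l<r. (\<Sum>j<n. y k j * y' j l) = (if k = l then 1 else 0))"
proof (induction "card {i. i < m \<and> (\<exists>j<n. a i j \<noteq> 0)}" arbitrary: a rule: less_induct)
  case less
  show ?case
  proof (cases "\<exists>i<m. \<exists>j<n. a i j \<noteq> 0")
    case False
    then have "a i j = 0" if "i < m" "j < n" for i j using that by blast
    then show ?thesis by (intro exI[of _ "0::nat"]) auto
  next
    case True
    then obtain i0 j0 where i0: "i0 < m" and j0: "j0 < n" and p0: "a i0 j0 \<noteq> 0" by blast
    define p where "p = a i0 j0"
    have p: "p \<noteq> 0" using p0 by (simp add: p_def)
    define b where "b i j = a i j - a i j0 * a i0 j / p" for i j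
    have "{i. i < m \<and> (\<exists>j<n. b i j \<noteq> 0)} \<subset> {i. i < m \<and> (\<exists>j<n. a i j \<noteq> 0)}"
    proof (rule psubsetI)
      show "{i. i < m \<and> (\<exists>j<n. b i j \<noteq> 0)} \<subseteq> {i. i < m \<and> (\<exists>j<n. a i j \<noteq> 0)}"
      proof clarify
        fix i j assume "i < m" "j < n" "b i j \<noteq> 0"
        then have "a i j \<noteq> 0 \<or> a i j0 \<noteq> 0" by (auto simp: b_def)
        then show "\<exists>j<n. a i j \<noteq> 0" using j0 \<open>j < n\<close> by blast
      qed
      have "i0 \<notin> {i. i < m \<and> (\<exists>j<n. b i j \<noteq> 0)}" using p by (auto simp: b_def p_def)
      moreover have "i0 \<in> {i. i < m \<and> (\<exists>j<n. a i j \<noteq> 0)}" using i0 j0 p0 by blast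
      ultimately show "{i. i < m \<and> (\<exists>j<n. b i j \<noteq> 0)} \<noteq> {i. i < m \<and> (\<exists>j<n. a i j \<noteq> 0)}" by blast
    qed
    then have "card {i. i < m \<and> (\<exists>j<n. b i j \<noteq> 0)} < card {i. i < m \<and> (\<exists>j<n. a i j \<noteq> 0)}"
      by (intro psubset_card_mono) auto
    from less[OF this] obtain r :: nat and x x' y y' :: "nat \<Rightarrow> nat \<Rightarrow> 'k" where
      b: "\<And>i j. i < m \<Longrightarrow> j < n \<Longrightarrow> b i j = (\<Sum>k<r. x i k * y k j)" and
      x: "\<And>k l. k < r \<Longrightarrow> l < r \<Longrightarrow> (\<Sum>i<m. x' k i * x i l) = (if k = l then 1 else 0)" and
      y: "\<And>k l. k < r \<Longrightarrow> l < r \<Longrightarrow> (\<Sum>j<n. y k j * y' j l) = (if k = l then 1 else 0)"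
      by blast
    have x0: "x i0 l = 0" if l: "l < r" for l
    proof -
      have "0 = (\<Sum>j<n. b i0 j * y' j l)" using p by (simp add: b_def p_def)
      also have "\<dots> = (\<Sum>j<n. \<Sum>k<r. x i0 k * (y k j * y' j l))"
        using b i0 by (intro sum.cong) (auto simp: sum_distrib_right mult.assoc)
      also have "\<dots> = (\<Sum>k<r. x i0 k * (\<Sum>j<n. y k j * y' j l))"
        by (subst sum.swap) (simp add: sum_distrib_left)
      also have "\<dots> = (\<Sum>k<r. x i0 k * (if k = l then 1 else 0))"
        using y l by (intro sum.cong) auto
      also have "\<dots> = x i0 l" using l by (simp add: if_distrib cong: if_cong)
      finally show ?thesis by simp
    qed
    have y0: "y k j0 = 0" if k: "k < r" for k
    proof -
      have "0 = (\<Sum>i<m. x' k i * b i j0)" using p by (simp add: b_def p_def)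
      also have "\<dots> = (\<Sum>i<m. \<Sum>l<r. (x' k i * x i l) * y l j0)"
        using b j0 by (intro sum.cong) (auto simp: sum_distrib_left mult.assoc)
      also have "\<dots> = (\<Sum>l<r. (\<Sum>i<m. x' k i * x i l) * y l j0)"
        by (subst sum.swap) (simp add: sum_distrib_right)
      also have "\<dots> = (\<Sum>l<r. (if k = l then 1 else 0) * y l j0)"
        using x k by (intro sum.cong) auto
      also have "\<dots> = y k j0" using k by (simp add: if_distrib if_distribR cong: if_cong)
      finally show ?thesis by simp
    qed
    define U where "U i k = (if k < r then x i k else a i j0 / p)" for i k
    define Y where "Y k j = (if k < r then y k j else a i0 j)" for k j
    define U' where "U' k i = (if k < r then x' k i - (if i = i0 then \<Sum>i'<m. x' k i' * (a i' j0 / p) else 0)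
       else if i = i0 then 1 else 0)" for k i
    define Y' where "Y' j l = (if l < r then y' j l - (if j = j0 then (\<Sum>j'<n. a i0 j' * y' j' l) / p else 0)
       else if j = j0 then 1 / p else 0)" for j l
    have pick: "(\<Sum>i<m. (if i = i0 then c else 0) * g i) = c * g i0" for c and g :: "nat \<Rightarrow> 'k"
      using i0 by (simp add: if_distrib if_distribR cong: if_cong)
    have pick': "(\<Sum>j<n. g j * (if j = j0 then c else 0)) = g j0 * c" for c and g :: "nat \<Rightarrow> 'k"
      using j0 by (simp add: if_distrib if_distribR cong: if_cong)
    have 1: "a i j = (\<Sum>k<Suc r. U i k * Y k j)" if "i < m" "j < n" for i j
    proof -
      have "(\<Sum>k<r. U i k * Y k j) = b i j" using b that by (simp add: U_def Y_def)
      then show ?thesis by (simp add: U_def Y_def b_def)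
    qed
    have 2: "(\<Sum>i<m. U' k i * U i l) = (if k = l then 1 else 0)" if "k < Suc r" "l < Suc r" for k l
    proof (cases "k < r")
      case True
      have "(\<Sum>i<m. U' k i * U i l) = (\<Sum>i<m. x' k i * U i l) - (\<Sum>i'<m. x' k i' * (a i' j0 / p)) * U i0 l"
        using True by (simp add: U'_def left_diff_distrib sum_subtractf pick)
      then show ?thesis using True that x x0 p by (auto simp: U_def p_def)
    next
      case False
      have "(\<Sum>i<m. U' k i * U i l) = U i0 l"
        using False pick[of 1 "\<lambda>i. U i l"] by (simp add: U'_def)
      then show ?thesis using False that x0 p by (auto simp: U_def p_def)
    qed
    have 3: "(\<Sum>j<n. Y k j * Y' j l) = (if k = l then 1 else 0)" if "k < Suc r" "l < Suc r" for k l
    proof (cases "l < r")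
      case True
      have "(\<Sum>j<n. Y k j * Y' j l) = (\<Sum>j<n. Y k j * y' j l) - Y k j0 * ((\<Sum>j'<n. a i0 j' * y' j' l) / p)"
        using True by (simp add: Y'_def right_diff_distrib sum_subtractf pick')
      then show ?thesis using True that y y0 p by (auto simp: Y_def p_def)
    next
      case False
      have "(\<Sum>j<n. Y k j * Y' j l) = Y k j0 * (1 / p)"
        using False pick'[of "\<lambda>j. Y k j" "1 / p"] by (simp add: Y'_def)
      then show ?thesis using False that y0 p by (auto simp: Y_def p_def)
    qed
    show ?thesis
      by (rule exI[of _ "Suc r"], rule exI[of _ U], rule exI[of _ U'], rule exI[of _ Y], rule exI[of _ Y'])
        (use 1 2 3 in blast)
  qed
qed

lemma full_rank_factorization:
  assumes "A \<in> carrier_mat m n"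
  obtains r U U' Y Y' where "U \<in> carrier_mat m r" "U' \<in> carrier_mat r m"
    "Y \<in> carrier_mat r n" "Y' \<in> carrier_mat n r"
    "A = U * Y" "U' * U = 1\<^sub>m r" "Y * Y' = (1\<^sub>m r :: 'k::field mat)"
proof -
  obtain r :: nat and x x' y y' where *: "\<And>i j. i < m \<Longrightarrow> j < n \<Longrightarrow> A $$ (i, j) = (\<Sum>k<r. x i k * y k j)"
     "\<And>k l. k < r \<Longrightarrow> l < r \<Longrightarrow> (\<Sum>i<m. x' k i * x i l) = (if k = l then 1 else 0)"
     "\<And>k l. k < r \<Longrightarrow> l < r \<Longrightarrow> (\<Sum>j<n. y k j * y' j l) = (if k = l then 1 else 0)"
    using full_rank_factorization_entries[of m n "\<lambda>i j. A $$ (i, j)"] by blast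
  define U where "U = mat m r (\<lambda>(i, k). x i k)"
  define U' where "U' = mat r m (\<lambda>(k, i). x' k i)"
  define Y where "Y = mat r n (\<lambda>(k, j). y k j)"
  define Y' where "Y' = mat n r (\<lambda>(j, k). y' j k)"
  have c: "U \<in> carrier_mat m r" "U' \<in> carrier_mat r m" "Y \<in> carrier_mat r n" "Y' \<in> carrier_mat n r"
    by (auto simp: U_def U'_def Y_def Y'_def)
  show thesis
  proof (rule that[OF c])
    show "A = U * Y"
      by (rule eq_matI)
        (use assms c * in \<open>auto simp del: index_mult_mat(1) simp add: mat_mult_index[OF c(1,3)]\<close>,
          auto simp: U_def Y_def)
    show "U' * U = 1\<^sub>m r"
      by (rule eq_matI)
        (use assms c * in \<open>auto simp del: index_mult_mat(1) simp add: mat_mult_index[OF c(2,1)]\<close>,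
          auto simp: U_def U'_def *)
    show "Y * Y' = 1\<^sub>m r"
      by (rule eq_matI)
        (use assms c * in \<open>auto simp del: index_mult_mat(1) simp add: mat_mult_index[OF c(3,4)]\<close>,
          auto simp: Y_def Y'_def *)
  qed
qed

lemma mat_left_cancel:
  assumes U: "U \<in> carrier_mat n r" and U': "U' \<in> carrier_mat r n" and U'U: "U' * U = 1\<^sub>m r"
    and A: "A \<in> carrier_mat r p" and B: "B \<in> carrier_mat r p" and eq: "U * A = U * (B :: 'k::semiring_1 mat)"
  shows "A = B"
proof -
  have "A = U' * (U * A)"
    unfolding assoc_mult_mat[OF U' U A, symmetric] U'U using A by simp
  also have "\<dots> = B"
    unfolding eq assoc_mult_mat[OF U' U B, symmetric] U'U using B by simp
  finally show ?thesis .
qed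

lemma mat_right_cancel:
  assumes Y: "Y \<in> carrier_mat r n" and Y': "Y' \<in> carrier_mat n r" and YY': "Y * Y' = 1\<^sub>m r"
    and A: "A \<in> carrier_mat p r" and B: "B \<in> carrier_mat p r" and eq: "A * Y = B * (Y :: 'k::semiring_1 mat)"
  shows "A = B"
proof -
  have "A = A * Y * Y'"
    unfolding assoc_mult_mat[OF A Y Y'] YY' using A by simp
  also have "\<dots> = B"
    unfolding eq assoc_mult_mat[OF B Y Y'] YY' using B by simp
  finally show ?thesis .
qed

text \<open>
  In a full rank factorization \<open>U * Y\<close> of an idempotent both factors can be
  cancelled, which leaves \<open>Y * U = 1\<close>.
\<close>

lemma split_idempotent:
  assumes P: "P \<in> carrier_mat n n" and idem: "P * P = (P :: 'k::field mat)"
  obtains r U Y where "U \<in> carrier_mat n r" "Y \<in> carrier_mat r n" "P = U * Y" "Y * U = 1\<^sub>m r"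
proof -
  obtain r U U' Y Y' where c: "U \<in> carrier_mat n r" "U' \<in> carrier_mat r n"
    "Y \<in> carrier_mat r n" "Y' \<in> carrier_mat n r"
    and e: "P = U * Y" "U' * U = 1\<^sub>m r" "Y * Y' = (1\<^sub>m r :: 'k mat)"
    using full_rank_factorization[OF P] by metis
  note YU = mult_carrier_mat[OF c(3,1)] and UY = mult_carrier_mat[OF c(1,3)]
  have "U * (Y * (U * Y)) = U * Y"
    using idem unfolding e(1) assoc_mult_mat[OF c(1,3) UY] .
  then have "Y * (U * Y) = Y"
    by (rule mat_left_cancel[OF c(1,2) e(2) mult_carrier_mat[OF c(3) UY] c(3)])
  then have "(Y * U) * Y = 1\<^sub>m r * Y"
    unfolding assoc_mult_mat[OF c(3,1,3)] left_mult_one_mat[OF c(3)] .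
  then have "Y * U = 1\<^sub>m r"
    by (rule mat_right_cancel[OF c(3,4) e(3) YU one_carrier_mat])
  then show thesis using that c e by blast
qed

text \<open>
  This is what makes multiplicities integers: averaging operators are idempotent, so that their
  traces are natural numbers and detect whether they vanish.
\<close>

lemma trace_idempotent:
  assumes P: "P \<in> carrier_mat n n" and idem: "P * P = (P :: 'k::field mat)"
  shows "\<exists>r. mat_trace P = of_nat r \<and> (r = 0 \<longrightarrow> P = 0\<^sub>m n n)"
proof -
  obtain r U Y where c: "U \<in> carrier_mat n r" "Y \<in> carrier_mat r n" and e: "P = U * Y" "Y * U = 1\<^sub>m r"
    using split_idempotent[OF assms] by metis
  have "mat_trace P = of_nat r"
    using mat_trace_mult_commute[OF c] e mat_trace_one by metis
  moreover have "P = 0\<^sub>m n n" if "r = 0"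
    using c that unfolding e by (intro eq_matI) (auto simp: scalar_prod_def)
  ultimately show ?thesis by blast
qed

text \<open>
  The idempotent \<open>1 - Y' * Y\<close> is factored; its two factors are the inclusion of the
  kernel of \<open>Y\<close> and the projection onto it.
\<close>

lemma complement_of_retraction:
  assumes Y: "Y \<in> carrier_mat r n" and Y': "Y' \<in> carrier_mat n r" and YY': "Y * Y' = (1\<^sub>m r :: 'k::field mat)"
  obtains q Z Z' where "Z \<in> carrier_mat n q" "Z' \<in> carrier_mat q n"
    "Z' * Z = 1\<^sub>m q" "Y * Z = 0\<^sub>m r q" "Z' * Y' = 0\<^sub>m q r" "Z * Z' + Y' * Y = 1\<^sub>m n"
proof -
  define E where "E = 1\<^sub>m n - Y' * Y"
  have YY: "Y' * Y \<in> carrier_mat n n" using Y Y' by (rule mult_carrier_mat[rotated])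
  have E: "E \<in> carrier_mat n n" unfolding E_def using YY by (rule minus_carrier_mat)
  have "Y * (Y' * Y) = Y" unfolding assoc_mult_mat[OF Y Y' Y, symmetric] YY' using Y by simp
  then have YE: "Y * E = 0\<^sub>m r n"
    unfolding E_def mult_minus_distrib_mat[OF Y one_carrier_mat YY] using Y by simp
  have "Y' * Y * Y' = Y'" unfolding assoc_mult_mat[OF Y' Y Y'] YY' using Y' by simp
  then have EY: "E * Y' = 0\<^sub>m n r"
    unfolding E_def minus_mult_distrib_mat[OF one_carrier_mat YY Y'] using Y' by simp
  have "E * (Y' * Y) = 0\<^sub>m n n"
    unfolding assoc_mult_mat[OF E Y' Y, symmetric] EY using Y by simp
  then have "E * (1\<^sub>m n - Y' * Y) = E"
    unfolding mult_minus_distrib_mat[OF E one_carrier_mat YY] using E by (auto intro!: eq_matI)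
  then have "E * E = E" unfolding E_def .
  then obtain q Z Z' where Z: "Z \<in> carrier_mat n q" and Z': "Z' \<in> carrier_mat q n"
    and e: "E = Z * Z'" "Z' * Z = 1\<^sub>m q"
    using split_idempotent[OF E] by metis
  have "Y * Z * Z' = 0\<^sub>m r q * Z'"
    unfolding assoc_mult_mat[OF Y Z Z'] e(1)[symmetric] YE using Z' by simp
  then have 1: "Y * Z = 0\<^sub>m r q"
    by (rule mat_right_cancel[OF Z' Z e(2) mult_carrier_mat[OF Y Z] zero_carrier_mat])
  have "Z * (Z' * Y') = Z * 0\<^sub>m q r"
    unfolding assoc_mult_mat[OF Z Z' Y', symmetric] e(1)[symmetric] EY using Z by simp
  then have 2: "Z' * Y' = 0\<^sub>m q r"
    by (rule mat_left_cancel[OF Z Z' e(2) mult_carrier_mat[OF Z' Y'] zero_carrier_mat])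
  have 3: "Z * Z' + Y' * Y = 1\<^sub>m n"
  proof -
    have "1\<^sub>m n - W + W = 1\<^sub>m n" if "W \<in> carrier_mat n n" for W :: "'k mat"
      using that by (intro eq_matI) auto
    then show ?thesis unfolding e(1)[symmetric] E_def using YY by blast
  qed
  show thesis using that Z Z' e(2) 1 2 3 by blast
qed

section \<open>Kronecker products\<close>

lemma sum_div_mod:
  fixes f :: "nat \<Rightarrow> nat \<Rightarrow> 'k::comm_monoid_add"
  shows "(\<Sum>k<m * n. f (k div n) (k mod n)) = (\<Sum>i<m. \<Sum>j<n. f i j)"
proof -
  have lt: "i * n + j < m * n" if "i < m" "j < n" for i j
  proof -
    have "i * n + j < Suc i * n" using that by simp
    also have "\<dots> \<le> m * n" using that by (intro mult_right_mono) auto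
    finally show ?thesis .
  qed
  have "(\<Sum>k<m * n. f (k div n) (k mod n)) = (\<Sum>(i, j)\<in>{..<m} \<times> {..<n}. f i j)"
  proof (rule sum.reindex_bij_witness[of _ "\<lambda>(i, j). i * n + j" "\<lambda>k. (k div n, k mod n)"])
    fix k assume "k \<in> {..<m * n}"
    moreover from this have "n > 0" by (cases n) auto
    ultimately show "(k div n, k mod n) \<in> {..<m} \<times> {..<n}" by (auto simp: less_mult_imp_div_less)
  qed (auto simp: lt)
  then show ?thesis by (simp add: sum.cartesian_product)
qed

lemma kronecker_prod_carrier:
  assumes "A \<in> carrier_mat m n" "B \<in> carrier_mat p q"
  shows "kronecker_prod A B \<in> carrier_mat (m * p) (n * q)"
  using assms by (simp add: kronecker_prod_def)

lemma kronecker_prod_index: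
  assumes "A \<in> carrier_mat m n" "B \<in> carrier_mat p q" "i < m * p" "j < n * q"
  shows "kronecker_prod A B $$ (i, j) = A $$ (i div p, j div q) * B $$ (i mod p, j mod q)"
  using assms by (simp add: kronecker_prod_def)

lemma kronecker_prod_mult:
  fixes A :: "'k::comm_semiring_0 mat"
  assumes A: "A \<in> carrier_mat m n" and B: "B \<in> carrier_mat p q"
    and C: "C \<in> carrier_mat n l" and D: "D \<in> carrier_mat q t"
  shows "kronecker_prod (A * C) (B * D) = kronecker_prod A B * kronecker_prod C D"
proof (rule eq_matI)
  note AB = kronecker_prod_carrier[OF A B] and CD = kronecker_prod_carrier[OF C D]
  note AC = mult_carrier_mat[OF A C] and BD = mult_carrier_mat[OF B D]
  fix i j assume "i < dim_row (kronecker_prod A B * kronecker_prod C D)"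
    "j < dim_col (kronecker_prod A B * kronecker_prod C D)"
  then have i: "i < m * p" and j: "j < l * t" using AB CD by auto
  then have pt: "p > 0" "t > 0" by (auto intro: Nat.gr0I)
  have i': "i div p < m" "i mod p < p" and j': "j div t < l" "j mod t < t"
    using i j pt by (auto simp: less_mult_imp_div_less)
  have "kronecker_prod (A * C) (B * D) $$ (i, j) = (A * C) $$ (i div p, j div t) * (B * D) $$ (i mod p, j mod t)"
    by (rule kronecker_prod_index[OF AC BD i j])
  also have "\<dots> = (\<Sum>a<n. \<Sum>b<q. (A $$ (i div p, a) * C $$ (a, j div t)) * (B $$ (i mod p, b) * D $$ (b, j mod t)))"
    unfolding mat_mult_index[OF A C i'(1) j'(1)] mat_mult_index[OF B D i'(2) j'(2)] sum_product ..
  also have "\<dots> = (\<Sum>k<n * q. (A $$ (i div p, k div q) * C $$ (k div q, j div t)) * (B $$ (i mod p, k mod q) * D $$ (k mod q, j mod t)))"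
    by (rule sum_div_mod[symmetric])
  also have "\<dots> = (\<Sum>k<n * q. kronecker_prod A B $$ (i, k) * kronecker_prod C D $$ (k, j))"
  proof (rule sum.cong[OF refl])
    fix k assume "k \<in> {..<n * q}"
    then have k: "k < n * q" by simp
    show "(A $$ (i div p, k div q) * C $$ (k div q, j div t)) * (B $$ (i mod p, k mod q) * D $$ (k mod q, j mod t))
      = kronecker_prod A B $$ (i, k) * kronecker_prod C D $$ (k, j)"
      unfolding kronecker_prod_index[OF A B i k] kronecker_prod_index[OF C D k j] by (simp add: ac_simps)
  qed
  also have "\<dots> = (kronecker_prod A B * kronecker_prod C D) $$ (i, j)"
    by (rule mat_mult_index[OF AB CD i j, symmetric])
  finally show "kronecker_prod (A * C) (B * D) $$ (i, j) = (kronecker_prod A B * kronecker_prod C D) $$ (i, j)" .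
qed (use assms in \<open>auto simp: kronecker_prod_def\<close>)

lemma kronecker_prod_assoc:
  "kronecker_prod (kronecker_prod A B) C = kronecker_prod A (kronecker_prod B (C :: 'k::semiring_0 mat))"
proof (rule eq_matI)
  define m n p q r s where d: "m = dim_row A" "n = dim_col A" "p = dim_row B" "q = dim_col B"
    "r = dim_row C" "s = dim_col C"
  have c: "A \<in> carrier_mat m n" "B \<in> carrier_mat p q" "C \<in> carrier_mat r s" by (auto simp: d)
  note AB = kronecker_prod_carrier[OF c(1,2)] and BC = kronecker_prod_carrier[OF c(2,3)]
  fix i j assume "i < dim_row (kronecker_prod A (kronecker_prod B C))"
    "j < dim_col (kronecker_prod A (kronecker_prod B C))"
  then have i: "i < m * (p * r)" and j: "j < n * (q * s)" by (auto simp: d kronecker_prod_def)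
  have i2: "i < m * p * r" and j2: "j < n * q * s" using i j by (auto simp: mult.assoc)
  have pos: "r > 0" "s > 0" "p > 0" "q > 0" using i j by (auto intro: Nat.gr0I)
  have i3: "i div r < m * p" "j div s < n * q" "i mod (p * r) < p * r" "j mod (q * s) < q * s"
    using i2 j2 pos by (auto simp: less_mult_imp_div_less)
  have dm: "i mod (p * r) div r = i div r mod p" "i mod (p * r) mod r = i mod r"
    "j mod (q * s) div s = j div s mod q" "j mod (q * s) mod s = j mod s"
    using pos by (simp_all add: mult.commute[of p] mult.commute[of q] mod_mult2_eq)
  have dd: "i div (p * r) = i div r div p" "j div (q * s) = j div s div q"
    by (simp_all add: mult.commute[of p] mult.commute[of q] div_mult2_eq)
  show "kronecker_prod (kronecker_prod A B) C $$ (i, j) = kronecker_prod A (kronecker_prod B C) $$ (i, j)"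
    unfolding kronecker_prod_index[OF AB c(3) i2 j2] kronecker_prod_index[OF c(1) BC i j]
      kronecker_prod_index[OF c(1,2) i3(1,2)] kronecker_prod_index[OF c(2,3) i3(3,4)] dm dd
    by (simp add: mult.assoc)
qed (auto simp: kronecker_prod_def)

lemma kronecker_prod_one_left [simp]: "kronecker_prod (1\<^sub>m 1) A = (A :: 'k::semiring_1 mat)"
  by (rule eq_matI) (auto simp: kronecker_prod_def)

lemma kronecker_prod_one_right [simp]: "kronecker_prod A (1\<^sub>m 1) = (A :: 'k::semiring_1 mat)"
  by (rule eq_matI) (auto simp: kronecker_prod_def)

lemma kronecker_prod_one: "kronecker_prod (1\<^sub>m m) (1\<^sub>m n) = (1\<^sub>m (m * n) :: 'k::semiring_1 mat)"
proof (rule eq_matI)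
  fix i j assume "i < dim_row (1\<^sub>m (m * n) :: 'k mat)" "j < dim_col (1\<^sub>m (m * n) :: 'k mat)"
  then have ij: "i < m * n" "j < m * n" by auto
  then have n: "n > 0" by (auto intro: Nat.gr0I)
  have "i = j \<longleftrightarrow> i div n = j div n \<and> i mod n = j mod n" by (metis div_mult_mod_eq)
  then show "kronecker_prod (1\<^sub>m m) (1\<^sub>m n) $$ (i, j) = (1\<^sub>m (m * n) :: 'k mat) $$ (i, j)"
    using ij n by (simp add: kronecker_prod_index[OF one_carrier_mat one_carrier_mat ij] less_mult_imp_div_less)
qed (auto simp: kronecker_prod_def)

lemma mat_trace_kronecker_prod:
  assumes "A \<in> carrier_mat m m" "B \<in> carrier_mat n n"
  shows "mat_trace (kronecker_prod A B) = mat_trace A * mat_trace (B :: 'k::semiring_0 mat)"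
proof -
  have "mat_trace (kronecker_prod A B) = (\<Sum>k<m * n. A $$ (k div n, k div n) * B $$ (k mod n, k mod n))"
    using kronecker_prod_carrier[OF assms] by (simp add: mat_trace_def kronecker_prod_index[OF assms])
  also have "\<dots> = (\<Sum>i<m. \<Sum>j<n. A $$ (i, i) * B $$ (j, j))"
    by (rule sum_div_mod)
  also have "\<dots> = mat_trace A * mat_trace B"
    using assms by (simp add: mat_trace_def sum_product)
  finally show ?thesis .
qed

section \<open>Minors and exterior powers\<close>

text \<open>
  Kept as a Leibniz sum over the permutations of an arbitrary finite index set, so that no
  enumeration of the set has to be chosen.
\<close>

definition principal_minor :: "(nat \<Rightarrow> nat \<Rightarrow> 'k::comm_ring_1) \<Rightarrow> nat set \<Rightarrow> 'k" where
  "principal_minor a S = (\<Sum>p | p permutes S. of_int (sign p) * (\<Prod>i\<in>S. a i (p i)))"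

lemma increasing_lists_bij:
  "bij_betw set (set (increasing_lists d k)) {S. S \<subseteq> {..<d} \<and> card S = k}"
proof -
  have dist: "distinct (map set (subseqs [0..<d]))" by (rule distinct_set_subseqs) simp
  then have inj: "inj_on set (set (subseqs [0..<d]))" by (simp add: distinct_map)
  have len: "card (set S) = length S" if "S \<in> set (subseqs [0..<d])" for S
    using subseqs_distinctD[OF that] by (simp add: distinct_card)
  show ?thesis unfolding bij_betw_def
  proof
    show "inj_on set (set (increasing_lists d k))"
      using inj by (rule inj_on_subset) (auto simp: increasing_lists_def)
    show "set ` set (increasing_lists d k) = {S. S \<subseteq> {..<d} \<and> card S = k}"
    proof (intro equalityI subsetI)
      fix S assume "S \<in> set ` set (increasing_lists d k)"
      then show "S \<in> {S. S \<subseteq> {..<d} \<and> card S = k}"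
        using len subseqs_powset[of "[0..<d]"] by (auto simp: increasing_lists_def atLeast0LessThan)
    next
      fix S assume S: "S \<in> {S. S \<subseteq> {..<d} \<and> card S = k}"
      then have "S \<in> set ` set (subseqs [0..<d])"
        unfolding subseqs_powset by (auto simp: atLeast0LessThan)
      then show "S \<in> set ` set (increasing_lists d k)" using len S by (auto simp: increasing_lists_def)
    qed
  qed
qed

lemma increasing_lists_distinct: "distinct (increasing_lists d k)"
  using distinct_set_subseqs[of "[0..<d]"] by (auto simp: increasing_lists_def distinct_map)

lemma increasing_listsD:
  assumes "S \<in> set (increasing_lists d k)"
  shows "distinct S" "length S = k" "set S \<subseteq> {..<d}" "\<And>i. i < k \<Longrightarrow> S ! i < d"
proof -
  show "distinct S" using assms subseqs_distinctD by (fastforce simp: increasing_lists_def)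
  show l: "length S = k" using assms by (auto simp: increasing_lists_def)
  show s: "set S \<subseteq> {..<d}" using assms increasing_lists_bij[of d k] by (auto simp: bij_betw_def)
  show "S ! i < d" if "i < k" for i using s l that nth_mem by fastforce
qed

abbreviation minor :: "'k::comm_ring_1 mat \<Rightarrow> nat list \<Rightarrow> nat list \<Rightarrow> nat \<Rightarrow> 'k" where
  "minor A R C k \<equiv> det (mat k k (\<lambda>(i, j). A $$ (R ! i, C ! j)))"

lemma exterior_power_mat_carrier:
  assumes "A \<in> carrier_mat m n"
  shows "exterior_power_mat k A \<in> carrier_mat (length (increasing_lists m k)) (length (increasing_lists n k))"
  using assms by (simp add: exterior_power_mat_def Let_def)

lemma exterior_power_mat_index:
  assumes "A \<in> carrier_mat m n" "a < length (increasing_lists m k)" "b < length (increasing_lists n k)"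
  shows "exterior_power_mat k A $$ (a, b) = minor A (increasing_lists m k ! a) (increasing_lists n k ! b) k"
  using assms by (simp add: exterior_power_mat_def Let_def)

lemma sum_increasing_lists:
  "(\<Sum>c<length (increasing_lists d k). g (increasing_lists d k ! c)) = (\<Sum>S\<in>set (increasing_lists d k). g S)"
  by (rule sum.reindex_bij_betw) (auto intro!: bij_betw_nth increasing_lists_distinct)

lemma det_mat_expand:
  "det (mat k k (\<lambda>(i, j). f i j)) = (\<Sum>p | p permutes {..<k}. of_int (sign p) * (\<Prod>i<k. f i (p i)))"
proof -
  have "det (mat k k (\<lambda>(i, j). f i j)) =
     (\<Sum>p | p permutes {0..<k}. of_int (sign p) * (\<Prod>i = 0..<k. mat k k (\<lambda>(i, j). f i j) $$ (i, p i)))"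
    by (rule det_def') simp
  also have "\<dots> = (\<Sum>p | p permutes {..<k}. of_int (sign p) * (\<Prod>i<k. f i (p i)))"
  proof (rule sum.cong)
    fix p assume "p \<in> {p. p permutes {..<k}}"
    then have p: "p permutes {..<k}" by simp
    have "p i < k" if "i < k" for i using permutes_in_image[OF p, of i] that by simp
    then show "of_int (sign p) * (\<Prod>i = 0..<k. mat k k (\<lambda>(i, j). f i j) $$ (i, p i)) =
      of_int (sign p) * (\<Prod>i<k. f i (p i))"
      by (auto simp: atLeast0LessThan intro!: prod.cong arg_cong2[of _ _ _ _ times])
  qed (simp add: atLeast0LessThan)
  finally show ?thesis .
qed

text \<open>
  Expand the determinant of the product over all maps into the middle index set. The maps that are
  not injective cancel because a determinant with two equal rows vanishes, and an injective map is
  an increasing list followed by a permutation.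
\<close>

lemma Cauchy_Binet:
  fixes A :: "'k::comm_ring_1 mat"
  assumes A: "A \<in> carrier_mat m n" and B: "B \<in> carrier_mat n q"
    and R: "\<And>i. i < k \<Longrightarrow> R ! i < m" and C: "\<And>i. i < k \<Longrightarrow> C ! i < q"
  shows "minor (A * B) R C k = (\<Sum>S\<in>set (increasing_lists n k). minor A R S k * minor B S C k)"
proof -
  let ?P = "{p. p permutes {..<k}}"
  define D where "D g = det (mat k k (\<lambda>(i, j). B $$ (g i, C ! j)))" for g
  have finP: "finite ?P" by (simp add: finite_permutations)
  have "minor (A * B) R C k = (\<Sum>p\<in>?P. of_int (sign p) * (\<Prod>i<k. (A * B) $$ (R ! i, C ! p i)))"
    by (rule det_mat_expand)
  also have "\<dots> = (\<Sum>p\<in>?P. of_int (sign p) * (\<Prod>i<k. \<Sum>l<n. A $$ (R ! i, l) * B $$ (l, C ! p i)))"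
  proof (rule sum.cong[OF refl], rule arg_cong2[of _ _ _ _ times, OF refl], rule prod.cong[OF refl])
    fix p i assume "p \<in> ?P" "i \<in> {..<k}"
    then have "i < k" "p i < k" using permutes_in_image[of p "{..<k}" i] by auto
    then show "(A * B) $$ (R ! i, C ! p i) = (\<Sum>l<n. A $$ (R ! i, l) * B $$ (l, C ! p i))"
      by (intro mat_mult_index[OF A B] R C)
  qed
  also have "\<dots> = (\<Sum>p\<in>?P. of_int (sign p) * (\<Sum>g\<in>{..<k} \<rightarrow>\<^sub>E {..<n}. \<Prod>i<k. A $$ (R ! i, g i) * B $$ (g i, C ! p i)))"
    by (simp add: prod_sum_PiE)
  also have "\<dots> = (\<Sum>p\<in>?P. \<Sum>g\<in>{..<k} \<rightarrow>\<^sub>E {..<n}. (\<Prod>i<k. A $$ (R ! i, g i)) * (of_int (sign p) * (\<Prod>i<k. B $$ (g i, C ! p i))))"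
    by (simp add: sum_distrib_left prod.distrib ac_simps)
  also have "\<dots> = (\<Sum>g\<in>{..<k} \<rightarrow>\<^sub>E {..<n}. (\<Prod>i<k. A $$ (R ! i, g i)) * D g)"
    by (subst sum.swap) (simp add: D_def det_mat_expand sum_distrib_left)
  also have "\<dots> = (\<Sum>g\<in>{g \<in> {..<k} \<rightarrow>\<^sub>E {..<n}. inj_on g {..<k}}. (\<Prod>i<k. A $$ (R ! i, g i)) * D g)"
  proof (rule sum.mono_neutral_right)
    show "finite ({..<k} \<rightarrow>\<^sub>E {..<n})" by (intro finite_PiE) auto
    show "\<forall>g\<in>({..<k} \<rightarrow>\<^sub>E {..<n}) - {g \<in> {..<k} \<rightarrow>\<^sub>E {..<n}. inj_on g {..<k}}. (\<Prod>i<k. A $$ (R ! i, g i)) * D g = 0"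
    proof
      fix g assume "g \<in> ({..<k} \<rightarrow>\<^sub>E {..<n}) - {g \<in> {..<k} \<rightarrow>\<^sub>E {..<n}. inj_on g {..<k}}"
      then obtain i j where ij: "i < k" "j < k" "i \<noteq> j" "g i = g j" by (auto simp: inj_on_def)
      have "D g = 0" unfolding D_def
        by (rule det_identical_rows[OF _ ij(3,1,2)]) (use ij in \<open>auto intro!: eq_vecI\<close>)
      then show "(\<Prod>i<k. A $$ (R ! i, g i)) * D g = 0" by simp
    qed
  qed auto
  also have "\<dots> = (\<Sum>(S, p)\<in>set (increasing_lists n k) \<times> ?P. (\<Prod>i<k. A $$ (R ! i, S ! p i)) * (of_int (sign p) * minor B S C k))"
  proof (rule sum.reindex_bij_betw[symmetric, THEN trans[OF _ sum.cong], rotated])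
    let ?h = "\<lambda>(S, p). \<lambda>i\<in>{..<k}. S ! (p i :: nat)"
    show "bij_betw ?h (set (increasing_lists n k) \<times> ?P) {g \<in> {..<k} \<rightarrow>\<^sub>E {..<n}. inj_on g {..<k}}"
      unfolding bij_betw_def
    proof
      show "inj_on ?h (set (increasing_lists n k) \<times> ?P)"
      proof (rule inj_onI, clarify)
        fix S p S' p' assume S: "S \<in> set (increasing_lists n k)" "S' \<in> set (increasing_lists n k)"
          and p: "p permutes {..<k}" "p' permutes {..<k}"
          and eq: "(\<lambda>i\<in>{..<k}. S ! p i) = (\<lambda>i\<in>{..<k}. S' ! p' i)"
        have e: "S ! p i = S' ! p' i" if "i < k" for i using fun_cong[OF eq, of i] that by simp
        have "set S = (\<lambda>i. S ! p i) ` {..<k}" if "S \<in> set (increasing_lists n k)" "p permutes {..<k}" for S p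
        proof -
          have "(\<lambda>i. S ! p i) ` {..<k} = (\<lambda>i. S ! i) ` (p ` {..<k})" by (simp add: image_image)
          also have "\<dots> = set S" unfolding permutes_image[OF that(2)]
            using increasing_listsD(2)[OF that(1)] by (auto simp: set_conv_nth)
          finally show ?thesis by simp
        qed
        then have "set S = (\<lambda>i. S ! p i) ` {..<k}" "set S' = (\<lambda>i. S' ! p' i) ` {..<k}" using S p by blast+
        moreover have "(\<lambda>i. S ! p i) ` {..<k} = (\<lambda>i. S' ! p' i) ` {..<k}" using e by (intro image_cong) auto
        ultimately have "set S = set S'" by simp
        then have SS: "S = S'" using increasing_lists_bij[of n k] S by (auto simp: bij_betw_def inj_on_def)
        have "p i = p' i" for i
        proof (cases "i < k")
          case True
          then have "p i < k" "p' i < k" using permutes_in_image[OF p(1), of i] permutes_in_image[OF p(2), of i] by auto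
          then show ?thesis using e[OF True] unfolding SS[symmetric]
            using nth_eq_iff_index_eq[OF increasing_listsD(1)[OF S(1)], of "p i" "p' i"] increasing_listsD(2)[OF S(1)] by simp
        next
          case False
          then show ?thesis using permutes_not_in[OF p(1), of i] permutes_not_in[OF p(2), of i] by auto
        qed
        then show "S = S' \<and> p = p'" using SS by auto
      qed
      show "?h ` (set (increasing_lists n k) \<times> ?P) = {g \<in> {..<k} \<rightarrow>\<^sub>E {..<n}. inj_on g {..<k}}"
      proof (intro equalityI subsetI)
        fix g assume "g \<in> ?h ` (set (increasing_lists n k) \<times> ?P)"
        then obtain S p where S: "S \<in> set (increasing_lists n k)" and p: "p permutes {..<k}"
          and g: "g = (\<lambda>i\<in>{..<k}. S ! p i)" by auto
        have pk: "p i < k" if "i < k" for i using permutes_in_image[OF p, of i] that by auto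
        have "inj_on (\<lambda>i. S ! p i) {..<k}"
        proof (rule inj_onI)
          fix i j assume ij: "i \<in> {..<k}" "j \<in> {..<k}" "S ! p i = S ! p j"
          then have "p i = p j"
            using nth_eq_iff_index_eq[OF increasing_listsD(1)[OF S], of "p i" "p j"] pk increasing_listsD(2)[OF S] by simp
          then show "i = j" using permutes_inj[OF p] by (simp add: inj_eq)
        qed
        then have "inj_on g {..<k}" unfolding g by (rule inj_on_cong[THEN iffD1, rotated]) simp
        moreover have "g \<in> {..<k} \<rightarrow>\<^sub>E {..<n}"
          unfolding g using increasing_listsD(4)[OF S pk] by (intro restrict_PiE_iff[THEN iffD2]) simp
        ultimately show "g \<in> {g \<in> {..<k} \<rightarrow>\<^sub>E {..<n}. inj_on g {..<k}}" by blast
      next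
        fix g assume "g \<in> {g \<in> {..<k} \<rightarrow>\<^sub>E {..<n}. inj_on g {..<k}}"
        then have g: "g \<in> {..<k} \<rightarrow>\<^sub>E {..<n}" and inj: "inj_on g {..<k}" by auto
        have "g ` {..<k} \<subseteq> {..<n}" "card (g ` {..<k}) = k" using g by (auto simp: card_image[OF inj])
        then have "g ` {..<k} \<in> set ` set (increasing_lists n k)"
          unfolding bij_betw_imp_surj_on[OF increasing_lists_bij] by simp
        then obtain S where S: "S \<in> set (increasing_lists n k)" and sg: "set S = g ` {..<k}" by auto
        note SD = increasing_listsD[OF S]
        have bS: "bij_betw ((!) S) {..<k} (set S)" using SD by (intro bij_betw_nth) auto
        define p where "p i = (if i < k then inv_into {..<k} ((!) S) (g i) else i)" for i
        have "bij_betw (inv_into {..<k} ((!) S) \<circ> g) {..<k} {..<k}"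
          by (rule bij_betw_trans[OF _ bij_betw_inv_into[OF bS]]) (auto simp: bij_betw_def inj sg)
        then have "bij_betw p {..<k} {..<k}" by (rule bij_betw_cong[THEN iffD1, rotated]) (auto simp: p_def)
        then have p: "p permutes {..<k}" by (rule bij_imp_permutes) (auto simp: p_def)
        have "g = (\<lambda>i\<in>{..<k}. S ! p i)"
        proof
          fix i show "g i = (\<lambda>i\<in>{..<k}. S ! p i) i"
            using g bij_betw_inv_into_right[OF bS, of "g i"] sg by (auto simp: p_def PiE_def extensional_def)
        qed
        then have "g = ?h (S, p)" by simp
        then show "g \<in> ?h ` (set (increasing_lists n k) \<times> ?P)" using S p by (rule_tac image_eqI) auto
      qed
    qed
    fix x assume "x \<in> set (increasing_lists n k) \<times> ?P"
    then obtain S p where x: "x = (S, p)" and S: "S \<in> set (increasing_lists n k)" and p: "p permutes {..<k}" by auto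
    have "D (\<lambda>i\<in>{..<k}. S ! p i) = det (mat k k (\<lambda>(i, j). mat k k (\<lambda>(i, j). B $$ (S ! i, C ! j)) $$ (p i, j)))"
      unfolding D_def using permutes_in_image[OF p] by (intro arg_cong[of _ _ det] eq_matI) auto
    also have "\<dots> = of_int (sign p) * minor B S C k"
      by (rule det_permute_rows) (use p in \<open>auto simp: atLeast0LessThan\<close>)
    finally show "(\<Prod>i<k. A $$ (R ! i, ?h x i)) * D (?h x) =
        (case x of (S, p) \<Rightarrow> (\<Prod>i<k. A $$ (R ! i, S ! p i)) * (of_int (sign p) * minor B S C k))"
      by (simp add: x)
  qed simp
  also have "\<dots> = (\<Sum>S\<in>set (increasing_lists n k). minor A R S k * minor B S C k)"
    unfolding sum.cartesian_product[symmetric]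
  proof (rule sum.cong[OF refl])
    fix S
    show "(\<Sum>p\<in>?P. (\<Prod>i<k. A $$ (R ! i, S ! p i)) * (of_int (sign p) * minor B S C k)) = minor A R S k * minor B S C k"
      unfolding det_mat_expand[of k "\<lambda>i j. A $$ (R ! i, S ! j)"] sum_distrib_right
      by (rule sum.cong) (simp_all only: ac_simps)
  qed
  finally show ?thesis .
qed

lemma exterior_power_mat_mult:
  fixes A :: "'k::comm_ring_1 mat"
  assumes A: "A \<in> carrier_mat m n" and B: "B \<in> carrier_mat n q"
  shows "exterior_power_mat k (A * B) = exterior_power_mat k A * exterior_power_mat k B"
proof (rule eq_matI)
  note eA = exterior_power_mat_carrier[OF A, of k] and eB = exterior_power_mat_carrier[OF B, of k]
  note AB = mult_carrier_mat[OF A B]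
  fix a b assume "a < dim_row (exterior_power_mat k A * exterior_power_mat k B)"
     "b < dim_col (exterior_power_mat k A * exterior_power_mat k B)"
  then have a: "a < length (increasing_lists m k)" and b: "b < length (increasing_lists q k)"
    using eA eB by auto
  let ?R = "increasing_lists m k ! a" and ?C = "increasing_lists q k ! b"
  have RC: "\<And>i. i < k \<Longrightarrow> ?R ! i < m" "\<And>i. i < k \<Longrightarrow> ?C ! i < q"
    using increasing_listsD(4) nth_mem a b by blast+
  have "exterior_power_mat k (A * B) $$ (a, b) = minor (A * B) ?R ?C k"
    by (rule exterior_power_mat_index[OF AB a b])
  also have "\<dots> = (\<Sum>S\<in>set (increasing_lists n k). minor A ?R S k * minor B S ?C k)"
    by (rule Cauchy_Binet[OF A B RC])
  also have "\<dots> = (\<Sum>c<length (increasing_lists n k). minor A ?R (increasing_lists n k ! c) k * minor B (increasing_lists n k ! c) ?C k)"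
    by (rule sum_increasing_lists[symmetric])
  also have "\<dots> = (\<Sum>c<length (increasing_lists n k). exterior_power_mat k A $$ (a, c) * exterior_power_mat k B $$ (c, b))"
    using a b by (intro sum.cong) (auto simp: exterior_power_mat_index[OF A] exterior_power_mat_index[OF B])
  also have "\<dots> = (exterior_power_mat k A * exterior_power_mat k B) $$ (a, b)"
    by (rule mat_mult_index[OF eA eB a b, symmetric])
  finally show "exterior_power_mat k (A * B) $$ (a, b) = (exterior_power_mat k A * exterior_power_mat k B) $$ (a, b)" .
qed (use assms in \<open>auto simp: exterior_power_mat_def Let_def\<close>)

lemma exterior_power_mat_one:
  "exterior_power_mat k (1\<^sub>m d) = (1\<^sub>m (length (increasing_lists d k)) :: 'k::comm_ring_1 mat)"
proof (rule eq_matI)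
  fix a b assume "a < dim_row (1\<^sub>m (length (increasing_lists d k)) :: 'k mat)" "b < dim_col (1\<^sub>m (length (increasing_lists d k)) :: 'k mat)"
  then have a: "a < length (increasing_lists d k)" and b: "b < length (increasing_lists d k)" by auto
  let ?R = "increasing_lists d k ! a" and ?C = "increasing_lists d k ! b"
  have R: "?R \<in> set (increasing_lists d k)" and C: "?C \<in> set (increasing_lists d k)" using a b by auto
  note RD = increasing_listsD[OF R] and CD = increasing_listsD[OF C]
  let ?M = "mat k k (\<lambda>(i, j). (1\<^sub>m d :: 'k mat) $$ (?R ! i, ?C ! j))"
  show "exterior_power_mat k (1\<^sub>m d) $$ (a, b) = (1\<^sub>m (length (increasing_lists d k)) :: 'k mat) $$ (a, b)"
  proof (cases "a = b")
    case True
    have "?M = 1\<^sub>m k" using True RD by (intro eq_matI) (auto simp: nth_eq_iff_index_eq)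
    then show ?thesis using a b True by (simp add: exterior_power_mat_index[OF one_carrier_mat])
  next
    case False
    then have "?R \<noteq> ?C" using a b increasing_lists_distinct by (simp add: nth_eq_iff_index_eq)
    then have "set ?R \<noteq> set ?C" using R C increasing_lists_bij[of d k] by (auto simp: bij_betw_def inj_on_def)
    moreover have "card (set ?R) = card (set ?C)" using RD CD by (simp add: distinct_card)
    ultimately have "\<not> set ?R \<subseteq> set ?C" by (metis List.finite_set card_subset_eq)
    then obtain i where i: "i < k" and nC: "?R ! i \<notin> set ?C" using RD(2) by (auto simp: set_conv_nth)
    have "det ?M = 0"
      unfolding det_mat_expand
    proof (rule sum.neutral, clarify)
      fix p assume p: "p permutes {..<k}"
      then have "p i < k" using i permutes_in_image[OF p, of i] by auto
      then have "?R ! i \<noteq> ?C ! p i" using nC CD(2) by auto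
      then have "(1\<^sub>m d :: 'k mat) $$ (?R ! i, ?C ! p i) = 0" using RD(4)[OF i] CD(4)[OF \<open>p i < k\<close>] by simp
      then have "(\<Prod>i<k. (1\<^sub>m d :: 'k mat) $$ (?R ! i, ?C ! p i)) = 0" using i by (intro prod_zero) auto
      then show "of_int (sign p) * (\<Prod>i<k. (1\<^sub>m d :: 'k mat) $$ (?R ! i, ?C ! p i)) = 0" by simp
    qed
    then show ?thesis using a b False by (simp add: exterior_power_mat_index[OF one_carrier_mat])
  qed
qed (auto simp: exterior_power_mat_def Let_def)

lemma principal_minor_list:
  assumes S: "distinct S" "length S = k"
  shows "det (mat k k (\<lambda>(i, j). a (S ! i) (S ! j))) = principal_minor a (set S)"
proof -
  have bS: "bij_betw ((!) S) {..<k} (set S)" using S by (intro bij_betw_nth) auto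
  let ?h = "\<lambda>p x. if x \<in> set S then S ! (p (inv_into {..<k} ((!) S) x)) else x"
  have bh: "bij_betw ?h {p. p permutes {..<k}} {p. p permutes set S}"
    by (rule bij_betw_permutations[OF bS])
  have "principal_minor a (set S) = (\<Sum>p | p permutes {..<k}. of_int (sign (?h p)) * (\<Prod>i\<in>set S. a i (?h p i)))"
    unfolding principal_minor_def by (rule sum.reindex_bij_betw[OF bh, symmetric])
  also have "\<dots> = (\<Sum>p | p permutes {..<k}. of_int (sign p) * (\<Prod>i<k. a (S ! i) (S ! p i)))"
  proof (rule sum.cong[OF refl])
    fix p assume "p \<in> {p. p permutes {..<k}}"
    then have p: "p permutes {..<k}" by simp
    have inv: "inv_into {..<k} ((!) S) (S ! i) = i" if "i < k" for i
      using bij_betw_inv_into_left[OF bS, of i] that by simp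
    interpret permutes_bij_finite p "{..<k}" "set S" "(!) S" "inv_into {..<k} ((!) S)" "?h p"
      by unfold_locales (use p bS inv in auto)
    have "(\<Prod>i\<in>set S. a i (?h p i)) = (\<Prod>i<k. a (S ! i) (?h p (S ! i)))"
      by (rule prod.reindex_bij_betw[OF bS, symmetric])
    also have "\<dots> = (\<Prod>i<k. a (S ! i) (S ! p i))"
      using S inv by (intro prod.cong) auto
    finally show "of_int (sign (?h p)) * (\<Prod>i\<in>set S. a i (?h p i)) = of_int (sign p) * (\<Prod>i<k. a (S ! i) (S ! p i))"
      using sign_p' by simp
  qed
  also have "\<dots> = det (mat k k (\<lambda>(i, j). a (S ! i) (S ! j)))" by (rule det_mat_expand[symmetric])
  finally show ?thesis by simp
qed

text \<open>
  The diagonal entries of an exterior power are the principal minors.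
\<close>

lemma mat_trace_exterior_power:
  assumes A: "A \<in> carrier_mat d d"
  shows "mat_trace (exterior_power_mat k A) =
    (\<Sum>S | S \<subseteq> {..<d} \<and> card S = k. principal_minor (\<lambda>i j. A $$ (i, j)) S)"
proof -
  have "mat_trace (exterior_power_mat k A) = (\<Sum>c<length (increasing_lists d k). minor A (increasing_lists d k ! c) (increasing_lists d k ! c) k)"
    using exterior_power_mat_carrier[OF A, of k]
    by (simp add: mat_trace_def exterior_power_mat_index[OF A])
  also have "\<dots> = (\<Sum>S\<in>set (increasing_lists d k). minor A S S k)" by (rule sum_increasing_lists)
  also have "\<dots> = (\<Sum>S\<in>set (increasing_lists d k). principal_minor (\<lambda>i j. A $$ (i, j)) (set S))"
    using increasing_listsD by (intro sum.cong[OF refl] principal_minor_list) auto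
  also have "\<dots> = (\<Sum>S | S \<subseteq> {..<d} \<and> card S = k. principal_minor (\<lambda>i j. A $$ (i, j)) S)"
    by (rule sum.reindex_bij_betw[OF increasing_lists_bij])
  finally show ?thesis .
qed

section \<open>Operations on representations\<close>

lemma is_repD:
  fixes \<rho> :: "'h \<Rightarrow> 'k::field mat"
  assumes "group H" and \<rho>: "is_rep H d \<rho>"
  shows "\<And>g. g \<in> carrier H \<Longrightarrow> \<rho> g \<in> carrier_mat d d"
    and "\<And>g h. g \<in> carrier H \<Longrightarrow> h \<in> carrier H \<Longrightarrow> \<rho> (g \<otimes>\<^bsub>H\<^esub> h) = \<rho> g * \<rho> h"
    and "\<rho> \<one>\<^bsub>H\<^esub> = 1\<^sub>m d"
proof -
  interpret group H by fact
  have U: "\<rho> g \<in> Units (ring_mat TYPE('k) d ())" if "g \<in> carrier H" for g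
    using \<rho> that by (auto simp: is_rep_def hom_def units_of_def)
  then show c: "\<rho> g \<in> carrier_mat d d" if "g \<in> carrier H" for g
    using that by (auto simp: Units_def ring_mat_def)
  show m: "\<rho> (g \<otimes>\<^bsub>H\<^esub> h) = \<rho> g * \<rho> h" if "g \<in> carrier H" "h \<in> carrier H" for g h
    using \<rho> that by (auto simp: is_rep_def hom_def units_of_def ring_mat_def)
  obtain y where y: "y \<in> carrier_mat d d" "y * \<rho> \<one>\<^bsub>H\<^esub> = 1\<^sub>m d"
    using U[OF one_closed] by (auto simp: Units_def ring_mat_def)
  note c1 = c[OF one_closed]
  have "\<rho> \<one>\<^bsub>H\<^esub> * \<rho> \<one>\<^bsub>H\<^esub> = \<rho> \<one>\<^bsub>H\<^esub> * 1\<^sub>m d"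
    using m[OF one_closed one_closed] c1 by simp
  then show "\<rho> \<one>\<^bsub>H\<^esub> = 1\<^sub>m d"
    by (rule mat_left_cancel[OF c1 y c1 one_carrier_mat])
qed

lemma is_rep_inv:
  fixes \<rho> :: "'h \<Rightarrow> 'k::field mat"
  assumes "group H" and \<rho>: "is_rep H d \<rho>" and g: "g \<in> carrier H"
  shows "\<rho> (inv\<^bsub>H\<^esub> g) * \<rho> g = 1\<^sub>m d" "\<rho> g * \<rho> (inv\<^bsub>H\<^esub> g) = 1\<^sub>m d"
proof -
  interpret group H by fact
  note D = is_repD[OF assms(1) \<rho>]
  show "\<rho> (inv\<^bsub>H\<^esub> g) * \<rho> g = 1\<^sub>m d" "\<rho> g * \<rho> (inv\<^bsub>H\<^esub> g) = 1\<^sub>m d"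
    using D(2)[of "inv\<^bsub>H\<^esub> g" g] D(2)[of g "inv\<^bsub>H\<^esub> g"] D(3) g by auto
qed

lemma is_rep_tensor_rep:
  fixes \<rho> \<sigma> :: "'h \<Rightarrow> 'k::field mat"
  assumes H: "group H" and \<rho>: "is_rep H d \<rho>" and \<sigma>: "is_rep H e \<sigma>"
  shows "is_rep H (d * e) (tensor_rep \<rho> \<sigma>)"
proof (rule is_repI[OF H])
  note R = is_repD[OF H \<rho>] and S = is_repD[OF H \<sigma>]
  show "tensor_rep \<rho> \<sigma> g \<in> carrier_mat (d * e) (d * e)" if "g \<in> carrier H" for g
    unfolding tensor_rep_def by (rule kronecker_prod_carrier[OF R(1) S(1)]) (fact that)+
  show "tensor_rep \<rho> \<sigma> (g \<otimes>\<^bsub>H\<^esub> h) = tensor_rep \<rho> \<sigma> g * tensor_rep \<rho> \<sigma> h"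
    if "g \<in> carrier H" "h \<in> carrier H" for g h
    unfolding tensor_rep_def R(2)[OF that] S(2)[OF that]
    by (rule kronecker_prod_mult[OF R(1) S(1) R(1) S(1)]) (fact that)+
  show "tensor_rep \<rho> \<sigma> \<one>\<^bsub>H\<^esub> = 1\<^sub>m (d * e)"
    unfolding tensor_rep_def R(3) S(3) by (rule kronecker_prod_one)
qed

lemma is_rep_triv_rep:
  assumes "group H"
  shows "is_rep H 1 (triv_rep :: 'h \<Rightarrow> 'k::field mat)"
  by (rule is_repI[OF assms]) (auto simp: triv_rep_def)

lemma is_rep_exterior_power_rep:
  fixes \<rho> :: "'h \<Rightarrow> 'k::field mat"
  assumes H: "group H" and \<rho>: "is_rep H d \<rho>"
  shows "is_rep H (length (increasing_lists d k)) (exterior_power_rep k \<rho>)"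
proof (rule is_repI[OF H])
  note R = is_repD[OF H \<rho>]
  show "exterior_power_rep k \<rho> g \<in> carrier_mat (length (increasing_lists d k)) (length (increasing_lists d k))"
    if "g \<in> carrier H" for g
    unfolding exterior_power_rep_def by (rule exterior_power_mat_carrier[OF R(1)[OF that]])
  show "exterior_power_rep k \<rho> (g \<otimes>\<^bsub>H\<^esub> h) = exterior_power_rep k \<rho> g * exterior_power_rep k \<rho> h"
    if "g \<in> carrier H" "h \<in> carrier H" for g h
    unfolding exterior_power_rep_def R(2)[OF that]
    by (rule exterior_power_mat_mult[OF R(1) R(1)]) (fact that)+
  show "exterior_power_rep k \<rho> \<one>\<^bsub>H\<^esub> = 1\<^sub>m (length (increasing_lists d k))"
    unfolding exterior_power_rep_def R(3) by (rule exterior_power_mat_one)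
qed

definition dual_rep :: "('h, 'm) monoid_scheme \<Rightarrow> ('h \<Rightarrow> 'k::field mat) \<Rightarrow> 'h \<Rightarrow> 'k mat" where
  "dual_rep H \<rho> g = transpose_mat (\<rho> (inv\<^bsub>H\<^esub> g))"

lemma is_rep_dual_rep:
  fixes \<rho> :: "'h \<Rightarrow> 'k::field mat"
  assumes H: "group H" and \<rho>: "is_rep H d \<rho>"
  shows "is_rep H d (dual_rep H \<rho>)"
proof -
  interpret group H by fact
  note R = is_repD[OF H \<rho>]
  show ?thesis
  proof (rule is_repI[OF H])
    show "dual_rep H \<rho> g \<in> carrier_mat d d" if "g \<in> carrier H" for g
      using R(1)[of "inv\<^bsub>H\<^esub> g"] that by (simp add: dual_rep_def)
    show "dual_rep H \<rho> (g \<otimes>\<^bsub>H\<^esub> h) = dual_rep H \<rho> g * dual_rep H \<rho> h"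
      if "g \<in> carrier H" "h \<in> carrier H" for g h
      using that R(2)[of "inv\<^bsub>H\<^esub> h" "inv\<^bsub>H\<^esub> g"] transpose_mult[OF R(1) R(1), of "inv\<^bsub>H\<^esub> h" "inv\<^bsub>H\<^esub> g"]
      by (simp add: dual_rep_def inv_mult_group)
    show "dual_rep H \<rho> \<one>\<^bsub>H\<^esub> = 1\<^sub>m d" using R(3) by (simp add: dual_rep_def)
  qed
qed

lemma (in group) sum_translate:
  assumes "g \<in> carrier G"
  shows "(\<Sum>h\<in>carrier G. f (g \<otimes> h)) = (\<Sum>h\<in>carrier G. f h)"
  by (rule sum.reindex_bij_witness[of _ "\<lambda>h. inv g \<otimes> h" "\<lambda>h. g \<otimes> h"])
    (use assms in \<open>auto simp: m_assoc[symmetric]\<close>)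

text \<open>
  The average over the group is an idempotent.
\<close>

lemma sum_trace_rep:
  fixes \<rho> :: "'h \<Rightarrow> 'k::field_char_0 mat"
  assumes H: "group H" and fin: "finite (carrier H)" and \<rho>: "is_rep H d \<rho>"
  shows "\<exists>m. (\<Sum>g\<in>carrier H. mat_trace (\<rho> g)) = of_nat (card (carrier H)) * of_nat m \<and>
    (m = 0 \<longrightarrow> (\<forall>i<d. \<forall>j<d. (\<Sum>g\<in>carrier H. \<rho> g $$ (i, j)) = 0))"
proof -
  interpret group H by fact
  note R = is_repD[OF H \<rho>]
  define N where "N = (of_nat (card (carrier H)) :: 'k)"
  have N0: "N \<noteq> 0" unfolding N_def using fin by auto
  define P where "P = mat d d (\<lambda>(i, j). (\<Sum>g\<in>carrier H. \<rho> g $$ (i, j)) / N)"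
  have P: "P \<in> carrier_mat d d" by (simp add: P_def)
  have "P * P = P"
  proof (rule eq_matI)
    fix i j assume "i < dim_row P" "j < dim_col P"
    then have ij: "i < d" "j < d" using P by auto
    have "(P * P) $$ (i, j) = (\<Sum>k<d. P $$ (i, k) * P $$ (k, j))"
      by (rule mat_mult_index[OF P P ij])
    also have "\<dots> = (\<Sum>k<d. \<Sum>g\<in>carrier H. \<Sum>h\<in>carrier H. \<rho> g $$ (i, k) * \<rho> h $$ (k, j)) / (N * N)"
      using ij by (simp add: P_def sum_product sum_divide_distrib)
    also have "\<dots> = (\<Sum>g\<in>carrier H. \<Sum>k<d. \<Sum>h\<in>carrier H. \<rho> g $$ (i, k) * \<rho> h $$ (k, j)) / (N * N)"
      by (subst sum.swap) simp
    also have "\<dots> = (\<Sum>g\<in>carrier H. \<Sum>h\<in>carrier H. \<Sum>k<d. \<rho> g $$ (i, k) * \<rho> h $$ (k, j)) / (N * N)"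
      by (intro arg_cong[of _ _ "\<lambda>x. x / (N * N)"] sum.cong[OF refl] sum.swap)
    also have "\<dots> = (\<Sum>g\<in>carrier H. \<Sum>h\<in>carrier H. \<rho> (g \<otimes>\<^bsub>H\<^esub> h) $$ (i, j)) / (N * N)"
      using mat_mult_index[OF R(1) R(1) ij] by (intro arg_cong[of _ _ "\<lambda>x. x / (N * N)"] sum.cong[OF refl]) (simp add: R(2))
    also have "\<dots> = (\<Sum>g\<in>carrier H. \<Sum>h\<in>carrier H. \<rho> h $$ (i, j)) / (N * N)"
      using sum_translate[of _ "\<lambda>h. \<rho> h $$ (i, j)"] by simp
    also have "\<dots> = P $$ (i, j)"
      using N0 ij by (simp add: P_def N_def)
    finally show "(P * P) $$ (i, j) = P $$ (i, j)" .
  qed (use P in auto)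
  then obtain m where m: "mat_trace P = of_nat m" "m = 0 \<longrightarrow> P = 0\<^sub>m d d"
    using trace_idempotent[OF P] by blast
  have "mat_trace P = (\<Sum>i<d. \<Sum>g\<in>carrier H. \<rho> g $$ (i, i)) / N"
    by (simp add: mat_trace_def P_def sum_divide_distrib)
  also have "(\<Sum>i<d. \<Sum>g\<in>carrier H. \<rho> g $$ (i, i)) = (\<Sum>g\<in>carrier H. \<Sum>i<d. \<rho> g $$ (i, i))"
    by (rule sum.swap)
  also have "\<dots> = (\<Sum>g\<in>carrier H. mat_trace (\<rho> g))"
    using R(1) by (intro sum.cong) (auto simp: mat_trace_def)
  finally have "(\<Sum>g\<in>carrier H. mat_trace (\<rho> g)) = N * of_nat m" using N0 m(1) by (simp add: field_simps)
  moreover have "(\<Sum>g\<in>carrier H. \<rho> g $$ (i, j)) = 0" if "m = 0" "i < d" "j < d" for i j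
  proof -
    have "P $$ (i, j) = 0" using m(2) that by simp
    then show ?thesis using that N0 by (simp add: P_def)
  qed
  ultimately show ?thesis unfolding N_def by blast
qed

text \<open>
  The average of \<open>\<sigma> \<otimes> \<rho>\<^sup>*\<close> over the group is an idempotent
  whose trace depends only on the characters. Since they agree, it is the trace of the average of
  \<open>\<rho> \<otimes> \<rho>\<^sup>*\<close>, which fixes the identity matrix and hence is not
  zero.
\<close>

lemma nonzero_intertwiner:
  fixes \<rho> \<sigma> :: "'h \<Rightarrow> 'k::field_char_0 mat"
  assumes H: "group H" and fin: "finite (carrier H)" and \<rho>: "is_rep H d \<rho>" and \<sigma>: "is_rep H d \<sigma>"
    and d: "d > 0" and tr: "\<And>g. g \<in> carrier H \<Longrightarrow> mat_trace (\<rho> g) = mat_trace (\<sigma> g)"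
  shows "\<exists>A \<in> carrier_mat d d. A \<noteq> 0\<^sub>m d d \<and> (\<forall>g\<in>carrier H. A * \<rho> g = \<sigma> g * A)"
proof -
  interpret group H by fact
  note R = is_repD[OF H \<rho>] and S = is_repD[OF H \<sigma>] and D = is_repD[OF H is_rep_dual_rep[OF H \<rho>]]
  have trD: "mat_trace (tensor_rep \<tau> (dual_rep H \<rho>) g) = mat_trace (\<tau> g) * mat_trace (dual_rep H \<rho> g)"
    if "is_rep H d \<tau>" "g \<in> carrier H" for \<tau> g
    unfolding tensor_rep_def using is_repD(1)[OF H that(1)] D(1) that by (intro mat_trace_kronecker_prod) auto
  have ent: "tensor_rep \<tau> (dual_rep H \<rho>) g $$ (i * d + k, j * d + l) = \<tau> g $$ (i, j) * \<rho> (inv\<^bsub>H\<^esub> g) $$ (l, k)"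
    and lt: "i * d + k < d * d"
    if "is_rep H d \<tau>" "g \<in> carrier H" "i < d" "j < d" "k < d" "l < d" for \<tau> g i j k l
  proof -
    have *: "i * d + k < d * d" if "i < d" "k < d" for i k
    proof -
      have "i * d + k < Suc i * d" using that by simp
      also have "\<dots> \<le> d * d" using that by (intro mult_right_mono) auto
      finally show ?thesis .
    qed
    then show "i * d + k < d * d" using that by blast
    have "inv\<^bsub>H\<^esub> g \<in> carrier H" using that by simp
    note c = R(1)[OF this]
    show "tensor_rep \<tau> (dual_rep H \<rho>) g $$ (i * d + k, j * d + l) = \<tau> g $$ (i, j) * \<rho> (inv\<^bsub>H\<^esub> g) $$ (l, k)"
      unfolding tensor_rep_def
      using kronecker_prod_index[OF is_repD(1)[OF H that(1,2)] D(1)[OF that(2)] *[OF that(3,5)] *[OF that(4,6)]] that c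
      by (simp add: dual_rep_def)
  qed
  have key: "\<exists>m. (\<Sum>g\<in>carrier H. mat_trace (\<tau> g) * mat_trace (dual_rep H \<rho> g)) = of_nat (card (carrier H)) * of_nat m \<and>
      (m = 0 \<longrightarrow> (\<forall>i<d. \<forall>j<d. \<forall>k<d. \<forall>l<d. (\<Sum>g\<in>carrier H. \<tau> g $$ (i, j) * \<rho> (inv\<^bsub>H\<^esub> g) $$ (l, k)) = 0))"
    if \<tau>: "is_rep H d \<tau>" for \<tau>
  proof -
    obtain m where m: "(\<Sum>g\<in>carrier H. mat_trace (tensor_rep \<tau> (dual_rep H \<rho>) g)) = of_nat (card (carrier H)) * of_nat m"
      "m = 0 \<longrightarrow> (\<forall>i<d * d. \<forall>j<d * d. (\<Sum>g\<in>carrier H. tensor_rep \<tau> (dual_rep H \<rho>) g $$ (i, j)) = 0)"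
      using sum_trace_rep[OF H fin is_rep_tensor_rep[OF H \<tau> is_rep_dual_rep[OF H \<rho>]]] by blast
    have "(\<Sum>g\<in>carrier H. \<tau> g $$ (i, j) * \<rho> (inv\<^bsub>H\<^esub> g) $$ (l, k)) = 0"
      if "m = 0" "i < d" "j < d" "k < d" "l < d" for i j k l
    proof -
      have "(\<Sum>g\<in>carrier H. tensor_rep \<tau> (dual_rep H \<rho>) g $$ (i * d + k, j * d + l)) = 0"
        using m(2) lt[OF \<tau> one_closed, of i 0 k 0] lt[OF \<tau> one_closed, of j 0 l 0] that d by blast
      then show ?thesis using ent[OF \<tau>] that by simp
    qed
    moreover have "(\<Sum>g\<in>carrier H. mat_trace (\<tau> g) * mat_trace (dual_rep H \<rho> g)) = of_nat (card (carrier H)) * of_nat m"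
      using m(1) trD[OF \<tau>] by simp
    ultimately show ?thesis by blast
  qed
  obtain m where m: "(\<Sum>g\<in>carrier H. mat_trace (\<rho> g) * mat_trace (dual_rep H \<rho> g)) = of_nat (card (carrier H)) * of_nat m"
    "m = 0 \<longrightarrow> (\<forall>i<d. \<forall>j<d. \<forall>k<d. \<forall>l<d. (\<Sum>g\<in>carrier H. \<rho> g $$ (i, j) * \<rho> (inv\<^bsub>H\<^esub> g) $$ (l, k)) = 0)"
    using key[OF \<rho>] by blast
  have "m \<noteq> 0"
  proof
    assume "m = 0"
    have "0 = (\<Sum>j<d. \<Sum>g\<in>carrier H. \<rho> g $$ (0, j) * \<rho> (inv\<^bsub>H\<^esub> g) $$ (j, 0))"
      using m(2) \<open>m = 0\<close> d by simp
    also have "\<dots> = (\<Sum>g\<in>carrier H. \<Sum>j<d. \<rho> g $$ (0, j) * \<rho> (inv\<^bsub>H\<^esub> g) $$ (j, 0))" by (rule sum.swap)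
    also have "\<dots> = (\<Sum>g\<in>carrier H. (\<rho> g * \<rho> (inv\<^bsub>H\<^esub> g)) $$ (0, 0))"
      using mat_mult_index[OF R(1) R(1) d d] by (intro sum.cong) simp_all
    also have "\<dots> = of_nat (card (carrier H))" using is_rep_inv(2)[OF H \<rho>] d by simp
    finally show False using fin by auto
  qed
  have nz: "\<exists>i<d. \<exists>j<d. \<exists>k<d. \<exists>l<d. (\<Sum>g\<in>carrier H. \<sigma> g $$ (i, j) * \<rho> (inv\<^bsub>H\<^esub> g) $$ (l, k)) \<noteq> 0"
  proof (rule ccontr)
    assume *: "\<not> ?thesis"
    have "(\<Sum>g\<in>carrier H. mat_trace (\<sigma> g) * mat_trace (dual_rep H \<rho> g)) =
      (\<Sum>g\<in>carrier H. \<Sum>i<d. \<Sum>k<d. \<sigma> g $$ (i, i) * \<rho> (inv\<^bsub>H\<^esub> g) $$ (k, k))"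
    proof (rule sum.cong[OF refl])
      fix g assume g: "g \<in> carrier H"
      then have "inv\<^bsub>H\<^esub> g \<in> carrier H" by simp
      from R(1)[OF this] show "mat_trace (\<sigma> g) * mat_trace (dual_rep H \<rho> g) = (\<Sum>i<d. \<Sum>k<d. \<sigma> g $$ (i, i) * \<rho> (inv\<^bsub>H\<^esub> g) $$ (k, k))"
        using S(1)[OF g] by (simp add: mat_trace_def dual_rep_def sum_product)
    qed
    also have "\<dots> = (\<Sum>i<d. \<Sum>g\<in>carrier H. \<Sum>k<d. \<sigma> g $$ (i, i) * \<rho> (inv\<^bsub>H\<^esub> g) $$ (k, k))" by (rule sum.swap)
    also have "\<dots> = (\<Sum>i<d. \<Sum>k<d. \<Sum>g\<in>carrier H. \<sigma> g $$ (i, i) * \<rho> (inv\<^bsub>H\<^esub> g) $$ (k, k))"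
      by (intro sum.cong[OF refl] sum.swap)
    also have "\<dots> = (\<Sum>i<d. \<Sum>k<d. 0)" using * by (intro sum.cong[OF refl]) blast
    also have "\<dots> = 0" by simp
    finally have "of_nat (card (carrier H)) * of_nat m = (0 :: 'k)" using m(1) tr by simp
    then show False using \<open>m \<noteq> 0\<close> fin by auto
  qed
  then obtain i0 j0 k0 l0 where nz: "i0 < d" "j0 < d" "k0 < d" "l0 < d"
     "(\<Sum>g\<in>carrier H. \<sigma> g $$ (i0, j0) * \<rho> (inv\<^bsub>H\<^esub> g) $$ (l0, k0)) \<noteq> 0" by blast
  define A where "A = mat d d (\<lambda>(i, k). \<Sum>g\<in>carrier H. \<sigma> g $$ (i, j0) * \<rho> (inv\<^bsub>H\<^esub> g) $$ (l0, k))"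
  have A: "A \<in> carrier_mat d d" by (simp add: A_def)
  have "A $$ (i0, k0) \<noteq> 0" using nz by (simp add: A_def)
  then have "A \<noteq> 0\<^sub>m d d" using nz by auto
  moreover have "A * \<rho> x = \<sigma> x * A" if x: "x \<in> carrier H" for x
  proof (rule eq_matI)
    have ix: "inv\<^bsub>H\<^esub> x \<in> carrier H" using x by simp
    note c = R(1)[OF x] S(1)[OF x]
    fix i k assume "i < dim_row (\<sigma> x * A)" "k < dim_col (\<sigma> x * A)"
    then have ik: "i < d" "k < d" using A c by auto
    have "(A * \<rho> x) $$ (i, k) = (\<Sum>j<d. A $$ (i, j) * \<rho> x $$ (j, k))"
      by (rule mat_mult_index[OF A c(1) ik])
    also have "\<dots> = (\<Sum>j<d. \<Sum>g\<in>carrier H. \<sigma> g $$ (i, j0) * \<rho> (inv\<^bsub>H\<^esub> g) $$ (l0, j) * \<rho> x $$ (j, k))"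
      using ik by (simp add: A_def sum_distrib_right)
    also have "\<dots> = (\<Sum>g\<in>carrier H. \<Sum>j<d. \<sigma> g $$ (i, j0) * \<rho> (inv\<^bsub>H\<^esub> g) $$ (l0, j) * \<rho> x $$ (j, k))"
      by (rule sum.swap)
    also have "\<dots> = (\<Sum>g\<in>carrier H. \<sigma> g $$ (i, j0) * \<rho> (inv\<^bsub>H\<^esub> g \<otimes>\<^bsub>H\<^esub> x) $$ (l0, k))"
      using mat_mult_index[OF R(1) R(1) nz(4) ik(2)] x R(2) by (intro sum.cong[OF refl]) (simp add: sum_distrib_left mult.assoc)
    also have "\<dots> = (\<Sum>g\<in>carrier H. \<sigma> (x \<otimes>\<^bsub>H\<^esub> g) $$ (i, j0) * \<rho> (inv\<^bsub>H\<^esub> (x \<otimes>\<^bsub>H\<^esub> g) \<otimes>\<^bsub>H\<^esub> x) $$ (l0, k))"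
      by (rule sum_translate[OF x, symmetric])
    also have "\<dots> = (\<Sum>g\<in>carrier H. \<Sum>j<d. \<sigma> x $$ (i, j) * \<sigma> g $$ (j, j0) * \<rho> (inv\<^bsub>H\<^esub> g) $$ (l0, k))"
    proof (rule sum.cong[OF refl])
      fix g assume g: "g \<in> carrier H"
      have "inv\<^bsub>H\<^esub> (x \<otimes>\<^bsub>H\<^esub> g) \<otimes>\<^bsub>H\<^esub> x = inv\<^bsub>H\<^esub> g" using x g by (simp add: inv_mult_group m_assoc)
      then show "\<sigma> (x \<otimes>\<^bsub>H\<^esub> g) $$ (i, j0) * \<rho> (inv\<^bsub>H\<^esub> (x \<otimes>\<^bsub>H\<^esub> g) \<otimes>\<^bsub>H\<^esub> x) $$ (l0, k) =
         (\<Sum>j<d. \<sigma> x $$ (i, j) * \<sigma> g $$ (j, j0) * \<rho> (inv\<^bsub>H\<^esub> g) $$ (l0, k))"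
        using mat_mult_index[OF S(1)[OF x] S(1)[OF g] ik(1) nz(2)] S(2)[OF x g] by (simp add: sum_distrib_right)
    qed
    also have "\<dots> = (\<Sum>j<d. \<Sum>g\<in>carrier H. \<sigma> x $$ (i, j) * \<sigma> g $$ (j, j0) * \<rho> (inv\<^bsub>H\<^esub> g) $$ (l0, k))" by (rule sum.swap)
    also have "\<dots> = (\<Sum>j<d. \<sigma> x $$ (i, j) * A $$ (j, k))"
      using ik by (simp add: A_def sum_distrib_left mult.assoc)
    also have "\<dots> = (\<sigma> x * A) $$ (i, k)" by (rule mat_mult_index[OF c(2) A ik, symmetric])
    finally show "(A * \<rho> x) $$ (i, k) = (\<sigma> x * A) $$ (i, k)" .
  qed (use A R(1)[OF x] S(1)[OF x] x in auto)
  ultimately show ?thesis using A by blast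
qed

section \<open>Exact sequences and relations\<close>

text \<open>
  The matrices \<open>A, A', B, B'\<close> describe a splitting of the space, and the assumption
  on \<open>B * (\<sigma> g * A)\<close> says that the image of \<open>A\<close> is invariant. In
  a basis adapted to the splitting \<open>\<sigma>\<close> is block triangular with diagonal
  blocks \<open>\<delta>\<close> and \<open>\<alpha>\<close>.
\<close>

lemma short_exact_split:
  fixes \<sigma> :: "'h \<Rightarrow> 'k::field mat"
  assumes H: "group H" and \<sigma>: "is_rep H N \<sigma>"
    and A: "A \<in> carrier_mat N q" and A': "A' \<in> carrier_mat q N"
    and B: "B \<in> carrier_mat p N" and B': "B' \<in> carrier_mat N p"
    and A'A: "A' * A = 1\<^sub>m q" and BB': "B * B' = 1\<^sub>m p" and sum1: "A * A' + B' * B = 1\<^sub>m N"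
    and inv: "\<And>g. g \<in> carrier H \<Longrightarrow> B * (\<sigma> g * A) = 0\<^sub>m p q"
    and \<delta>: "\<And>g. g \<in> carrier H \<Longrightarrow> \<delta> g = A' * (\<sigma> g * A)"
    and \<alpha>: "\<And>g. g \<in> carrier H \<Longrightarrow> \<alpha> g = B * (\<sigma> g * B')"
  shows "is_rep H q \<delta>" "is_rep H p \<alpha>" "short_exact_reps H \<delta> \<sigma> \<alpha>"
    "\<And>g. g \<in> carrier H \<Longrightarrow> mat_trace (\<sigma> g) = mat_trace (\<delta> g) + mat_trace (\<alpha> g)"
proof -
  interpret group H by fact
  note S = is_repD[OF H \<sigma>]
  note AA' = mult_carrier_mat[OF A A'] and B'B = mult_carrier_mat[OF B' B]
  have BA: "B * A = 0\<^sub>m p q" using inv[OF one_closed] A by (simp add: S(3))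
  have split_left: "M = A * (A' * M) + B' * (B * M)" if "M \<in> carrier_mat N r" for M r
  proof -
    have "M = (A * A' + B' * B) * M" using that by (simp add: sum1)
    also have "\<dots> = A * A' * M + B' * B * M" by (rule add_mult_distrib_mat[OF AA' B'B that])
    finally show ?thesis unfolding assoc_mult_mat[OF A A' that] assoc_mult_mat[OF B' B that] .
  qed
  have split_right: "M = (M * A) * A' + (M * B') * B" if "M \<in> carrier_mat r N" for M r
  proof -
    have "M = M * (A * A' + B' * B)" using that by (simp add: sum1)
    also have "\<dots> = M * (A * A') + M * (B' * B)" by (rule mult_add_distrib_mat[OF that AA' B'B])
    finally show ?thesis unfolding assoc_mult_mat[OF that A A'] assoc_mult_mat[OF that B' B] .
  qed
  have SA: "\<sigma> g * A \<in> carrier_mat N q" and SB: "\<sigma> g * B' \<in> carrier_mat N p" and BS: "B * \<sigma> g \<in> carrier_mat p N" if "g \<in> carrier H" for g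
    using S(1)[OF that] A B B' by (blast intro: mult_carrier_mat)+
  have dc: "\<delta> g \<in> carrier_mat q q" and ac: "\<alpha> g \<in> carrier_mat p p" if "g \<in> carrier H" for g
    unfolding \<delta>[OF that] \<alpha>[OF that] using SA[OF that] SB[OF that] A' B by (blast intro: mult_carrier_mat)+
  have sA: "\<sigma> g * A = A * \<delta> g" if g: "g \<in> carrier H" for g
  proof -
    have "A * (A' * (\<sigma> g * A)) \<in> carrier_mat N q" using A A' SA[OF g] by (blast intro: mult_carrier_mat)
    then have "A * (A' * (\<sigma> g * A)) + B' * 0\<^sub>m p q = A * (A' * (\<sigma> g * A))" using B' by simp
    then show ?thesis using split_left[OF SA[OF g]] unfolding inv[OF g] \<delta>[OF g] by simp
  qed
  have Bs: "B * \<sigma> g = \<alpha> g * B" if g: "g \<in> carrier H" for g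
  proof -
    have "B * \<sigma> g = (B * \<sigma> g * A) * A' + (B * \<sigma> g * B') * B" by (rule split_right[OF BS[OF g]])
    also have "B * \<sigma> g * A = 0\<^sub>m p q" unfolding assoc_mult_mat[OF B S(1)[OF g] A] by (rule inv[OF g])
    also have "B * \<sigma> g * B' = \<alpha> g" unfolding assoc_mult_mat[OF B S(1)[OF g] B'] \<alpha>[OF g] ..
    also have "0\<^sub>m p q * A' = 0\<^sub>m p N" using A' by simp
    also have "0\<^sub>m p N + \<alpha> g * B = \<alpha> g * B" using ac[OF g] B by (intro left_add_zero_mat) (blast intro: mult_carrier_mat)
    finally show ?thesis .
  qed
  show d: "is_rep H q \<delta>"
  proof (rule is_repI[OF H dc])
    show "\<delta> (g \<otimes>\<^bsub>H\<^esub> h) = \<delta> g * \<delta> h" if g: "g \<in> carrier H" and h: "h \<in> carrier H" for g h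
    proof -
      have "A * \<delta> (g \<otimes>\<^bsub>H\<^esub> h) = \<sigma> g * \<sigma> h * A" using sA[OF m_closed[OF g h]] S(2)[OF g h] by simp
      also have "\<dots> = \<sigma> g * (A * \<delta> h)" unfolding assoc_mult_mat[OF S(1)[OF g] S(1)[OF h] A] sA[OF h] ..
      also have "\<dots> = \<sigma> g * A * \<delta> h" by (rule assoc_mult_mat[OF S(1)[OF g] A dc[OF h], symmetric])
      also have "\<dots> = A * (\<delta> g * \<delta> h)" unfolding sA[OF g] by (rule assoc_mult_mat[OF A dc[OF g] dc[OF h]])
      finally show ?thesis
        by (rule mat_left_cancel[OF A A' A'A dc[OF m_closed[OF g h]] mult_carrier_mat[OF dc[OF g] dc[OF h]]])
    qed
    show "\<delta> \<one>\<^bsub>H\<^esub> = 1\<^sub>m q" unfolding \<delta>[OF one_closed] S(3) using A A'A by simp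
  qed
  show a: "is_rep H p \<alpha>"
  proof (rule is_repI[OF H ac])
    show "\<alpha> (g \<otimes>\<^bsub>H\<^esub> h) = \<alpha> g * \<alpha> h" if g: "g \<in> carrier H" and h: "h \<in> carrier H" for g h
    proof -
      have "\<alpha> (g \<otimes>\<^bsub>H\<^esub> h) * B = B * (\<sigma> g * \<sigma> h)" using Bs[OF m_closed[OF g h]] S(2)[OF g h] by simp
      also have "\<dots> = \<alpha> g * B * \<sigma> h" unfolding assoc_mult_mat[OF B S(1)[OF g] S(1)[OF h], symmetric] Bs[OF g] ..
      also have "\<dots> = \<alpha> g * (\<alpha> h * B)" unfolding assoc_mult_mat[OF ac[OF g] B S(1)[OF h]] Bs[OF h] ..
      also have "\<dots> = \<alpha> g * \<alpha> h * B" by (rule assoc_mult_mat[OF ac[OF g] ac[OF h] B, symmetric])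
      finally show ?thesis
        by (rule mat_right_cancel[OF B B' BB' ac[OF m_closed[OF g h]] mult_carrier_mat[OF ac[OF g] ac[OF h]]])
    qed
    show "\<alpha> \<one>\<^bsub>H\<^esub> = 1\<^sub>m p" unfolding \<alpha>[OF one_closed] S(3) using B' BB' by simp
  qed
  show "mat_trace (\<sigma> g) = mat_trace (\<delta> g) + mat_trace (\<alpha> g)" if g: "g \<in> carrier H" for g
  proof -
    note s = S(1)[OF g]
    have "\<sigma> g = (\<sigma> g * A) * A' + (\<sigma> g * B') * B" by (rule split_right[OF s])
    then have "mat_trace (\<sigma> g) = mat_trace ((\<sigma> g * A) * A' + (\<sigma> g * B') * B)" by (rule arg_cong)
    also have "\<dots> = mat_trace ((\<sigma> g * A) * A') + mat_trace ((\<sigma> g * B') * B)"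
      by (rule mat_trace_add[OF mult_carrier_mat[OF SA[OF g] A'] mult_carrier_mat[OF SB[OF g] B]])
    also have "\<dots> = mat_trace (\<delta> g) + mat_trace (\<alpha> g)"
      unfolding mat_trace_mult_commute[OF SA[OF g] A'] mat_trace_mult_commute[OF SB[OF g] B] \<delta>[OF g] \<alpha>[OF g] ..
    finally show ?thesis .
  qed
  have dims: "dim_row (\<sigma> \<one>\<^bsub>H\<^esub>) = N" "dim_row (\<delta> \<one>\<^bsub>H\<^esub>) = q" "dim_row (\<alpha> \<one>\<^bsub>H\<^esub>) = p"
    using S(1) dc ac one_closed by auto
  have cols: "dim_col A = q" "dim_col B = N" "dim_row B = p" using A B by auto
  have "intertwiner H \<delta> \<sigma> A" "intertwiner H \<sigma> \<alpha> B"
    using A B sA Bs by (auto simp: intertwiner_def dims)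
  moreover have "inj_on ((*\<^sub>v) A) (carrier_vec q)"
  proof (rule inj_onI)
    fix x y assume x: "x \<in> carrier_vec q" and y: "y \<in> carrier_vec q" and eq: "A *\<^sub>v x = A *\<^sub>v y"
    have "v = A' *\<^sub>v (A *\<^sub>v v)" if "v \<in> carrier_vec q" for v
      unfolding assoc_mult_mat_vec[OF A' A that, symmetric] A'A using that by simp
    then show "x = y" using x y eq by metis
  qed
  moreover have "(*\<^sub>v) A ` carrier_vec q = mat_kernel B"
  proof (intro equalityI subsetI)
    fix v assume "v \<in> (*\<^sub>v) A ` carrier_vec q"
    then obtain u where u: "u \<in> carrier_vec q" "v = A *\<^sub>v u" by auto
    have "B *\<^sub>v v = 0\<^sub>v p"
      unfolding u(2) assoc_mult_mat_vec[OF B A u(1), symmetric] BA using u by (intro eq_vecI) (auto simp: scalar_prod_def)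
    then show "v \<in> mat_kernel B" using mult_mat_vec_carrier[OF A u(1)] u(2) by (auto simp: mat_kernel_def cols)
  next
    fix v assume "v \<in> mat_kernel B"
    then have v: "v \<in> carrier_vec N" "B *\<^sub>v v = 0\<^sub>v p" by (auto simp: mat_kernel_def cols)
    note A'v = mult_mat_vec_carrier[OF A' v(1)]
    have "v = (A * A' + B' * B) *\<^sub>v v" using v by (simp add: sum1)
    also have "\<dots> = (A * A') *\<^sub>v v + (B' * B) *\<^sub>v v" by (rule add_mult_distrib_mat_vec[OF AA' B'B v(1)])
    also have "\<dots> = A *\<^sub>v (A' *\<^sub>v v) + B' *\<^sub>v 0\<^sub>v p"
      unfolding assoc_mult_mat_vec[OF A A' v(1)] assoc_mult_mat_vec[OF B' B v(1)] v(2) ..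
    also have "\<dots> = A *\<^sub>v (A' *\<^sub>v v)"
    proof -
      have "B' *\<^sub>v 0\<^sub>v p = 0\<^sub>v N" using B' by (intro eq_vecI) (auto simp: scalar_prod_def)
      then show ?thesis using mult_mat_vec_carrier[OF A A'v] by simp
    qed
    finally show "v \<in> (*\<^sub>v) A ` carrier_vec q" using A'v by (rule image_eqI)
  qed
  moreover have "(*\<^sub>v) B ` carrier_vec N = carrier_vec p"
  proof (intro equalityI subsetI)
    fix v :: "'k vec" assume v: "v \<in> carrier_vec p"
    have "v = B *\<^sub>v (B' *\<^sub>v v)" unfolding assoc_mult_mat_vec[OF B B' v, symmetric] BB' using v by simp
    then show "v \<in> (*\<^sub>v) B ` carrier_vec N" using mult_mat_vec_carrier[OF B' v] by (rule image_eqI)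
  qed (use B in \<open>auto intro: mult_mat_vec_carrier\<close>)
  ultimately show "short_exact_reps H \<delta> \<sigma> \<alpha>"
    unfolding short_exact_reps_def reps_def using d \<sigma> a cols by blast
qed

lemma mat_from_columns:
  assumes A: "A \<in> carrier_mat m r" and Z: "Z \<in> carrier_mat m q"
    and im: "\<And>j. j < q \<Longrightarrow> \<exists>u\<in>carrier_vec r. A *\<^sub>v u = col Z j"
  obtains L where "L \<in> carrier_mat r q" "A * L = (Z :: 'k::comm_semiring_0 mat)"
proof -
  obtain u where u: "\<And>j. j < q \<Longrightarrow> u j \<in> carrier_vec r" "\<And>j. j < q \<Longrightarrow> A *\<^sub>v u j = col Z j"
    using im by metis
  define L where "L = mat r q (\<lambda>(i, j). u j $ i)"
  have cL: "col L j = u j" if "j < q" for j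
    using u(1)[OF that] that by (intro eq_vecI) (auto simp: L_def)
  have L: "L \<in> carrier_mat r q" by (simp add: L_def)
  have "A * L = Z"
  proof (rule eq_matI)
    fix i j assume "i < dim_row Z" "j < dim_col Z"
    then have ij: "i < m" "j < q" using Z by auto
    have "(A * L) $$ (i, j) = (A *\<^sub>v u j) $ i" using A L ij cL by simp
    then show "(A * L) $$ (i, j) = Z $$ (i, j)" using u(2) ij Z by simp
  qed (use A L Z in auto)
  then show thesis using that L by blast
qed

lemma mat_left_cancel_inj:
  assumes A: "A \<in> carrier_mat m r" and inj: "inj_on ((*\<^sub>v) A) (carrier_vec r)"
    and P: "P \<in> carrier_mat r q" and Q: "Q \<in> carrier_mat r q" and eq: "A * P = A * (Q :: 'k::comm_semiring_0 mat)"
  shows "P = Q"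
proof (rule eq_matI)
  fix i j assume "i < dim_row Q" "j < dim_col Q"
  then have ij: "i < r" "j < q" using Q by auto
  have "A *\<^sub>v col P j = A *\<^sub>v col Q j"
    using col_mult2[OF A P ij(2)] col_mult2[OF A Q ij(2)] eq by simp
  moreover have "col P j \<in> carrier_vec r" "col Q j \<in> carrier_vec r" using P Q ij by (auto simp: carrier_vecI)
  ultimately have "col P j = col Q j" by (rule inj_onD[OF inj])
  then have "col P j $ i = col Q j $ i" by simp
  then show "P $$ (i, j) = Q $$ (i, j)" using P Q ij by simp
qed (use P Q in auto)

text \<open>
  An exact sequence splits over the field, which reduces the claim to block triangular matrices.
\<close>

lemma short_exact_reps_trace:
  fixes \<rho> \<sigma> \<tau> :: "'h \<Rightarrow> 'k::field mat"
  assumes H: "group H" and ses: "short_exact_reps H \<rho> \<sigma> \<tau>" and g: "g \<in> carrier H"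
  shows "mat_trace (\<sigma> g) = mat_trace (\<rho> g) + mat_trace (\<tau> g)"
proof -
  interpret group H by fact
  obtain q N p where reps: "is_rep H q \<rho>" "is_rep H N \<sigma>" "is_rep H p \<tau>"
    using ses by (auto simp: short_exact_reps_def reps_def)
  note R = is_repD[OF H reps(1)] and S = is_repD[OF H reps(2)] and T = is_repD[OF H reps(3)]
  obtain A B where AB: "intertwiner H \<rho> \<sigma> A" "intertwiner H \<sigma> \<tau> B"
    "inj_on ((*\<^sub>v) A) (carrier_vec (dim_col A))" "(*\<^sub>v) A ` carrier_vec (dim_col A) = mat_kernel B"
    "(*\<^sub>v) B ` carrier_vec (dim_col B) = carrier_vec (dim_row B)"
    using ses by (auto simp: short_exact_reps_def)
  have "dim_row (\<sigma> \<one>\<^bsub>H\<^esub>) = N" "dim_row (\<rho> \<one>\<^bsub>H\<^esub>) = q" "dim_row (\<tau> \<one>\<^bsub>H\<^esub>) = p"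
    using R(1) S(1) T(1) one_closed by auto
  then have A: "A \<in> carrier_mat N q" and B: "B \<in> carrier_mat p N"
    and sA: "\<And>g. g \<in> carrier H \<Longrightarrow> A * \<rho> g = \<sigma> g * A"
    and Bs: "\<And>g. g \<in> carrier H \<Longrightarrow> B * \<sigma> g = \<tau> g * B"
    using AB(1,2) by (auto simp: intertwiner_def)
  have inj: "inj_on ((*\<^sub>v) A) (carrier_vec q)" using AB(3) A by auto
  have ker: "(*\<^sub>v) A ` carrier_vec q = mat_kernel B" using AB(4) A by auto
  have surj: "(*\<^sub>v) B ` carrier_vec N = carrier_vec p" using AB(5) B by auto
  have "\<exists>u\<in>carrier_vec N. B *\<^sub>v u = col (1\<^sub>m p) j" if "j < p" for j
  proof -
    have "col (1\<^sub>m p) j \<in> (*\<^sub>v) B ` carrier_vec N" unfolding surj by (simp add: carrier_vecI)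
    then show ?thesis by auto
  qed
  then obtain B' where B': "B' \<in> carrier_mat N p" and BB': "B * B' = 1\<^sub>m p"
    using mat_from_columns[OF B one_carrier_mat] by blast
  obtain q' Z Z' where Z: "Z \<in> carrier_mat N q'" and Z': "Z' \<in> carrier_mat q' N"
    and Z'Z: "Z' * Z = 1\<^sub>m q'" and BZ: "B * Z = 0\<^sub>m p q'" and one: "Z * Z' + B' * B = 1\<^sub>m N"
    using complement_of_retraction[OF B B' BB'] by metis
  have "B * (\<sigma> h * Z) = 0\<^sub>m p q'" if h: "h \<in> carrier H" for h
    unfolding assoc_mult_mat[OF B S(1)[OF h] Z, symmetric] Bs[OF h] assoc_mult_mat[OF T(1)[OF h] B Z] BZ
    using T(1)[OF h] by simp
  note split = short_exact_split(4)[OF H reps(2) Z Z' B B' Z'Z BB' one this refl refl g]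
  have BA: "B * A = 0\<^sub>m p q"
  proof (rule eq_matI)
    fix i j assume "i < dim_row (0\<^sub>m p q :: 'k mat)" "j < dim_col (0\<^sub>m p q :: 'k mat)"
    then have ij: "i < p" "j < q" by auto
    have e: "col (1\<^sub>m q) j \<in> carrier_vec q" using ij by (simp add: carrier_vecI)
    have "col A j = A *\<^sub>v col (1\<^sub>m q) j"
      using col_mult2[OF A one_carrier_mat ij(2)] A by simp
    then have "col A j \<in> mat_kernel B" unfolding ker[symmetric] using e by (rule image_eqI)
    then have "B *\<^sub>v col A j = 0\<^sub>v p" using B by (auto simp: mat_kernel_def)
    then have "col (B * A) j = 0\<^sub>v p" using col_mult2[OF B A ij(2)] by simp
    then have "col (B * A) j $ i = 0" using ij by simp
    then show "(B * A) $$ (i, j) = 0\<^sub>m p q $$ (i, j)" using A B ij by simp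
  qed (use A B in auto)
  have AZ: "A = Z * (Z' * A)"
  proof -
    have "A = (Z * Z' + B' * B) * A" using A one by simp
    also have "\<dots> = Z * Z' * A + B' * B * A"
      by (rule add_mult_distrib_mat[OF mult_carrier_mat[OF Z Z'] mult_carrier_mat[OF B' B] A])
    also have "\<dots> = Z * (Z' * A) + B' * 0\<^sub>m p q"
      unfolding assoc_mult_mat[OF Z Z' A] assoc_mult_mat[OF B' B A] BA ..
    also have "\<dots> = Z * (Z' * A)" using B' mult_carrier_mat[OF Z mult_carrier_mat[OF Z' A]] by simp
    finally show ?thesis .
  qed
  have "\<exists>u\<in>carrier_vec q. A *\<^sub>v u = col Z j" if j: "j < q'" for j
  proof -
    have "col Z j \<in> carrier_vec N" using Z j by (auto simp: carrier_vecI)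
    moreover have "B *\<^sub>v col Z j = col (B * Z) j" by (rule col_mult2[OF B Z j, symmetric])
    then have "B *\<^sub>v col Z j = 0\<^sub>v p" unfolding BZ using j by simp
    ultimately have "col Z j \<in> mat_kernel B" using B by (auto simp: mat_kernel_def)
    then show ?thesis unfolding ker[symmetric] by auto
  qed
  then obtain L where L: "L \<in> carrier_mat q q'" and AL: "A * L = Z"
    using mat_from_columns[OF A Z] by blast
  note M = mult_carrier_mat[OF Z' A]
  have ZAL: "Z' * A * L = 1\<^sub>m q'" unfolding assoc_mult_mat[OF Z' A L] AL by (rule Z'Z)
  have "A * (L * (Z' * A)) = A * 1\<^sub>m q"
    unfolding assoc_mult_mat[OF A L M, symmetric] AL AZ[symmetric] using A by simp
  then have LM: "L * (Z' * A) = 1\<^sub>m q"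
    by (rule mat_left_cancel_inj[OF A inj mult_carrier_mat[OF L M] one_carrier_mat])
  note r = R(1)[OF g] and rL = mult_carrier_mat[OF R(1)[OF g] L]
  have "Z' * (\<sigma> g * Z) = Z' * A * (\<rho> g * L)"
    unfolding AL[symmetric] assoc_mult_mat[OF S(1)[OF g] A L, symmetric] sA[OF g, symmetric]
      assoc_mult_mat[OF A r L] assoc_mult_mat[OF Z' A rL] ..
  then have "mat_trace (Z' * (\<sigma> g * Z)) = mat_trace (\<rho> g * L * (Z' * A))"
    using mat_trace_mult_commute[OF M rL] by simp
  also have "\<rho> g * L * (Z' * A) = \<rho> g" unfolding assoc_mult_mat[OF r L M] LM using r by simp
  finally have 1: "mat_trace (Z' * (\<sigma> g * Z)) = mat_trace (\<rho> g)" .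
  have "B * (\<sigma> g * B') = \<tau> g"
    unfolding assoc_mult_mat[OF B S(1)[OF g] B', symmetric] Bs[OF g] assoc_mult_mat[OF T(1)[OF g] B B'] BB'
    using T(1)[OF g] by simp
  then show ?thesis using split 1 by simp
qed

lemma subgroup_rep_relations:
  assumes "group H"
  shows "subgroup (rep_relations TYPE('k::field) H) (free_Abelian_group (reps H :: ('h \<Rightarrow> 'k mat) set))"
  unfolding rep_relations_def
  by (rule group.generate_is_subgroup)
    (auto simp: short_exact_reps_def dest!: keys_diff[THEN subsetD])

lemma rep_relations_closed:
  fixes x y :: "('h \<Rightarrow> 'k::field mat) \<Rightarrow>\<^sub>0 int"
  assumes "group H" "x \<in> rep_relations TYPE('k) H" "y \<in> rep_relations TYPE('k) H"
  shows "x + y \<in> rep_relations TYPE('k) H" "- x \<in> rep_relations TYPE('k) H" "x - y \<in> rep_relations TYPE('k) H"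
    "0 \<in> rep_relations TYPE('k) H" "Poly_Mapping.keys x \<subseteq> reps H"
proof -
  note s = subgroup_rep_relations[OF assms(1), where 'k = 'k]
  have k: "Poly_Mapping.keys z \<subseteq> reps H" if "z \<in> rep_relations TYPE('k) H" for z :: "('h \<Rightarrow> 'k mat) \<Rightarrow>\<^sub>0 int"
    using subgroup.mem_carrier[OF s that] by simp
  show "Poly_Mapping.keys x \<subseteq> reps H" using k assms(2) .
  have p: "a + b \<in> rep_relations TYPE('k) H" if "a \<in> rep_relations TYPE('k) H" "b \<in> rep_relations TYPE('k) H" for a b :: "('h \<Rightarrow> 'k mat) \<Rightarrow>\<^sub>0 int"
    using subgroup.m_closed[OF s that] by simp
  have m: "- a \<in> rep_relations TYPE('k) H" if "a \<in> rep_relations TYPE('k) H" for a :: "('h \<Rightarrow> 'k mat) \<Rightarrow>\<^sub>0 int"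
    using subgroup.m_inv_closed[OF s that] k[OF that] by simp
  show "x + y \<in> rep_relations TYPE('k) H" "- x \<in> rep_relations TYPE('k) H" using p m assms by blast+
  show "x - y \<in> rep_relations TYPE('k) H" using p[OF assms(2) m[OF assms(3)]] by simp
  show "0 \<in> rep_relations TYPE('k) H" using subgroup.one_closed[OF s] by simp
qed

lemma short_exact_in_rep_relations:
  fixes \<rho> \<sigma> \<tau> :: "'h \<Rightarrow> 'k::field mat"
  assumes "short_exact_reps H \<rho> \<sigma> \<tau>"
  shows "frag_of \<sigma> - frag_of \<rho> - frag_of \<tau> \<in> rep_relations TYPE('k) H"
  unfolding rep_relations_def by (rule generate.incl) (use assms in blast)

lemma zero_dim_in_rep_relations:
  fixes \<tau> :: "'h \<Rightarrow> 'k::field mat"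
  assumes H: "group H" and \<tau>: "is_rep H 0 \<tau>"
  shows "frag_of \<tau> \<in> rep_relations TYPE('k) H"
proof -
  have Z: "(0\<^sub>m 0 0 :: 'k mat) \<in> carrier_mat 0 0" by simp
  have e: "P = (Q :: 'k mat)" if "P \<in> carrier_mat 0 0" "Q \<in> carrier_mat 0 0" for P Q
    using that by (intro eq_matI) auto
  note T = is_repD[OF H \<tau>]
  have tt: "\<tau> g = 0\<^sub>m 0 0" if "g \<in> carrier H" for g using T(1)[OF that] by (intro e) auto
  have "short_exact_reps H \<tau> \<tau> \<tau>"
    by (rule short_exact_split(3)[OF H \<tau> Z Z Z Z]) (auto simp: tt intro!: e)
  then show ?thesis
    using short_exact_in_rep_relations[of H \<tau> \<tau> \<tau>] rep_relations_closed(2)[OF H] by force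
qed

text \<open>
  Induction on the dimension: a nonzero intertwiner splits a common constituent off both
  representations, and the remainders have the same character.
\<close>

lemma equal_characters_in_rep_relations:
  fixes \<rho> \<sigma> :: "'h \<Rightarrow> 'k::field_char_0 mat"
  assumes H: "group H" and fin: "finite (carrier H)" and \<rho>: "is_rep H d \<rho>" and \<sigma>: "is_rep H e \<sigma>"
    and tr: "\<And>g. g \<in> carrier H \<Longrightarrow> mat_trace (\<rho> g) = mat_trace (\<sigma> g)"
  shows "frag_of \<rho> - frag_of \<sigma> \<in> rep_relations TYPE('k) H"
  using \<rho> \<sigma> tr
proof (induction d arbitrary: \<rho> \<sigma> e rule: less_induct)
  case (less d)
  interpret group H by fact
  note \<rho> = less.prems(1) and \<sigma> = less.prems(2) and tr = less.prems(3)
  note R = is_repD[OF H \<rho>] and S = is_repD[OF H \<sigma>]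
  have "e = d" using tr[OF one_closed] unfolding R(3) S(3) mat_trace_one by simp
  note S = S[unfolded \<open>e = d\<close>] and \<sigma> = \<sigma>[unfolded \<open>e = d\<close>]
  show ?case
  proof (cases "d = 0")
    case True
    then show ?thesis
      using zero_dim_in_rep_relations[OF H] rep_relations_closed(3)[OF H] \<rho> \<sigma> by metis
  next
    case False
    then obtain A where A: "A \<in> carrier_mat d d" and A0: "A \<noteq> 0\<^sub>m d d"
      and int: "\<And>g. g \<in> carrier H \<Longrightarrow> A * \<rho> g = \<sigma> g * A"
      using nonzero_intertwiner[OF H fin \<rho> \<sigma> _ tr] by blast
    obtain r U U' Y Y' where U: "U \<in> carrier_mat d r" and U': "U' \<in> carrier_mat r d"
      and Y: "Y \<in> carrier_mat r d" and Y': "Y' \<in> carrier_mat d r"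
      and AUY: "A = U * Y" and U'U: "U' * U = 1\<^sub>m r" and YY': "Y * Y' = 1\<^sub>m r"
      using full_rank_factorization[OF A] by metis
    have r: "r > 0"
    proof (rule Nat.gr0I)
      assume "r = 0"
      then have "A = 0\<^sub>m d d" unfolding AUY using U Y by (intro eq_matI) (auto simp: scalar_prod_def)
      then show False using A0 by contradiction
    qed
    obtain q Z Z' where Z: "Z \<in> carrier_mat d q" and Z': "Z' \<in> carrier_mat q d" and Z'Z: "Z' * Z = 1\<^sub>m q"
      and YZ: "Y * Z = 0\<^sub>m r q" and one: "Z * Z' + Y' * Y = 1\<^sub>m d"
      using complement_of_retraction[OF Y Y' YY'] by metis
    obtain p W W' where W: "W \<in> carrier_mat d p" and W': "W' \<in> carrier_mat p d" and W'W: "W' * W = 1\<^sub>m p"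
      and W'U: "W' * U = 0\<^sub>m p r" and one': "W * W' + U * U' = 1\<^sub>m d"
      using complement_of_retraction[OF U' U U'U] by metis
    have UY: "U * (Y * M) = A * M" if "M \<in> carrier_mat d l" for M l
      unfolding AUY by (rule assoc_mult_mat[OF U Y that, symmetric])
    have sub\<rho>: "Y * (\<rho> g * Z) = 0\<^sub>m r q" if g: "g \<in> carrier H" for g
    proof -
      note rZ = mult_carrier_mat[OF R(1)[OF g] Z]
      have "U * (Y * (\<rho> g * Z)) = A * \<rho> g * Z" unfolding UY[OF rZ] by (rule assoc_mult_mat[OF A R(1)[OF g] Z, symmetric])
      also have "\<dots> = \<sigma> g * (U * (Y * Z))" unfolding int[OF g] UY[OF Z] by (rule assoc_mult_mat[OF S(1)[OF g] A Z])
      also have "\<dots> = U * 0\<^sub>m r q" unfolding YZ using U S(1)[OF g] by simp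
      finally show ?thesis by (rule mat_left_cancel[OF U U' U'U mult_carrier_mat[OF Y rZ] zero_carrier_mat])
    qed
    have sU: "\<sigma> g * U = U * (Y * (\<rho> g * Y'))" if g: "g \<in> carrier H" for g
    proof -
      note rY = mult_carrier_mat[OF R(1)[OF g] Y']
      have "U * (Y * (\<rho> g * Y')) = A * \<rho> g * Y'" unfolding UY[OF rY] by (rule assoc_mult_mat[OF A R(1)[OF g] Y', symmetric])
      also have "\<dots> = \<sigma> g * (U * (Y * Y'))" unfolding int[OF g] UY[OF Y'] by (rule assoc_mult_mat[OF S(1)[OF g] A Y'])
      also have "\<dots> = \<sigma> g * U" unfolding YY' using U by simp
      finally show ?thesis by simp
    qed
    have ryc: "Y * (\<rho> g * Y') \<in> carrier_mat r r" if g: "g \<in> carrier H" for g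
      by (rule mult_carrier_mat[OF Y mult_carrier_mat[OF R(1)[OF g] Y']])
    have sub\<sigma>: "W' * (\<sigma> g * U) = 0\<^sub>m p r" if g: "g \<in> carrier H" for g
      unfolding sU[OF g] assoc_mult_mat[OF W' U ryc[OF g], symmetric] W'U by (rule left_mult_zero_mat[OF ryc[OF g]])
    have same: "Y * (\<rho> g * Y') = U' * (\<sigma> g * U)" if g: "g \<in> carrier H" for g
      unfolding sU[OF g] assoc_mult_mat[OF U' U ryc[OF g], symmetric] U'U by (rule left_mult_one_mat[OF ryc[OF g], symmetric])
    have one2: "U * U' + W * W' = 1\<^sub>m d"
      using one' comm_add_mat[OF mult_carrier_mat[OF U U'] mult_carrier_mat[OF W W']] by simp
    define a where "a g = Y * (\<rho> g * Y')" for g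
    define b where "b g = Z' * (\<rho> g * Z)" for g
    define c where "c g = W' * (\<sigma> g * W)" for g
    note E1 = short_exact_split[OF H \<rho> Z Z' Y Y' Z'Z YY' one sub\<rho> b_def a_def]
    note E2 = short_exact_split[OF H \<sigma> U U' W' W U'U W'W one2 sub\<sigma> same[folded a_def] c_def]
    have "mat_trace (b g) = mat_trace (c g)" if "g \<in> carrier H" for g
      using E1(4)[OF _ that] E2(4)[OF _ _ that] tr[OF that] by simp
    moreover have "q < d"
    proof -
      have "mat_trace (1\<^sub>m d :: 'k mat) = mat_trace (1\<^sub>m q) + mat_trace (1\<^sub>m r)"
        using E1(4)[OF _ one_closed] R(3) is_repD(3)[OF H E1(1)] is_repD(3)[OF H E1(2)] by simp
      then have "(of_nat d :: 'k) = of_nat (q + r)" by (simp add: mat_trace_one)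
      then have "d = q + r" using of_nat_eq_iff by blast
      then show ?thesis using r by simp
    qed
    ultimately have "frag_of b - frag_of c \<in> rep_relations TYPE('k) H"
      using less.IH E1(1) E2(2) by blast
    moreover have "frag_of \<rho> - frag_of \<sigma> = (frag_of \<rho> - frag_of b - frag_of a) - (frag_of \<sigma> - frag_of a - frag_of c)
      + (frag_of b - frag_of c)" by simp
    ultimately show ?thesis
      using short_exact_in_rep_relations[OF E1(3)] short_exact_in_rep_relations[OF E2(3)] rep_relations_closed[OF H]
      by metis
  qed
qed

section \<open>Classes and characters\<close>

definition frag_char :: "(('h \<Rightarrow> 'k::field mat) \<Rightarrow>\<^sub>0 int) \<Rightarrow> 'h \<Rightarrow> 'k" where
  "frag_char x g = (\<Sum>\<rho>\<in>Poly_Mapping.keys x. of_int (Poly_Mapping.lookup x \<rho>) * mat_trace (\<rho> g))"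

lemma frag_char_superset:
  assumes "finite S" "Poly_Mapping.keys x \<subseteq> S"
  shows "frag_char x g = (\<Sum>\<rho>\<in>S. of_int (Poly_Mapping.lookup x \<rho>) * mat_trace (\<rho> g))"
  unfolding frag_char_def using assms
  by (intro sum.mono_neutral_left) (auto simp: in_keys_iff)

lemma frag_char_simps [simp]:
  "frag_char 0 g = 0" "frag_char (frag_of \<rho>) g = mat_trace (\<rho> g)"
  "frag_char (x + y) g = frag_char x g + frag_char y g" "frag_char (- x) g = - frag_char x g"
  "frag_char (x - y) g = frag_char x g - frag_char y g"
proof -
  show "frag_char 0 g = 0" "frag_char (frag_of \<rho>) g = mat_trace (\<rho> g)"
    by (simp_all add: frag_char_def)
  show add: "frag_char (x + y) g = frag_char x g + frag_char y g" for x y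
  proof -
    let ?S = "Poly_Mapping.keys x \<union> Poly_Mapping.keys y"
    have "frag_char (x + y) g = (\<Sum>\<rho>\<in>?S. of_int (Poly_Mapping.lookup (x + y) \<rho>) * mat_trace (\<rho> g))"
      by (rule frag_char_superset) (use keys_add[of x y] in auto)
    also have "\<dots> = frag_char x g + frag_char y g"
      unfolding frag_char_superset[of ?S x, OF _ Un_upper1, simplified] frag_char_superset[of ?S y, OF _ Un_upper2, simplified]
      by (simp add: lookup_add distrib_right sum.distrib)
    finally show ?thesis .
  qed
  show neg: "frag_char (- x) g = - frag_char x g" for x
    by (simp add: frag_char_def sum_negf)
  show "frag_char (x - y) g = frag_char x g - frag_char y g"
    using add[of x "- y"] neg[of y] by simp
qed

text \<open>
  Realised by block diagonal matrices.
\<close>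

lemma direct_sum_in_rep_relations:
  fixes \<rho> \<tau> :: "'h \<Rightarrow> 'k::field_char_0 mat"
  assumes H: "group H" and fin: "finite (carrier H)" and \<rho>: "\<rho> \<in> reps H" and \<tau>: "\<tau> \<in> reps H"
  shows "\<exists>\<sigma>\<in>reps H. frag_of \<sigma> - frag_of \<rho> - frag_of \<tau> \<in> rep_relations TYPE('k) H"
proof -
  interpret group H by fact
  obtain d e where d: "is_rep H d \<rho>" and e: "is_rep H e \<tau>" using \<rho> \<tau> by (auto simp: reps_def)
  note R = is_repD[OF H d] and T = is_repD[OF H e]
  define \<sigma> where "\<sigma> g = four_block_mat (\<rho> g) (0\<^sub>m d e) (0\<^sub>m e d) (\<tau> g)" for g
  have s: "is_rep H (d + e) \<sigma>"
  proof (rule is_repI[OF H])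
    show "\<sigma> g \<in> carrier_mat (d + e) (d + e)" if "g \<in> carrier H" for g
      unfolding \<sigma>_def by (rule four_block_carrier_mat[OF R(1)[OF that] T(1)[OF that]])
    show "\<sigma> (g \<otimes>\<^bsub>H\<^esub> h) = \<sigma> g * \<sigma> h" if g: "g \<in> carrier H" and h: "h \<in> carrier H" for g h
    proof -
      have "\<rho> g * \<rho> h \<in> carrier_mat d d" "\<tau> g * \<tau> h \<in> carrier_mat e e"
        using mult_carrier_mat[OF R(1)[OF g] R(1)[OF h]] mult_carrier_mat[OF T(1)[OF g] T(1)[OF h]] .
      then show ?thesis
        unfolding \<sigma>_def R(2)[OF g h] T(2)[OF g h]
          mult_four_block_mat[OF R(1)[OF g] zero_carrier_mat zero_carrier_mat T(1)[OF g] R(1)[OF h] zero_carrier_mat zero_carrier_mat T(1)[OF h]]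
        using R(1)[OF g] R(1)[OF h] T(1)[OF g] T(1)[OF h] by simp
    qed
    show "\<sigma> \<one>\<^bsub>H\<^esub> = 1\<^sub>m (d + e)" unfolding \<sigma>_def R(3) T(3) by (intro eq_matI) auto
  qed
  note S = is_repD[OF H s]
  define A where "A = mat (d + e) d (\<lambda>(i, j). if i = j then 1 else (0 :: 'k))"
  define A' where "A' = mat d (d + e) (\<lambda>(i, j). if i = j then 1 else (0 :: 'k))"
  define B where "B = mat e (d + e) (\<lambda>(i, j). if j = i + d then 1 else (0 :: 'k))"
  define B' where "B' = mat (d + e) e (\<lambda>(i, j). if i = j + d then 1 else (0 :: 'k))"
  have A: "A \<in> carrier_mat (d + e) d" and A': "A' \<in> carrier_mat d (d + e)"
    and B: "B \<in> carrier_mat e (d + e)" and B': "B' \<in> carrier_mat (d + e) e"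
    by (auto simp: A_def A'_def B_def B'_def)
  have MA: "(M * A) $$ (i, j) = M $$ (i, j)" if "M \<in> carrier_mat r (d + e)" "i < r" "j < d" for M r i j
    unfolding mat_mult_index[OF that(1) A that(2,3)] using that
    by (simp add: A_def if_distrib[of "\<lambda>x. _ * x"] cong: if_cong)
  have MB: "(M * B') $$ (i, j) = M $$ (i, j + d)" if "M \<in> carrier_mat r (d + e)" "i < r" "j < e" for M r i j
    unfolding mat_mult_index[OF that(1) B' that(2,3)] using that
    by (simp add: B'_def if_distrib[of "\<lambda>x. _ * x"] cong: if_cong)
  have AM: "(A' * M) $$ (i, j) = M $$ (i, j)" if "M \<in> carrier_mat (d + e) r" "i < d" "j < r" for M r i j
    unfolding mat_mult_index[OF A' that] using that
    by (simp add: A'_def if_distrib[of "\<lambda>x. x * _"] cong: if_cong)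
  have BM: "(B * M) $$ (i, j) = M $$ (i + d, j)" if "M \<in> carrier_mat (d + e) r" "i < e" "j < r" for M r i j
    unfolding mat_mult_index[OF B that] using that
    by (simp add: B_def if_distrib[of "\<lambda>x. x * _"] cong: if_cong)
  have "A' * A = 1\<^sub>m d"
    by (rule eq_matI) (use A A' in \<open>auto simp: AM[OF A] simp del: index_mult_mat(1)\<close>, auto simp: A_def)
  moreover have "B * B' = 1\<^sub>m e"
    by (rule eq_matI) (use B B' in \<open>auto simp: BM[OF B'] simp del: index_mult_mat(1)\<close>, auto simp: B'_def)
  moreover have "A * A' + B' * B = 1\<^sub>m (d + e)"
  proof (rule eq_matI)
    fix i j assume "i < dim_row (1\<^sub>m (d + e) :: 'k mat)" "j < dim_col (1\<^sub>m (d + e) :: 'k mat)"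
    then have ij: "i < d + e" "j < d + e" by auto
    have a: "(A * A') $$ (i, j) = (if i = j \<and> i < d then 1 else 0)"
      unfolding mat_mult_index[OF A A' ij] using ij
      by (simp add: A_def A'_def if_distrib[of "\<lambda>x. x * _"] if_distrib[of "\<lambda>x. _ * x"] sum.If_cases Int_def)
    have b: "(B' * B) $$ (i, j) = (if i = j \<and> i \<ge> d then 1 else 0)"
    proof -
      have "(B' * B) $$ (i, j) = (\<Sum>k<e. if k = i - d \<and> i \<ge> d then (if i = j then 1 else 0) else 0)"
        unfolding mat_mult_index[OF B' B ij] using ij by (intro sum.cong) (auto simp: B_def B'_def)
      then show ?thesis using ij by (cases "i \<ge> d") auto
    qed
    show "(A * A' + B' * B) $$ (i, j) = 1\<^sub>m (d + e) $$ (i, j)"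
      using a b ij A A' B B' by (simp del: index_mult_mat(1) add: index_add_mat)
  qed (use A A' B B' in auto)
  moreover have "B * (\<sigma> g * A) = 0\<^sub>m e d" if g: "g \<in> carrier H" for g
  proof (rule eq_matI)
    note sA = mult_carrier_mat[OF S(1)[OF g] A]
    fix i j assume "i < dim_row (0\<^sub>m e d :: 'k mat)" "j < dim_col (0\<^sub>m e d :: 'k mat)"
    then have ij: "i < e" "j < d" by auto
    have "(B * (\<sigma> g * A)) $$ (i, j) = \<sigma> g $$ (i + d, j)"
      using BM[OF sA ij] MA[OF S(1)[OF g], of "i + d" j] ij by (simp del: index_mult_mat(1))
    also have "\<dots> = 0" using ij R(1)[OF g] T(1)[OF g] by (simp add: \<sigma>_def)
    finally show "(B * (\<sigma> g * A)) $$ (i, j) = 0\<^sub>m e d $$ (i, j)" using ij by simp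
  qed (use A B in auto)
  moreover have "\<rho> g = A' * (\<sigma> g * A)" if g: "g \<in> carrier H" for g
  proof (rule eq_matI)
    note sA = mult_carrier_mat[OF S(1)[OF g] A]
    fix i j assume "i < dim_row (A' * (\<sigma> g * A))" "j < dim_col (A' * (\<sigma> g * A))"
    then have ij: "i < d" "j < d" using A A' by auto
    have "(A' * (\<sigma> g * A)) $$ (i, j) = \<sigma> g $$ (i, j)"
      using AM[OF sA ij] MA[OF S(1)[OF g], of i j] ij by (simp del: index_mult_mat(1))
    then show "\<rho> g $$ (i, j) = (A' * (\<sigma> g * A)) $$ (i, j)" using ij R(1)[OF g] T(1)[OF g] by (simp add: \<sigma>_def)
  qed (use A A' R(1)[OF g] in auto)
  moreover have "\<tau> g = B * (\<sigma> g * B')" if g: "g \<in> carrier H" for g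
  proof (rule eq_matI)
    note sB = mult_carrier_mat[OF S(1)[OF g] B']
    fix i j assume "i < dim_row (B * (\<sigma> g * B'))" "j < dim_col (B * (\<sigma> g * B'))"
    then have ij: "i < e" "j < e" using B B' by auto
    have "(B * (\<sigma> g * B')) $$ (i, j) = \<sigma> g $$ (i + d, j + d)"
      using BM[OF sB ij] MB[OF S(1)[OF g], of "i + d" j] ij by (simp del: index_mult_mat(1))
    then show "\<tau> g $$ (i, j) = (B * (\<sigma> g * B')) $$ (i, j)" using ij R(1)[OF g] T(1)[OF g] by (simp add: \<sigma>_def)
  qed (use B B' T(1)[OF g] in auto)
  ultimately have "short_exact_reps H \<rho> \<sigma> \<tau>"
    by (rule short_exact_split(3)[OF H s A A' B B'])
  from short_exact_in_rep_relations[OF this] show ?thesis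
    using s by (auto simp: reps_def)
qed

lemma frag_char_rep_relations:
  fixes x :: "('h \<Rightarrow> 'k::field mat) \<Rightarrow>\<^sub>0 int"
  assumes H: "group H" and x: "x \<in> rep_relations TYPE('k) H"
  shows "\<forall>g\<in>carrier H. frag_char x g = 0"
  using x unfolding rep_relations_def
  proof (induction rule: generate.induct)
    case (incl h)
    then show ?case using short_exact_reps_trace[OF H] by fastforce
  next
    case (inv h)
    then obtain \<rho> \<sigma> \<tau> where h: "h = frag_of \<sigma> - frag_of \<rho> - frag_of \<tau>" and ses: "short_exact_reps H \<rho> \<sigma> \<tau>" by blast
    have "h \<in> rep_relations TYPE('k) H" unfolding h by (rule short_exact_in_rep_relations[OF ses])
    then have "Poly_Mapping.keys h \<subseteq> reps H" using rep_relations_closed(5)[OF H] by blast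
    then show ?case using short_exact_reps_trace[OF H ses] by (simp add: h)
  qed simp_all

text \<open>
  Additivity of the trace gives one direction. For the other, a formal combination is modulo
  relations the difference of two representations, namely of the direct sums of the terms with
  positive and with negative coefficients, and these two have equal characters.
\<close>

theorem rep_relations_iff_character:
  fixes x :: "('h \<Rightarrow> 'k::field_char_0 mat) \<Rightarrow>\<^sub>0 int"
  assumes H: "group H" and fin: "finite (carrier H)"
  shows "x \<in> rep_relations TYPE('k) H \<longleftrightarrow>
    Poly_Mapping.keys x \<subseteq> reps H \<and> (\<forall>g\<in>carrier H. frag_char x g = 0)"
proof
  assume x: "x \<in> rep_relations TYPE('k) H"
  have "\<forall>g\<in>carrier H. frag_char x g = 0" using frag_char_rep_relations[OF H x] by blast
  then show "Poly_Mapping.keys x \<subseteq> reps H \<and> (\<forall>g\<in>carrier H. frag_char x g = 0)"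
    using rep_relations_closed(5)[OF H x x] by blast
next
  assume x: "Poly_Mapping.keys x \<subseteq> reps H \<and> (\<forall>g\<in>carrier H. frag_char x g = 0)"
  interpret group H by fact
  note cl = rep_relations_closed[OF H, where 'k = 'k]
  have "\<exists>\<rho>\<in>reps H. \<exists>\<sigma>\<in>reps H. x - (frag_of \<rho> - frag_of \<sigma>) \<in> rep_relations TYPE('k) H"
    using x[THEN conjunct1]
  proof (induction x rule: frag_induction)
    case zero
    have "triv_rep \<in> (reps H :: ('h \<Rightarrow> 'k mat) set)" using is_rep_triv_rep[OF H] by (auto simp: reps_def)
    moreover have "(0 :: ('h \<Rightarrow> 'k mat) \<Rightarrow>\<^sub>0 int) \<in> rep_relations TYPE('k) H"
      using subgroup.one_closed[OF subgroup_rep_relations[OF H]] by simp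
    ultimately show ?case by (metis diff_self)
  next
    case (one \<rho>)
    define z :: "'h \<Rightarrow> 'k mat" where "z g = 0\<^sub>m 0 0" for g
    have z: "is_rep H 0 z" by (rule is_repI[OF H]) (auto simp: z_def)
    then have "frag_of z \<in> rep_relations TYPE('k) H" by (rule zero_dim_in_rep_relations[OF H])
    then have "frag_of \<rho> - (frag_of \<rho> - frag_of z) \<in> rep_relations TYPE('k) H" by simp
    moreover have "z \<in> reps H" using z by (auto simp: reps_def)
    ultimately show ?case using one by blast
  next
    case (diff a b)
    then obtain \<rho> \<sigma> \<rho>' \<sigma>' where 1: "\<rho> \<in> reps H" "\<sigma> \<in> reps H" "a - (frag_of \<rho> - frag_of \<sigma>) \<in> rep_relations TYPE('k) H"
      "\<rho>' \<in> reps H" "\<sigma>' \<in> reps H" "b - (frag_of \<rho>' - frag_of \<sigma>') \<in> rep_relations TYPE('k) H" by blast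
    obtain \<alpha> where \<alpha>: "\<alpha> \<in> reps H" "frag_of \<alpha> - frag_of \<rho> - frag_of \<sigma>' \<in> rep_relations TYPE('k) H"
      using direct_sum_in_rep_relations[OF H fin 1(1,5)] by blast
    obtain \<beta> where \<beta>: "\<beta> \<in> reps H" "frag_of \<beta> - frag_of \<sigma> - frag_of \<rho>' \<in> rep_relations TYPE('k) H"
      using direct_sum_in_rep_relations[OF H fin 1(2,4)] by blast
    have "((a - (frag_of \<rho> - frag_of \<sigma>)) - (b - (frag_of \<rho>' - frag_of \<sigma>'))) -
       ((frag_of \<alpha> - frag_of \<rho> - frag_of \<sigma>') - (frag_of \<beta> - frag_of \<sigma> - frag_of \<rho>')) \<in> rep_relations TYPE('k) H"
      by (intro cl(3) 1(3,6) \<alpha>(2) \<beta>(2))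
    also have "((a - (frag_of \<rho> - frag_of \<sigma>)) - (b - (frag_of \<rho>' - frag_of \<sigma>'))) -
       ((frag_of \<alpha> - frag_of \<rho> - frag_of \<sigma>') - (frag_of \<beta> - frag_of \<sigma> - frag_of \<rho>')) = (a - b) - (frag_of \<alpha> - frag_of \<beta>)"
      by simp
    finally show ?case using \<alpha>(1) \<beta>(1) by blast
  qed
  then obtain \<rho> \<sigma> where \<rho>: "\<rho> \<in> reps H" and \<sigma>: "\<sigma> \<in> reps H"
    and e: "x - (frag_of \<rho> - frag_of \<sigma>) \<in> rep_relations TYPE('k) H" by blast
  have "\<forall>g\<in>carrier H. frag_char (x - (frag_of \<rho> - frag_of \<sigma>)) g = 0"
    using frag_char_rep_relations[OF H e] by blast
  then have tr: "mat_trace (\<rho> g) = mat_trace (\<sigma> g)" if "g \<in> carrier H" for g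
    using x that by simp
  then have "frag_of \<rho> - frag_of \<sigma> \<in> rep_relations TYPE('k) H"
  proof -
    obtain d e where "is_rep H d \<rho>" "is_rep H e \<sigma>" using \<rho> \<sigma> by (auto simp: reps_def)
    then show ?thesis by (rule equal_characters_in_rep_relations[OF H fin _ _ tr])
  qed
  from cl(1)[OF e this] show "x \<in> rep_relations TYPE('k) H" by simp
qed

lemma frag_extend_fun_add: "frag_extend (\<lambda>x. f x + g x) c = frag_extend f c + frag_extend g c"
  by (simp add: frag_extend_def frag_cmul_distrib2 sum.distrib)

lemma ring_free_rep_ring:
  assumes H: "group H"
  shows "ring (free_rep_ring TYPE('k::field) (H :: ('h, 'm) monoid_scheme))"
proof -
  let ?F = "free_rep_ring TYPE('k) H"
  let ?m = "\<lambda>x y. frag_extend (\<lambda>\<rho>. frag_extend (\<lambda>\<sigma>. frag_of (tensor_rep \<rho> \<sigma>)) y) x :: ('h \<Rightarrow> 'k mat) \<Rightarrow>\<^sub>0 int"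
  have ops: "x \<otimes>\<^bsub>?F\<^esub> y = ?m x y" "x \<oplus>\<^bsub>?F\<^esub> y = x + y" "\<one>\<^bsub>?F\<^esub> = frag_of triv_rep" "\<zero>\<^bsub>?F\<^esub> = 0"
    "x \<in> carrier ?F \<longleftrightarrow> Poly_Mapping.keys x \<subseteq> reps H" for x y
    by (simp_all add: free_rep_ring_def)
  have tens: "tensor_rep \<rho> \<sigma> \<in> reps H" if rs: "\<rho> \<in> reps H" "\<sigma> \<in> reps H" for \<rho> \<sigma> :: "'h \<Rightarrow> 'k mat"
  proof -
    obtain d e where "is_rep H d \<rho>" "is_rep H e \<sigma>" using rs by (auto simp: reps_def)
    from is_rep_tensor_rep[OF H this] show ?thesis by (auto simp: reps_def)
  qed
  have radd: "?m x (y + z) = ?m x y + ?m x z" for x y z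
    unfolding frag_extend_add by (rule frag_extend_fun_add)
  have closed: "Poly_Mapping.keys (?m x y) \<subseteq> reps H" if "Poly_Mapping.keys x \<subseteq> reps H" "Poly_Mapping.keys y \<subseteq> reps H" for x y
  proof -
    have "Poly_Mapping.keys (?m x y) \<subseteq> (\<Union>\<rho>\<in>Poly_Mapping.keys x. \<Union>\<sigma>\<in>Poly_Mapping.keys y. {tensor_rep \<rho> \<sigma>})"
      by (rule order_trans[OF keys_frag_extend UN_mono[OF subset_refl order_trans[OF keys_frag_extend]]]) simp
    then show ?thesis using that tens by blast
  qed
  have base: "?m (?m (frag_of \<rho>) y) z = ?m (frag_of \<rho>) (?m y z)" for \<rho> y z
    using subset_UNIV
  proof (induction y rule: frag_induction)
    case (one \<sigma>)
    show ?case using subset_UNIV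
      by (induction z rule: frag_induction)
        (simp_all add: frag_extend_diff tensor_rep_def[abs_def] kronecker_prod_assoc)
  qed (simp_all add: frag_extend_diff)
  have assoc: "?m (?m x y) z = ?m x (?m y z)" for x y z
    using subset_UNIV
  proof (induction x rule: frag_induction)
    case (one \<rho>)
    show ?case by (rule base)
  qed (simp_all add: frag_extend_diff)
  have t1: "tensor_rep triv_rep \<rho> = \<rho>" "tensor_rep \<rho> triv_rep = \<rho>" for \<rho> :: "'h \<Rightarrow> 'k mat"
    unfolding tensor_rep_def triv_rep_def using kronecker_prod_one_left kronecker_prod_one_right by (auto intro!: ext simp del: One_nat_def)
  show ?thesis
  proof (rule ringI)
    show "abelian_group ?F"
      by (rule abelian_groupI) (auto simp: ops dest: keys_add[THEN subsetD] intro!: bexI[of _ "- _"])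
    show "monoid ?F"
    proof (rule monoidI)
      show "\<one>\<^bsub>?F\<^esub> \<in> carrier ?F" using is_rep_triv_rep[OF H] by (auto simp: ops reps_def)
    qed (auto simp: ops closed assoc t1 frag_expansion[symmetric])
    show "(x \<oplus>\<^bsub>?F\<^esub> y) \<otimes>\<^bsub>?F\<^esub> z = x \<otimes>\<^bsub>?F\<^esub> z \<oplus>\<^bsub>?F\<^esub> y \<otimes>\<^bsub>?F\<^esub> z"
      "z \<otimes>\<^bsub>?F\<^esub> (x \<oplus>\<^bsub>?F\<^esub> y) = z \<otimes>\<^bsub>?F\<^esub> x \<oplus>\<^bsub>?F\<^esub> z \<otimes>\<^bsub>?F\<^esub> y" for x y z
      using radd by (simp_all add: ops frag_extend_add)
  qed
qed

section \<open>Subrings of virtual characters\<close>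

text \<open>
  Functions are considered up to their values on the carrier; outside of it they are arbitrary.
\<close>

definition virtual_characters :: "('h, 'm) monoid_scheme \<Rightarrow> ('h \<Rightarrow> 'k::field) set" where
  "virtual_characters H =
     {f. \<exists>x. Poly_Mapping.keys x \<subseteq> reps H \<and> (\<forall>g\<in>carrier H. f g = frag_char x g)}"

text \<open>
  The closure properties that the preimage in the virtual characters of a subring of the
  representation ring enjoys.
\<close>

locale character_subring =
  fixes H :: "('h, 'm) monoid_scheme" and A :: "('h \<Rightarrow> 'k::field) set"
  assumes cong: "\<And>f f'. f \<in> A \<Longrightarrow> (\<And>g. g \<in> carrier H \<Longrightarrow> f' g = f g) \<Longrightarrow> f' \<in> A"
    and one: "(\<lambda>_. 1) \<in> A"
    and diff: "\<And>f f'. f \<in> A \<Longrightarrow> f' \<in> A \<Longrightarrow> (\<lambda>g. f g - f' g) \<in> A"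
    and mult: "\<And>f f'. f \<in> A \<Longrightarrow> f' \<in> A \<Longrightarrow> (\<lambda>g. f g * f' g) \<in> A"
    and virtual: "A \<subseteq> virtual_characters H"

lemma frag_char_mult:
  fixes x y :: "('h \<Rightarrow> 'k::field mat) \<Rightarrow>\<^sub>0 int"
  assumes H: "group H" and x: "Poly_Mapping.keys x \<subseteq> reps H" and y: "Poly_Mapping.keys y \<subseteq> reps H" and g: "g \<in> carrier H"
  shows "frag_char (frag_extend (\<lambda>\<rho>. frag_extend (\<lambda>\<sigma>. frag_of (tensor_rep \<rho> \<sigma>)) y) x) g = frag_char x g * frag_char y g"
  using x
proof (induction x rule: frag_induction)
  case (one \<rho>)
  note \<rho> = one
  show ?case using y
  proof (induction y rule: frag_induction)
    case (one \<sigma>)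
    obtain d e where de: "is_rep H d \<rho>" "is_rep H e \<sigma>" using \<rho> one by (auto simp: reps_def)
    show ?case
      by (simp add: tensor_rep_def mat_trace_kronecker_prod[OF is_repD(1)[OF H de(1) g] is_repD(1)[OF H de(2) g]])
  qed (simp_all add: frag_extend_diff algebra_simps)
qed (simp_all add: frag_extend_diff algebra_simps)

lemma ideal_rep_relations:
  assumes H: "group H" and fin: "finite (carrier H)"
  shows "ideal (rep_relations TYPE('k::field_char_0) H) (free_rep_ring TYPE('k) (H :: ('h, 'm) monoid_scheme))"
proof (rule idealI)
  let ?F = "free_rep_ring TYPE('k) H" and ?I = "rep_relations TYPE('k) H"
  show R: "ring ?F" by (rule ring_free_rep_ring[OF H])
  have ops: "x \<otimes>\<^bsub>?F\<^esub> y = frag_extend (\<lambda>\<rho>. frag_extend (\<lambda>\<sigma>. frag_of (tensor_rep \<rho> \<sigma>)) y) x" "x \<oplus>\<^bsub>?F\<^esub> y = x + y"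
    "\<zero>\<^bsub>?F\<^esub> = 0" "x \<in> carrier ?F \<longleftrightarrow> Poly_Mapping.keys x \<subseteq> reps H" for x y
    by (simp_all add: free_rep_ring_def)
  note iff = rep_relations_iff_character[OF H fin, where 'k = 'k]
  have ainv: "inv\<^bsub>add_monoid ?F\<^esub> x = - x" if "Poly_Mapping.keys x \<subseteq> reps H" for x
  proof -
    interpret ring ?F by fact
    have "\<ominus>\<^bsub>?F\<^esub> x = - x" by (rule minus_equality) (use that in \<open>auto simp: ops\<close>)
    then show ?thesis unfolding a_inv_def .
  qed
  show "subgroup ?I (add_monoid ?F)"
  proof (rule subgroup.intro)
    show "?I \<subseteq> carrier (add_monoid ?F)" using iff by (auto simp: ops)
    show "x \<otimes>\<^bsub>add_monoid ?F\<^esub> y \<in> ?I" if "x \<in> ?I" "y \<in> ?I" for x y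
      using rep_relations_closed(1)[OF H that] by (simp add: ops)
    show "\<one>\<^bsub>add_monoid ?F\<^esub> \<in> ?I" using iff[of 0] by (simp add: ops)
    show "inv\<^bsub>add_monoid ?F\<^esub> x \<in> ?I" if "x \<in> ?I" for x
      unfolding ainv[OF rep_relations_closed(5)[OF H that that]] by (rule rep_relations_closed(2)[OF H that that])
  qed
  show "x \<otimes>\<^bsub>?F\<^esub> a \<in> ?I" "a \<otimes>\<^bsub>?F\<^esub> x \<in> ?I" if a: "a \<in> ?I" and x: "x \<in> carrier ?F" for a x
  proof -
    interpret ring ?F by fact
    have a': "a \<in> carrier ?F" "\<forall>g\<in>carrier H. frag_char a g = 0" using a iff[of a] by (auto simp: ops)
    have "x \<otimes>\<^bsub>?F\<^esub> a \<in> carrier ?F" "a \<otimes>\<^bsub>?F\<^esub> x \<in> carrier ?F" using a' x by auto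
    moreover have "frag_char (x \<otimes>\<^bsub>?F\<^esub> a) g = 0" "frag_char (a \<otimes>\<^bsub>?F\<^esub> x) g = 0" if g: "g \<in> carrier H" for g
      using frag_char_mult[OF H _ _ g, of x a] frag_char_mult[OF H _ _ g, of a x] a' x g by (simp_all add: ops)
    ultimately show "x \<otimes>\<^bsub>?F\<^esub> a \<in> ?I" "a \<otimes>\<^bsub>?F\<^esub> x \<in> ?I" unfolding iff ops(4)[symmetric] by blast+
  qed
qed

text \<open>
  The subring generated by the classes of \<open>\<Gamma>\<close> is pulled back along the
  character map. Its preimage is a set of functions to which the assumption applies, and by
  \<open>rep_relations_iff_character\<close> a class is determined by its character.
\<close>

theorem rep_ring_generated:
  fixes H :: "('h, 'm) monoid_scheme" and \<Gamma> :: "('h \<Rightarrow> 'k::field_char_0 mat) set"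
  assumes H: "group H" and fin: "finite (carrier H)" and \<Gamma>: "\<Gamma> \<subseteq> reps H"
    and main: "\<And>A \<rho>. character_subring H A \<Longrightarrow> (\<And>\<gamma>. \<gamma> \<in> \<Gamma> \<Longrightarrow> (\<lambda>g. mat_trace (\<gamma> g)) \<in> A) \<Longrightarrow> \<rho> \<in> reps H \<Longrightarrow>
      (\<lambda>g. mat_trace (\<rho> g)) \<in> A"
  shows "generate_ring (rep_ring TYPE('k) H) (rep_class H ` \<Gamma>) = carrier (rep_ring TYPE('k) H)"
proof -
  let ?F = "free_rep_ring TYPE('k) H" and ?I = "rep_relations TYPE('k) H" and ?R = "rep_ring TYPE('k) H"
  have ops: "x \<otimes>\<^bsub>?F\<^esub> y = frag_extend (\<lambda>\<rho>. frag_extend (\<lambda>\<sigma>. frag_of (tensor_rep \<rho> \<sigma>)) y) x" "x \<oplus>\<^bsub>?F\<^esub> y = x + y"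
    "\<zero>\<^bsub>?F\<^esub> = 0" "\<one>\<^bsub>?F\<^esub> = frag_of triv_rep" "x \<in> carrier ?F \<longleftrightarrow> Poly_Mapping.keys x \<subseteq> reps H" for x y
    by (simp_all add: free_rep_ring_def)
  note iff = rep_relations_iff_character[OF H fin, where 'k = 'k]
  interpret I: ideal ?I ?F by (rule ideal_rep_relations[OF H fin])
  interpret R: ring ?R unfolding rep_ring_def by (rule I.quotient_is_ring)
  let ?c = "\<lambda>x. ?I +>\<^bsub>?F\<^esub> x"
  note hom = I.rcos_ring_hom[folded rep_ring_def]
  have carr: "carrier ?R = ?c ` carrier ?F"
    by (auto simp: rep_ring_def FactRing_def A_RCOSETS_def' a_r_coset_def')
  have eq: "?c x = ?c y" if "x \<in> carrier ?F" "y \<in> carrier ?F" "\<And>g. g \<in> carrier H \<Longrightarrow> frag_char x g = frag_char y g" for x y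
  proof -
    have "x - y \<in> ?I" unfolding iff using that keys_diff[of x y] by (auto simp: ops)
    moreover have "x = (x - y) + y" by simp
    ultimately have "x \<in> ?c y" by (force simp: a_r_coset_def' ops)
    then show ?thesis using I.a_repr_independence'[of x y] that by simp
  qed
  have \<Gamma>c: "rep_class H ` \<Gamma> \<subseteq> carrier ?R" using \<Gamma> by (auto simp: rep_class_def carr ops intro!: imageI)
  let ?gen = "generate_ring ?R (rep_class H ` \<Gamma>)"
  have sub: "subring ?gen ?R" by (rule R.generate_ring_is_subring[OF \<Gamma>c])
  define P where "P = {x \<in> carrier ?F. ?c x \<in> ?gen}"
  have closed: "x - y \<in> P" "x \<otimes>\<^bsub>?F\<^esub> y \<in> P" if xy: "x \<in> P" "y \<in> P" for x y
  proof -
    have c: "x \<in> carrier ?F" "y \<in> carrier ?F" "?c x \<in> ?gen" "?c y \<in> ?gen" using xy by (auto simp: P_def)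
    have "x - y \<in> carrier ?F" using c keys_diff[of x y] by (auto simp: ops)
    moreover have "?c x = ?c (x - y) \<oplus>\<^bsub>?R\<^esub> ?c y"
      using ring_hom_add[OF hom \<open>x - y \<in> carrier ?F\<close> c(2)] by (simp add: ops)
    then have "?c (x - y) = ?c x \<ominus>\<^bsub>?R\<^esub> ?c y"
    proof -
      have "?c x \<in> carrier ?R" "?c y \<in> carrier ?R" "?c (x - y) \<in> carrier ?R"
        using c(1,2) \<open>x - y \<in> carrier ?F\<close> unfolding carr by blast+
      then show ?thesis using \<open>?c x = ?c (x - y) \<oplus>\<^bsub>?R\<^esub> ?c y\<close> by (simp add: a_minus_def R.a_assoc R.r_neg)
    qed
    ultimately show "x - y \<in> P" using c subringE(5,7)[OF sub] unfolding P_def a_minus_def by auto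
    show "x \<otimes>\<^bsub>?F\<^esub> y \<in> P"
      using ring_hom_mult[OF hom c(1,2)] c subringE(6)[OF sub] by (simp add: P_def)
  qed
  define A where "A = {f. \<exists>x\<in>P. \<forall>g\<in>carrier H. f g = frag_char x g}"
  have "character_subring H A"
  proof
    show "f' \<in> A" if "f \<in> A" "\<And>g. g \<in> carrier H \<Longrightarrow> f' g = f g" for f f'
      using that by (auto simp: A_def)
    have "\<one>\<^bsub>?F\<^esub> \<in> P" using ring_hom_one[OF hom] subringE(3)[OF sub] by (simp add: P_def)
    moreover have "frag_char \<one>\<^bsub>?F\<^esub> g = 1" for g by (simp add: ops triv_rep_def mat_trace_def)
    ultimately show "(\<lambda>_. 1) \<in> A" by (auto simp: A_def intro!: bexI[of _ "\<one>\<^bsub>?F\<^esub>"])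
    show "(\<lambda>g. f g - f' g) \<in> A" if ff: "f \<in> A" "f' \<in> A" for f f'
    proof -
      obtain x y where "x \<in> P" "y \<in> P" "\<forall>g\<in>carrier H. f g = frag_char x g" "\<forall>g\<in>carrier H. f' g = frag_char y g"
        using ff by (auto simp: A_def)
      then show ?thesis using closed(1)[of x y] by (auto simp: A_def intro!: bexI[of _ "x - y"])
    qed
    show "(\<lambda>g. f g * f' g) \<in> A" if ff: "f \<in> A" "f' \<in> A" for f f'
    proof -
      obtain x y where xy: "x \<in> P" "y \<in> P" "\<forall>g\<in>carrier H. f g = frag_char x g" "\<forall>g\<in>carrier H. f' g = frag_char y g"
        using ff by (auto simp: A_def)
      then have "frag_char (x \<otimes>\<^bsub>?F\<^esub> y) g = frag_char x g * frag_char y g" if "g \<in> carrier H" for g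
        using frag_char_mult[OF H _ _ that] by (auto simp: P_def ops)
      then show ?thesis using closed(2)[OF xy(1,2)] xy by (auto simp: A_def intro!: bexI[of _ "x \<otimes>\<^bsub>?F\<^esub> y"])
    qed
    show "A \<subseteq> virtual_characters H" by (auto simp: A_def P_def virtual_characters_def ops)
  qed
  moreover have "(\<lambda>g. mat_trace (\<gamma> g)) \<in> A" if \<gamma>: "\<gamma> \<in> \<Gamma>" for \<gamma>
  proof -
    have "frag_of \<gamma> \<in> P" using \<gamma> \<Gamma> generate_ring.incl[of "rep_class H \<gamma>" "rep_class H ` \<Gamma>"]
      by (auto simp: P_def ops rep_class_def)
    then show ?thesis by (auto simp: A_def intro!: bexI[of _ "frag_of \<gamma>"])
  qed
  ultimately have all: "(\<lambda>g. mat_trace (\<rho> g)) \<in> A" if "\<rho> \<in> reps H" for \<rho> using main that by blast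
  have one: "frag_of \<rho> \<in> P" if \<rho>: "\<rho> \<in> reps H" for \<rho>
  proof -
    obtain x where x: "x \<in> P" "\<forall>g\<in>carrier H. mat_trace (\<rho> g) = frag_char x g" using all[OF \<rho>] by (auto simp: A_def)
    have "?c (frag_of \<rho>) = ?c x" by (rule eq) (use x \<rho> in \<open>auto simp: P_def ops\<close>)
    then show ?thesis using x(1) \<rho> by (simp add: P_def ops)
  qed
  have "x \<in> P" if "x \<in> carrier ?F" for x
    using that[unfolded ops]
  proof (induction x rule: frag_induction)
    case zero
    have "frag_of triv_rep - frag_of triv_rep \<in> P"
      using is_rep_triv_rep[OF H] by (intro closed one) (auto simp: reps_def)
    then show ?case by simp
  qed (use one closed in auto)
  then have "carrier ?R \<subseteq> ?gen" unfolding carr by (auto simp: P_def)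
  moreover have "?gen \<subseteq> carrier ?R" by (rule R.generate_ring_incl[OF \<Gamma>c])
  ultimately show ?thesis by blast
qed

text \<open>
  The average of \<open>\<psi>\<^sup>-\<^sup>1 \<rho>\<close> over the subgroup is an idempotent,
  whose trace is the multiplicity of \<open>\<psi>\<close> in the restriction of
  \<open>\<rho>\<close>.
\<close>

lemma linear_character_multiplicity:
  fixes \<rho> :: "'h \<Rightarrow> 'k::field_char_0 mat" and \<psi> :: "'h \<Rightarrow> 'k"
  assumes H: "group H" and fin: "finite (carrier H)" and Y: "subgroup Y H" and \<rho>: "\<rho> \<in> reps H"
    and mult: "\<And>x y. x \<in> Y \<Longrightarrow> y \<in> Y \<Longrightarrow> \<psi> (x \<otimes>\<^bsub>H\<^esub> y) = \<psi> x * \<psi> y"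
    and nz: "\<And>x. x \<in> Y \<Longrightarrow> \<psi> x \<noteq> 0"
  shows "\<exists>m. (\<Sum>y\<in>Y. inverse (\<psi> y) * mat_trace (\<rho> y)) = of_nat (card Y) * of_nat m"
proof -
  interpret group H by fact
  obtain d where d: "is_rep H d \<rho>" using \<rho> by (auto simp: reps_def)
  note R = is_repD[OF H d]
  let ?Y = "H\<lparr>carrier := Y\<rparr>"
  have YH: "y \<in> carrier H" if "y \<in> Y" for y using subgroup.mem_carrier[OF Y that] .
  have gY: "group ?Y" by (rule subgroup.subgroup_is_group[OF Y H])
  have "\<psi> \<one>\<^bsub>H\<^esub> * \<psi> \<one>\<^bsub>H\<^esub> = \<psi> \<one>\<^bsub>H\<^esub>" using mult[of "\<one>\<^bsub>H\<^esub>" "\<one>\<^bsub>H\<^esub>"] subgroup.one_closed[OF Y] by simp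
  then have \<psi>1: "\<psi> \<one>\<^bsub>H\<^esub> = 1" using nz[OF subgroup.one_closed[OF Y]] by simp
  define \<pi> where "\<pi> y = inverse (\<psi> y) \<cdot>\<^sub>m \<rho> y" for y
  have "is_rep ?Y d \<pi>"
  proof (rule is_repI[OF gY])
    show "\<pi> g \<in> carrier_mat d d" if "g \<in> carrier ?Y" for g
      using R(1)[OF YH] that by (simp add: \<pi>_def)
    show "\<pi> (g \<otimes>\<^bsub>?Y\<^esub> h) = \<pi> g * \<pi> h" if "g \<in> carrier ?Y" "h \<in> carrier ?Y" for g h
    proof -
      have gh: "g \<in> Y" "h \<in> Y" using that by auto
      note c = R(1)[OF YH[OF gh(1)]] R(1)[OF YH[OF gh(2)]]
      have "\<pi> g * \<pi> h = (inverse (\<psi> g) * inverse (\<psi> h)) \<cdot>\<^sub>m (\<rho> g * \<rho> h)"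
        unfolding \<pi>_def mult_smult_assoc_mat[OF c(1) smult_carrier_mat[OF c(2)]] mult_smult_distrib[OF c]
        by (intro eq_matI) (auto simp: mult.assoc simp del: index_mult_mat(1))
      then show ?thesis using mult[OF gh] R(2)[OF YH[OF gh(1)] YH[OF gh(2)]] by (simp add: \<pi>_def mult.commute)
    qed
    show "\<pi> \<one>\<^bsub>?Y\<^esub> = 1\<^sub>m d" using R(3) \<psi>1 by (intro eq_matI) (auto simp: \<pi>_def)
  qed
  moreover have "finite Y" using fin subgroup.subset[OF Y] by (rule finite_subset[rotated])
  ultimately obtain m where m: "(\<Sum>g\<in>Y. mat_trace (\<pi> g)) = of_nat (card Y) * of_nat m"
    using sum_trace_rep[OF gY, of d \<pi>] by auto
  have "mat_trace (\<pi> g) = inverse (\<psi> g) * mat_trace (\<rho> g)" if "g \<in> Y" for g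
    using R(1)[OF YH[OF that]] by (simp add: \<pi>_def mat_trace_def sum_distrib_left)
  then show ?thesis using m by auto
qed

lemma virtual_character_multiplicity:
  fixes f \<psi> :: "'h \<Rightarrow> 'k::field_char_0"
  assumes H: "group H" and fin: "finite (carrier H)" and Y: "subgroup Y H" and f: "f \<in> virtual_characters H"
    and mult: "\<And>x y. x \<in> Y \<Longrightarrow> y \<in> Y \<Longrightarrow> \<psi> (x \<otimes>\<^bsub>H\<^esub> y) = \<psi> x * \<psi> y"
    and nz: "\<And>x. x \<in> Y \<Longrightarrow> \<psi> x \<noteq> 0"
  shows "\<exists>m :: int. (\<Sum>y\<in>Y. inverse (\<psi> y) * f y) = of_nat (card Y) * of_int m"
proof -
  obtain x where x: "Poly_Mapping.keys x \<subseteq> reps H" "\<And>g. g \<in> carrier H \<Longrightarrow> f g = frag_char x g"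
    using f by (auto simp: virtual_characters_def)
  have "\<exists>m :: int. (\<Sum>y\<in>Y. inverse (\<psi> y) * frag_char x y) = of_nat (card Y) * of_int m"
    using x(1)
  proof (induction x rule: frag_induction)
    case zero
    then show ?case by (intro exI[of _ 0]) simp
  next
    case (one \<rho>)
    obtain m where "(\<Sum>y\<in>Y. inverse (\<psi> y) * mat_trace (\<rho> y)) = of_nat (card Y) * of_nat m"
      using linear_character_multiplicity[OF H fin Y one mult nz] by blast
    then show ?case by (intro exI[of _ "int m"]) simp
  next
    case (diff a b)
    then obtain m m' :: int where "(\<Sum>y\<in>Y. inverse (\<psi> y) * frag_char a y) = of_nat (card Y) * of_int m"
      "(\<Sum>y\<in>Y. inverse (\<psi> y) * frag_char b y) = of_nat (card Y) * of_int m'" by blast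
    then show ?case by (intro exI[of _ "m - m'"]) (simp add: right_diff_distrib sum_subtractf)
  qed
  moreover have "(\<Sum>y\<in>Y. inverse (\<psi> y) * f y) = (\<Sum>y\<in>Y. inverse (\<psi> y) * frag_char x y)"
    using x(2) subgroup.mem_carrier[OF Y] by (intro sum.cong) auto
  ultimately show ?thesis by simp
qed

lemma virtual_character_conj:
  assumes H: "group H" and f: "f \<in> virtual_characters H" and g: "g \<in> carrier H" and h: "h \<in> carrier H"
  shows "f (h \<otimes>\<^bsub>H\<^esub> g \<otimes>\<^bsub>H\<^esub> inv\<^bsub>H\<^esub> h) = f g"
proof -
  interpret group H by fact
  obtain x where x: "Poly_Mapping.keys x \<subseteq> reps H" "\<And>g. g \<in> carrier H \<Longrightarrow> f g = frag_char x g"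
    using f by (auto simp: virtual_characters_def)
  have "frag_char x (h \<otimes>\<^bsub>H\<^esub> g \<otimes>\<^bsub>H\<^esub> inv\<^bsub>H\<^esub> h) = frag_char x g"
    using x(1)
  proof (induction x rule: frag_induction)
    case (one \<rho>)
    obtain d where d: "is_rep H d \<rho>" using one by (auto simp: reps_def)
    note R = is_repD[OF H d]
    note c = R(1)[OF h] R(1)[OF g] R(1)[OF inv_closed[OF h]]
    have "\<rho> (h \<otimes>\<^bsub>H\<^esub> g \<otimes>\<^bsub>H\<^esub> inv\<^bsub>H\<^esub> h) = \<rho> h * \<rho> g * \<rho> (inv\<^bsub>H\<^esub> h)" using g h R(2) by simp
    then have "mat_trace (\<rho> (h \<otimes>\<^bsub>H\<^esub> g \<otimes>\<^bsub>H\<^esub> inv\<^bsub>H\<^esub> h)) = mat_trace (\<rho> (inv\<^bsub>H\<^esub> h) * (\<rho> h * \<rho> g))"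
      using mat_trace_mult_commute[OF mult_carrier_mat[OF c(1,2)] c(3)] by metis
    also have "\<rho> (inv\<^bsub>H\<^esub> h) * (\<rho> h * \<rho> g) = \<rho> g"
      unfolding assoc_mult_mat[OF c(3,1,2), symmetric] is_rep_inv(1)[OF H d h] using c(2) by simp
    finally show ?case by simp
  qed simp_all
  then show ?thesis using x(2) g h by simp
qed

section \<open>Signs and orbits of permutations\<close>

lemma ex_fiberwise_bij:
  assumes A: "finite A" and B: "finite B"
    and card: "\<And>l. card {x \<in> A. p x = l} = card {x \<in> B. q x = l}"
  shows "\<exists>f. bij_betw f A B \<and> (\<forall>x\<in>A. q (f x) = p x)"
proof -
  have "\<exists>g. bij_betw g {x \<in> A. p x = l} {x \<in> B. q x = l}" for l
    using A B card by (intro finite_same_card_bij) auto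
  then obtain g where g: "\<And>l. bij_betw (g l) {x \<in> A. p x = l} {x \<in> B. q x = l}" by metis
  define f where "f x = g (p x) x" for x
  have f: "f x \<in> B" "q (f x) = p x" if "x \<in> A" for x
    using bij_betwE[OF g[of "p x"]] that by (auto simp: f_def)
  have "inj_on f A"
  proof (rule inj_onI)
    fix x y assume xy: "x \<in> A" "y \<in> A" "f x = f y"
    then have "p x = p y" using f(2) by metis
    then show "x = y" using xy bij_betw_imp_inj_on[OF g[of "p x"]] by (auto simp: f_def inj_on_def)
  qed
  moreover have "f ` A = B"
  proof (intro equalityI subsetI)
    fix y assume y: "y \<in> B"
    then have "y \<in> g (q y) ` {x \<in> A. p x = q y}" using bij_betw_imp_surj_on[OF g[of "q y"]] by auto
    then obtain x where x: "x \<in> A" "p x = q y" "y = g (q y) x" by auto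
    then have "y = f x" by (simp add: f_def)
    then show "y \<in> f ` A" using x(1) by (rule image_eqI)
  qed (use f in auto)
  ultimately show ?thesis using f by (auto simp: bij_betw_def)
qed

lemma sign_on_Un_disjoint:
  assumes fin: "finite A" "finite B" and inj: "inj \<sigma>" and inv: "\<sigma> ` A = A" "\<sigma> ` B = B" and disj: "A \<inter> B = {}"
  shows "sign_on (A \<union> B) \<sigma> = sign_on A \<sigma> * sign_on B \<sigma>"
proof -
  have bij: "bij_betw \<sigma> A A" "bij_betw \<sigma> B B" using inj inv by (auto simp: bij_betw_def intro: inj_on_subset)
  have p: "permutation (restrict_id \<sigma> A)" "permutation (restrict_id \<sigma> B)"
    using permutes_imp_permutation[OF fin(1) permutes_restrict_id[OF bij(1)]]
      permutes_imp_permutation[OF fin(2) permutes_restrict_id[OF bij(2)]] .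
  have "restrict_id \<sigma> (A \<union> B) = restrict_id \<sigma> A \<circ> restrict_id \<sigma> B"
    using inv disj by (auto simp: restrict_id_def fun_eq_iff)
  then show ?thesis unfolding sign_on_def using sign_compose[OF p] by simp
qed

lemma sign_on_sym_diff:
  assumes fin: "finite A" "finite B" and inj: "inj \<sigma>" and inv: "\<sigma> ` A = A" "\<sigma> ` B = B"
  shows "sign_on (A - B \<union> (B - A)) \<sigma> = sign_on A \<sigma> * sign_on B \<sigma>"
proof -
  have i: "\<sigma> ` (A - B) = A - B" "\<sigma> ` (B - A) = B - A" "\<sigma> ` (A \<inter> B) = A \<inter> B"
    using inv by (simp_all add: image_set_diff[OF inj] image_Int[OF inj])
  have "sign_on A \<sigma> = sign_on ((A - B) \<union> (A \<inter> B)) \<sigma>" by (rule arg_cong2[of _ _ _ _ sign_on]) auto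
  also have "\<dots> = sign_on (A - B) \<sigma> * sign_on (A \<inter> B) \<sigma>"
    by (rule sign_on_Un_disjoint) (use fin inj i in auto)
  finally have a: "sign_on A \<sigma> = sign_on (A - B) \<sigma> * sign_on (A \<inter> B) \<sigma>" .
  have "sign_on B \<sigma> = sign_on ((B - A) \<union> (A \<inter> B)) \<sigma>" by (rule arg_cong2[of _ _ _ _ sign_on]) auto
  also have "\<dots> = sign_on (B - A) \<sigma> * sign_on (A \<inter> B) \<sigma>"
    by (rule sign_on_Un_disjoint) (use fin inj i in auto)
  finally have b: "sign_on B \<sigma> = sign_on (B - A) \<sigma> * sign_on (A \<inter> B) \<sigma>" .
  have "sign_on (A - B \<union> (B - A)) \<sigma> = sign_on (A - B) \<sigma> * sign_on (B - A) \<sigma>"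
    by (rule sign_on_Un_disjoint) (use fin inj i in auto)
  moreover have "sign_on (A \<inter> B) \<sigma> * sign_on (A \<inter> B) \<sigma> = 1" by (simp add: sign_on_def)
  ultimately show ?thesis unfolding a b by (simp add: algebra_simps)
qed

text \<open>
  The signs of a permutation on invariant sets multiply like characters of the group of invariant
  sets under symmetric difference, hence only the parity of the number of sets containing a point
  matters.
\<close>

lemma sign_on_odd_parity:
  assumes T: "finite T" and fin: "\<And>t. t \<in> T \<Longrightarrow> finite (u t)" and inj: "inj \<sigma>"
    and inv: "\<And>t. t \<in> T \<Longrightarrow> \<sigma> ` u t = u t"
  shows "sign_on {x. odd (card {t \<in> T. x \<in> u t})} \<sigma> = (\<Prod>t\<in>T. sign_on (u t) \<sigma>)"
    and "\<sigma> ` {x. odd (card {t \<in> T. x \<in> u t})} = {x. odd (card {t \<in> T. x \<in> u t})}"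
proof -
  have "sign_on {x. odd (card {t \<in> T. x \<in> u t})} \<sigma> = (\<Prod>t\<in>T. sign_on (u t) \<sigma>) \<and>
    \<sigma> ` {x. odd (card {t \<in> T. x \<in> u t})} = {x. odd (card {t \<in> T. x \<in> u t})} \<and> finite {x. odd (card {t \<in> T. x \<in> u t})}"
    using T fin inv
  proof (induction T rule: finite_induct)
    case empty
    then show ?case by (simp add: sign_on_def restrict_id_def id_def[symmetric])
  next
    case (insert t T)
    define A where "A = {x. odd (card {t \<in> T. x \<in> u t})}"
    have IH: "sign_on A \<sigma> = (\<Prod>t\<in>T. sign_on (u t) \<sigma>)" "\<sigma> ` A = A" "finite A" using insert unfolding A_def by auto
    have e: "{x. odd (card {t' \<in> insert t T. x \<in> u t'})} = A - u t \<union> (u t - A)"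
    proof (rule Set.set_eqI)
      fix x
      have "{t' \<in> insert t T. x \<in> u t'} = (if x \<in> u t then insert t {t' \<in> T. x \<in> u t'} else {t' \<in> T. x \<in> u t'})" by auto
      then show "x \<in> {x. odd (card {t' \<in> insert t T. x \<in> u t'})} \<longleftrightarrow> x \<in> A - u t \<union> (u t - A)"
        using insert(1,2) by (simp add: A_def)
    qed
    have "\<sigma> ` (A - u t \<union> (u t - A)) = A - u t \<union> (u t - A)"
      using IH insert by (simp add: image_Un image_set_diff[OF inj])
    then show ?case unfolding e
      using sign_on_sym_diff[OF IH(3) _ inj IH(2), of "u t"] IH insert by simp
  qed
  then show "sign_on {x. odd (card {t \<in> T. x \<in> u t})} \<sigma> = (\<Prod>t\<in>T. sign_on (u t) \<sigma>)"
    "\<sigma> ` {x. odd (card {t \<in> T. x \<in> u t})} = {x. odd (card {t \<in> T. x \<in> u t})}" by blast+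
qed

lemma sign_cycle_of_list:
  assumes "distinct cs" "cs \<noteq> []"
  shows "sign (cycle_of_list cs) = (- 1) ^ (length cs - 1)"
  using assms
proof (induction cs rule: cycle_of_list.induct)
  case (1 i j cs)
  have e: "sign (cycle_of_list (i # j # cs)) = sign (transpose i j) * sign (cycle_of_list (j # cs))"
    unfolding cycle_of_list.simps by (rule sign_compose[OF permutation_swap_id permutation_of_cycle])
  have "sign (cycle_of_list (j # cs)) = (- 1) ^ length cs" using 1 by simp
  then show ?case unfolding e using 1(2) by (simp add: sign_swap_id)
qed auto

text \<open>
  On an orbit the permutation acts as a cycle, which fixes the sign.
\<close>

lemma orbit_facts:
  assumes \<sigma>: "\<sigma> permutes N" and N: "finite N" and x: "x \<in> N"
  defines "C \<equiv> range (\<lambda>i. (\<sigma> ^^ i) x)"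
  shows "C \<subseteq> N" "x \<in> C" "\<sigma> ` C = C" "sign_on C \<sigma> = (- 1) ^ (card C - 1)"
proof -
  have p: "permutation \<sigma>" using permutes_imp_permutation[OF N \<sigma>] .
  have C: "C = set (support \<sigma> x)" unfolding C_def support_set[OF p] ..
  have "(\<sigma> ^^ i) x \<in> N" for i using x permutes_in_image[OF \<sigma>] by (induction i) auto
  then show CN: "C \<subseteq> N" by (auto simp: C_def)
  show "x \<in> C" unfolding C_def by (rule range_eqI[of _ _ 0]) simp
  have "\<sigma> ((\<sigma> ^^ i) x) \<in> C" for i unfolding C_def by (rule range_eqI[of _ _ "Suc i"]) simp
  then have sub: "\<sigma> ` C \<subseteq> C" by (auto simp: C_def)
  have "finite C" using CN N by (rule finite_subset)
  then show "\<sigma> ` C = C" using sub permutes_inj[OF \<sigma>] by (intro card_subset_eq) (auto simp: card_image inj_on_subset)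
  have "restrict_id \<sigma> C = cycle_of_list (support \<sigma> x)"
  proof
    fix y show "restrict_id \<sigma> C y = cycle_of_list (support \<sigma> x) y"
      using cycle_restrict[OF p, of y x] id_outside_supp[of y "support \<sigma> x"] by (cases "y \<in> C") (auto simp: C)
  qed
  moreover have d: "distinct (support \<sigma> x)" by (rule cycle_of_permutation[OF p])
  moreover have ne: "support \<sigma> x \<noteq> []" using \<open>x \<in> C\<close> unfolding C by auto
  ultimately show "sign_on C \<sigma> = (- 1) ^ (card C - 1)"
    unfolding sign_on_def C distinct_card[OF d] using sign_cycle_of_list[OF d ne] by simp
qed

section \<open>States\<close>

text \<open>
  A state assigns a label to every letter. Permutations of the letters preserve the label counts,
  and two states with the same counts that agree outside of the letters lie in one orbit.
\<close>

definition state_orbit :: "nat \<Rightarrow> (nat \<Rightarrow> 'l) \<Rightarrow> (nat \<Rightarrow> 'l) set" where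
  "state_orbit n s = {s \<circ> \<alpha> | \<alpha>. \<alpha> permutes {..<n}}"

lemma finite_state_orbit [simp]: "finite (state_orbit n s)"
proof -
  have "state_orbit n s = (\<lambda>\<alpha>. s \<circ> \<alpha>) ` {\<alpha>. \<alpha> permutes {..<n}}" by (auto simp: state_orbit_def)
  then show ?thesis by (simp add: finite_permutations)
qed

lemma state_orbit_self [simp]: "s \<in> state_orbit n s"
  unfolding state_orbit_def using permutes_id[of "{..<n}"] by (intro CollectI exI[of _ id]) simp

lemma state_orbit_comp: "s' \<in> state_orbit n s \<Longrightarrow> \<alpha> permutes {..<n} \<Longrightarrow> s' \<circ> \<alpha> \<in> state_orbit n s"
  unfolding state_orbit_def using permutes_compose[of \<alpha> "{..<n}"] by (auto simp: comp_assoc)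

lemma state_orbit_eq:
  assumes "s' \<in> state_orbit n s"
  shows "state_orbit n s' = state_orbit n s"
proof -
  obtain \<alpha> where \<alpha>: "\<alpha> permutes {..<n}" "s' = s \<circ> \<alpha>" using assms by (auto simp: state_orbit_def)
  have s: "s = s' \<circ> Hilbert_Choice.inv \<alpha>" using permutes_inv_o[OF \<alpha>(1)] by (simp add: \<alpha>(2) comp_assoc)
  have "s \<in> state_orbit n s'" unfolding s using permutes_inv[OF \<alpha>(1)] by (rule state_orbit_comp[OF state_orbit_self])
  have sub: "state_orbit n b \<subseteq> state_orbit n a" if "b \<in> state_orbit n a" for a b :: "nat \<Rightarrow> 'a"
    using state_orbit_comp[OF that] unfolding state_orbit_def[of n b] by blast
  show ?thesis using sub[OF assms] sub[OF \<open>s \<in> state_orbit n s'\<close>] by blast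
qed

lemma state_orbit_relabel: "state_orbit n (\<theta> \<circ> s) = (\<lambda>s'. \<theta> \<circ> s') ` state_orbit n s"
  by (auto simp: state_orbit_def comp_assoc image_def)

lemma card_fiber_permute:
  assumes "\<alpha> permutes {..<n}"
  shows "card {x \<in> {..<n}. Q (s (\<alpha> x))} = card {x \<in> {..<n}. Q (s x)}"
proof -
  have "bij_betw \<alpha> {x \<in> {..<n}. Q (s (\<alpha> x))} {x \<in> {..<n}. Q (s x)}"
    unfolding bij_betw_def
  proof
    show "inj_on \<alpha> {x \<in> {..<n}. Q (s (\<alpha> x))}" using permutes_inj[OF assms] by (rule inj_on_subset) simp
    show "\<alpha> ` {x \<in> {..<n}. Q (s (\<alpha> x))} = {x \<in> {..<n}. Q (s x)}"
    proof (intro equalityI subsetI)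
      fix y assume y: "y \<in> {x \<in> {..<n}. Q (s x)}"
      then have "Hilbert_Choice.inv \<alpha> y \<in> {..<n}" using permutes_in_image[OF permutes_inv[OF assms]] by blast
      then show "y \<in> \<alpha> ` {x \<in> {..<n}. Q (s (\<alpha> x))}"
        using y permutes_inverses(1)[OF assms] by (intro image_eqI[of _ _ "Hilbert_Choice.inv \<alpha> y"]) auto
    qed (use permutes_in_image[OF assms] in auto)
  qed
  then show ?thesis by (rule bij_betw_same_card)
qed

lemma state_orbitD:
  assumes "s' \<in> state_orbit n s"
  shows "\<And>x. x \<ge> n \<Longrightarrow> s' x = s x" "\<And>Q. card {x \<in> {..<n}. Q (s' x)} = card {x \<in> {..<n}. Q (s x)}" "s' ` {..<n} = s ` {..<n}"
proof -
  obtain \<alpha> where \<alpha>: "\<alpha> permutes {..<n}" "s' = s \<circ> \<alpha>" using assms by (auto simp: state_orbit_def)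
  show "s' x = s x" if "x \<ge> n" for x using permutes_not_in[OF \<alpha>(1), of x] that by (simp add: \<alpha>(2))
  show "card {x \<in> {..<n}. Q (s' x)} = card {x \<in> {..<n}. Q (s x)}" for Q
    unfolding \<alpha>(2) o_apply by (rule card_fiber_permute[OF \<alpha>(1)])
  show "s' ` {..<n} = s ` {..<n}" unfolding \<alpha>(2) image_comp[symmetric] permutes_image[OF \<alpha>(1)] ..
qed

lemma state_orbitI:
  assumes out: "\<And>x. x \<ge> n \<Longrightarrow> s' x = s x"
    and card: "\<And>l. card {x \<in> {..<n}. s' x = l} = card {x \<in> {..<n}. s x = l}"
  shows "s' \<in> state_orbit n s"
proof -
  obtain f where f: "bij_betw f {..<n} {..<n}" "\<forall>x\<in>{..<n}. s (f x) = s' x"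
    using ex_fiberwise_bij[of "{..<n}" "{..<n}" s' s] card by auto
  define \<alpha> where "\<alpha> x = (if x < n then f x else x)" for x
  have "bij_betw \<alpha> {..<n} {..<n}" using f(1) by (rule bij_betw_cong[THEN iffD1, rotated]) (auto simp: \<alpha>_def)
  then have \<alpha>: "\<alpha> permutes {..<n}" by (rule bij_imp_permutes) (auto simp: \<alpha>_def)
  have "s' = s \<circ> \<alpha>" using f(2) out by (auto simp: \<alpha>_def fun_eq_iff)
  then show ?thesis using \<alpha> by (auto simp: state_orbit_def)
qed

text \<open>
  The trace of \<open>(f, \<sigma>)\<close> on the line spanned by the state \<open>s\<close> in a
  sum of tensor products of symmetric and exterior powers: zero unless the state is fixed,
  otherwise the product of the characters attached to the labels, with the sign of
  \<open>\<sigma>\<close> on the letters with odd label.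
\<close>

definition state_char :: "nat \<Rightarrow> ('l \<Rightarrow> 'g \<Rightarrow> 'k::comm_ring_1) \<Rightarrow> ('l \<Rightarrow> bool) \<Rightarrow> (nat \<Rightarrow> 'l) \<Rightarrow> (nat \<Rightarrow> 'g) \<times> (nat \<Rightarrow> nat) \<Rightarrow> 'k" where
  "state_char n w od s = (\<lambda>(f, \<sigma>). if s \<circ> \<sigma> = s
     then (\<Prod>x<n. w (s x) (f x)) * of_int (sign_on {x \<in> {..<n}. od (s x)} \<sigma>) else 0)"

definition orbit_char :: "nat \<Rightarrow> ('l \<Rightarrow> 'g \<Rightarrow> 'k::comm_ring_1) \<Rightarrow> ('l \<Rightarrow> bool) \<Rightarrow> (nat \<Rightarrow> 'l) \<Rightarrow> (nat \<Rightarrow> 'g) \<times> (nat \<Rightarrow> nat) \<Rightarrow> 'k" where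
  "orbit_char n w od s p = (\<Sum>s'\<in>state_orbit n s. state_char n w od s' p)"

text \<open>
  With \<open>od\<close> the analogue of an elementary, without it of a complete symmetric
  function.
\<close>

definition subset_char :: "nat \<Rightarrow> ('g \<Rightarrow> 'k::comm_ring_1) \<Rightarrow> bool \<Rightarrow> nat \<Rightarrow> (nat \<Rightarrow> 'g) \<times> (nat \<Rightarrow> nat) \<Rightarrow> 'k" where
  "subset_char n \<chi> od d = (\<lambda>(f, \<sigma>). \<Sum>S | S \<subseteq> {..<n} \<and> card S = d.
     if \<sigma> ` S = S then (\<Prod>x\<in>S. \<chi> (f x)) * (if od then of_int (sign_on S \<sigma>) else 1) else 0)"

text \<open>
  Only the label counts and the data attached to the labels matter.
\<close>

lemma orbit_char_relabel:
  assumes inj: "inj_on \<theta> (range s)" and w: "\<And>x f. x < n \<Longrightarrow> w' (\<theta> (s x)) = w (s x)" and od: "\<And>x. x < n \<Longrightarrow> od' (\<theta> (s x)) = od (s x)"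
  shows "orbit_char n w' od' (\<theta> \<circ> s) p = orbit_char n w od s p"
proof -
  have rng: "s' x \<in> range s" if "s' \<in> state_orbit n s" for s' x using that by (auto simp: state_orbit_def)
  have "inj_on (\<lambda>s'. \<theta> \<circ> s') (state_orbit n s)"
  proof (rule inj_onI)
    fix s1 s2 assume s: "s1 \<in> state_orbit n s" "s2 \<in> state_orbit n s" "\<theta> \<circ> s1 = \<theta> \<circ> s2"
    show "s1 = s2"
    proof
      fix x show "s1 x = s2 x"
        using fun_cong[OF s(3), of x] by (intro inj_onD[OF inj] rng[OF s(1)] rng[OF s(2)]) simp
    qed
  qed
  then have "orbit_char n w' od' (\<theta> \<circ> s) p = (\<Sum>s'\<in>state_orbit n s. state_char n w' od' (\<theta> \<circ> s') p)"
    unfolding orbit_char_def state_orbit_relabel by (simp add: sum.reindex)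
  also have "\<dots> = orbit_char n w od s p"
    unfolding orbit_char_def
  proof (rule sum.cong[OF refl])
    fix s' assume s': "s' \<in> state_orbit n s"
    have e: "w' (\<theta> (s' x)) = w (s' x)" "od' (\<theta> (s' x)) = od (s' x)" if "x < n" for x
    proof -
      have "s' x \<in> s ` {..<n}" using state_orbitD(3)[OF s'] that by auto
      then show "w' (\<theta> (s' x)) = w (s' x)" "od' (\<theta> (s' x)) = od (s' x)" using w od by auto
    qed
    have c: "\<theta> \<circ> s' \<circ> \<sigma> = \<theta> \<circ> s' \<longleftrightarrow> s' \<circ> \<sigma> = s'" for \<sigma>
    proof
      assume "\<theta> \<circ> s' \<circ> \<sigma> = \<theta> \<circ> s'"
      then have "\<theta> (s' (\<sigma> x)) = \<theta> (s' x)" for x by (simp add: fun_eq_iff)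
      then have "s' (\<sigma> x) = s' x" for x by (rule inj_onD[OF inj _ rng[OF s'] rng[OF s']])
      then show "s' \<circ> \<sigma> = s'" by (simp add: fun_eq_iff)
    qed (simp add: comp_assoc)
    have "{x \<in> {..<n}. od' ((\<theta> \<circ> s') x)} = {x \<in> {..<n}. od (s' x)}" using e by auto
    moreover have "(\<Prod>x<n. w' ((\<theta> \<circ> s') x) (f x)) = (\<Prod>x<n. w (s' x) (f x))" for f using e by simp
    ultimately show "state_char n w' od' (\<theta> \<circ> s') p = state_char n w od s' p"
      by (auto simp: state_char_def c split: prod.split)
  qed
  finally show ?thesis .
qed

context character_subring begin

lemma zero: "(\<lambda>_. 0) \<in> A"
  using diff[OF one one] by simp

lemma neg: "f \<in> A \<Longrightarrow> (\<lambda>g. - f g) \<in> A"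
  using diff[OF zero, of f] by simp

lemma add: "f \<in> A \<Longrightarrow> f' \<in> A \<Longrightarrow> (\<lambda>g. f g + f' g) \<in> A"
  using diff[OF _ neg, of f f'] by simp

lemma of_nat_mult: "f \<in> A \<Longrightarrow> (\<lambda>g. of_nat m * f g) \<in> A"
  by (induction m) (use zero add in \<open>auto simp: distrib_right\<close>)

lemma of_int_mult: "f \<in> A \<Longrightarrow> (\<lambda>g. of_int c * f g) \<in> A"
  by (cases c rule: int_cases2) (use of_nat_mult neg in auto)

lemma prod: "finite T \<Longrightarrow> (\<And>t. t \<in> T \<Longrightarrow> f t \<in> A) \<Longrightarrow> (\<lambda>g. \<Prod>t\<in>T. f t g) \<in> A"
  by (induction T rule: finite_induct) (use one mult in auto)

end

text \<open>
  An invariant set of states is a union of orbits; the coefficients are constant on each of them.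
\<close>

lemma sum_closed_states:
  fixes A :: "((nat \<Rightarrow> 'g) \<times> (nat \<Rightarrow> nat) \<Rightarrow> 'k::field) set"
  assumes "character_subring H A"
    and "finite Z" and "\<And>s \<alpha>. s \<in> Z \<Longrightarrow> \<alpha> permutes {..<n} \<Longrightarrow> s \<circ> \<alpha> \<in> Z"
    and c: "\<And>s s'. s' \<in> state_orbit n s \<Longrightarrow> c s' = c s"
    and "\<And>s. s \<in> Z \<Longrightarrow> orbit_char n w od s \<in> A"
  shows "(\<lambda>p. \<Sum>s\<in>Z. of_int (c s) * state_char n w od s p) \<in> A"
  using assms(2,3,5)
proof (induction "card Z" arbitrary: Z rule: less_induct)
  case less
  interpret character_subring H A by fact
  show ?case
  proof (cases "Z = {}")
    case True
    then show ?thesis using zero by simp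
  next
    case False
    then obtain s where s: "s \<in> Z" by blast
    have O: "state_orbit n s \<subseteq> Z" using less.prems(2)[OF s] by (auto simp: state_orbit_def)
    let ?Z = "Z - state_orbit n s"
    have "?Z \<subset> Z" using s state_orbit_self[of s n] by blast
    then have "card ?Z < card Z" by (rule psubset_card_mono[OF less.prems(1)])
    moreover have "s' \<circ> \<alpha> \<in> ?Z" if s': "s' \<in> ?Z" and \<alpha>: "\<alpha> permutes {..<n}" for s' \<alpha>
    proof -
      have "s' \<circ> \<alpha> \<notin> state_orbit n s"
      proof
        assume *: "s' \<circ> \<alpha> \<in> state_orbit n s"
        have "s' = s' \<circ> \<alpha> \<circ> Hilbert_Choice.inv \<alpha>" using permutes_inv_o[OF \<alpha>] by (simp add: comp_assoc)
        also have "\<dots> \<in> state_orbit n s" by (rule state_orbit_comp[OF * permutes_inv[OF \<alpha>]])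
        finally show False using s' by simp
      qed
      then show ?thesis using less.prems(2) s' \<alpha> by blast
    qed
    ultimately have "(\<lambda>p. \<Sum>s\<in>?Z. of_int (c s) * state_char n w od s p) \<in> A"
      using less.prems by (intro less.hyps) auto
    from add[OF of_int_mult[OF less.prems(3)[OF s], of "c s"] this]
    show ?thesis
    proof (rule cong)
      fix g
      have "(\<Sum>s\<in>Z. of_int (c s) * state_char n w od s g) =
        (\<Sum>s\<in>?Z. of_int (c s) * state_char n w od s g) + (\<Sum>s\<in>state_orbit n s. of_int (c s) * state_char n w od s g)"
        by (rule sum.subset_diff[OF O less.prems(1)])
      also have "(\<Sum>s'\<in>state_orbit n s. of_int (c s') * state_char n w od s' g) = of_int (c s) * orbit_char n w od s g"
        unfolding orbit_char_def sum_distrib_left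
      proof (rule sum.cong[OF refl])
        fix s' assume "s' \<in> state_orbit n s"
        from c[OF this] show "of_int (c s') * state_char n w od s' g = of_int (c s) * state_char n w od s' g" by simp
      qed
      finally show "(\<Sum>s\<in>Z. of_int (c s) * state_char n w od s g) =
        of_int (c s) * orbit_char n w od s g + (\<Sum>s\<in>?Z. of_int (c s) * state_char n w od s g)" by simp
    qed
  qed
qed

section \<open>Generating the orbit characters\<close>

lemma invariant_iff_image:
  assumes \<sigma>: "\<sigma> permutes N" and A: "A \<subseteq> N" and N: "finite N"
  shows "\<sigma> ` A = A \<longleftrightarrow> (\<forall>x\<in>N. \<sigma> x \<in> A \<longleftrightarrow> x \<in> A)"
proof
  assume e: "\<sigma> ` A = A"
  show "\<forall>x\<in>N. \<sigma> x \<in> A \<longleftrightarrow> x \<in> A"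
  proof
    fix x assume "x \<in> N"
    have "\<sigma> x \<in> \<sigma> ` A \<longleftrightarrow> x \<in> A" using permutes_inj[OF \<sigma>] by (rule inj_image_mem_iff)
    then show "\<sigma> x \<in> A \<longleftrightarrow> x \<in> A" using e by simp
  qed
next
  assume *: "\<forall>x\<in>N. \<sigma> x \<in> A \<longleftrightarrow> x \<in> A"
  have "finite A" using A N by (rule finite_subset)
  then show "\<sigma> ` A = A"
    using * A permutes_inj[OF \<sigma>] by (intro card_subset_eq) (auto simp: card_image inj_on_subset)
qed

lemma state_invariant_image:
  fixes n :: nat
  assumes \<sigma>: "\<sigma> permutes {..<n}" and z: "z \<circ> \<sigma> = z"
  shows "\<sigma> ` {x \<in> {..<n}. Q (z x)} = {x \<in> {..<n}. Q (z x)}"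
proof -
  have "z (\<sigma> x) = z x" for x using fun_cong[OF z, of x] by simp
  then show ?thesis
    using permutes_in_image[OF \<sigma>] by (subst invariant_iff_image[OF \<sigma> _ finite_lessThan]) auto
qed

lemma prod_over_incidence:
  assumes "finite T" "finite N" "\<And>x. x \<in> N \<Longrightarrow> D x \<subseteq> T"
  shows "(\<Prod>t\<in>T. \<Prod>x\<in>{x \<in> N. t \<in> D x}. g t x) = (\<Prod>x\<in>N. \<Prod>t\<in>D x. (g t x :: 'k::comm_monoid_mult))"
proof -
  have "(\<Prod>t\<in>T. \<Prod>x\<in>{x \<in> N. t \<in> D x}. g t x) = (\<Prod>t\<in>T. \<Prod>x\<in>N. if t \<in> D x then g t x else 1)"
    using assms by (simp add: prod.inter_filter)
  also have "\<dots> = (\<Prod>x\<in>N. \<Prod>t\<in>T. if t \<in> D x then g t x else 1)" by (rule prod.swap)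
  also have "\<dots> = (\<Prod>x\<in>N. \<Prod>t\<in>D x. g t x)"
  proof (rule prod.cong[OF refl])
    fix x assume x: "x \<in> N"
    have "(\<Prod>t\<in>T. if t \<in> D x then g t x else 1) = (\<Prod>t\<in>{t \<in> T. t \<in> D x}. g t x)"
      by (rule prod.inter_filter[OF assms(1), symmetric])
    also have "{t \<in> T. t \<in> D x} = D x" using assms(3)[OF x] by auto
    finally show "(\<Prod>t\<in>T. if t \<in> D x then g t x else 1) = (\<Prod>t\<in>D x. g t x)" .
  qed
  finally show ?thesis .
qed

lemma sum_over_incidence:
  assumes "finite T" "finite N" "\<And>x. x \<in> N \<Longrightarrow> D x \<subseteq> T"
  shows "(\<Sum>t\<in>T. card {x \<in> N. t \<in> D x}) = (\<Sum>x\<in>N. card (D x))"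
proof -
  have "(\<Sum>t\<in>T. card {x \<in> N. t \<in> D x}) = (\<Sum>t\<in>T. \<Sum>x\<in>N. if t \<in> D x then 1 else 0)"
    using assms by (simp add: sum.If_cases Int_def)
  also have "\<dots> = (\<Sum>x\<in>N. \<Sum>t\<in>T. if t \<in> D x then 1 else 0)" by (rule sum.swap)
  also have "\<dots> = (\<Sum>x\<in>N. card (D x))"
  proof (rule sum.cong[OF refl])
    fix x assume x: "x \<in> N"
    have "{t. t \<in> T \<and> t \<in> D x} = D x" using assms(3)[OF x] by auto
    then show "(\<Sum>t\<in>T. if t \<in> D x then 1 else 0) = card (D x)"
      using assms(1) by (simp add: sum.If_cases Int_def)
  qed
  finally show ?thesis .
qed

text \<open>
  Multiplying out the one-colour sums gives a sum over families of invariant subsets, one for each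
  colour. A letter is recorded with the set of colours whose subset contains it, encoded as a
  natural number; it carries the product of the characters and the sum of the parities of these
  colours. Families of disjoint subsets give the orbit character itself. In any other family some
  letter lies in two subsets, so fewer letters are coloured, and the assumption for fewer coloured
  letters applies.
\<close>

lemma product_of_subset_chars:
  fixes A :: "((nat \<Rightarrow> 'g) \<times> (nat \<Rightarrow> nat) \<Rightarrow> 'k::field) set" and s :: "nat \<Rightarrow> nat"
  assumes A: "character_subring H A"
    and carH: "\<And>f \<sigma>. (f, \<sigma>) \<in> carrier H \<Longrightarrow> \<sigma> permutes {..<n}"
    and Ch: "(\<lambda>_. 1) \<in> Ch" "\<And>\<chi> \<chi>'. \<chi> \<in> Ch \<Longrightarrow> \<chi>' \<in> Ch \<Longrightarrow> (\<lambda>a. \<chi> a * \<chi>' a) \<in> Ch"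
    and w: "w 0 = (\<lambda>_. 1)" "\<And>t. w t \<in> Ch" and od: "\<not> od 0" and out: "\<And>x. x \<ge> n \<Longrightarrow> s x = 0"
    and single: "\<And>t. t \<in> s ` {..<n} \<Longrightarrow> t \<noteq> 0 \<Longrightarrow> subset_char n (w t) (od t) (card {x \<in> {..<n}. s x = t}) \<in> A"
    and lower: "\<And>w' od' (s' :: nat \<Rightarrow> nat). w' 0 = (\<lambda>_. 1) \<Longrightarrow> (\<And>t. w' t \<in> Ch) \<Longrightarrow> \<not> od' 0 \<Longrightarrow> (\<And>x. x \<ge> n \<Longrightarrow> s' x = 0) \<Longrightarrow>
       card {x \<in> {..<n}. s' x \<noteq> 0} < card {x \<in> {..<n}. s x \<noteq> 0} \<Longrightarrow> orbit_char n w' od' s' \<in> A"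
  shows "orbit_char n w od s \<in> A"
proof -
  interpret character_subring H A by fact
  define T where "T = s ` {..<n} - {0}"
  have T: "finite T" "0 \<notin> T" by (auto simp: T_def)
  define d where "d t = card {x \<in> {..<n}. s x = t}" for t
  define w' where "w' c = (\<lambda>a. \<Prod>t\<in>set_decode c. w t a)" for c
  define od' where "od' c = odd (card {t \<in> set_decode c. od t})" for c
  define \<theta> :: "nat \<Rightarrow> nat" where "\<theta> t = (if t = 0 then 0 else set_encode {t})" for t
  have dec\<theta>: "set_decode (\<theta> t) = (if t = 0 then {} else {t})" for t by (auto simp: \<theta>_def simp del: set_encode_insert)
  have inj\<theta>: "inj \<theta>"
  proof (rule injI)
    fix a b assume "\<theta> a = \<theta> b"
    then have "set_decode (\<theta> a) = set_decode (\<theta> b)" by simp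
    then show "a = b" unfolding dec\<theta> by (auto split: if_splits)
  qed
  have w'0: "w' 0 = (\<lambda>_. 1)" and od'0: "\<not> od' 0" by (simp_all add: w'_def od'_def)
  have w'Ch: "w' c \<in> Ch" for c
  proof -
    have "(\<lambda>a. \<Prod>t\<in>S. w t a) \<in> Ch" if "finite S" for S
      using that by (induction S rule: finite_induct) (use Ch w in auto)
    then show ?thesis by (simp add: w'_def)
  qed
  define Z where "Z = {z. (\<forall>x\<ge>n. z x = 0) \<and> (\<forall>x<n. set_decode (z x) \<subseteq> T) \<and>
     (\<forall>t\<in>T. card {x \<in> {..<n}. t \<in> set_decode (z x)} = d t)}"
  define U where "U = PiE T (\<lambda>t. {S. S \<subseteq> {..<n} \<and> card S = d t})"
  define h where "h z = (\<lambda>t\<in>T. {x \<in> {..<n}. t \<in> set_decode (z x)})" for z :: "nat \<Rightarrow> nat"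
  define g where "g u = (\<lambda>x. if x < n then set_encode {t \<in> T. x \<in> u t} else 0)" for u :: "nat \<Rightarrow> nat set"
  have bij: "bij_betw h Z U"
  proof (rule bij_betw_byWitness[where f' = g])
    show "\<forall>z\<in>Z. g (h z) = z"
    proof (intro ballI ext)
      fix z x assume z: "z \<in> Z"
      show "g (h z) x = z x"
      proof (cases "x < n")
        case True
        then have "{t \<in> T. x \<in> h z t} = set_decode (z x)" using z by (auto simp: h_def Z_def)
        then show ?thesis using True by (simp add: g_def)
      qed (use z in \<open>auto simp: g_def Z_def\<close>)
    qed
    have dg: "set_decode (g u x) = {t \<in> T. x \<in> u t}" if "x < n" for u x
      using that T by (simp add: g_def)
    have fib: "{x \<in> {..<n}. t \<in> set_decode (g u x)} = u t" if "u \<in> U" "t \<in> T" for u t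
      using that dg by (auto simp: U_def PiE_def Pi_def)
    show "\<forall>u\<in>U. h (g u) = u"
    proof (intro ballI ext)
      fix u t assume "u \<in> U"
      then show "h (g u) t = u t" using fib[of u t] by (cases "t \<in> T") (auto simp: h_def U_def PiE_def extensional_def)
    qed
    show "h ` Z \<subseteq> U" by (auto simp: h_def Z_def U_def)
    show "g ` U \<subseteq> Z"
    proof clarify
      fix u assume u: "u \<in> U"
      show "g u \<in> Z" unfolding Z_def
      proof (intro CollectI conjI allI impI ballI)
        show "card {x \<in> {..<n}. t \<in> set_decode (g u x)} = d t" if "t \<in> T" for t
          unfolding fib[OF u that] using u that by (auto simp: U_def PiE_def Pi_def)
      qed (auto simp: dg, simp add: g_def)
    qed
  qed
  have "finite U" unfolding U_def using T by (intro finite_PiE) auto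
  then have finZ: "finite Z" using bij bij_betw_finite by blast
  have prod_eq: "(\<Prod>t\<in>T. subset_char n (w t) (od t) (d t) p) = (\<Sum>z\<in>Z. state_char n w' od' z p)" if p: "p \<in> carrier H" for p
  proof -
    obtain f \<sigma> where pf: "p = (f, \<sigma>)" by fastforce
    have \<sigma>: "\<sigma> permutes {..<n}" using carH p pf by blast
    define trm where "trm t S = (if \<sigma> ` S = S then (\<Prod>x\<in>S. w t (f x)) * (if od t then of_int (sign_on S \<sigma>) else 1) else (0::'k))" for t S
    have "(\<Prod>t\<in>T. subset_char n (w t) (od t) (d t) p) = (\<Prod>t\<in>T. \<Sum>S | S \<subseteq> {..<n} \<and> card S = d t. trm t S)"
      by (simp add: subset_char_def pf trm_def)
    also have "\<dots> = (\<Sum>u\<in>U. \<Prod>t\<in>T. trm t (u t))"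
      unfolding U_def by (rule prod_sum_PiE) (use T in auto)
    also have "\<dots> = (\<Sum>z\<in>Z. \<Prod>t\<in>T. trm t (h z t))"
      by (rule sum.reindex_bij_betw[OF bij, symmetric])
    also have "\<dots> = (\<Sum>z\<in>Z. state_char n w' od' z p)"
    proof (rule sum.cong[OF refl])
      fix z assume z: "z \<in> Z"
      have sub: "set_decode (z x) \<subseteq> T" if "x < n" for x using z that by (auto simp: Z_def)
      have inv: "(\<forall>t\<in>T. \<sigma> ` h z t = h z t) \<longleftrightarrow> z \<circ> \<sigma> = z"
      proof
        assume "z \<circ> \<sigma> = z"
        from state_invariant_image[OF \<sigma> this, where Q = "\<lambda>c. _ \<in> set_decode c"]
        show "\<forall>t\<in>T. \<sigma> ` h z t = h z t" by (simp add: h_def)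
      next
        assume *: "\<forall>t\<in>T. \<sigma> ` h z t = h z t"
        have "z (\<sigma> x) = z x" for x
        proof (cases "x < n")
          case True
          then have \<sigma>x: "\<sigma> x < n" using permutes_in_image[OF \<sigma>, of x] by simp
          have "t \<in> set_decode (z (\<sigma> x)) \<longleftrightarrow> t \<in> set_decode (z x)" if "t \<in> T" for t
          proof -
            have "h z t \<subseteq> {..<n}" using that by (auto simp: h_def)
            then have "\<sigma> x \<in> h z t \<longleftrightarrow> x \<in> h z t"
              using invariant_iff_image[OF \<sigma>, of "h z t"] * that True by auto
            then show ?thesis using that True \<sigma>x by (simp add: h_def)
          qed
          then have "set_decode (z (\<sigma> x)) = set_decode (z x)" using sub[OF True] sub[OF \<sigma>x] by blast
          then have "set_encode (set_decode (z (\<sigma> x))) = set_encode (set_decode (z x))" by simp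
          then show ?thesis by simp
        qed (use permutes_not_in[OF \<sigma>, of x] in simp)
        then show "z \<circ> \<sigma> = z" by (simp add: fun_eq_iff)
      qed
      show "(\<Prod>t\<in>T. trm t (h z t)) = state_char n w' od' z p"
      proof (cases "z \<circ> \<sigma> = z")
        case False
        then obtain t where "t \<in> T" "\<sigma> ` h z t \<noteq> h z t" using inv by blast
        then have "(\<Prod>t\<in>T. trm t (h z t)) = 0" using T by (intro prod_zero bexI[of _ t]) (auto simp: trm_def)
        then show ?thesis using False by (simp add: state_char_def pf)
      next
        case True
        then have I: "\<sigma> ` h z t = h z t" if "t \<in> T" for t using inv that by blast
        have "(\<Prod>t\<in>T. trm t (h z t)) = (\<Prod>t\<in>T. \<Prod>x\<in>h z t. w t (f x)) * (\<Prod>t\<in>T. if od t then of_int (sign_on (h z t) \<sigma>) else 1)"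
          using I by (simp add: trm_def prod.distrib)
        also have "(\<Prod>t\<in>T. \<Prod>x\<in>h z t. w t (f x)) = (\<Prod>t\<in>T. \<Prod>x\<in>{x \<in> {..<n}. t \<in> set_decode (z x)}. w t (f x))"
          by (simp add: h_def)
        also have "\<dots> = (\<Prod>x<n. w' (z x) (f x))"
          unfolding w'_def using T sub by (intro prod_over_incidence) auto
        also have "(\<Prod>t\<in>T. if od t then of_int (sign_on (h z t) \<sigma>) else 1) = (\<Prod>t\<in>{t \<in> T. od t}. of_int (sign_on (h z t) \<sigma>) :: 'k)"
          by (rule prod.inter_filter[OF T(1), symmetric])
        also have "\<dots> = of_int (\<Prod>t\<in>{t \<in> T. od t}. sign_on (h z t) \<sigma>)" by simp
        also have "(\<Prod>t\<in>{t \<in> T. od t}. sign_on (h z t) \<sigma>) = sign_on {x. odd (card {t \<in> {t \<in> T. od t}. x \<in> h z t})} \<sigma>"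
          by (rule sign_on_odd_parity(1)[symmetric]) (use T I permutes_inj[OF \<sigma>] in \<open>auto simp: h_def\<close>)
        also have "{x. odd (card {t \<in> {t \<in> T. od t}. x \<in> h z t})} = {x \<in> {..<n}. od' (z x)}"
        proof (rule Set.set_eqI)
          fix x
          have "{t \<in> {t \<in> T. od t}. x \<in> h z t} = (if x < n then {t \<in> set_decode (z x). od t} else {})"
            using sub[of x] by (auto simp: h_def)
          then show "x \<in> {x. odd (card {t \<in> {t \<in> T. od t}. x \<in> h z t})} \<longleftrightarrow> x \<in> {x \<in> {..<n}. od' (z x)}"
            by (auto simp: od'_def)
        qed
        finally show ?thesis using True by (simp add: state_char_def pf)
      qed
    qed
    finally show ?thesis .
  qed
  have prodA: "(\<lambda>p. \<Prod>t\<in>T. subset_char n (w t) (od t) (d t) p) \<in> A"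
    using T single by (intro prod) (auto simp: T_def d_def)
  have sZ: "\<theta> \<circ> s \<in> Z"
  proof -
    have "card {x \<in> {..<n}. t \<in> set_decode (\<theta> (s x))} = d t" if "t \<in> T" for t
    proof -
      have "t \<noteq> 0" using that T(2) by metis
      then have "{x \<in> {..<n}. t \<in> set_decode (\<theta> (s x))} = {x \<in> {..<n}. s x = t}" by (auto simp: dec\<theta>)
      then show ?thesis by (simp add: d_def)
    qed
    then show ?thesis using out by (auto simp: Z_def dec\<theta> T_def) (simp add: \<theta>_def)
  qed
  have Zclosed: "z \<circ> \<alpha> \<in> Z" if z: "z \<in> Z" and \<alpha>: "\<alpha> permutes {..<n}" for z \<alpha>
  proof -
    have "\<alpha> x < n" if "x < n" for x using permutes_in_image[OF \<alpha>, of x] that by simp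
    moreover have "\<alpha> x = x" if "x \<ge> n" for x using permutes_not_in[OF \<alpha>, of x] that by simp
    ultimately show ?thesis
      using z card_fiber_permute[OF \<alpha>, where Q = "\<lambda>c. _ \<in> set_decode c"] by (simp add: Z_def)
  qed
  have total: "(\<Sum>x<n. card (set_decode (z x))) = sum d T" if "z \<in> Z" for z
  proof -
    have "(\<Sum>t\<in>T. card {x \<in> {..<n}. t \<in> set_decode (z x)}) = (\<Sum>x<n. card (set_decode (z x)))"
      by (rule sum_over_incidence) (use that T in \<open>auto simp: Z_def\<close>)
    then show ?thesis using that by (simp add: Z_def)
  qed
  have degs: "card {x \<in> {..<n}. (z x :: nat) \<noteq> 0} = (\<Sum>x<n. if z x \<noteq> 0 then 1 else 0)" for z
    by (simp add: sum.If_cases Int_def)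
  have D: "card {x \<in> {..<n}. s x \<noteq> 0} = sum d T"
    unfolding total[OF sZ, symmetric] degs by (intro sum.cong) (auto simp: dec\<theta>)
  have low: "card {x \<in> {..<n}. z x \<noteq> 0} < card {x \<in> {..<n}. s x \<noteq> 0}" if z: "z \<in> Z" and no: "z \<notin> state_orbit n (\<theta> \<circ> s)" for z
  proof (rule ccontr)
    assume *: "\<not> ?thesis"
    have le: "(if z x \<noteq> 0 then 1 else 0) \<le> card (set_decode (z x))" for x
    proof (cases "z x = 0")
      case False
      then have "set_decode (z x) \<noteq> {}" by (metis set_decode_inverse set_encode_empty)
      then show ?thesis using False by (simp add: Suc_le_eq card_gt_0_iff)
    qed simp
    have eq: "card (set_decode (z x)) = (if z x \<noteq> 0 then 1 else 0)" if x: "x < n" for x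
    proof (rule ccontr)
      assume "card (set_decode (z x)) \<noteq> (if z x \<noteq> 0 then 1 else 0)"
      then have "(\<Sum>x<n. if z x \<noteq> 0 then 1 else 0) < (\<Sum>x<n. card (set_decode (z x)))"
        using le le_neq_implies_less[OF le[of x]] x by (intro sum_strict_mono_ex1 ballI bexI[of _ x]) auto
      then show False using * total[OF z] D degs[of z] by simp
    qed
    then have degz: "card {x \<in> {..<n}. z x \<noteq> 0} = card {x \<in> {..<n}. s x \<noteq> 0}"
      unfolding D total[OF z, symmetric] degs by (intro sum.cong) auto
    have zx: "z x = 0 \<or> (\<exists>t\<in>T. z x = \<theta> t)" if x: "x < n" for x
    proof (cases "z x = 0")
      case False
      then obtain t where t: "set_decode (z x) = {t}" using eq[OF x] by (auto simp: card_1_singleton_iff)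
      then have "t \<in> T" using z x by (auto simp: Z_def)
      have "t \<noteq> 0" using \<open>t \<in> T\<close> T(2) by metis
      have "z x = set_encode {t}" unfolding t[symmetric] by simp
      then have "z x = \<theta> t" using \<open>t \<noteq> 0\<close> unfolding \<theta>_def by (simp del: set_encode_insert)
      then show ?thesis using \<open>t \<in> T\<close> by blast
    qed simp
    have "z \<in> state_orbit n (\<theta> \<circ> s)"
    proof (rule state_orbitI)
      show "z x = (\<theta> \<circ> s) x" if "x \<ge> n" for x using that z out by (auto simp: Z_def \<theta>_def)
      fix l
      consider "l = 0" | t where "t \<in> T" "l = \<theta> t" | "l \<noteq> 0" "\<forall>t\<in>T. l \<noteq> \<theta> t" by blast
      then show "card {x \<in> {..<n}. z x = l} = card {x \<in> {..<n}. (\<theta> \<circ> s) x = l}"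
      proof cases
        case 1
        have c: "card {x \<in> {..<n}. y x = (0::nat)} = n - card {x \<in> {..<n}. y x \<noteq> 0}" for y
        proof -
          have "{x \<in> {..<n}. y x = 0} = {..<n} - {x \<in> {..<n}. y x \<noteq> 0}" by auto
          moreover have "card ({..<n} - {x \<in> {..<n}. y x \<noteq> 0}) = card {..<n} - card {x \<in> {..<n}. y x \<noteq> 0}"
            by (rule card_Diff_subset) auto
          ultimately show ?thesis by simp
        qed
        have "\<theta> (s x) = 0 \<longleftrightarrow> s x = 0" for x using inj_eq[OF inj\<theta>, of "s x" 0] by (simp add: \<theta>_def)
        then show ?thesis using degz by (simp only: 1 c o_apply)
      next
        case 2
        have "{x \<in> {..<n}. z x = l} = {x \<in> {..<n}. t \<in> set_decode (z x)}"
        proof -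
          have "t \<noteq> 0" using 2 T(2) by metis
          have "z x = l \<longleftrightarrow> t \<in> set_decode (z x)" if "x < n" for x
            using zx[OF that]
          proof
            assume "z x = 0"
            moreover have "\<theta> t \<noteq> 0" using inj_eq[OF inj\<theta>, of t 0] \<open>t \<noteq> 0\<close> by (simp add: \<theta>_def)
            ultimately show ?thesis using 2 by simp
          next
            assume "\<exists>t\<in>T. z x = \<theta> t"
            then show ?thesis using 2 \<open>t \<noteq> 0\<close> T(2) by (auto simp: dec\<theta> inj_eq[OF inj\<theta>] split: if_splits)
          qed
          then show ?thesis by auto
        qed
        then have "card {x \<in> {..<n}. z x = l} = d t" using z 2 by (simp add: Z_def)
        moreover have "{x \<in> {..<n}. (\<theta> \<circ> s) x = l} = {x \<in> {..<n}. s x = t}"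
          using inj_eq[OF inj\<theta>] 2 by auto
        ultimately show ?thesis by (simp add: d_def)
      next
        case 3
        have "z x \<noteq> l" if "x < n" for x using zx[OF that] 3 by auto
        then have e1: "{x \<in> {..<n}. z x = l} = {}" by auto
        have "\<theta> (s x) \<noteq> l" if "x < n" for x
        proof (cases "s x = 0")
          case True
          then have "\<theta> (s x) = 0" by (simp add: \<theta>_def)
          then show ?thesis using 3 by simp
        next
          case False
          then have "s x \<in> T" using that by (auto simp: T_def)
          then show ?thesis using 3 by auto
        qed
        then have e2: "{x \<in> {..<n}. (\<theta> \<circ> s) x = l} = {}" by auto
        show ?thesis by (simp only: e1 e2)
      qed
    qed
    then show False using no by contradiction
  qed
  have O: "state_orbit n (\<theta> \<circ> s) \<subseteq> Z" using Zclosed[OF sZ] by (auto simp: state_orbit_def)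
  have "(\<lambda>p. \<Sum>z\<in>Z - state_orbit n (\<theta> \<circ> s). of_int 1 * state_char n w' od' z p) \<in> A"
  proof (rule sum_closed_states[OF A])
    show "finite (Z - state_orbit n (\<theta> \<circ> s))" using finZ by simp
    show "z \<circ> \<alpha> \<in> Z - state_orbit n (\<theta> \<circ> s)" if z: "z \<in> Z - state_orbit n (\<theta> \<circ> s)" and \<alpha>: "\<alpha> permutes {..<n}" for z \<alpha>
    proof -
      have "z \<circ> \<alpha> \<in> state_orbit n z" by (rule state_orbit_comp[OF state_orbit_self \<alpha>])
      note e = state_orbit_eq[OF this]
      have "z \<circ> \<alpha> \<notin> state_orbit n (\<theta> \<circ> s)"
      proof
        assume "z \<circ> \<alpha> \<in> state_orbit n (\<theta> \<circ> s)"
        from state_orbit_eq[OF this] have "state_orbit n z = state_orbit n (\<theta> \<circ> s)" unfolding e .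
        then show False using z state_orbit_self[of z n] by blast
      qed
      then show ?thesis using Zclosed[OF _ \<alpha>] z by blast
    qed
    show "orbit_char n w' od' z \<in> A" if z: "z \<in> Z - state_orbit n (\<theta> \<circ> s)" for z
      by (rule lower) (use w'0 od'0 w'Ch low z in \<open>auto simp: Z_def\<close>)
  qed simp
  from diff[OF prodA this] have "orbit_char n w' od' (\<theta> \<circ> s) \<in> A"
  proof (rule cong)
    fix p assume p: "p \<in> carrier H"
    have "(\<Sum>z\<in>Z. state_char n w' od' z p) =
      (\<Sum>z\<in>Z - state_orbit n (\<theta> \<circ> s). state_char n w' od' z p) + orbit_char n w' od' (\<theta> \<circ> s) p"
      unfolding orbit_char_def by (rule sum.subset_diff[OF O finZ])
    then show "orbit_char n w' od' (\<theta> \<circ> s) p = (\<Prod>t\<in>T. subset_char n (w t) (od t) (d t) p) -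
      (\<Sum>z\<in>Z - state_orbit n (\<theta> \<circ> s). of_int 1 * state_char n w' od' z p)"
      unfolding prod_eq[OF p] by simp
  qed
  moreover have "orbit_char n w' od' (\<theta> \<circ> s) p = orbit_char n w od s p" for p
  proof (rule orbit_char_relabel)
    show "inj_on \<theta> (range s)" using inj\<theta> by (rule inj_on_subset) simp
    show "w' (\<theta> (s x)) = w (s x)" for x using w(1) by (auto simp: w'_def dec\<theta>)
    show "od' (\<theta> (s x)) = od (s x)" for x
    proof -
      have "{t \<in> set_decode (\<theta> (s x)). od t} = (if s x \<noteq> 0 \<and> od (s x) then {s x} else {})" by (auto simp: dec\<theta>)
      then show ?thesis using od by (auto simp: od'_def)
    qed
  qed
  then have "orbit_char n w' od' (\<theta> \<circ> s) = orbit_char n w od s" by (rule ext)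
  ultimately show ?thesis by simp
qed


text \<open>
  The alternating relation between elementary and complete symmetric functions, at the level of
  states with one odd colour 1 and one even colour 2 carrying the same character. Interchanging
  the two colours on the \<open>\<sigma>\<close>-orbit of the smallest coloured letter is a sign-
  reversing involution: an orbit of size \<open>c\<close> contributes \<open>(- 1) ^ c\<close>
  from the coefficient and \<open>(- 1) ^ (c - 1)\<close> from the sign when it is odd, and
  \<open>1\<close> when it is even.
\<close>

lemma alternating_state_sum:
  fixes \<chi> :: "'g \<Rightarrow> 'k::field_char_0"
  assumes \<sigma>: "\<sigma> permutes {..<n}" and D: "D \<ge> 1"
    and w: "w = (\<lambda>c. if c = 1 \<or> c = 2 then \<chi> else (\<lambda>_. 1))" and od: "od = (\<lambda>c. c = (1::nat))"
    and Z: "Z = {z. (\<forall>x\<ge>n. z x = 0) \<and> (\<forall>x<n. z x \<le> 2) \<and> card {x \<in> {..<n}. z x \<noteq> (0::nat)} = D}"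
    and finZ: "finite Z"
  shows "(\<Sum>z\<in>Z. of_int ((- 1) ^ card {x \<in> {..<n}. z x = 1}) * state_char n w od z (f, \<sigma>)) = 0"
proof -
  define F where "F z = of_int ((- 1) ^ card {x \<in> {..<n}. z x = 1}) * state_char n w od z (f, \<sigma>)" for z
  define x0 where "x0 z = Min {x \<in> {..<n}. z x \<noteq> (0::nat)}" for z
  define C where "C z = range (\<lambda>i. (\<sigma> ^^ i) (x0 z))" for z
  (* The involution: colours 1 and 2 are exchanged on the orbit of the smallest coloured letter. *)
  define tog where "tog z = (\<lambda>x. if x \<in> C z then 3 - z x else z x)" for z
  have tp: "x0 z < n" "C z \<subseteq> {..<n}" "\<sigma> ` C z = C z" "sign_on (C z) \<sigma> = (- 1) ^ (card (C z) - 1)" "C z \<noteq> {}"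
    "\<And>x. x \<in> C z \<Longrightarrow> z x = z (x0 z)" "z (x0 z) \<noteq> 0" "z (x0 z) \<le> 2" if z: "z \<in> Z" "z \<circ> \<sigma> = z" for z
  proof -
    have "{x \<in> {..<n}. z x \<noteq> 0} \<noteq> {}"
    proof
      assume e: "{x \<in> {..<n}. z x \<noteq> 0} = {}"
      have "card {x \<in> {..<n}. z x \<noteq> 0} = D" using z by (simp add: Z)
      then show False unfolding e using D by simp
    qed
    then have "x0 z \<in> {x \<in> {..<n}. z x \<noteq> 0}" unfolding x0_def by (intro Min_in) auto
    then show x: "x0 z < n" "z (x0 z) \<noteq> 0" by auto
    then show "z (x0 z) \<le> 2" using z by (auto simp: Z)
    have x': "x0 z \<in> {..<n}" using x(1) by simp
    have O: "C z \<subseteq> {..<n}" "x0 z \<in> C z" "\<sigma> ` C z = C z" "sign_on (C z) \<sigma> = (- 1) ^ (card (C z) - 1)"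
      unfolding C_def by (rule orbit_facts[OF \<sigma> finite_lessThan x'])+
    then show "C z \<subseteq> {..<n}" "\<sigma> ` C z = C z" "sign_on (C z) \<sigma> = (- 1) ^ (card (C z) - 1)" "C z \<noteq> {}"
      by blast+
    have "z (\<sigma> y) = z y" for y using fun_cong[OF z(2), of y] by simp
    then have "z ((\<sigma> ^^ i) (x0 z)) = z (x0 z)" for i by (induction i) auto
    then show "z x = z (x0 z)" if "x \<in> C z" for x using that by (auto simp: C_def)
  qed
  have one_two: "z x = 1 \<or> z x = 2" if z: "z \<in> Z" "z \<circ> \<sigma> = z" and x: "x \<in> C z" for z x
    using tp(6)[OF z x] tp(7,8)[OF z] by linarith
  have nz: "tog z x \<noteq> 0 \<longleftrightarrow> z x \<noteq> 0" "tog z x \<le> 2 \<longleftrightarrow> z x \<le> 2" if z: "z \<in> Z" "z \<circ> \<sigma> = z" for z x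
    using one_two[OF z, of x] by (auto simp: tog_def)
  have x0t: "x0 (tog z) = x0 z" "C (tog z) = C z" if z: "z \<in> Z" "z \<circ> \<sigma> = z" for z
    using nz[OF z] by (simp_all add: x0_def C_def)
  define Y where "Y = {z \<in> Z. z \<circ> \<sigma> = z}"
  have inY: "tog z \<in> Y" if z: "z \<in> Y" for z
  proof -
    have z': "z \<in> Z" "z \<circ> \<sigma> = z" using z by (auto simp: Y_def)
    have "\<sigma> x \<in> C z \<longleftrightarrow> x \<in> C z" for x
      using inj_image_mem_iff[OF permutes_inj[OF \<sigma>], of x "C z"] tp(3)[OF z'] by simp
    moreover have "z (\<sigma> x) = z x" for x using fun_cong[OF z'(2), of x] by simp
    ultimately have "tog z \<circ> \<sigma> = tog z" by (auto simp: tog_def fun_eq_iff)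
    moreover have "tog z \<in> Z"
    proof -
      have "tog z x = 0" if "x \<ge> n" for x using that z' tp(2)[OF z'] by (auto simp: tog_def Z)
      then show ?thesis using z' nz[OF z'] by (simp add: Z)
    qed
    ultimately show ?thesis by (simp add: Y_def)
  qed
  have tt: "tog (tog z) = z" if z: "z \<in> Y" for z
  proof
    fix x
    have z': "z \<in> Z" "z \<circ> \<sigma> = z" using z by (auto simp: Y_def)
    have "3 - (3 - z x) = z x" if "x \<in> C z" using one_two[OF z' that] by auto
    moreover have "tog (tog z) x = (if x \<in> C z then 3 - tog z x else tog z x)"
      by (simp add: tog_def[of "tog z"] x0t(2)[OF z'])
    ultimately show "tog (tog z) x = z x" by (simp add: tog_def)
  qed
  have Ft: "F (tog z) = - F z" if z: "z \<in> Y" for z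
  proof -
    have z': "z \<in> Z" "z \<circ> \<sigma> = z" using z by (auto simp: Y_def)
    note P = tp[OF z']
    have t': "tog z \<circ> \<sigma> = tog z" using inY[OF z] by (simp add: Y_def)
    have wt: "w (tog z x) = w (z x)" for x using one_two[OF z', of x] by (auto simp: tog_def w)
    define S where "S = {x \<in> {..<n}. z x = 1}"
    define S' where "S' = {x \<in> {..<n}. tog z x = 1}"
    have finS: "finite S" "finite (C z)" using P(2) by (auto simp: S_def intro: finite_subset)
    have "z (x0 z) = 1 \<or> z (x0 z) = 2" using P(7,8) by linarith
    then have cs: "(C z \<subseteq> S \<and> S' = S - C z) \<or> (C z \<inter> S = {} \<and> S' = S \<union> C z)"
    proof
      assume "z (x0 z) = 1"
      then have "\<forall>x\<in>C z. z x = 1" using P(6) by metis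
      then have "C z \<subseteq> S \<and> S' = S - C z" using P(2) by (auto simp: S_def S'_def tog_def)
      then show ?thesis by simp
    next
      assume "z (x0 z) = 2"
      then have "\<forall>x\<in>C z. z x = 2" using P(6) by metis
      then have "C z \<inter> S = {} \<and> S' = S \<union> C z" using P(2) by (auto simp: S_def S'_def tog_def)
      then show ?thesis by simp
    qed
    then have sd: "S' = S - C z \<union> (C z - S)" by auto
    have inv: "\<sigma> ` S = S" unfolding S_def by (rule state_invariant_image[OF \<sigma> z'(2)])
    have sg: "sign_on S' \<sigma> = sign_on S \<sigma> * (- 1) ^ (card (C z) - 1)"
      unfolding sd sign_on_sym_diff[OF finS permutes_inj[OF \<sigma>] inv P(3)] P(4) ..
    have par: "(- 1) ^ card S' = (- 1) ^ card S * ((- 1) ^ card (C z) :: int)"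
      using cs
    proof
      assume "C z \<subseteq> S \<and> S' = S - C z"
      then have "card S = card S' + card (C z)"
        using card_Diff_subset[OF finS(2), of S] card_mono[OF finS(1), of "C z"] by simp
      then have "(- 1) ^ card S = (- 1) ^ card S' * ((- 1) ^ card (C z) :: int)" by (simp only: power_add)
      moreover have "(- 1) ^ card (C z) * (- 1) ^ card (C z) = (1 :: int)"
        by (simp only: power_mult_distrib[symmetric]) simp
      ultimately show ?thesis by (simp only: mult.assoc mult_1_right)
    next
      assume "C z \<inter> S = {} \<and> S' = S \<union> C z"
      then have "card S' = card S + card (C z)" using card_Un_disjoint[OF finS] by (simp add: Int_commute)
      then show ?thesis by (simp add: power_add)
    qed
    have "card (C z) \<noteq> 0" using P(5) finS by simp
    then obtain c where c: "card (C z) = Suc c" by (cases "card (C z)") auto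
    have cc: "(- 1) ^ c * (- 1) ^ c = (1 :: int)" by (simp only: power_mult_distrib[symmetric]) simp
    have "(- 1) ^ card S' * sign_on S' \<sigma> = - ((- 1) ^ card S * sign_on S \<sigma>) * ((- 1) ^ c * (- 1) ^ c)"
      unfolding par sg c by simp
    then have "(- 1) ^ card S' * sign_on S' \<sigma> = - ((- 1) ^ card S * sign_on S \<sigma>)" unfolding cc by simp
    from arg_cong[OF this, of "of_int :: int \<Rightarrow> 'k"]
    have e: "of_int ((- 1) ^ card S') * of_int (sign_on S' \<sigma>) = - (of_int ((- 1) ^ card S) * of_int (sign_on S \<sigma>) :: 'k)"
      by simp
    have "F (tog z) = (of_int ((- 1) ^ card S') * of_int (sign_on S' \<sigma>)) * (\<Prod>x<n. w (z x) (f x))"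
      using t' by (simp add: F_def state_char_def wt od S'_def)
    also have "\<dots> = - F z" unfolding e using z'(2) by (simp add: F_def state_char_def od S_def)
    finally show ?thesis .
  qed
  have "sum F Z = sum F Y"
    unfolding Y_def by (rule sum.mono_neutral_right) (use finZ in \<open>auto simp: F_def state_char_def\<close>)
  also have "sum F Y = (\<Sum>z\<in>Y. - F z)"
    by (rule sum.reindex_bij_witness[of _ tog tog]) (use inY tt Ft in auto)
  finally have "sum F Z = - sum F Y" by (simp add: sum_negf)
  moreover have "sum F Z = sum F Y" by fact
  ultimately have "sum F Z = 0" by simp
  then show ?thesis by (simp add: F_def)
qed


text \<open>
  All terms of the alternating relation except the one in which every coloured letter is even are
  already available.
\<close>

lemma even_subset_char_from_odd:
  fixes A :: "((nat \<Rightarrow> 'g) \<times> (nat \<Rightarrow> nat) \<Rightarrow> 'k::field_char_0) set"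
  assumes A: "character_subring H A"
    and carH: "\<And>f \<sigma>. (f, \<sigma>) \<in> carrier H \<Longrightarrow> \<sigma> permutes {..<n}"
    and D: "D \<ge> 1"
    and w: "w = (\<lambda>c. if c = 1 \<or> c = 2 then \<chi> else (\<lambda>_. 1))" and od: "od = (\<lambda>c. c = (1::nat))"
    and mid: "\<And>z. (\<And>x. x \<ge> n \<Longrightarrow> z x = 0) \<Longrightarrow> (\<And>x. x < n \<Longrightarrow> z x \<le> 2) \<Longrightarrow> card {x \<in> {..<n}. z x \<noteq> (0::nat)} = D \<Longrightarrow>
       (\<exists>x<n. z x = 1) \<Longrightarrow> orbit_char n w od z \<in> A"
  shows "subset_char n \<chi> False D \<in> A"
proof -
  interpret character_subring H A by fact
  define Z where "Z = {z. (\<forall>x\<ge>n. z x = 0) \<and> (\<forall>x<n. z x \<le> 2) \<and> card {x \<in> {..<n}. z x \<noteq> (0::nat)} = D}"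
  define Z0 where "Z0 = {z \<in> Z. \<forall>x<n. z x \<noteq> 1}"
  have finZ: "finite Z"
  proof (rule finite_subset)
    show "Z \<subseteq> (\<lambda>g x. if x < n then g x else 0) ` ({..<n} \<rightarrow>\<^sub>E {..2})"
    proof
      fix z assume z: "z \<in> Z"
      have "z = (\<lambda>x. if x < n then restrict z {..<n} x else 0)" using z by (auto simp: Z_def fun_eq_iff)
      moreover have "restrict z {..<n} \<in> {..<n} \<rightarrow>\<^sub>E {..2}" using z by (auto simp: Z_def)
      ultimately show "z \<in> (\<lambda>g x. if x < n then g x else 0) ` ({..<n} \<rightarrow>\<^sub>E {..2})" by (rule image_eqI)
    qed
  qed (intro finite_imageI finite_PiE; simp)
  define c where "c z = (- 1 :: int) ^ card {x \<in> {..<n}. z x = (1::nat)}" for z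
  have closed: "z \<circ> \<alpha> \<in> Z - Z0" if z: "z \<in> Z - Z0" and \<alpha>: "\<alpha> permutes {..<n}" for z \<alpha>
  proof -
    have lt: "\<alpha> x < n \<longleftrightarrow> x < n" for x using permutes_in_image[OF \<alpha>, of x] by simp
    have out: "\<alpha> x = x" if "x \<ge> n" for x using permutes_not_in[OF \<alpha>, of x] that by simp
    have "z \<circ> \<alpha> \<in> Z" using z lt out card_fiber_permute[OF \<alpha>, of "\<lambda>c. c \<noteq> 0" z] by (auto simp: Z_def)
    moreover obtain x where x: "x < n" "z x = 1" using z by (auto simp: Z0_def)
    then have "Hilbert_Choice.inv \<alpha> x < n" "z (\<alpha> (Hilbert_Choice.inv \<alpha> x)) = 1"
      using permutes_in_image[OF permutes_inv[OF \<alpha>], of x] permutes_inverses(1)[OF \<alpha>] by auto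
    ultimately show ?thesis by (auto simp: Z0_def)
  qed
  have "(\<lambda>p. \<Sum>z\<in>Z - Z0. of_int (c z) * state_char n w od z p) \<in> A"
  proof (rule sum_closed_states[OF A _ closed])
    show "c s' = c s" if "s' \<in> state_orbit n s" for s s'
      unfolding c_def using state_orbitD(2)[OF that, of "\<lambda>l. l = 1"] by simp
    show "orbit_char n w od z \<in> A" if "z \<in> Z - Z0" for z
      by (rule mid) (use that in \<open>auto simp: Z_def Z0_def\<close>)
  qed (use finZ in auto)
  from neg[OF this] show ?thesis
  proof (rule cong)
    fix p assume p: "p \<in> carrier H"
    obtain f \<sigma> where pf: "p = (f, \<sigma>)" by fastforce
    have \<sigma>: "\<sigma> permutes {..<n}" using carH p pf by blast
    have "(\<Sum>z\<in>Z0. of_int (c z) * state_char n w od z p) = subset_char n \<chi> False D p"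
    proof -
      let ?h = "\<lambda>z. {x \<in> {..<n}. z x = (2::nat)}" and ?g = "\<lambda>S x. if x \<in> S then 2 else (0::nat)"
      have "subset_char n \<chi> False D p = (\<Sum>S | S \<subseteq> {..<n} \<and> card S = D. if \<sigma> ` S = S then \<Prod>x\<in>S. \<chi> (f x) else 0)"
        by (simp add: subset_char_def pf cong: if_cong)
      also have "\<dots> = (\<Sum>z\<in>Z0. of_int (c z) * state_char n w od z p)"
      proof (rule sum.reindex_bij_witness[of _ ?h ?g])
        have two: "z x = 0 \<or> z x = 2" if "z \<in> Z0" for z x
        proof (cases "x < n")
          case True
          then have "z x \<le> 2" "z x \<noteq> 1" using that by (auto simp: Z0_def Z_def)
          then show ?thesis by linarith
        qed (use that in \<open>auto simp: Z0_def Z_def\<close>)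
        show "?h (?g S) = S" if "S \<in> {S. S \<subseteq> {..<n} \<and> card S = D}" for S using that by auto
        show "?g S \<in> Z0" if "S \<in> {S. S \<subseteq> {..<n} \<and> card S = D}" for S
        proof -
          have "{x \<in> {..<n}. ?g S x \<noteq> 0} = S" using that by auto
          then show ?thesis using that by (auto simp: Z0_def Z_def)
        qed
        show "?g (?h z) = z" if z: "z \<in> Z0" for z
        proof
          fix x show "?g (?h z) x = z x" using two[OF z, of x] z by (auto simp: Z0_def Z_def)
        qed
        show "?h z \<in> {S. S \<subseteq> {..<n} \<and> card S = D}" if z: "z \<in> Z0" for z
        proof -
          have "z x = 2 \<longleftrightarrow> z x \<noteq> 0" for x using two[OF z, of x] by auto
          then have "{x \<in> {..<n}. z x = 2} = {x \<in> {..<n}. z x \<noteq> 0}" by simp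
          then show ?thesis using z by (auto simp: Z0_def Z_def)
        qed
        fix S assume S: "S \<in> {S. S \<subseteq> {..<n} \<and> card S = D}"
        have inv: "?g S \<circ> \<sigma> = ?g S \<longleftrightarrow> \<sigma> ` S = S"
        proof
          assume "?g S \<circ> \<sigma> = ?g S"
          from state_invariant_image[OF \<sigma> this, of "\<lambda>c. c = 2"]
          have "\<sigma> ` {x \<in> {..<n}. ?g S x = 2} = {x \<in> {..<n}. ?g S x = 2}" .
          moreover have "{x \<in> {..<n}. ?g S x = 2} = S" using S by auto
          ultimately show "\<sigma> ` S = S" by simp
        next
          assume "\<sigma> ` S = S"
          then have "\<sigma> x \<in> S \<longleftrightarrow> x \<in> S" for x
            using inj_image_mem_iff[OF permutes_inj[OF \<sigma>], of x S] by simp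
          then show "?g S \<circ> \<sigma> = ?g S" by (simp add: fun_eq_iff)
        qed
        have c1: "c (?g S) = 1" by (simp add: c_def)
        have o: "{x \<in> {..<n}. od (?g S x)} = {}" by (auto simp: od)
        have "(\<Prod>x<n. w (?g S x) (f x)) = (\<Prod>x<n. if x \<in> S then \<chi> (f x) else 1)"
          by (rule prod.cong) (auto simp: w)
        also have "\<dots> = (\<Prod>x\<in>{x \<in> {..<n}. x \<in> S}. \<chi> (f x))" by (rule prod.inter_filter[symmetric]) simp
        also have "{x \<in> {..<n}. x \<in> S} = S" using S by auto
        finally have pr: "(\<Prod>x<n. w (?g S x) (f x)) = (\<Prod>x\<in>S. \<chi> (f x))" .
        have "sign_on {} \<sigma> = 1" by (simp add: sign_on_def restrict_id_def id_def[symmetric])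
        then have "state_char n w od (?g S) p = (if \<sigma> ` S = S then \<Prod>x\<in>S. \<chi> (f x) else 0)"
          unfolding state_char_def pf prod.case inv o pr by simp
        then show "of_int (c (?g S)) * state_char n w od (?g S) p = (if \<sigma> ` S = S then \<Prod>x\<in>S. \<chi> (f x) else 0)"
          unfolding c1 by simp
      qed
      finally show ?thesis by simp
    qed
    moreover have "(\<Sum>z\<in>Z. of_int (c z) * state_char n w od z p) = 0"
      unfolding pf c_def by (rule alternating_state_sum[OF \<sigma> D w od Z_def finZ])
    moreover have "(\<Sum>z\<in>Z. of_int (c z) * state_char n w od z p) =
      (\<Sum>z\<in>Z - Z0. of_int (c z) * state_char n w od z p) + (\<Sum>z\<in>Z0. of_int (c z) * state_char n w od z p)"
      by (rule sum.subset_diff[OF _ finZ]) (auto simp: Z0_def)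
    ultimately show "subset_char n \<chi> False D p = - (\<Sum>z\<in>Z - Z0. of_int (c z) * state_char n w od z p)"
      by (simp add: eq_neg_iff_add_eq_0 add.commute)
  qed
qed

text \<open>
  Induction on the number \<open>D\<close> of coloured letters. The even one-colour sums with
  \<open>D\<close> letters come first, by the alternating relation; its mixed terms involve two
  colours and are therefore products of one-colour sums with fewer letters up to lower terms.
\<close>

theorem orbit_chars_generated:
  fixes A :: "((nat \<Rightarrow> 'g) \<times> (nat \<Rightarrow> nat) \<Rightarrow> 'k::field_char_0) set" and s :: "nat \<Rightarrow> nat"
  assumes A: "character_subring H A"
    and carH: "\<And>f \<sigma>. (f, \<sigma>) \<in> carrier H \<Longrightarrow> \<sigma> permutes {..<n}"
    and Ch: "(\<lambda>_. 1) \<in> Ch" "\<And>\<chi> \<chi>'. \<chi> \<in> Ch \<Longrightarrow> \<chi>' \<in> Ch \<Longrightarrow> (\<lambda>a. \<chi> a * \<chi>' a) \<in> Ch"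
    and gen: "\<And>\<chi> d. \<chi> \<in> Ch \<Longrightarrow> subset_char n \<chi> True d \<in> A"
    and w: "w 0 = (\<lambda>_. 1)" "\<And>t. w t \<in> Ch" and od: "\<not> od 0" and out: "\<And>x. x \<ge> n \<Longrightarrow> s x = 0"
  shows "orbit_char n w od s \<in> A"
proof -
  interpret character_subring H A by fact
  have "(\<forall>\<chi>\<in>Ch. subset_char n \<chi> False D \<in> A) \<and>
    (\<forall>w od s. w 0 = (\<lambda>_. 1) \<longrightarrow> (\<forall>t. w t \<in> Ch) \<longrightarrow> \<not> od 0 \<longrightarrow> (\<forall>x\<ge>n. s x = (0::nat)) \<longrightarrow>
       card {x \<in> {..<n}. s x \<noteq> 0} = D \<longrightarrow> orbit_char n w od s \<in> A)" for D
  proof (induction D rule: less_induct)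
    case (less D)
    have IH1: "subset_char n \<chi> False d \<in> A" if "d < D" "\<chi> \<in> Ch" for d \<chi>
      using less.IH[OF that(1), THEN conjunct1] that(2) by (rule bspec)
    have IH2: "orbit_char n w od s \<in> A" if "w 0 = (\<lambda>_. 1)" "\<And>t. w t \<in> Ch" "\<not> od 0" "\<And>x. x \<ge> n \<Longrightarrow> s x = 0"
      "card {x \<in> {..<n}. s x \<noteq> 0} < D" for w od and s :: "nat \<Rightarrow> nat"
      by (rule less.IH[OF that(5), THEN conjunct2, rule_format]) (use that in auto)
    have even: "subset_char n \<chi> False D \<in> A" if \<chi>: "\<chi> \<in> Ch" for \<chi>
    proof (cases "D = 0")
      case True
      have e: "{S. S \<subseteq> {..<n} \<and> card S = 0} = {{}}" by (auto dest: finite_subset)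
      have "subset_char n \<chi> False D p = 1" for p
        unfolding True subset_char_def e by (simp split: prod.split)
      then show ?thesis using one by (intro cong[OF one]) simp
    next
      case False
      define w where "w = (\<lambda>c. if c = (1::nat) \<or> c = 2 then \<chi> else (\<lambda>_. 1))"
      define od where "od = (\<lambda>c. c = (1::nat))"
      show ?thesis
      proof (rule even_subset_char_from_odd[OF A _ _ w_def od_def])
        show "\<sigma> permutes {..<n}" if "(f, \<sigma>) \<in> carrier H" for f \<sigma> by (rule carH[OF that])
        show "1 \<le> D" using False by simp
        fix z assume z: "\<And>x. x \<ge> n \<Longrightarrow> z x = 0" "\<And>x. x < n \<Longrightarrow> z x \<le> 2" "card {x \<in> {..<n}. z x \<noteq> (0::nat)} = D"
          and one: "\<exists>x<n. z x = 1"
        show "orbit_char n w od z \<in> A"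
        proof (rule product_of_subset_chars[OF A])
          show "\<sigma> permutes {..<n}" if "(f, \<sigma>) \<in> carrier H" for f \<sigma> by (rule carH[OF that])
          show "(\<lambda>_. 1) \<in> Ch" by (rule Ch(1))
          show "(\<lambda>a. \<chi> a * \<chi>' a) \<in> Ch" if "\<chi> \<in> Ch" "\<chi>' \<in> Ch" for \<chi> \<chi>' by (rule Ch(2)[OF that])
          show "subset_char n (w t) (od t) (card {x \<in> {..<n}. z x = t}) \<in> A" if t: "t \<in> z ` {..<n}" "t \<noteq> 0" for t
          proof (cases "t = 1")
            case True
            then show ?thesis using gen[OF \<chi>] by (simp add: w_def od_def)
          next
            case False
            obtain y where "y < n" "z y = t" using t(1) by auto
            then have t2: "t = 2" using z(2)[of y] t(2) False by linarith
            obtain x where x: "x < n" "z x = 1" using one by blast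
            have "{x \<in> {..<n}. z x = t} \<subseteq> {x \<in> {..<n}. z x \<noteq> 0}" using t(2) by blast
            moreover have "x \<in> {x \<in> {..<n}. z x \<noteq> 0}" "x \<notin> {x \<in> {..<n}. z x = t}" using x t2 by simp_all
            ultimately have "{x \<in> {..<n}. z x = t} \<subset> {x \<in> {..<n}. z x \<noteq> 0}" by blast
            then have "card {x \<in> {..<n}. z x = t} < D" unfolding z(3)[symmetric] by (intro psubset_card_mono) auto
            then show ?thesis using IH1[OF _ \<chi>] t2 by (simp add: w_def od_def)
          qed
          show "orbit_char n w' od' s' \<in> A" if "w' 0 = (\<lambda>_. 1)" "\<And>t. w' t \<in> Ch" "\<not> od' 0" "\<And>x. x \<ge> n \<Longrightarrow> s' x = 0"
            "card {x \<in> {..<n}. s' x \<noteq> 0} < card {x \<in> {..<n}. z x \<noteq> 0}" for w' od' and s' :: "nat \<Rightarrow> nat"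
            by (rule IH2) (use that z(3) in auto)
          show "z x = 0" if "x \<ge> n" for x using z(1) that .
        qed (simp_all add: w_def od_def Ch(1) \<chi>)
      qed
    qed
    have "orbit_char n w od s \<in> A" if ws: "w 0 = (\<lambda>_. 1)" "\<And>t. w t \<in> Ch" "\<not> od 0" "\<And>x. x \<ge> n \<Longrightarrow> s x = 0"
      "card {x \<in> {..<n}. s x \<noteq> 0} = D" for w od and s :: "nat \<Rightarrow> nat"
    proof (rule product_of_subset_chars[OF A])
          show "\<sigma> permutes {..<n}" if "(f, \<sigma>) \<in> carrier H" for f \<sigma> by (rule carH[OF that])
          show "(\<lambda>_. 1) \<in> Ch" by (rule Ch(1))
          show "(\<lambda>a. \<chi> a * \<chi>' a) \<in> Ch" if "\<chi> \<in> Ch" "\<chi>' \<in> Ch" for \<chi> \<chi>' by (rule Ch(2)[OF that])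
      show "subset_char n (w t) (od t) (card {x \<in> {..<n}. s x = t}) \<in> A" if t: "t \<in> s ` {..<n}" "t \<noteq> 0" for t
      proof (cases "od t")
        case True
        then show ?thesis using gen[OF ws(2)] by simp
      next
        case False
        have "card {x \<in> {..<n}. s x = t} \<le> D" unfolding ws(5)[symmetric] using t by (intro card_mono) auto
        then consider "card {x \<in> {..<n}. s x = t} < D" | "card {x \<in> {..<n}. s x = t} = D" by linarith
        then show ?thesis by cases (use False IH1[OF _ ws(2)] even[OF ws(2)] in auto)
      qed
      show "orbit_char n w' od' s' \<in> A" if "w' 0 = (\<lambda>_. 1)" "\<And>t. w' t \<in> Ch" "\<not> od' 0" "\<And>x. x \<ge> n \<Longrightarrow> s' x = 0"
        "card {x \<in> {..<n}. s' x \<noteq> 0} < card {x \<in> {..<n}. s x \<noteq> 0}" for w' od' and s' :: "nat \<Rightarrow> nat"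
        by (rule IH2) (use that ws(5) in auto)
      show "w 0 = (\<lambda>_. 1)" "\<not> od 0" by (rule ws)+
      show "w t \<in> Ch" for t by (rule ws)
      show "s x = 0" if "x \<ge> n" for x using that by (rule ws)
    qed
    then show ?case using even by simp
  qed
  from this[of "card {x \<in> {..<n}. s x \<noteq> 0}", THEN conjunct2, rule_format, of w od s]
  show ?thesis using w od out by simp
qed

section \<open>Wreath products\<close>

lemma wreath_carrier_iff:
  "(f, \<sigma>) \<in> carrier (wreath G I) \<longleftrightarrow> f \<in> I \<rightarrow>\<^sub>E carrier G \<and> \<sigma> permutes I"
  by (simp add: wreath_def sym_group_on_def)

lemma wreath_mult:
  "(f, \<sigma>) \<otimes>\<^bsub>wreath G I\<^esub> (g, \<tau>) = ((\<lambda>i\<in>I. f i \<otimes>\<^bsub>G\<^esub> g (Hilbert_Choice.inv \<sigma> i)), \<sigma> \<circ> \<tau>)"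
  by (simp add: wreath_def sym_group_on_def)

lemma wreath_one: "\<one>\<^bsub>wreath G I\<^esub> = ((\<lambda>i\<in>I. \<one>\<^bsub>G\<^esub>), id)"
  by (simp add: wreath_def sym_group_on_def)

lemma group_wreath:
  assumes "group G"
  shows "group (wreath G I)"
proof -
  interpret G: group G by fact
  have app: "f i \<in> carrier G" if "f \<in> I \<rightarrow>\<^sub>E carrier G" "i \<in> I" for f i using that by (auto simp: PiE_def)
  have inv_in: "Hilbert_Choice.inv \<sigma> i \<in> I \<longleftrightarrow> i \<in> I" if "\<sigma> permutes I" for \<sigma> i
    using permutes_in_image[OF permutes_inv[OF that]] .
  show ?thesis
  proof (rule groupI)
    fix x y assume x: "x \<in> carrier (wreath G I)" and y: "y \<in> carrier (wreath G I)"
    obtain f \<sigma> g \<tau> where [simp]: "x = (f, \<sigma>)" "y = (g, \<tau>)" by (cases x; cases y) auto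
    show "x \<otimes>\<^bsub>wreath G I\<^esub> y \<in> carrier (wreath G I)"
      using x y app inv_in by (auto simp: wreath_carrier_iff wreath_mult permutes_compose)
    fix z assume z: "z \<in> carrier (wreath G I)"
    obtain h \<upsilon> where [simp]: "z = (h, \<upsilon>)" by (cases z) auto
    have \<sigma>\<tau>: "\<sigma> permutes I" "\<tau> permutes I" using x y by (auto simp: wreath_carrier_iff)
    have "Hilbert_Choice.inv (\<sigma> \<circ> \<tau>) i = Hilbert_Choice.inv \<tau> (Hilbert_Choice.inv \<sigma> i)" for i
      using o_inv_distrib[OF permutes_bij[OF \<sigma>\<tau>(1)] permutes_bij[OF \<sigma>\<tau>(2)]] by simp
    then show "x \<otimes>\<^bsub>wreath G I\<^esub> y \<otimes>\<^bsub>wreath G I\<^esub> z = x \<otimes>\<^bsub>wreath G I\<^esub> (y \<otimes>\<^bsub>wreath G I\<^esub> z)"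
      using x y z app inv_in by (auto simp: wreath_carrier_iff wreath_mult comp_assoc fun_eq_iff restrict_def G.m_assoc)
  next
    show "\<one>\<^bsub>wreath G I\<^esub> \<in> carrier (wreath G I)" by (simp add: wreath_one wreath_carrier_iff permutes_id)
  next
    fix x assume x: "x \<in> carrier (wreath G I)"
    obtain f \<sigma> where [simp]: "x = (f, \<sigma>)" by (cases x) auto
    have f: "f \<in> I \<rightarrow>\<^sub>E carrier G" and \<sigma>: "\<sigma> permutes I" using x by (auto simp: wreath_carrier_iff)
    show "\<one>\<^bsub>wreath G I\<^esub> \<otimes>\<^bsub>wreath G I\<^esub> x = x"
      using f app[OF f] by (auto simp: wreath_one wreath_mult fun_eq_iff restrict_def PiE_def extensional_def)
    have "(\<lambda>i\<in>I. inv\<^bsub>G\<^esub> f (\<sigma> i), Hilbert_Choice.inv \<sigma>) \<otimes>\<^bsub>wreath G I\<^esub> x = \<one>\<^bsub>wreath G I\<^esub>"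
      using f app[OF f] permutes_inv_inv[OF \<sigma>] permutes_inv_o[OF \<sigma>] permutes_in_image[OF \<sigma>]
      by (auto simp: wreath_one wreath_mult fun_eq_iff restrict_def)
    moreover have "(\<lambda>i\<in>I. inv\<^bsub>G\<^esub> f (\<sigma> i), Hilbert_Choice.inv \<sigma>) \<in> carrier (wreath G I)"
      using f app[OF f] permutes_inv[OF \<sigma>] permutes_in_image[OF \<sigma>] by (auto simp: wreath_carrier_iff)
    ultimately show "\<exists>y\<in>carrier (wreath G I). y \<otimes>\<^bsub>wreath G I\<^esub> x = \<one>\<^bsub>wreath G I\<^esub>" by blast
  qed
qed

lemma wreath_inv:
  assumes "group G" and x: "(f, \<sigma>) \<in> carrier (wreath G I)"
  shows "inv\<^bsub>wreath G I\<^esub> (f, \<sigma>) = ((\<lambda>i\<in>I. inv\<^bsub>G\<^esub> f (\<sigma> i)), Hilbert_Choice.inv \<sigma>)"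
proof -
  interpret G: group G by fact
  interpret W: group "wreath G I" by (rule group_wreath) fact
  have f: "f \<in> I \<rightarrow>\<^sub>E carrier G" and \<sigma>: "\<sigma> permutes I" using x by (auto simp: wreath_carrier_iff)
  have app: "f i \<in> carrier G" if "i \<in> I" for i using that f by (auto simp: PiE_def)
  have "(\<lambda>i\<in>I. inv\<^bsub>G\<^esub> f (\<sigma> i), Hilbert_Choice.inv \<sigma>) \<otimes>\<^bsub>wreath G I\<^esub> (f, \<sigma>) = \<one>\<^bsub>wreath G I\<^esub>"
    using app permutes_inv_inv[OF \<sigma>] permutes_inv_o[OF \<sigma>] permutes_in_image[OF \<sigma>]
    by (auto simp: wreath_one wreath_mult fun_eq_iff restrict_def)
  moreover have "(\<lambda>i\<in>I. inv\<^bsub>G\<^esub> f (\<sigma> i), Hilbert_Choice.inv \<sigma>) \<in> carrier (wreath G I)"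
    using app permutes_inv[OF \<sigma>] permutes_in_image[OF \<sigma>] by (auto simp: wreath_carrier_iff)
  ultimately show ?thesis using x by (intro W.inv_equality) auto
qed

lemma finite_wreath:
  assumes "finite (carrier G)" "finite I"
  shows "finite (carrier (wreath G I))"
  using assms by (auto simp: wreath_def sym_group_on_def intro!: finite_PiE finite_permutations)

lemma characters_iff:
  "\<chi> \<in> characters G \<longleftrightarrow> (\<forall>a\<in>carrier G. \<chi> a \<noteq> (0 :: 'k::field)) \<and>
     (\<forall>a\<in>carrier G. \<forall>b\<in>carrier G. \<chi> (a \<otimes>\<^bsub>G\<^esub> b) = \<chi> a * \<chi> b)"
proof -
  have "x \<in> Units (ring_of_type_algebra :: 'k ring) \<longleftrightarrow> x \<noteq> 0" for x :: 'k
    by (auto simp: Units_def ring_of_type_algebra_def intro: exI[of _ "inverse x"])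
  then show ?thesis
    by (auto simp: characters_def hom_def units_of_def ring_of_type_algebra_def)
qed

lemma character_one:
  assumes "group G" "\<chi> \<in> characters G"
  shows "\<chi> \<one>\<^bsub>G\<^esub> = (1 :: 'k::field)"
proof -
  interpret group G by fact
  have "\<chi> \<one>\<^bsub>G\<^esub> * \<chi> \<one>\<^bsub>G\<^esub> = \<chi> \<one>\<^bsub>G\<^esub>" "\<chi> \<one>\<^bsub>G\<^esub> \<noteq> 0"
    using assms(2) one_closed l_one[OF one_closed] unfolding characters_iff by (metis, blast)
  then show ?thesis by simp
qed

lemma character_inv:
  assumes "group G" "\<chi> \<in> characters G" "a \<in> carrier G"
  shows "\<chi> (inv\<^bsub>G\<^esub> a) = (inverse (\<chi> a) :: 'k::field)"
proof -
  interpret group G by fact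
  have "\<chi> (inv\<^bsub>G\<^esub> a) * \<chi> a = \<chi> (inv\<^bsub>G\<^esub> a \<otimes>\<^bsub>G\<^esub> a)" using assms(2,3) inv_closed[OF assms(3)] unfolding characters_iff by metis
  then have "\<chi> (inv\<^bsub>G\<^esub> a) * \<chi> a = 1" using assms character_one[OF assms(1,2)] by simp
  then show ?thesis using assms by (simp add: characters_iff field_simps)
qed

section \<open>Monomial matrices\<close>

text \<open>
  Among the permutations of \<open>S\<close> at most one picks only nonzero entries, namely the
  inverse of \<open>\<sigma>\<close> transported along \<open>p\<close>; the diagonal rescaling by
  \<open>c\<close> cancels.
\<close>

lemma principal_minor_monomial:
  fixes v :: "nat \<Rightarrow> 'k::field"
  assumes \<sigma>: "\<sigma> permutes {..<n}" and p: "bij_betw p {..<m} {..<n}" and S: "S \<subseteq> {..<m}" and c: "\<And>i. i < m \<Longrightarrow> c i \<noteq> 0"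
    and a: "\<And>i j. i < m \<Longrightarrow> j < m \<Longrightarrow> a i j = (if \<sigma> (p j) = p i then inverse (c i) * v (p i) * c j else 0)"
  shows "principal_minor a S = (if \<sigma> ` (p ` S) = p ` S then (\<Prod>x\<in>p ` S. v x) * of_int (sign_on (p ` S) \<sigma>) else 0)"
proof -
  define T where "T = p ` S"
  have inj: "inj_on p S" using p S by (auto simp: bij_betw_def intro: inj_on_subset)
  have finS: "finite S" using S by (rule finite_subset) simp
  have fin: "finite {\<pi>. \<pi> permutes S}" using finS by (rule finite_permutations)
  have pS: "\<pi> i < m" if "\<pi> permutes S" "i \<in> S" for \<pi> i using permutes_in_image[OF that(1)] that(2) S by auto
  have tm: "(\<Prod>i\<in>S. a i (\<pi> i)) = (if \<forall>i\<in>S. \<sigma> (p (\<pi> i)) = p i then \<Prod>x\<in>T. v x else 0)" if \<pi>: "\<pi> permutes S" for \<pi>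
  proof (cases "\<forall>i\<in>S. \<sigma> (p (\<pi> i)) = p i")
    case True
    have "(\<Prod>i\<in>S. a i (\<pi> i)) = (\<Prod>i\<in>S. inverse (c i) * v (p i) * c (\<pi> i))"
      using True S pS[OF \<pi>] by (intro prod.cong) (auto simp: a)
    also have "\<dots> = (\<Prod>i\<in>S. inverse (c i)) * (\<Prod>i\<in>S. v (p i)) * (\<Prod>i\<in>S. c (\<pi> i))" by (simp add: prod.distrib)
    also have "(\<Prod>i\<in>S. c (\<pi> i)) = (\<Prod>i\<in>S. c i)" using prod.permute[OF \<pi>, of c] by (simp add: o_def)
    also have "(\<Prod>i\<in>S. inverse (c i)) * (\<Prod>i\<in>S. v (p i)) * (\<Prod>i\<in>S. c i) = (\<Prod>i\<in>S. inverse (c i) * c i) * (\<Prod>i\<in>S. v (p i))"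
      by (simp add: prod.distrib)
    also have "(\<Prod>i\<in>S. inverse (c i) * c i) = 1" using c S by (intro prod.neutral) auto
    also have "(\<Prod>i\<in>S. v (p i)) = (\<Prod>x\<in>T. v x)" unfolding T_def by (simp add: prod.reindex[OF inj])
    finally show ?thesis using True by simp
  next
    case False
    then obtain i where i: "i \<in> S" "\<sigma> (p (\<pi> i)) \<noteq> p i" by blast
    then have "a i (\<pi> i) = 0" using S pS[OF \<pi> i(1)] by (subst a) auto
    then have "(\<Prod>i\<in>S. a i (\<pi> i)) = 0" using finS i by (intro prod_zero) auto
    then show ?thesis using False by (simp only: if_False)
  qed
  show ?thesis
  proof (cases "\<sigma> ` T = T")
    case False
    have no: "\<not> (\<forall>i\<in>S. \<sigma> (p (\<pi> i)) = p i)" if \<pi>: "\<pi> permutes S" for \<pi>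
    proof
      assume *: "\<forall>i\<in>S. \<sigma> (p (\<pi> i)) = p i"
      have "T \<subseteq> \<sigma> ` T"
      proof
        fix x assume "x \<in> T"
        then obtain i where i: "i \<in> S" "x = p i" by (auto simp: T_def)
        then have "x = \<sigma> (p (\<pi> i))" using * by simp
        then show "x \<in> \<sigma> ` T" using permutes_in_image[OF \<pi>] i by (auto simp: T_def)
      qed
      moreover have "card (\<sigma> ` T) = card T" by (rule card_image[OF inj_on_subset[OF permutes_inj[OF \<sigma>] subset_UNIV]])
      ultimately have "T = \<sigma> ` T" using finS by (intro card_subset_eq) (auto simp: T_def)
      then show False using False by simp
    qed
    have "principal_minor a S = 0"
      unfolding principal_minor_def
    proof (rule sum.neutral, clarify)
      fix \<pi> assume "\<pi> permutes S"
      then show "of_int (sign \<pi>) * (\<Prod>i\<in>S. a i (\<pi> i)) = 0" using tm no by simp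
    qed
    then show ?thesis using False by (simp add: T_def)
  next
    case True
    define q where "q = inv_into S p"
    have qp: "q (p i) = i" if "i \<in> S" for i using inv_into_f_f[OF inj that] by (simp add: q_def)
    have pq: "p (q x) = x" if "x \<in> T" for x using f_inv_into_f[of x p S] that by (simp add: q_def T_def)
    have bq: "bij_betw q T S" unfolding q_def T_def by (rule bij_betw_inv_into) (simp add: bij_betw_def inj)
    have "bij_betw \<sigma> T T" using True permutes_inj[OF \<sigma>] by (auto simp: bij_betw_def intro: inj_on_subset)
    then have rT: "restrict_id \<sigma> T permutes T" by (rule permutes_restrict_id)
    define \<pi>1 where "\<pi>1 = (\<lambda>i. if i \<in> S then q (restrict_id \<sigma> T (p i)) else i)"
    interpret permutes_bij_finite "restrict_id \<sigma> T" T S q p \<pi>1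
      by unfold_locales (use rT bq pq finS in \<open>auto simp: \<pi>1_def T_def\<close>)
    have \<pi>1: "\<pi>1 permutes S" "sign \<pi>1 = sign_on T \<sigma>" using permutes_p' sign_p' by (simp_all add: sign_on_def)
    have p1: "p (\<pi>1 i) = \<sigma> (p i)" if "i \<in> S" for i
    proof -
      have "p i \<in> T" using that by (simp add: T_def)
      then show ?thesis using that pq[of "\<sigma> (p i)"] True by (auto simp: \<pi>1_def)
    qed
    define \<pi>0 where "\<pi>0 = Hilbert_Choice.inv \<pi>1"
    have \<pi>0: "\<pi>0 permutes S" unfolding \<pi>0_def by (rule permutes_inv[OF \<pi>1(1)])
    have good: "(\<forall>i\<in>S. \<sigma> (p (\<pi> i)) = p i) \<longleftrightarrow> \<pi> = \<pi>0" if \<pi>: "\<pi> permutes S" for \<pi>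
    proof
      assume *: "\<forall>i\<in>S. \<sigma> (p (\<pi> i)) = p i"
      show "\<pi> = \<pi>0"
      proof
        fix i show "\<pi> i = \<pi>0 i"
        proof (cases "i \<in> S")
          case True
          have "\<pi> i \<in> S" using permutes_in_image[OF \<pi>] True by blast
          then have "p (\<pi>1 (\<pi> i)) = p i" using * p1 True by simp
          moreover have "\<pi>1 (\<pi> i) \<in> S" using permutes_in_image[OF \<pi>1(1)] \<open>\<pi> i \<in> S\<close> by blast
          ultimately have "\<pi>1 (\<pi> i) = i" using inj_onD[OF inj] True by blast
          then show ?thesis unfolding \<pi>0_def using permutes_inv_eq[OF \<pi>1(1)] by metis
        qed (use permutes_not_in[OF \<pi>] permutes_not_in[OF \<pi>0] in simp)
      qed
    next
      assume e: "\<pi> = \<pi>0"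
      show "\<forall>i\<in>S. \<sigma> (p (\<pi> i)) = p i"
      proof
        fix i assume i: "i \<in> S"
        have "\<pi>0 i \<in> S" using permutes_in_image[OF \<pi>0] i by blast
        then have "\<sigma> (p (\<pi>0 i)) = p (\<pi>1 (\<pi>0 i))" using p1 by simp
        also have "\<pi>1 (\<pi>0 i) = i" unfolding \<pi>0_def by (rule permutes_inverses(1)[OF \<pi>1(1)])
        finally show "\<sigma> (p (\<pi> i)) = p i" by (simp add: e)
      qed
    qed
    have sgn: "sign \<pi>0 = sign_on T \<sigma>"
      unfolding \<pi>0_def using sign_inverse[OF permutes_imp_permutation[OF finS \<pi>1(1)]] \<pi>1(2) by simp
    have "principal_minor a S = (\<Sum>\<pi> | \<pi> permutes S. if \<pi> = \<pi>0 then of_int (sign \<pi>0) * (\<Prod>x\<in>T. v x) else 0)"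
      unfolding principal_minor_def by (rule sum.cong) (use tm good in auto)
    also have "\<dots> = of_int (sign \<pi>0) * (\<Prod>x\<in>T. v x)" using fin \<pi>0 by simp
    finally show ?thesis using True sgn by (simp add: T_def mult.commute)
  qed
qed

lemma trace_exterior_power_monomial:
  fixes v :: "'g \<Rightarrow> 'k::field"
  assumes \<sigma>: "\<sigma> permutes {..<n}" and p: "bij_betw p {..<n} {..<n}" and c: "\<And>i. i < n \<Longrightarrow> c i \<noteq> 0"
  shows "mat_trace (exterior_power_mat k (mat n n (\<lambda>(i, j). if \<sigma> (p j) = p i then inverse (c i) * v (f (p i)) * c j else 0))) =
    subset_char n v True k (f, \<sigma>)"
proof -
  let ?M = "mat n n (\<lambda>(i, j). if \<sigma> (p j) = p i then inverse (c i) * v (f (p i)) * c j else 0)"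
  let ?t = "\<lambda>T. if \<sigma> ` T = T then (\<Prod>x\<in>T. v (f x)) * of_int (sign_on T \<sigma>) else 0"
  have "mat_trace (exterior_power_mat k ?M) = (\<Sum>S | S \<subseteq> {..<n} \<and> card S = k. principal_minor (\<lambda>i j. ?M $$ (i, j)) S)"
    by (rule mat_trace_exterior_power) simp
  also have "\<dots> = (\<Sum>S | S \<subseteq> {..<n} \<and> card S = k. ?t (p ` S))"
    by (rule sum.cong[OF refl], rule principal_minor_monomial[OF \<sigma> p _ c]) (auto)
  also have "\<dots> = (\<Sum>T | T \<subseteq> {..<n} \<and> card T = k. ?t T)"
  proof (rule sum.reindex_bij_betw)
    have inj: "inj_on p S" if "S \<subseteq> {..<n}" for S using p that by (auto simp: bij_betw_def intro: inj_on_subset)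
    show "bij_betw ((`) p) {S. S \<subseteq> {..<n} \<and> card S = k} {T. T \<subseteq> {..<n} \<and> card T = k}"
      unfolding bij_betw_def
    proof
      show "inj_on ((`) p) {S. S \<subseteq> {..<n} \<and> card S = k}"
        using p by (auto simp: bij_betw_def intro!: inj_onI dest: inj_on_image_eq_iff)
      show "(`) p ` {S. S \<subseteq> {..<n} \<and> card S = k} = {T. T \<subseteq> {..<n} \<and> card T = k}"
      proof (intro equalityI subsetI)
        fix T assume "T \<in> (`) p ` {S. S \<subseteq> {..<n} \<and> card S = k}"
        then obtain S where S: "S \<subseteq> {..<n}" "card S = k" "T = p ` S" by auto
        have "p ` S \<subseteq> {..<n}" using S(1) bij_betw_imp_surj_on[OF p] by blast
        then show "T \<in> {T. T \<subseteq> {..<n} \<and> card T = k}" using S card_image[OF inj[OF S(1)]] by simp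
      next
        fix T assume T: "T \<in> {T. T \<subseteq> {..<n} \<and> card T = k}"
        then have "T \<subseteq> p ` {..<n}" using bij_betw_imp_surj_on[OF p] by simp
        then obtain S where S: "S \<subseteq> {..<n}" "T = p ` S" by (auto simp: subset_image_iff)
        then show "T \<in> (`) p ` {S. S \<subseteq> {..<n} \<and> card S = k}" using T card_image[OF inj[OF S(1)]] by auto
      qed
    qed
  qed
  also have "\<dots> = subset_char n v True k (f, \<sigma>)" unfolding subset_char_def by (simp only: prod.case if_True)
  finally show ?thesis .
qed

section \<open>The reflection representation\<close>

lemma principal_minor_cong:
  assumes "\<And>i j. i \<in> S \<Longrightarrow> j \<in> S \<Longrightarrow> a i j = b i j"
  shows "principal_minor a S = principal_minor b S"
  unfolding principal_minor_def
proof (rule sum.cong[OF refl])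
  fix p assume "p \<in> {p. p permutes S}"
  then show "of_int (sign p) * (\<Prod>i\<in>S. a i (p i)) = of_int (sign p) * (\<Prod>i\<in>S. b i (p i))"
    using assms permutes_in_image[of p S] by (intro arg_cong[of _ _ "\<lambda>x. _ * x"] prod.cong) auto
qed

text \<open>
  Laplace expansion along a column of the identity matrix.
\<close>

lemma principal_minor_unit_column:
  assumes fin: "finite S" and l: "l \<in> S" and col: "\<And>i. i \<in> S \<Longrightarrow> a i l = (if i = l then 1 else 0)"
  shows "principal_minor a S = principal_minor a (S - {l})"
proof -
  have "principal_minor a S = (\<Sum>p | p permutes (S - {l}). of_int (sign p) * (\<Prod>i\<in>S. a i (p i)))"
    unfolding principal_minor_def
  proof (rule sum.mono_neutral_right)
    show "finite {p. p permutes S}" using fin by (rule finite_permutations)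
    show "{p. p permutes S - {l}} \<subseteq> {p. p permutes S}" using permutes_subset by blast
    show "\<forall>p\<in>{p. p permutes S} - {p. p permutes S - {l}}. of_int (sign p) * (\<Prod>i\<in>S. a i (p i)) = 0"
    proof
      fix p assume p: "p \<in> {p. p permutes S} - {p. p permutes S - {l}}"
      then have pS: "p permutes S" by simp
      have "p l \<noteq> l"
      proof
        assume "p l = l"
        then have "p permutes S - {l}" using permutes_superset[OF pS, of "S - {l}"] by auto
        then show False using p by simp
      qed
      define i where "i = Hilbert_Choice.inv p l"
      have pi: "p i = l" "i \<in> S" using permutes_inverses(1)[OF pS] permutes_in_image[OF permutes_inv[OF pS]] l by (auto simp: i_def)
      then have "a i (p i) = 0" using col[of i] \<open>p l \<noteq> l\<close> by auto
      then have "(\<Prod>i\<in>S. a i (p i)) = 0" using fin pi by (intro prod_zero) auto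
      then show "of_int (sign p) * (\<Prod>i\<in>S. a i (p i)) = 0" by simp
    qed
  qed
  also have "\<dots> = principal_minor a (S - {l})"
    unfolding principal_minor_def
  proof (rule sum.cong[OF refl])
    fix p assume "p \<in> {p. p permutes S - {l}}"
    then have "p l = l" using permutes_not_in[of p "S - {l}" l] by simp
    then have "(\<Prod>i\<in>S. a i (p i)) = (\<Prod>i\<in>S - {l}. a i (p i))"
      using col[OF l] by (simp add: prod.remove[OF fin l])
    then show "of_int (sign p) * (\<Prod>i\<in>S. a i (p i)) = of_int (sign p) * (\<Prod>i\<in>S - {l}. a i (p i))" by simp
  qed
  finally show ?thesis .
qed

lemma trace_exterior_power_similar:
  fixes P :: "'k::field mat"
  assumes P: "P \<in> carrier_mat n n" and Q: "Q \<in> carrier_mat n n" and T: "T \<in> carrier_mat n n" and T': "T' \<in> carrier_mat n n"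
    and TT': "T * T' = 1\<^sub>m n" and PT: "P * T = T * Q"
  shows "mat_trace (exterior_power_mat k P) = mat_trace (exterior_power_mat k Q)"
proof -
  let ?E = "exterior_power_mat k :: 'k mat \<Rightarrow> 'k mat"
  note e = exterior_power_mat_carrier[of _ n n k] and m = exterior_power_mat_mult[of _ n n _ n k]
  have T'T: "T' * T = 1\<^sub>m n" by (rule mat_mult_left_right_inverse[OF T T' TT'])
  have 1: "?E T * ?E T' = 1\<^sub>m (length (increasing_lists n k))" "?E T' * ?E T = 1\<^sub>m (length (increasing_lists n k))"
    unfolding m[OF T T', symmetric] m[OF T' T, symmetric] TT' T'T by (rule exterior_power_mat_one)+
  have PT': "?E P * ?E T = ?E T * ?E Q" unfolding m[OF P T, symmetric] m[OF T Q, symmetric] PT ..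
  have "?E P = ?E P * ?E T * ?E T'" unfolding assoc_mult_mat[OF e[OF P] e[OF T] e[OF T']] 1 using e[OF P] by simp
  then have "mat_trace (?E P) = mat_trace (?E T * ?E Q * ?E T')" unfolding PT' by simp
  also have "\<dots> = mat_trace (?E T' * (?E T * ?E Q))"
    by (rule mat_trace_mult_commute[OF mult_carrier_mat[OF e[OF T] e[OF Q]] e[OF T']])
  also have "?E T' * (?E T * ?E Q) = ?E Q"
    unfolding assoc_mult_mat[OF e[OF T'] e[OF T] e[OF Q], symmetric] 1 using e[OF Q] by simp
  finally show ?thesis .
qed

text \<open>
  In the basis \<open>e\<^sub>0, \<dots>, e\<^bsub>n-2\<^esub>, e\<^sub>0 + \<dots> +
  e\<^bsub>n-1\<^esub>\<close> the permutation matrix is block triangular with the reflection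
  representation and \<open>1\<close> on the diagonal. A principal minor either avoids the last
  index, or contains it and loses it by expansion along the last column.
\<close>

lemma trace_exterior_power_reflection:
  assumes n: "n \<ge> 1" and \<sigma>: "\<sigma> permutes {..<n}"
  shows "mat_trace (exterior_power_mat k (permutation_rep n \<sigma> :: 'k::field mat)) =
    mat_trace (exterior_power_mat k (reflection_rep n \<sigma>)) +
    (if k = 0 then 0 else mat_trace (exterior_power_mat (k - 1) (reflection_rep n \<sigma>)))"
proof -
  let ?l = "n - 1"
  define T where "T = mat n n (\<lambda>(i, j). if i = j \<or> j = ?l then 1 else (0 :: 'k))"
  define T' where "T' = mat n n (\<lambda>(i, j). if i = j then 1 else if j = ?l then - 1 else (0 :: 'k))"
  define Q where "Q = mat n n (\<lambda>(i, j). if j = ?l then if i = ?l then 1 else 0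
     else if i = ?l then if \<sigma> j = ?l then 1 else 0 else reflection_rep n \<sigma> $$ (i, j) :: 'k)"
  let ?P = "permutation_rep n \<sigma> :: 'k mat"
  have c: "T \<in> carrier_mat n n" "T' \<in> carrier_mat n n" "Q \<in> carrier_mat n n" "?P \<in> carrier_mat n n"
    "(reflection_rep n \<sigma> :: 'k mat) \<in> carrier_mat ?l ?l"
    by (auto simp: T_def T'_def Q_def permutation_rep_def reflection_rep_def)
  have Qij: "Q $$ (i, j) = reflection_rep n \<sigma> $$ (i, j)" if "i < ?l" "j < ?l" for i j
    using that by (simp add: Q_def)
  have split: "(\<Sum>k<n. g k) = (\<Sum>k<?l. g k) + g ?l" for g :: "nat \<Rightarrow> 'k"
    using n by (cases n) auto
  have "T * T' = 1\<^sub>m n"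
  proof (rule eq_matI)
    fix i j assume "i < dim_row (1\<^sub>m n :: 'k mat)" "j < dim_col (1\<^sub>m n :: 'k mat)"
    then have ij: "i < n" "j < n" by auto
    have "(T * T') $$ (i, j) = (\<Sum>k<?l. (if i = k then 1 else 0) * T' $$ (k, j)) + T' $$ (?l, j)"
      unfolding mat_mult_index[OF c(1,2) ij] split using ij by (simp add: T_def)
    also have "(\<Sum>k<?l. (if i = k then 1 else 0) * T' $$ (k, j)) = (if i < ?l then T' $$ (i, j) else 0)"
      by (simp add: if_distribR if_distrib[of "\<lambda>x. x * _"] cong: if_cong)
    finally show "(T * T') $$ (i, j) = 1\<^sub>m n $$ (i, j)"
      using ij n by (auto simp: T'_def split: if_splits)
  qed (use c in auto)
  moreover have "?P * T = T * Q"
  proof (rule eq_matI)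
    fix i j assume "i < dim_row (T * Q)" "j < dim_col (T * Q)"
    then have ij: "i < n" "j < n" using c by auto
    have sj: "\<sigma> j < n" using permutes_in_image[OF \<sigma>, of j] ij by simp
    have "(T * Q) $$ (i, j) = (\<Sum>k<?l. (if i = k then 1 else 0) * Q $$ (k, j)) + Q $$ (?l, j)"
      unfolding mat_mult_index[OF c(1,3) ij] split using ij by (simp add: T_def)
    also have "(\<Sum>k<?l. (if i = k then 1 else 0) * Q $$ (k, j)) = (if i < ?l then Q $$ (i, j) else 0)"
      by (simp add: if_distribR if_distrib[of "\<lambda>x. x * _"] cong: if_cong)
    finally have R: "(T * Q) $$ (i, j) = (if j = ?l then 1 else if \<sigma> j = i then 1 else 0)"
      using ij n sj by (auto simp: Q_def reflection_rep_def split: if_splits)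
    have "(?P * T) $$ (i, j) = (\<Sum>k<n. (if \<sigma> k = i then 1 else 0) * T $$ (k, j))"
      unfolding mat_mult_index[OF c(4,1) ij] using ij by (simp add: permutation_rep_def)
    also have "\<dots> = (if j = ?l then \<Sum>k<n. (if \<sigma> k = i then 1 else 0) else \<Sum>k<n. if k = j then (if \<sigma> j = i then 1 else 0) else 0)"
    proof (cases "j = ?l")
      case True
      then show ?thesis using ij by (auto simp: T_def intro!: sum.cong)
    next
      case False
      have "(if \<sigma> k = i then 1 else 0) * T $$ (k, j) = (if k = j then (if \<sigma> j = i then 1 else 0) else 0)" if "k < n" for k
        using that ij False by (simp add: T_def)
      then have "(\<Sum>k<n. (if \<sigma> k = i then 1 else 0) * T $$ (k, j)) = (\<Sum>k<n. if k = j then (if \<sigma> j = i then 1 else 0) else 0)"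
        by (intro sum.cong) simp_all
      then show ?thesis using False by (simp only: if_False)
    qed
    also have "(\<Sum>k<n. (if \<sigma> k = i then 1 else 0)) = (\<Sum>k<n. (if k = i then 1 else (0 :: 'k)))"
      using sum.permute[OF \<sigma>, of "\<lambda>k. if k = i then 1 else (0 :: 'k)"] by (simp add: o_def)
    finally show "(?P * T) $$ (i, j) = (T * Q) $$ (i, j)" unfolding R using ij by simp
  qed (use c in auto)
  ultimately have "mat_trace (exterior_power_mat k ?P) = mat_trace (exterior_power_mat k Q)"
    by (rule trace_exterior_power_similar[OF c(4,3,1,2)])
  also have "\<dots> = (\<Sum>S | S \<subseteq> {..<n} \<and> card S = k. principal_minor (\<lambda>i j. Q $$ (i, j)) S)"
    by (rule mat_trace_exterior_power[OF c(3)])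
  also have "\<dots> = (\<Sum>S\<in>{S. S \<subseteq> {..<?l} \<and> card S = k} \<union> {S. ?l \<in> S \<and> S \<subseteq> {..<n} \<and> card S = k}. principal_minor (\<lambda>i j. Q $$ (i, j)) S)"
  proof (rule sum.cong[OF _ refl])
    have "x < ?l" if "x < n" "x \<noteq> ?l" for x using that by linarith
    then show "{S. S \<subseteq> {..<n} \<and> card S = k} = {S. S \<subseteq> {..<?l} \<and> card S = k} \<union> {S. ?l \<in> S \<and> S \<subseteq> {..<n} \<and> card S = k}"
      using n by (auto simp: subset_eq)
  qed
  also have "\<dots> = (\<Sum>S\<in>{S. S \<subseteq> {..<?l} \<and> card S = k}. principal_minor (\<lambda>i j. Q $$ (i, j)) S) +
     (\<Sum>S\<in>{S. ?l \<in> S \<and> S \<subseteq> {..<n} \<and> card S = k}. principal_minor (\<lambda>i j. Q $$ (i, j)) S)"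
    by (rule sum.union_disjoint) (auto intro: finite_subset[of _ "Pow {..<?l}"] finite_subset[of _ "Pow {..<n}"])
  also have "(\<Sum>S\<in>{S. S \<subseteq> {..<?l} \<and> card S = k}. principal_minor (\<lambda>i j. Q $$ (i, j)) S) =
     mat_trace (exterior_power_mat k (reflection_rep n \<sigma>))"
    unfolding mat_trace_exterior_power[OF c(5)]
  proof (intro sum.cong[OF refl] principal_minor_cong)
    fix S i j assume "S \<in> {S. S \<subseteq> {..<?l} \<and> card S = k}" "i \<in> S" "j \<in> S"
    then show "Q $$ (i, j) = reflection_rep n \<sigma> $$ (i, j)" by (intro Qij) auto
  qed
  also have "(\<Sum>S\<in>{S. ?l \<in> S \<and> S \<subseteq> {..<n} \<and> card S = k}. principal_minor (\<lambda>i j. Q $$ (i, j)) S) =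
     (if k = 0 then 0 else mat_trace (exterior_power_mat (k - 1) (reflection_rep n \<sigma>)))"
  proof (cases "k = 0")
    case True
    have none: "{S. ?l \<in> S \<and> S \<subseteq> {..<n} \<and> card S = k} = {}"
      using True by (auto dest: finite_subset[OF _ finite_lessThan] simp: card_eq_0_iff)
    show ?thesis unfolding none using True by simp
  next
    case False
    have "(\<Sum>S\<in>{S. ?l \<in> S \<and> S \<subseteq> {..<n} \<and> card S = k}. principal_minor (\<lambda>i j. Q $$ (i, j)) S) =
      (\<Sum>S | S \<subseteq> {..<?l} \<and> card S = k - 1. principal_minor (\<lambda>i j. reflection_rep n \<sigma> $$ (i, j)) S)"
    proof (rule sum.reindex_bij_witness[of _ "insert ?l" "\<lambda>S. S - {?l}"])
      fix S assume S: "S \<in> {S. ?l \<in> S \<and> S \<subseteq> {..<n} \<and> card S = k}"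
      then have fin: "finite S" by (auto dest: finite_subset)
      have sub: "S - {?l} \<subseteq> {..<?l}"
      proof
        fix x assume "x \<in> S - {?l}"
        then have "x < n" "x \<noteq> ?l" using S by auto
        then show "x \<in> {..<?l}" by simp
      qed
      show "insert ?l (S - {?l}) = S" using S by auto
      show "S - {?l} \<in> {S. S \<subseteq> {..<?l} \<and> card S = k - 1}" using S sub fin by simp
      have "principal_minor (\<lambda>i j. Q $$ (i, j)) S = principal_minor (\<lambda>i j. Q $$ (i, j)) (S - {?l})"
        by (rule principal_minor_unit_column[OF fin]) (use S n in \<open>auto simp: Q_def\<close>)
      also have "\<dots> = principal_minor (\<lambda>i j. reflection_rep n \<sigma> $$ (i, j)) (S - {?l})"
      proof (rule principal_minor_cong)
        fix i j assume "i \<in> S - {?l}" "j \<in> S - {?l}"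
        then have "i \<in> {..<?l}" "j \<in> {..<?l}" using sub by blast+
        then show "Q $$ (i, j) = reflection_rep n \<sigma> $$ (i, j)" by (intro Qij) simp_all
      qed
      finally show "principal_minor (\<lambda>i j. reflection_rep n \<sigma> $$ (i, j)) (S - {?l}) = principal_minor (\<lambda>i j. Q $$ (i, j)) S" by simp
    next
      fix S assume S: "S \<in> {S. S \<subseteq> {..<?l} \<and> card S = k - 1}"
      then have fin: "finite S" "?l \<notin> S" by (auto dest: finite_subset)
      show "insert ?l S - {?l} = S" using fin by auto
      have "insert ?l S \<subseteq> {..<n}" using S n by auto
      then show "insert ?l S \<in> {S. ?l \<in> S \<and> S \<subseteq> {..<n} \<and> card S = k}" using S fin False by auto
    qed
    then show ?thesis using False by (simp add: mat_trace_exterior_power[OF c(5)])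
  qed
  finally show ?thesis .
qed

lemma trace_exterior_power_permutation:
  assumes "\<sigma> permutes {..<n}"
  shows "mat_trace (exterior_power_mat k (permutation_rep n \<sigma> :: 'k::field mat)) = subset_char n (\<lambda>_. 1) True k (f, \<sigma>)"
proof -
  have "permutation_rep n \<sigma> = (mat n n (\<lambda>(i, j). if \<sigma> (id j) = id i then inverse 1 * 1 * 1 else 0) :: 'k mat)"
    unfolding permutation_rep_def by (intro eq_matI) auto
  then show ?thesis using trace_exterior_power_monomial[OF assms, of id "\<lambda>_. 1" k "\<lambda>_. 1" f] by simp
qed

lemma is_rep_reflection:
  assumes n: "n \<ge> 1" and G: "group G"
  shows "is_rep (wreath G {..<n}) (n - 1) ((reflection_rep n :: _ \<Rightarrow> 'k::field mat) \<circ> snd)"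
proof -
  have S: "group (sym_group_on {..<n})" by (rule group_sym_group)
  interpret S: group "sym_group_on {..<n}" by fact
  obtain d where d: "is_rep (sym_group_on {..<n}) d (reflection_rep n :: _ \<Rightarrow> 'k mat)"
    using reflection_rep_quotient[OF n, where 'k = 'k] by (auto simp: short_exact_reps_def reps_def)
  note R = is_repD[OF S d]
  have "d = n - 1" using R(1)[OF S.one_closed] by (auto simp: reflection_rep_def)
  have sc: "\<sigma> \<in> carrier (sym_group_on {..<n}) \<longleftrightarrow> \<sigma> permutes {..<n}" "\<sigma> \<otimes>\<^bsub>sym_group_on {..<n}\<^esub> \<tau> = \<sigma> \<circ> \<tau>"
    "\<one>\<^bsub>sym_group_on {..<n}\<^esub> = id" for \<sigma> \<tau>
    by (simp_all add: sym_group_on_def)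
  show ?thesis
  proof (rule is_repI[OF group_wreath[OF G]])
    show "(reflection_rep n \<circ> snd) x \<in> carrier_mat (n - 1) (n - 1)" for x :: "(nat \<Rightarrow> 'a) \<times> (nat \<Rightarrow> nat)" by (simp add: reflection_rep_def)
    show "(reflection_rep n \<circ> snd) \<one>\<^bsub>wreath G {..<n}\<^esub> = (1\<^sub>m (n - 1) :: 'k mat)"
      using R(3) \<open>d = n - 1\<close> by (simp add: wreath_one sc)
    fix x y assume "x \<in> carrier (wreath G {..<n})" "y \<in> carrier (wreath G {..<n})"
    then show "(reflection_rep n \<circ> snd) (x \<otimes>\<^bsub>wreath G {..<n}\<^esub> y) = (reflection_rep n \<circ> snd) x * ((reflection_rep n \<circ> snd) y :: 'k mat)"
      using R(2)[of "snd x" "snd y"] by (cases x; cases y) (simp add: wreath_carrier_iff wreath_mult sc)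
  qed
qed

section \<open>The induced representations\<close>

text \<open>
  The subgroup is the stabilizer of the letter \<open>0\<close>, which makes it possible to work
  without the embedding.
\<close>

lemma embedded_subgroup:
  assumes G: "group G" and n: "n \<ge> 1"
  shows "wreath_embed ` carrier (G \<times>\<times> wreath G {1..<n}) = {(f, \<sigma>) \<in> carrier (wreath G {..<n}). \<sigma> 0 = 0}" (is "?L = ?R")
proof (intro equalityI subsetI)
  fix x assume "x \<in> ?L"
  then obtain a f \<sigma> where x: "x = (f(0 := a), \<sigma>)" and a: "a \<in> carrier G" and f: "f \<in> {1..<n} \<rightarrow>\<^sub>E carrier G" and \<sigma>: "\<sigma> permutes {1..<n}"
    by (auto simp: wreath_embed_def DirProd_def wreath_carrier_iff)
  have "\<sigma> permutes {..<n}" using \<sigma> by (rule permutes_subset) auto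
  moreover have "\<sigma> 0 = 0" using permutes_not_in[OF \<sigma>] by simp
  moreover have "f(0 := a) \<in> {..<n} \<rightarrow>\<^sub>E carrier G" using f a n by (auto simp: PiE_def extensional_def Pi_def)
  ultimately show "x \<in> ?R" by (simp add: x wreath_carrier_iff)
next
  fix x assume "x \<in> ?R"
  then obtain f \<sigma> where x: "x = (f, \<sigma>)" and f: "f \<in> {..<n} \<rightarrow>\<^sub>E carrier G" and \<sigma>: "\<sigma> permutes {..<n}" "\<sigma> 0 = 0"
    by (auto simp: wreath_carrier_iff)
  have "\<sigma> permutes {1..<n}" using \<sigma> by (intro permutes_superset[OF \<sigma>(1)]) (auto simp: not_le)
  moreover have "f(0 := undefined) \<in> {1..<n} \<rightarrow>\<^sub>E carrier G" using f by (auto simp: PiE_def extensional_def Pi_def)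
  moreover have "f 0 \<in> carrier G" using f n by (auto simp: PiE_def Pi_def)
  ultimately have "(f 0, f(0 := undefined), \<sigma>) \<in> carrier (G \<times>\<times> wreath G {1..<n})" by (simp add: DirProd_def wreath_carrier_iff)
  moreover have "x = wreath_embed (f 0, f(0 := undefined), \<sigma>)" by (simp add: x wreath_embed_def)
  ultimately show "x \<in> ?L" by blast
qed

lemma wreath_embed_first:
  assumes "x \<in> wreath_embed ` carrier (G \<times>\<times> wreath G {1..<n})"
  shows "fst (inv_into (carrier (G \<times>\<times> wreath G {1..<n})) wreath_embed x) = fst x 0"
proof -
  have "wreath_embed (inv_into (carrier (G \<times>\<times> wreath G {1..<n})) wreath_embed x) = x" by (rule f_inv_into_f[OF assms])
  then show ?thesis
    by (cases "inv_into (carrier (G \<times>\<times> wreath G {1..<n})) wreath_embed x") (auto simp: wreath_embed_def)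
qed

text \<open>
  A coset of the stabilizer of \<open>0\<close> is determined by the image of \<open>0\<close>.
\<close>

lemma wreath_coset_iff:
  assumes G: "group G" and n: "n \<ge> 1" and t: "(h, \<tau>) \<in> carrier (wreath G {..<n})" and x: "(f, \<sigma>) \<in> carrier (wreath G {..<n})"
  shows "(f, \<sigma>) \<in> (h, \<tau>) <#\<^bsub>wreath G {..<n}\<^esub> (wreath_embed ` carrier (G \<times>\<times> wreath G {1..<n})) \<longleftrightarrow> \<sigma> 0 = \<tau> 0"
proof -
  interpret W: group "wreath G {..<n}" by (rule group_wreath[OF G])
  let ?L = "wreath_embed ` carrier (G \<times>\<times> wreath G {1..<n})"
  have L: "?L = {(f, \<sigma>) \<in> carrier (wreath G {..<n}). \<sigma> 0 = 0}" by (rule embedded_subgroup[OF G n])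
  have \<tau>: "\<tau> permutes {..<n}" using t by (simp add: wreath_carrier_iff)
  define y where "y = inv\<^bsub>wreath G {..<n}\<^esub> (h, \<tau>) \<otimes>\<^bsub>wreath G {..<n}\<^esub> (f, \<sigma>)"
  have y: "y \<in> carrier (wreath G {..<n})" "(f, \<sigma>) = (h, \<tau>) \<otimes>\<^bsub>wreath G {..<n}\<^esub> y"
    unfolding y_def using t x by (simp_all add: W.m_assoc[symmetric])
  have sy: "snd y = Hilbert_Choice.inv \<tau> \<circ> \<sigma>" by (simp add: y_def wreath_inv[OF G t] wreath_mult)
  have "(f, \<sigma>) \<in> (h, \<tau>) <#\<^bsub>wreath G {..<n}\<^esub> ?L \<longleftrightarrow> y \<in> ?L"
  proof
    assume "(f, \<sigma>) \<in> (h, \<tau>) <#\<^bsub>wreath G {..<n}\<^esub> ?L"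
    then obtain z where z: "z \<in> ?L" "(f, \<sigma>) = (h, \<tau>) \<otimes>\<^bsub>wreath G {..<n}\<^esub> z" unfolding l_coset_def by blast
    have "z \<in> carrier (wreath G {..<n})" using z(1) unfolding L by auto
    then have "y = z" using y(2) z(2) W.l_cancel[OF _ y(1) _ t] by metis
    then show "y \<in> ?L" using z(1) by simp
  next
    assume "y \<in> ?L"
    then show "(f, \<sigma>) \<in> (h, \<tau>) <#\<^bsub>wreath G {..<n}\<^esub> ?L" using y(2) unfolding l_coset_def by blast
  qed
  also have "\<dots> \<longleftrightarrow> snd y 0 = 0" using y(1) unfolding L by (cases y) auto
  also have "\<dots> \<longleftrightarrow> \<sigma> 0 = \<tau> 0" using permutes_inv_eq[OF \<tau>, of "\<sigma> 0" 0] by (auto simp: sy)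
  finally show ?thesis .
qed

lemma ex_left_transversal_wreath:
  assumes G: "group G" and n: "n \<ge> 1"
  shows "\<exists>ts. left_transversal (wreath G {..<n}) (wreath_embed ` carrier (G \<times>\<times> wreath G {1..<n})) ts"
proof -
  interpret G: group G by fact
  define t where "t y = ((\<lambda>i\<in>{..<n}. \<one>\<^bsub>G\<^esub>), transpose 0 y)" for y :: nat
  have t: "t y \<in> carrier (wreath G {..<n})" if "y < n" for y
    using that n by (auto simp: t_def wreath_carrier_iff intro!: permutes_swap_id)
  have inj: "t y = t z \<longleftrightarrow> y = z" for y z by (auto simp: t_def dest!: fun_cong[of _ _ 0])
  have cos: "(f, \<sigma>) \<in> t y <#\<^bsub>wreath G {..<n}\<^esub> (wreath_embed ` carrier (G \<times>\<times> wreath G {1..<n})) \<longleftrightarrow> \<sigma> 0 = y"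
    if "y < n" "(f, \<sigma>) \<in> carrier (wreath G {..<n})" for f \<sigma> y
    using wreath_coset_iff[OF G n t[OF that(1), unfolded t_def] that(2)] by (simp add: t_def)
  show ?thesis
  proof (intro exI, unfold left_transversal_def, intro conjI ballI)
    show "distinct (map t [0..<n])" by (simp add: distinct_map inj_on_def inj)
    show "set (map t [0..<n]) \<subseteq> carrier (wreath G {..<n})" using t by auto
    fix x assume x: "x \<in> carrier (wreath G {..<n})"
    obtain f \<sigma> where [simp]: "x = (f, \<sigma>)" by (cases x)
    have "\<sigma> permutes {..<n}" using x by (simp add: wreath_carrier_iff)
    then have "\<sigma> 0 < n" using permutes_in_image[of \<sigma> "{..<n}" 0] n by simp
    then show "\<exists>!s. s \<in> set (map t [0..<n]) \<and> x \<in> s <#\<^bsub>wreath G {..<n}\<^esub> (wreath_embed ` carrier (G \<times>\<times> wreath G {1..<n}))"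
      using x cos by (intro ex1I[of _ "t (\<sigma> 0)"]) auto
  qed
qed

lemma left_transversal_wreath:
  assumes G: "group G" and n: "n \<ge> 1"
    and ts: "left_transversal (wreath G {..<n}) (wreath_embed ` carrier (G \<times>\<times> wreath G {1..<n})) ts"
  shows "length ts = n" "bij_betw (\<lambda>i. snd (ts ! i) 0) {..<n} {..<n}" "set ts \<subseteq> carrier (wreath G {..<n})"
proof -
  let ?W = "wreath G {..<n}" and ?L = "wreath_embed ` carrier (G \<times>\<times> wreath G {1..<n})"
  show sub: "set ts \<subseteq> carrier ?W" using ts by (simp add: left_transversal_def)
  interpret G: group G by fact
  have cos: "x \<in> t <#\<^bsub>?W\<^esub> ?L \<longleftrightarrow> snd x 0 = snd t 0" if "t \<in> set ts" "x \<in> carrier ?W" for t x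
    using wreath_coset_iff[OF G n, of "fst t" "snd t" "fst x" "snd x"] that sub by auto
  have un: "\<exists>!t. t \<in> set ts \<and> snd x 0 = snd t 0" if x: "x \<in> carrier ?W" for x
  proof -
    have "\<exists>!t. t \<in> set ts \<and> x \<in> t <#\<^bsub>?W\<^esub> ?L" using ts x by (simp add: left_transversal_def)
    moreover have "t \<in> set ts \<and> x \<in> t <#\<^bsub>?W\<^esub> ?L \<longleftrightarrow> t \<in> set ts \<and> snd x 0 = snd t 0" for t using cos[OF _ x] by blast
    ultimately show ?thesis by simp
  qed
  have b: "bij_betw (\<lambda>t. snd t 0) (set ts) {..<n}"
    unfolding bij_betw_def
  proof (intro conjI inj_onI equalityI subsetI)
    fix s t assume "s \<in> set ts" "t \<in> set ts" "snd s 0 = snd t 0"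
    then show "s = t" using un[of s] sub by blast
  next
    fix y assume "y \<in> (\<lambda>t. snd t 0) ` set ts"
    then obtain t where t: "t \<in> set ts" "y = snd t 0" by blast
    then have "snd t permutes {..<n}" using sub wreath_carrier_iff[of "fst t" "snd t"] by auto
    then show "y \<in> {..<n}" using permutes_in_image[of "snd t" "{..<n}" 0] n t(2) by auto
  next
    fix y assume "y \<in> {..<n}"
    then have "((\<lambda>i\<in>{..<n}. \<one>\<^bsub>G\<^esub>), transpose 0 y) \<in> carrier ?W" using n by (auto simp: wreath_carrier_iff intro!: permutes_swap_id)
    from un[OF this] show "y \<in> (\<lambda>t. snd t 0) ` set ts" by auto
  qed
  have d: "distinct ts" using ts by (simp add: left_transversal_def)
  then show l: "length ts = n" using bij_betw_same_card[OF b] by (simp add: distinct_card)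
  have "bij_betw (\<lambda>i. ts ! i) {..<n} (set ts)" by (rule bij_betw_nth) (use d l in auto)
  from bij_betw_trans[OF this b] show "bij_betw (\<lambda>i. snd (ts ! i) 0) {..<n} {..<n}" by (simp add: o_def)
qed

lemma box_character_entry:
  "(box_rep (character_rep \<chi>) triv_rep x :: 'k::field mat) = mat 1 1 (\<lambda>_. \<chi> (fst x))"
  by (cases x) (auto simp: box_rep_def character_rep_def triv_rep_def kronecker_prod_def intro!: eq_matI)

text \<open>
  The coset representative with index \<open>i\<close> sends \<open>0\<close> to \<open>p
  i\<close>. Nothing is known about the representatives beyond this, whence the unknown
  enumeration \<open>p\<close> and the scalars \<open>c\<close>, which measure how the
  representatives differ from permutations.
\<close>

lemma wreath_induced_rep_monomial:
  fixes \<chi> :: "'g \<Rightarrow> 'k::field"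
  assumes G: "group G" and n: "n \<ge> 1" and \<chi>: "\<chi> \<in> characters G"
  obtains p c where "bij_betw p {..<n} {..<n}" "\<And>i. i < n \<Longrightarrow> c i \<noteq> 0"
    "\<And>f \<sigma>. (f, \<sigma>) \<in> carrier (wreath G {..<n}) \<Longrightarrow> wreath_induced_rep G n \<chi> (f, \<sigma>) =
       mat n n (\<lambda>(i, j). if \<sigma> (p j) = p i then inverse (c i) * \<chi> (f (p i)) * c j else 0)"
proof -
  interpret G: group G by fact
  let ?W = "wreath G {..<n}" and ?L = "wreath_embed ` carrier (G \<times>\<times> wreath G {1..<n})"
  let ?\<rho> = "box_rep (character_rep \<chi>) triv_rep \<circ> inv_into (carrier (G \<times>\<times> wreath G {1..<n})) wreath_embed :: _ \<Rightarrow> 'k mat"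
  define ts where "ts = (SOME ts. left_transversal ?W ?L ts)"
  have lt: "left_transversal ?W ?L ts" unfolding ts_def by (rule someI_ex[OF ex_left_transversal_wreath[OF G n]])
  note T = left_transversal_wreath[OF G n lt]
  define p where "p i = snd (ts ! i) 0" for i
  define c where "c i = \<chi> (fst (ts ! i) (p i))" for i
  have ti: "(fst (ts ! i), snd (ts ! i)) \<in> carrier ?W" if "i < n" for i using T(1,3) that nth_mem[of i ts] by auto
  have pi: "p i < n" if "i < n" for i using bij_betw_apply[OF T(2)] that by (auto simp: p_def)
  have fc: "f i \<in> carrier G" if "(f, \<sigma>) \<in> carrier ?W" "i < n" for f \<sigma> i using that by (auto simp: wreath_carrier_iff PiE_def Pi_def)
  have perm: "\<sigma> permutes {..<n}" if "(f, \<sigma>) \<in> carrier ?W" for f \<sigma> using that by (simp add: wreath_carrier_iff)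
  interpret W: group ?W by (rule group_wreath[OF G])
  show ?thesis
  proof
    show "bij_betw p {..<n} {..<n}" using T(2) by (simp add: p_def[abs_def])
    show "c i \<noteq> 0" if "i < n" for i using \<chi> fc[OF ti[OF that] pi[OF that]] by (simp add: c_def characters_iff)
    fix f \<sigma> assume x: "(f, \<sigma>) \<in> carrier ?W"
    have en: "(let y = inv\<^bsub>?W\<^esub> (ts ! i) \<otimes>\<^bsub>?W\<^esub> (f, \<sigma>) \<otimes>\<^bsub>?W\<^esub> (ts ! j) in if y \<in> ?L then ?\<rho> y $$ (0, 0) else 0) =
        (if \<sigma> (p j) = p i then inverse (c i) * \<chi> (f (p i)) * c j else 0)" (is "?l = ?r") if ij: "i < n" "j < n" for i j
    proof -
      obtain h \<tau> where hi: "ts ! i = (h, \<tau>)" by (cases "ts ! i")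
      obtain h' \<tau>' where hj: "ts ! j = (h', \<tau>')" by (cases "ts ! j")
      have wi: "(h, \<tau>) \<in> carrier ?W" and wj: "(h', \<tau>') \<in> carrier ?W" using ti[OF ij(1)] ti[OF ij(2)] hi hj by auto
      define y where "y = inv\<^bsub>?W\<^esub> (h, \<tau>) \<otimes>\<^bsub>?W\<^esub> (f, \<sigma>) \<otimes>\<^bsub>?W\<^esub> (h', \<tau>')"
      have yc: "y \<in> carrier ?W" unfolding y_def using wi wj x by simp
      have y: "y = ((\<lambda>i\<in>{..<n}. (\<lambda>i\<in>{..<n}. (\<lambda>i\<in>{..<n}. inv\<^bsub>G\<^esub> h (\<tau> i)) i \<otimes>\<^bsub>G\<^esub> f (Hilbert_Choice.inv (Hilbert_Choice.inv \<tau>) i)) i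
          \<otimes>\<^bsub>G\<^esub> h' (Hilbert_Choice.inv (Hilbert_Choice.inv \<tau> \<circ> \<sigma>) i)), Hilbert_Choice.inv \<tau> \<circ> \<sigma> \<circ> \<tau>')"
        unfolding y_def by (simp only: wreath_inv[OF G wi] wreath_mult)
      have pm: "\<tau> permutes {..<n}" "\<sigma> permutes {..<n}" using perm wi x by auto
      have pp: "p i = \<tau> 0" "p j = \<tau>' 0" by (simp_all add: p_def hi hj)
      have yL: "y \<in> ?L \<longleftrightarrow> \<sigma> (p j) = p i"
      proof -
        have "y \<in> ?L \<longleftrightarrow> snd y 0 = 0" using yc unfolding embedded_subgroup[OF G n] by (cases y) auto
        also have "\<dots> \<longleftrightarrow> Hilbert_Choice.inv \<tau> (\<sigma> (\<tau>' 0)) = 0" by (simp add: y)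
        also have "\<dots> \<longleftrightarrow> \<sigma> (\<tau>' 0) = \<tau> 0" using permutes_inv_eq[OF pm(1), of "\<sigma> (\<tau>' 0)" 0] by auto
        finally show ?thesis by (simp add: pp)
      qed
      show ?thesis
      proof (cases "\<sigma> (p j) = p i")
        case True
        then have "y \<in> ?L" using yL by simp
        then have "?\<rho> y $$ (0, 0) = \<chi> (fst y 0)" unfolding o_apply box_character_entry by (simp only: wreath_embed_first index_mat prod.case zero_less_one)
        also have "fst y 0 = inv\<^bsub>G\<^esub> h (\<tau> 0) \<otimes>\<^bsub>G\<^esub> f (\<tau> 0) \<otimes>\<^bsub>G\<^esub> h' (Hilbert_Choice.inv (Hilbert_Choice.inv \<tau> \<circ> \<sigma>) 0)"
          using n by (simp add: y permutes_inv_inv[OF pm(1)])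
        also have "Hilbert_Choice.inv (Hilbert_Choice.inv \<tau> \<circ> \<sigma>) 0 = p j"
        proof -
          have "(Hilbert_Choice.inv \<tau> \<circ> \<sigma>) (p j) = 0" using True pp permutes_inverses(2)[OF pm(1)] by simp
          moreover have "(Hilbert_Choice.inv \<tau> \<circ> \<sigma>) permutes {..<n}" using pm by (intro permutes_compose permutes_inv)
          ultimately show ?thesis using permutes_inv_eq by metis
        qed
        also have "\<chi> (inv\<^bsub>G\<^esub> h (\<tau> 0) \<otimes>\<^bsub>G\<^esub> f (\<tau> 0) \<otimes>\<^bsub>G\<^esub> h' (p j)) = inverse (c i) * \<chi> (f (p i)) * c j"
        proof -
          have "h (\<tau> 0) \<in> carrier G" "f (\<tau> 0) \<in> carrier G" "h' (p j) \<in> carrier G"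
            using fc[OF wi pi[OF ij(1)]] fc[OF x pi[OF ij(1)]] fc[OF wj pi[OF ij(2)]] by (simp_all add: pp)
          moreover have "\<chi> (a \<otimes>\<^bsub>G\<^esub> b) = \<chi> a * \<chi> b" if "a \<in> carrier G" "b \<in> carrier G" for a b
            using \<chi> that by (simp add: characters_iff)
          ultimately show ?thesis by (simp add: character_inv[OF G \<chi>] c_def hi hj pp)
        qed
        finally show ?thesis using True yL by (simp add: hi hj y_def[symmetric] Let_def)
      next
        case False
        then show ?thesis using yL by (simp add: hi hj y_def[symmetric] Let_def)
      qed
    qed
    have d1: "dim_row (?\<rho> \<one>\<^bsub>?W\<^esub>) = 1" by (simp add: box_character_entry)
    have "wreath_induced_rep G n \<chi> (f, \<sigma>) = mat n n (\<lambda>(i, j).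
        let y = inv\<^bsub>?W\<^esub> (ts ! i) \<otimes>\<^bsub>?W\<^esub> (f, \<sigma>) \<otimes>\<^bsub>?W\<^esub> (ts ! j) in if y \<in> ?L then ?\<rho> y $$ (0, 0) else 0)"
      unfolding wreath_induced_rep_def induced_rep_def Let_def ts_def[symmetric] d1 T(1)
      by (simp only: mult_1_right div_by_1 mod_by_1)
    also have "\<dots> = mat n n (\<lambda>(i, j). if \<sigma> (p j) = p i then inverse (c i) * \<chi> (f (p i)) * c j else 0)"
      by (rule cong_mat) (simp_all only: en prod.case)
    finally show "wreath_induced_rep G n \<chi> (f, \<sigma>) = mat n n (\<lambda>(i, j). if \<sigma> (p j) = p i then inverse (c i) * \<chi> (f (p i)) * c j else 0)" .
  qed
qed

lemma is_rep_wreath_induced: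
  fixes \<chi> :: "'g \<Rightarrow> 'k::field"
  assumes G: "group G" and n: "n \<ge> 1" and \<chi>: "\<chi> \<in> characters G"
  shows "is_rep (wreath G {..<n}) n (wreath_induced_rep G n \<chi>)"
proof -
  interpret G: group G by fact
  let ?W = "wreath G {..<n}"
  interpret W: group ?W by (rule group_wreath[OF G])
  obtain p c where p: "bij_betw p {..<n} {..<n}" and c: "\<And>i. i < n \<Longrightarrow> c i \<noteq> 0"
    and M: "\<And>f \<sigma>. (f, \<sigma>) \<in> carrier ?W \<Longrightarrow> wreath_induced_rep G n \<chi> (f, \<sigma>) =
       mat n n (\<lambda>(i, j). if \<sigma> (p j) = p i then inverse (c i) * \<chi> (f (p i)) * c j else 0)"
    using wreath_induced_rep_monomial[OF assms] by blast
  have pi: "p i < n" if "i < n" for i using bij_betw_apply[OF p] that by auto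
  have inj: "p i = p j \<longleftrightarrow> i = j" if "i < n" "j < n" for i j using p that by (auto simp: bij_betw_def inj_on_def)
  show ?thesis
  proof (rule is_repI[OF group_wreath[OF G]])
    show "wreath_induced_rep G n \<chi> x \<in> carrier_mat n n" if "x \<in> carrier ?W" for x
      using M[of "fst x" "snd x"] that by simp
    show "wreath_induced_rep G n \<chi> \<one>\<^bsub>?W\<^esub> = 1\<^sub>m n"
    proof (rule eq_matI)
      fix i j assume "i < dim_row (1\<^sub>m n :: 'k mat)" "j < dim_col (1\<^sub>m n :: 'k mat)"
      then have ij: "i < n" "j < n" by auto
      show "wreath_induced_rep G n \<chi> \<one>\<^bsub>?W\<^esub> $$ (i, j) = 1\<^sub>m n $$ (i, j)"
        using M[OF W.one_closed[unfolded wreath_one]] ij c pi inj character_one[OF G \<chi>] by (auto simp: wreath_one)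
    qed (simp_all add: M[OF W.one_closed[unfolded wreath_one]] wreath_one)
    fix x y assume xy: "x \<in> carrier ?W" "y \<in> carrier ?W"
    obtain f \<sigma> g \<tau> where [simp]: "x = (f, \<sigma>)" "y = (g, \<tau>)" by (cases x; cases y) auto
    have pm: "\<sigma> permutes {..<n}" "\<tau> permutes {..<n}" using xy by (auto simp: wreath_carrier_iff)
    have cl: "((\<lambda>i\<in>{..<n}. f i \<otimes>\<^bsub>G\<^esub> g (Hilbert_Choice.inv \<sigma> i)), \<sigma> \<circ> \<tau>) \<in> carrier ?W"
      using W.m_closed[OF xy] by (simp add: wreath_mult)
    let ?A = "wreath_induced_rep G n \<chi> x" and ?B = "wreath_induced_rep G n \<chi> y"
    have AB: "?A \<in> carrier_mat n n" "?B \<in> carrier_mat n n" using xy by (simp_all add: M)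
    show "wreath_induced_rep G n \<chi> (x \<otimes>\<^bsub>?W\<^esub> y) = ?A * ?B"
    proof (rule eq_matI)
      fix i j assume "i < dim_row (?A * ?B)" "j < dim_col (?A * ?B)"
      then have ij: "i < n" "j < n" using AB by auto
      have tj: "\<tau> (p j) < n" using permutes_in_image[OF pm(2), of "p j"] pi[OF ij(2)] by simp
      then obtain m where m: "m < n" "\<tau> (p j) = p m" using bij_betw_imp_surj_on[OF p] by (metis imageE lessThan_iff)
      have "(?A * ?B) $$ (i, j) = (\<Sum>k<n. ?A $$ (i, k) * ?B $$ (k, j))" by (rule mat_mult_index[OF AB ij])
      also have "\<dots> = (\<Sum>k<n. if k = m then ?A $$ (i, m) * (inverse (c m) * \<chi> (g (p m)) * c j) else 0)"
      proof (rule sum.cong[OF refl])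
        fix k assume "k \<in> {..<n}"
        then have k: "k < n" by simp
        have "?B $$ (k, j) = (if k = m then inverse (c m) * \<chi> (g (p m)) * c j else 0)"
          using M xy k ij m inj[OF m(1) k] by auto
        then show "?A $$ (i, k) * ?B $$ (k, j) = (if k = m then ?A $$ (i, m) * (inverse (c m) * \<chi> (g (p m)) * c j) else 0)" by simp
      qed
      also have "\<dots> = ?A $$ (i, m) * (inverse (c m) * \<chi> (g (p m)) * c j)" using m by simp
      also have "?A $$ (i, m) = (if \<sigma> (p m) = p i then inverse (c i) * \<chi> (f (p i)) * c m else 0)" using M xy m ij by simp
      also have "\<dots> * (inverse (c m) * \<chi> (g (p m)) * c j) =
         (if (\<sigma> \<circ> \<tau>) (p j) = p i then inverse (c i) * \<chi> (f (p i) \<otimes>\<^bsub>G\<^esub> g (Hilbert_Choice.inv \<sigma> (p i))) * c j else 0)"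
      proof (cases "\<sigma> (p m) = p i")
        case True
        have "Hilbert_Choice.inv \<sigma> (p i) = p m" using permutes_inverses(2)[OF pm(1), of "p m"] True by simp
        moreover have "f (p i) \<in> carrier G" "g (p m) \<in> carrier G"
          using xy pi[OF ij(1)] pi[OF m(1)] by (auto simp: wreath_carrier_iff PiE_def Pi_def)
        ultimately show ?thesis using True m c[OF m(1)] \<chi> by (simp add: characters_iff field_simps)
      qed (simp add: m)
      finally show "wreath_induced_rep G n \<chi> (x \<otimes>\<^bsub>?W\<^esub> y) $$ (i, j) = (?A * ?B) $$ (i, j)"
        using ij pi[OF ij(1)] by (simp add: wreath_mult M[OF cl])
    qed (use AB in \<open>simp_all add: wreath_mult M[OF cl]\<close>)
  qed
qed

lemma trace_exterior_power_wreath_induced: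
  fixes \<chi> :: "'g \<Rightarrow> 'k::field"
  assumes G: "group G" and n: "n \<ge> 1" and \<chi>: "\<chi> \<in> characters G" and x: "x \<in> carrier (wreath G {..<n})"
  shows "mat_trace (exterior_power_mat k (wreath_induced_rep G n \<chi> x)) = subset_char n \<chi> True k x"
proof -
  obtain p c where p: "bij_betw p {..<n} {..<n}" and c: "\<And>i. i < n \<Longrightarrow> c i \<noteq> 0"
    and M: "\<And>f \<sigma>. (f, \<sigma>) \<in> carrier (wreath G {..<n}) \<Longrightarrow> wreath_induced_rep G n \<chi> (f, \<sigma>) =
       mat n n (\<lambda>(i, j). if \<sigma> (p j) = p i then inverse (c i) * \<chi> (f (p i)) * c j else 0)"
    using wreath_induced_rep_monomial[OF assms(1-3)] by blast
  obtain f \<sigma> where [simp]: "x = (f, \<sigma>)" by (cases x)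
  have "\<sigma> permutes {..<n}" using x by (simp add: wreath_carrier_iff)
  then show ?thesis using trace_exterior_power_monomial[OF _ p c, of \<sigma>] M x by simp
qed

section \<open>Characters of a finite abelian group\<close>

text \<open>
  If \<open>m\<close> is the least positive exponent with \<open>a\<^sup>m \<in> H\<close> then
  any \<open>m\<close>-th root \<open>z\<close> of \<open>\<chi> (a\<^sup>m)\<close> is a
  consistent value at \<open>a\<close>. The freedom in \<open>z\<close> is what separates points
  below.
\<close>

lemma character_extends_to_adjoined_element:
  fixes \<chi> :: "'g \<Rightarrow> 'k::field"
  assumes "comm_group G" and H: "subgroup H G" and \<chi>: "\<chi> \<in> characters (G\<lparr>carrier := H\<rparr>)"
    and a: "a \<in> carrier G" and fin: "finite (carrier G)"
    and m: "0 < m" "a [^]\<^bsub>G\<^esub> m \<in> H" "\<And>i. 0 < i \<Longrightarrow> i < m \<Longrightarrow> a [^]\<^bsub>G\<^esub> i \<notin> H" and z: "z ^ m = \<chi> (a [^]\<^bsub>G\<^esub> m)"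
  shows "\<exists>H' \<chi>'. subgroup H' G \<and> H \<subseteq> H' \<and> a \<in> H' \<and> \<chi>' \<in> characters (G\<lparr>carrier := H'\<rparr>) \<and> (\<forall>h\<in>H. \<chi>' h = \<chi> h) \<and> \<chi>' a = z"
proof -
  interpret comm_group G by fact
  have nz: "\<chi> h \<noteq> 0" if "h \<in> H" for h using \<chi> that by (simp add: characters_iff)
  have mult: "\<chi> (h \<otimes>\<^bsub>G\<^esub> h') = \<chi> h * \<chi> h'" if "h \<in> H" "h' \<in> H" for h h' using \<chi> that by (simp add: characters_iff)
  note [simp] = subgroup.mem_carrier[OF H] and Hc = subgroup.m_closed[OF H] subgroup.m_inv_closed[OF H] subgroup.one_closed[OF H]
  have \<chi>1: "\<chi> \<one>\<^bsub>G\<^esub> = 1" using mult[OF Hc(3,3)] nz[OF Hc(3)] by simp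
  have z0: "z \<noteq> 0"
  proof
    assume "z = 0"
    then show False using z nz[OF m(2)] m(1) by (simp add: zero_power)
  qed
  have powH: "a [^]\<^bsub>G\<^esub> (m * q) \<in> H \<and> \<chi> (a [^]\<^bsub>G\<^esub> (m * q)) = z ^ (m * q)" for q :: nat
  proof (induction q)
    case (Suc q)
    have "a [^]\<^bsub>G\<^esub> (m * Suc q) = a [^]\<^bsub>G\<^esub> m \<otimes>\<^bsub>G\<^esub> a [^]\<^bsub>G\<^esub> (m * q)" using a by (simp add: nat_pow_mult)
    then show ?case using Suc Hc(1)[OF m(2)] mult[OF m(2)] z by (simp add: power_add)
  qed (use Hc(3) \<chi>1 in simp)
  have pow: "\<chi> (a [^]\<^bsub>G\<^esub> d) = z ^ d" if d: "a [^]\<^bsub>G\<^esub> d \<in> H" for d :: nat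
  proof -
    have split: "a [^]\<^bsub>G\<^esub> d = a [^]\<^bsub>G\<^esub> (m * (d div m)) \<otimes>\<^bsub>G\<^esub> a [^]\<^bsub>G\<^esub> (d mod m)" using a by (simp add: nat_pow_mult)
    then have "a [^]\<^bsub>G\<^esub> (d mod m) = inv\<^bsub>G\<^esub> (a [^]\<^bsub>G\<^esub> (m * (d div m))) \<otimes>\<^bsub>G\<^esub> a [^]\<^bsub>G\<^esub> d"
      using a by (metis inv_solve_left' nat_pow_closed)
    then have "a [^]\<^bsub>G\<^esub> (d mod m) \<in> H" using Hc(1)[OF Hc(2) d] powH by simp
    then have "d mod m = 0" using m(3)[of "d mod m"] m(1) by (meson gr0I mod_less_divisor)
    then show ?thesis using powH[of "d div m"] by (simp add: mod_eq_0_iff_dvd)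
  qed
  have wd': "\<chi> h * z ^ i = \<chi> h' * z ^ j"
    if h: "h \<in> H" "h' \<in> H" and e: "h \<otimes>\<^bsub>G\<^esub> a [^]\<^bsub>G\<^esub> i = h' \<otimes>\<^bsub>G\<^esub> a [^]\<^bsub>G\<^esub> j" and le: "i \<le> j" for h h' and i j :: nat
  proof -
    have "a [^]\<^bsub>G\<^esub> j = a [^]\<^bsub>G\<^esub> (j - i) \<otimes>\<^bsub>G\<^esub> a [^]\<^bsub>G\<^esub> i" using a le by (simp add: nat_pow_mult)
    then have "h \<otimes>\<^bsub>G\<^esub> a [^]\<^bsub>G\<^esub> i = (h' \<otimes>\<^bsub>G\<^esub> a [^]\<^bsub>G\<^esub> (j - i)) \<otimes>\<^bsub>G\<^esub> a [^]\<^bsub>G\<^esub> i" using e h a by (simp add: m_assoc)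
    then have h2: "h = h' \<otimes>\<^bsub>G\<^esub> a [^]\<^bsub>G\<^esub> (j - i)" using h a by simp
    then have "a [^]\<^bsub>G\<^esub> (j - i) = inv\<^bsub>G\<^esub> h' \<otimes>\<^bsub>G\<^esub> h" using h a by (simp add: m_assoc[symmetric])
    then have dH: "a [^]\<^bsub>G\<^esub> (j - i) \<in> H" using Hc(1)[OF Hc(2)[OF h(2)] h(1)] by simp
    have "\<chi> h = \<chi> h' * z ^ (j - i)" using mult[OF h(2) dH] pow[OF dH] h2 by simp
    then show ?thesis using le by (simp add: power_add[symmetric])
  qed
  have wd: "\<chi> h * z ^ i = \<chi> h' * z ^ j"
    if "h \<in> H" "h' \<in> H" "h \<otimes>\<^bsub>G\<^esub> a [^]\<^bsub>G\<^esub> i = h' \<otimes>\<^bsub>G\<^esub> a [^]\<^bsub>G\<^esub> j" for h h' and i j :: nat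
    using wd'[OF that] wd'[OF that(2,1) that(3)[symmetric]] by (cases "i \<le> j") simp_all
  define H' where "H' = {h \<otimes>\<^bsub>G\<^esub> a [^]\<^bsub>G\<^esub> i | h i. h \<in> H \<and> i \<in> (UNIV :: nat set)}"
  define \<chi>' where "\<chi>' x = (SOME v. \<exists>h i. h \<in> H \<and> x = h \<otimes>\<^bsub>G\<^esub> a [^]\<^bsub>G\<^esub> (i :: nat) \<and> v = \<chi> h * z ^ i)" for x
  have val: "\<chi>' (h \<otimes>\<^bsub>G\<^esub> a [^]\<^bsub>G\<^esub> i) = \<chi> h * z ^ i" if "h \<in> H" for h and i :: nat
    unfolding \<chi>'_def
  proof (rule some_equality)
    show "\<exists>ha ia. ha \<in> H \<and> h \<otimes>\<^bsub>G\<^esub> a [^]\<^bsub>G\<^esub> i = ha \<otimes>\<^bsub>G\<^esub> a [^]\<^bsub>G\<^esub> (ia :: nat) \<and> \<chi> h * z ^ i = \<chi> ha * z ^ ia"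
      using that by blast
    fix v assume "\<exists>ha ia. ha \<in> H \<and> h \<otimes>\<^bsub>G\<^esub> a [^]\<^bsub>G\<^esub> i = ha \<otimes>\<^bsub>G\<^esub> a [^]\<^bsub>G\<^esub> (ia :: nat) \<and> v = \<chi> ha * z ^ ia"
    then obtain ha and ia :: nat where h': "ha \<in> H" "h \<otimes>\<^bsub>G\<^esub> a [^]\<^bsub>G\<^esub> i = ha \<otimes>\<^bsub>G\<^esub> a [^]\<^bsub>G\<^esub> ia" "v = \<chi> ha * z ^ ia" by blast
    show "v = \<chi> h * z ^ i" using wd[OF that h'(1,2)] h'(3) by simp
  qed
  have prod: "(h \<otimes>\<^bsub>G\<^esub> a [^]\<^bsub>G\<^esub> i) \<otimes>\<^bsub>G\<^esub> (h' \<otimes>\<^bsub>G\<^esub> a [^]\<^bsub>G\<^esub> j) = (h \<otimes>\<^bsub>G\<^esub> h') \<otimes>\<^bsub>G\<^esub> a [^]\<^bsub>G\<^esub> (i + j)"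
    if "h \<in> H" "h' \<in> H" for h h' and i j :: nat
  proof -
    have "h \<in> carrier G" "h' \<in> carrier G" "a [^]\<^bsub>G\<^esub> i \<in> carrier G" "a [^]\<^bsub>G\<^esub> j \<in> carrier G" using that a by auto
    then show ?thesis unfolding nat_pow_mult[OF a, symmetric] by (simp add: m_ac)
  qed
  have H'I: "h \<otimes>\<^bsub>G\<^esub> a [^]\<^bsub>G\<^esub> i \<in> H'" if "h \<in> H" for h and i :: nat using that by (auto simp: H'_def)
  show ?thesis
  proof (intro exI conjI ballI)
    show "H \<subseteq> H'" using H'I[of _ 0] by (auto simp: subset_eq)
    show "a \<in> H'" using H'I[OF Hc(3), of 1] a by simp
    show "\<chi>' h = \<chi> h" if "h \<in> H" for h using val[OF that, of 0] that by simp
    show "\<chi>' a = z" using val[OF Hc(3), of 1] a \<chi>1 by simp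
    have "\<chi>' h \<noteq> 0" if "h \<in> H'" for h using that val nz z0 by (auto simp: H'_def)
    moreover have "\<chi>' (x \<otimes>\<^bsub>G\<^esub> y) = \<chi>' x * \<chi>' y" if xy: "x \<in> H'" "y \<in> H'" for x y
    proof -
      obtain h i h' j where x: "x = h \<otimes>\<^bsub>G\<^esub> a [^]\<^bsub>G\<^esub> (i :: nat)" "h \<in> H" and y: "y = h' \<otimes>\<^bsub>G\<^esub> a [^]\<^bsub>G\<^esub> (j :: nat)" "h' \<in> H"
        using xy unfolding H'_def by blast
      show ?thesis unfolding x(1) y(1) prod[OF x(2) y(2)] using x(2) y(2) by (simp add: val Hc(1) mult power_add)
    qed
    ultimately show "\<chi>' \<in> characters (G\<lparr>carrier := H'\<rparr>)" by (simp add: characters_iff)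
    show "subgroup H' G"
    proof (rule subgroupI)
      show "H' \<subseteq> carrier G" using a by (auto simp: H'_def)
      show "H' \<noteq> {}" using H'I[OF Hc(3)] by blast
      fix x assume "x \<in> H'"
      then obtain h i where x: "x = h \<otimes>\<^bsub>G\<^esub> a [^]\<^bsub>G\<^esub> (i :: nat)" "h \<in> H" by (auto simp: H'_def)
      let ?y = "inv\<^bsub>G\<^esub> h \<otimes>\<^bsub>G\<^esub> a [^]\<^bsub>G\<^esub> (i * (Coset.order G - 1))"
      have "0 < Coset.order G" using fin by (simp add: order_gt_0_iff_finite)
      then have e: "i + i * (Coset.order G - 1) = Coset.order G * i" by (cases "Coset.order G") simp_all
      have "a [^]\<^bsub>G\<^esub> (Coset.order G * i) = \<one>\<^bsub>G\<^esub>" using pow_order_eq_1[OF a] a by (simp add: nat_pow_pow[symmetric])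
      then have "x \<otimes>\<^bsub>G\<^esub> ?y = \<one>\<^bsub>G\<^esub>" unfolding x(1) prod[OF x(2) Hc(2)[OF x(2)]] e using x(2) by simp
      then have "inv\<^bsub>G\<^esub> x = ?y" using x a by (intro inv_equality) (simp_all add: m_comm)
      then show "inv\<^bsub>G\<^esub> x \<in> H'" using H'I[OF Hc(2)[OF x(2)]] by simp
      fix y assume "y \<in> H'"
      then obtain h' j where y: "y = h' \<otimes>\<^bsub>G\<^esub> a [^]\<^bsub>G\<^esub> (j :: nat)" "h' \<in> H" by (auto simp: H'_def)
      show "x \<otimes>\<^bsub>G\<^esub> y \<in> H'" unfolding x(1) y(1) prod[OF x(2) y(2)] by (rule H'I[OF Hc(1)[OF x(2) y(2)]])
    qed
  qed
qed

lemma least_power_into_subgroup: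
  assumes "group G" "finite (carrier G)" and H: "subgroup H G" and a: "a \<in> carrier G"
  obtains m :: nat where "0 < m" "a [^]\<^bsub>G\<^esub> m \<in> H" "\<And>i. 0 < i \<Longrightarrow> i < m \<Longrightarrow> a [^]\<^bsub>G\<^esub> i \<notin> H"
proof -
  interpret group G by fact
  let ?P = "\<lambda>m :: nat. 0 < m \<and> a [^]\<^bsub>G\<^esub> m \<in> H"
  have "?P (Coset.order G)" using pow_order_eq_1[OF a] subgroup.one_closed[OF H] assms(2) by (simp add: order_gt_0_iff_finite)
  then have "?P (Least ?P)" by (rule LeastI)
  moreover have "\<not> ?P i" if "i < Least ?P" for i using not_less_Least[OF that] .
  ultimately show ?thesis using that by blast
qed

text \<open>
  Adjoin elements one at a time; algebraic closedness supplies the roots.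
\<close>

lemma character_extends:
  fixes \<chi> :: "'g \<Rightarrow> 'k::alg_closed_field"
  assumes G: "comm_group G" and fin: "finite (carrier G)"
    and "subgroup H G" "\<chi> \<in> characters (G\<lparr>carrier := H\<rparr>)"
  shows "\<exists>\<chi>'\<in>characters G. \<forall>h\<in>H. \<chi>' h = \<chi> h"
  using assms(3,4)
proof (induction "card (carrier G - H)" arbitrary: H \<chi> rule: less_induct)
  case less
  interpret comm_group G by fact
  note H = less.prems(1) and \<chi> = less.prems(2)
  have sub: "H \<subseteq> carrier G" using H by (rule subgroup.subset)
  show ?case
  proof (cases "H = carrier G")
    case True
    then show ?thesis using \<chi> by (intro bexI[of _ \<chi>]) (simp_all add: characters_iff)
  next
    case False
    then obtain a where a: "a \<in> carrier G" "a \<notin> H" using sub by blast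
    obtain m :: nat where m: "0 < m" "a [^]\<^bsub>G\<^esub> m \<in> H" "\<And>i. 0 < i \<Longrightarrow> i < m \<Longrightarrow> a [^]\<^bsub>G\<^esub> i \<notin> H"
      using least_power_into_subgroup[OF is_group fin H a(1)] by blast
    obtain z where z: "z ^ m = \<chi> (a [^]\<^bsub>G\<^esub> m)" using nth_root_exists[OF m(1)] by blast
    obtain H' \<chi>' where H': "subgroup H' G" "H \<subseteq> H'" "a \<in> H'" "\<chi>' \<in> characters (G\<lparr>carrier := H'\<rparr>)" and ext: "\<forall>h\<in>H. \<chi>' h = \<chi> h"
      using character_extends_to_adjoined_element[OF G H \<chi> a(1) fin m z] by blast
    have "card (carrier G - H') < card (carrier G - H)"
      using fin H'(2,3) a by (intro psubset_card_mono) auto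
    from less.hyps[OF this H'(1,4)] obtain \<chi>'' where "\<chi>'' \<in> characters G" "\<forall>h\<in>H'. \<chi>'' h = \<chi>' h" by blast
    then show ?thesis using H'(2) ext by (intro bexI[of _ \<chi>'']) auto
  qed
qed

text \<open>
  A root of \<open>1 + z + \<dots> + z\<^bsup>m-1\<^esup>\<close>; it differs from
  \<open>1\<close> because \<open>m \<noteq> 0\<close> in the field.
\<close>

lemma ex_nontrivial_root_of_unity:
  assumes "m \<ge> 2"
  shows "\<exists>z :: 'k::{alg_closed_field, field_char_0}. z ^ m = 1 \<and> z \<noteq> 1"
proof -
  obtain z :: 'k where z: "(\<Sum>k\<le>m - 1. 1 * z ^ k) = 0" using alg_closed[of "m - 1" "\<lambda>_. 1 :: 'k"] assms by auto
  have s: "(\<Sum>k<m. z ^ k) = 0" using z assms by (cases m) (simp_all add: lessThan_Suc_atMost)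
  have "z \<noteq> 1"
  proof
    assume "z = 1"
    then show False using s assms by simp
  qed
  moreover have "z ^ m - 1 = (z - 1) * (\<Sum>k<m. z ^ k)" by (rule power_diff_1_eq)
  ultimately show ?thesis using s by (intro exI[of _ z]) simp
qed

text \<open>
  Start with the trivial character of the trivial subgroup and adjoin \<open>g\<close> with a
  value other than \<open>1\<close>.
\<close>

lemma characters_separate:
  fixes G :: "('g, 'm) monoid_scheme"
  assumes G: "comm_group G" and fin: "finite (carrier G)" and g: "g \<in> carrier G" "g \<noteq> \<one>\<^bsub>G\<^esub>"
  shows "\<exists>\<chi>\<in>characters G. \<chi> g \<noteq> (1 :: 'k::{alg_closed_field, field_char_0})"
proof -
  interpret comm_group G by fact
  have H: "subgroup {\<one>\<^bsub>G\<^esub>} G" by (rule triv_subgroup)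
  obtain m :: nat where m: "0 < m" "g [^]\<^bsub>G\<^esub> m \<in> {\<one>\<^bsub>G\<^esub>}" "\<And>i. 0 < i \<Longrightarrow> i < m \<Longrightarrow> g [^]\<^bsub>G\<^esub> i \<notin> {\<one>\<^bsub>G\<^esub>}"
    using least_power_into_subgroup[OF is_group fin H g(1)] by blast
  have "m \<noteq> 1" using m(2) g by auto
  then have "m \<ge> 2" using m(1) by simp
  then obtain z :: 'k where z: "z ^ m = 1" "z \<noteq> 1" using ex_nontrivial_root_of_unity by blast
  have one: "(\<lambda>_. 1 :: 'k) \<in> characters (G\<lparr>carrier := {\<one>\<^bsub>G\<^esub>}\<rparr>)" by (simp add: characters_iff)
  obtain H' \<chi> where \<chi>: "subgroup H' G" "g \<in> H'" "\<chi> \<in> characters (G\<lparr>carrier := H'\<rparr>)" "\<chi> g = z"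
    using character_extends_to_adjoined_element[OF G H one g(1) fin m z(1)] by blast
  obtain \<chi>' :: "'g \<Rightarrow> 'k" where \<chi>': "\<chi>' \<in> characters G" "\<forall>h\<in>H'. \<chi>' h = \<chi> h" using character_extends[OF G fin \<chi>(1,3)] by blast
  have "\<chi>' g \<noteq> 1" using \<chi>'(2) \<chi>(2,4) z(2) by simp
  then show ?thesis using \<chi>'(1) by blast
qed

lemma character_pow:
  assumes "group G" "\<chi> \<in> characters G" "a \<in> carrier G"
  shows "\<chi> (a [^]\<^bsub>G\<^esub> (i :: nat)) = (\<chi> a ^ i :: 'k::field)"
proof -
  interpret group G by fact
  show ?thesis using assms by (induction i) (simp_all add: character_one characters_iff mult.commute)
qed

text \<open>
  Characters are normalised outside of the carrier so that there are finitely many of them and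
  equality is equality on the group.
\<close>

definition dual :: "('g, 'm) monoid_scheme \<Rightarrow> ('g \<Rightarrow> 'k::field) set" where
  "dual G = characters G \<inter> extensional (carrier G)"

lemma dual_mult:
  assumes "group G" "\<chi> \<in> dual G" "\<psi> \<in> dual G"
  shows "(\<lambda>a\<in>carrier G. \<chi> a * \<psi> a) \<in> dual G"
proof -
  interpret group G by fact
  show ?thesis using assms by (auto simp: dual_def characters_iff)
qed

lemma finite_dual:
  assumes "group G" "finite (carrier G)"
  shows "finite (dual G :: ('g \<Rightarrow> 'k::field) set)"
proof -
  interpret group G by fact
  have o: "0 < Coset.order G" using assms(2) by (simp add: order_gt_0_iff_finite)
  let ?p = "monom 1 (Coset.order G) - 1 :: 'k poly"
  have "poly ?p 0 \<noteq> 0" using o by (simp add: poly_monom zero_power)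
  then have "?p \<noteq> 0" by auto
  then have "finite {z. poly ?p z = 0}" by (rule poly_roots_finite)
  then have "finite (carrier G \<rightarrow>\<^sub>E {z. poly ?p z = 0})" using assms(2) by (intro finite_PiE) auto
  moreover have "\<chi> \<in> carrier G \<rightarrow>\<^sub>E {z. poly ?p z = 0}" if "\<chi> \<in> dual G" for \<chi>
  proof -
    have "\<chi> a ^ Coset.order G = 1" if "a \<in> carrier G" for a
      using character_pow[OF assms(1) _ that, of \<chi> "Coset.order G"] \<open>\<chi> \<in> dual G\<close> character_one[OF assms(1), of \<chi>] pow_order_eq_1[OF that]
      by (simp add: dual_def)
    then show ?thesis using that by (auto simp: dual_def PiE_iff poly_monom)
  qed
  ultimately show ?thesis by (meson finite_subset subsetI)
qed

lemma dual_nonempty: "group G \<Longrightarrow> (\<lambda>a\<in>carrier G. 1) \<in> dual G"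
  by (auto simp: dual_def characters_iff group.is_monoid monoid.m_closed)

text \<open>
  Multiplication by a character that does not take the value \<open>1\<close> at \<open>g\<close>
  permutes the dual.
\<close>

lemma sum_over_dual:
  assumes G: "comm_group G" and fin: "finite (carrier G)" and g: "g \<in> carrier G"
  shows "(\<Sum>\<chi>\<in>dual G. \<chi> g) = (if g = \<one>\<^bsub>G\<^esub> then of_nat (card (dual G :: ('g \<Rightarrow> 'k) set)) else (0 :: 'k::{alg_closed_field, field_char_0}))"
proof -
  interpret comm_group G by fact
  show ?thesis
  proof (cases "g = \<one>\<^bsub>G\<^esub>")
    case True
    have "(\<Sum>\<chi>\<in>dual G. \<chi> g) = (\<Sum>\<chi>\<in>(dual G :: ('g \<Rightarrow> 'k) set). 1 :: 'k)"
      by (intro sum.cong refl) (simp add: True dual_def character_one[OF is_group])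
    then show ?thesis using True by simp
  next
    case False
    obtain \<psi>0 :: "'g \<Rightarrow> 'k" where \<psi>0: "\<psi>0 \<in> characters G" "\<psi>0 g \<noteq> 1" using characters_separate[OF G fin g False] by blast
    define \<psi> where "\<psi> = restrict \<psi>0 (carrier G)"
    have \<psi>: "\<psi> \<in> dual G" "\<psi> g \<noteq> 1" using \<psi>0 g by (auto simp: \<psi>_def dual_def characters_iff)
    let ?t = "\<lambda>\<chi>. \<lambda>a\<in>carrier G. \<psi> a * \<chi> a"
    have inj: "inj_on ?t (dual G)"
    proof (rule inj_onI)
      fix \<chi> \<chi>' assume c: "\<chi> \<in> dual G" "\<chi>' \<in> dual G" and e: "?t \<chi> = ?t \<chi>'"
      show "\<chi> = \<chi>'"
      proof (rule extensionalityI[of _ "carrier G"])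
        fix a assume a: "a \<in> carrier G"
        have "\<psi> a * \<chi> a = \<psi> a * \<chi>' a" using fun_cong[OF e, of a] a by simp
        then show "\<chi> a = \<chi>' a" using \<psi>(1) a by (auto simp: dual_def characters_iff)
      qed (use c in \<open>auto simp: dual_def\<close>)
    qed
    have "?t ` dual G = dual G"
      by (rule endo_inj_surj[OF finite_dual[OF is_group fin] _ inj]) (use dual_mult[OF is_group \<psi>(1)] in blast)
    then have "(\<Sum>\<chi>\<in>dual G. \<chi> g) = (\<Sum>\<chi>\<in>?t ` dual G. \<chi> g)" by simp
    also have "\<dots> = \<psi> g * (\<Sum>\<chi>\<in>dual G. \<chi> g)" unfolding sum.reindex[OF inj] using g by (simp add: sum_distrib_left)
    finally show ?thesis using \<psi>(2) False by simp
  qed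
qed

lemma sum_dual_quotient:
  fixes \<chi> \<psi> :: "'g \<Rightarrow> 'k::field"
  assumes G: "comm_group G" and fin: "finite (carrier G)" and \<chi>: "\<chi> \<in> dual G" and \<psi>: "\<psi> \<in> dual G"
  shows "(\<Sum>a\<in>carrier G. inverse (\<psi> a) * \<chi> a) = (if \<chi> = \<psi> then of_nat (card (carrier G)) else 0)"
proof (cases "\<chi> = \<psi>")
  case True
  have "(\<Sum>a\<in>carrier G. inverse (\<psi> a) * \<chi> a) = (\<Sum>a\<in>carrier G. 1)"
    using \<psi> True by (intro sum.cong) (auto simp: dual_def characters_iff)
  then show ?thesis using True by simp
next
  case False
  interpret comm_group G by fact
  let ?q = "\<lambda>a. inverse (\<psi> a) * \<chi> a"
  have "\<exists>b\<in>carrier G. \<chi> b \<noteq> \<psi> b"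
  proof (rule ccontr)
    assume "\<not> ?thesis"
    then have "\<chi> = \<psi>" using \<chi> \<psi> by (intro extensionalityI[of _ "carrier G"]) (auto simp: dual_def)
    then show False using False by simp
  qed
  then obtain b where b: "b \<in> carrier G" "\<chi> b \<noteq> \<psi> b" by blast
  have nz: "\<psi> b \<noteq> 0" using \<psi> b by (auto simp: dual_def characters_iff)
  have "(\<Sum>a\<in>carrier G. ?q a) = (\<Sum>a\<in>carrier G. ?q (b \<otimes>\<^bsub>G\<^esub> a))" using sum_translate[OF b(1), of ?q] by simp
  also have "\<dots> = (\<Sum>a\<in>carrier G. ?q b * ?q a)"
    using \<chi> \<psi> b by (intro sum.cong) (auto simp: dual_def characters_iff)
  also have "\<dots> = ?q b * (\<Sum>a\<in>carrier G. ?q a)" by (rule sum_distrib_left[symmetric])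
  finally have "(?q b - 1) * (\<Sum>a\<in>carrier G. ?q a) = 0" by (simp add: left_diff_distrib)
  moreover have "?q b \<noteq> 1" using b(2) nz by (simp add: field_simps)
  ultimately show ?thesis using False by simp
qed

section \<open>Rows and columns\<close>

text \<open>
  A labelling \<open>r\<close> of the letters is regarded as a tableau whose rows are its fibres;
  the letters of a row are placed in increasing order, and this is the position of
  \<open>x\<close> in its row.
\<close>

definition row_index :: "(nat \<Rightarrow> 'r) \<Rightarrow> nat \<Rightarrow> nat" where
  "row_index r x = card {y. y < x \<and> r y = r x}"

lemma row_index_less: "y < x \<Longrightarrow> r y = r x \<Longrightarrow> row_index r y < row_index r x"
  unfolding row_index_def by (rule psubset_card_mono) auto

lemma row_index_inj: "r x = r y \<Longrightarrow> row_index r x = row_index r y \<Longrightarrow> x = y"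
  using row_index_less[of x y r] row_index_less[of y x r] by (metis less_irrefl linorder_neqE_nat)

lemma row_index_bij: "bij_betw (row_index r) {x. x < n \<and> r x = \<rho>} {..<card {x. x < n \<and> r x = \<rho>}}"
  unfolding bij_betw_def
proof
  show inj: "inj_on (row_index r) {x. x < n \<and> r x = \<rho>}" by (rule inj_onI, rule row_index_inj[of r]) auto
  show "row_index r ` {x. x < n \<and> r x = \<rho>} = {..<card {x. x < n \<and> r x = \<rho>}}"
  proof (rule card_subset_eq)
    show "row_index r ` {x. x < n \<and> r x = \<rho>} \<subseteq> {..<card {x. x < n \<and> r x = \<rho>}}"
      by (auto simp: row_index_def intro!: psubset_card_mono)
  qed (simp_all add: card_image[OF inj])
qed

lemma card_row_index_less: "card {x. x < n \<and> r x = \<rho> \<and> row_index r x < k} = min (card {x. x < n \<and> r x = \<rho>}) k"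
proof -
  let ?R = "{x. x < n \<and> r x = \<rho>}"
  have "card {x. x < n \<and> r x = \<rho> \<and> row_index r x < k} = card {i \<in> {..<card ?R}. i < k}"
  proof (rule bij_betw_same_card)
    show "bij_betw (row_index r) {x. x < n \<and> r x = \<rho> \<and> row_index r x < k} {i \<in> {..<card ?R}. i < k}"
      unfolding bij_betw_def
    proof (intro conjI equalityI subsetI)
      show "inj_on (row_index r) {x. x < n \<and> r x = \<rho> \<and> row_index r x < k}" by (rule inj_onI, rule row_index_inj[of r]) auto
      show "i \<in> {i \<in> {..<card ?R}. i < k}" if im: "i \<in> row_index r ` {x. x < n \<and> r x = \<rho> \<and> row_index r x < k}" for i
      proof -
        obtain x where x: "x < n" "r x = \<rho>" "row_index r x < k" "i = row_index r x" using im by blast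
        then have "row_index r x \<in> {..<card ?R}" by (intro bij_betw_apply[OF row_index_bij]) simp
        then show ?thesis using x by simp
      qed
      fix i assume i: "i \<in> {i \<in> {..<card ?R}. i < k}"
      then have "i \<in> row_index r ` ?R" using row_index_bij[of r n \<rho>] by (simp add: bij_betw_def)
      then obtain x where "x < n" "r x = \<rho>" "i = row_index r x" by blast
      then show "i \<in> row_index r ` {x. x < n \<and> r x = \<rho> \<and> row_index r x < k}" using i by blast
    qed
  qed
  also have "{i \<in> {..<card ?R}. i < k} = {..<min (card ?R) k}" by auto
  finally show ?thesis by simp
qed

text \<open>
  The number of boxes in the first \<open>k\<close> columns of the rows with character
  \<open>c\<close>. These numbers compare diagrams in the dominance order.
\<close>

definition dominance :: "nat \<Rightarrow> (nat \<Rightarrow> 'c \<times> 'i) \<Rightarrow> 'c \<Rightarrow> nat \<Rightarrow> nat" where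
  "dominance n r c k = card {x. x < n \<and> fst (r x) = c \<and> row_index r x < k}"

text \<open>
  The column of a letter, remembered together with the character of its row. The value
  \<open>n\<close> in the second component is not the position of any of the \<open>n\<close>
  letters and separates the letters from the other natural numbers.
\<close>

definition column :: "nat \<Rightarrow> (nat \<Rightarrow> 'c \<times> 'i) \<Rightarrow> nat \<Rightarrow> 'c \<times> nat" where
  "column n r x = (fst (r x), if x < n then row_index r x else n)"

lemma sum_rows:
  fixes r :: "nat \<Rightarrow> 'c \<times> 'i"
  shows "card {x. x < n \<and> fst (r x) = c \<and> Q x} = (\<Sum>\<rho> | \<rho> \<in> r ` {..<n} \<and> fst \<rho> = c. card {x. x < n \<and> r x = \<rho> \<and> Q x})"
proof -
  let ?R = "{\<rho>. \<rho> \<in> r ` {..<n} \<and> fst \<rho> = c}"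
  have "{x. x < n \<and> fst (r x) = c \<and> Q x} = (\<Union>\<rho>\<in>?R. {x. x < n \<and> r x = \<rho> \<and> Q x})" by auto
  also have "card \<dots> = (\<Sum>\<rho>\<in>?R. card {x. x < n \<and> r x = \<rho> \<and> Q x})"
  proof (rule card_UN_disjoint)
    show "finite ?R" by simp
    show "\<forall>\<rho>\<in>?R. finite {x. x < n \<and> r x = \<rho> \<and> Q x}" by simp
    show "\<forall>\<rho>\<in>?R. \<forall>\<rho>'\<in>?R. \<rho> \<noteq> \<rho>' \<longrightarrow> {x. x < n \<and> r x = \<rho> \<and> Q x} \<inter> {x. x < n \<and> r x = \<rho>' \<and> Q x} = {}" by blast
  qed
  finally show ?thesis .
qed

text \<open>
  In a row of \<open>r'\<close> the labels \<open>s\<close> have the same first component, hence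
  distinct second components, so at most \<open>k\<close> of them are below \<open>k\<close>.
\<close>

lemma row_le_dominance:
  assumes s: "s \<in> state_orbit n (column n r)" and fst: "\<forall>x<n. fst (s x) = fst (r' x)"
    and inj: "inj_on (\<lambda>x. (r' x, s x)) {..<n}"
  shows "dominance n r c k = (\<Sum>\<rho> | \<rho> \<in> r' ` {..<n} \<and> fst \<rho> = c. card {x. x < n \<and> r' x = \<rho> \<and> snd (s x) < k})"
    and "card {x. x < n \<and> r' x = \<rho> \<and> snd (s x) < k} \<le> min (card {x. x < n \<and> r' x = \<rho>}) k"
proof -
  have "dominance n r c k = card {x \<in> {..<n}. fst (column n r x) = c \<and> snd (column n r x) < k}"
    unfolding dominance_def column_def by (rule arg_cong[where f = card]) auto
  also have "\<dots> = card {x \<in> {..<n}. fst (s x) = c \<and> snd (s x) < k}"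
    using state_orbitD(2)[OF s, of "\<lambda>u. fst u = c \<and> snd u < k"] by simp
  also have "{x \<in> {..<n}. fst (s x) = c \<and> snd (s x) < k} = {x. x < n \<and> fst (r' x) = c \<and> snd (s x) < k}" using fst by auto
  finally show "dominance n r c k = (\<Sum>\<rho> | \<rho> \<in> r' ` {..<n} \<and> fst \<rho> = c. card {x. x < n \<and> r' x = \<rho> \<and> snd (s x) < k})"
    unfolding sum_rows .
  have "card {x. x < n \<and> r' x = \<rho> \<and> snd (s x) < k} \<le> card {x. x < n \<and> r' x = \<rho>}" by (rule card_mono) auto
  moreover have "card {x. x < n \<and> r' x = \<rho> \<and> snd (s x) < k} \<le> card {..<k}"
  proof (rule card_inj_on_le)
    show "inj_on (\<lambda>x. snd (s x)) {x. x < n \<and> r' x = \<rho> \<and> snd (s x) < k}"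
    proof (rule inj_onI)
      fix x y assume x: "x \<in> {x. x < n \<and> r' x = \<rho> \<and> snd (s x) < k}" and y: "y \<in> {x. x < n \<and> r' x = \<rho> \<and> snd (s x) < k}"
        and e: "snd (s x) = snd (s y)"
      then have "s x = s y" using fst by (auto intro: prod_eqI)
      then show "x = y" using x y inj_onD[OF inj, of x y] by auto
    qed
  qed auto
  ultimately show "card {x. x < n \<and> r' x = \<rho> \<and> snd (s x) < k} \<le> min (card {x. x < n \<and> r' x = \<rho>}) k" by simp
qed

lemma dominance_rows: "dominance n r c k = (\<Sum>\<rho> | \<rho> \<in> r ` {..<n} \<and> fst \<rho> = c. min (card {x. x < n \<and> r x = \<rho>}) k)"
  unfolding dominance_def sum_rows card_row_index_less ..

text \<open>
  Compare the classical fact that a 0-1 matrix with given row and column sums exists only if these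
  are comparable in the dominance order: a row of \<open>r'\<close> and a column of
  \<open>r\<close> meet in at most one letter.
\<close>

lemma dominance_mono:
  assumes "s \<in> state_orbit n (column n r)" "\<forall>x<n. fst (s x) = fst (r' x)" "inj_on (\<lambda>x. (r' x, s x)) {..<n}"
  shows "dominance n r c k \<le> dominance n r' c k"
  unfolding row_le_dominance(1)[OF assms] unfolding dominance_rows by (rule sum_mono) (rule row_le_dominance(2)[OF assms])

text \<open>
  When shape and content agree all estimates are equalities.
\<close>

lemma dominance_tight:
  assumes s: "s \<in> state_orbit n (column n r)" "\<forall>x<n. fst (s x) = fst (r x)" "inj_on (\<lambda>x. (r x, s x)) {..<n}" and x: "x < n"
  shows "snd (s x) < card {y. y < n \<and> r y = r x}"
proof -
  let ?R = "{\<rho> \<in> r ` {..<n}. fst \<rho> = fst (r x)}" and ?k = "card {y. y < n \<and> r y = r x}"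
  have "(\<Sum>\<rho>\<in>?R. card {x. x < n \<and> r x = \<rho> \<and> snd (s x) < ?k}) = (\<Sum>\<rho>\<in>?R. min (card {x. x < n \<and> r x = \<rho>}) ?k)"
    using row_le_dominance(1)[OF s, of "fst (r x)" ?k] dominance_rows[of n r "fst (r x)" ?k] by simp
  then have "card {y. y < n \<and> r y = \<rho> \<and> snd (s y) < ?k} = min (card {y. y < n \<and> r y = \<rho>}) ?k" if "\<rho> \<in> ?R" for \<rho>
    by (rule sum_mono_inv[OF _ row_le_dominance(2)[OF s] that]) simp
  from this[of "r x"] have "card {y. y < n \<and> r y = r x \<and> snd (s y) < ?k} = ?k" using x by auto
  then have "{y. y < n \<and> r y = r x \<and> snd (s y) < ?k} = {y. y < n \<and> r y = r x}" by (intro card_subset_eq) auto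
  then show ?thesis using x by blast
qed

text \<open>
  The rearrangements of the columns of \<open>r\<close> that respect the characters and repeat no
  label in a row of \<open>r'\<close>. Their number is an entry of the matrix of pairings, up to
  the order of the row stabilizer.
\<close>

definition aligned :: "nat \<Rightarrow> (nat \<Rightarrow> 'c \<times> 'i) \<Rightarrow> (nat \<Rightarrow> 'c \<times> 'i) \<Rightarrow> (nat \<Rightarrow> 'c \<times> nat) set" where
  "aligned n r' r = {s \<in> state_orbit n (column n r). (\<forall>x<n. fst (s x) = fst (r' x)) \<and> inj_on (\<lambda>x. (r' x, s x)) {..<n}}"

definition row_stabilizer :: "nat \<Rightarrow> (nat \<Rightarrow> 'r) \<Rightarrow> (nat \<Rightarrow> nat) set" where
  "row_stabilizer n r = {\<sigma>. \<sigma> permutes {..<n} \<and> r \<circ> \<sigma> = r}"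

lemma row_column_inj: "x < n \<Longrightarrow> y < n \<Longrightarrow> r x = r y \<Longrightarrow> column n r x = column n r y \<Longrightarrow> x = y"
  by (rule row_index_inj[of r]) (auto simp: column_def)

text \<open>
  By tightness the labels in each row are a permutation of the columns of this row, so that the
  aligned states form one free orbit of the row stabilizer. This is the diagonal of the matrix of
  pairings.
\<close>

lemma card_aligned_self: "card (aligned n r r) = card (row_stabilizer n r)"
proof -
  have "bij_betw (\<lambda>\<sigma>. column n r \<circ> \<sigma>) (row_stabilizer n r) (aligned n r r)"
    unfolding bij_betw_def
  proof
    show "inj_on (\<lambda>\<sigma>. column n r \<circ> \<sigma>) (row_stabilizer n r)"
    proof (rule inj_onI)
      fix \<sigma> \<tau> assume st: "\<sigma> \<in> row_stabilizer n r" "\<tau> \<in> row_stabilizer n r" and e: "column n r \<circ> \<sigma> = column n r \<circ> \<tau>"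
      show "\<sigma> = \<tau>"
      proof
        fix x
        have \<sigma>\<tau>: "\<sigma> permutes {..<n}" "\<tau> permutes {..<n}" using st by (auto simp: row_stabilizer_def)
        have "r (\<sigma> x) = r x" "r (\<tau> x) = r x" using st by (auto simp: row_stabilizer_def dest: fun_cong[of _ _ x])
        then show "\<sigma> x = \<tau> x"
          using row_column_inj[of "\<sigma> x" n "\<tau> x" r] fun_cong[OF e, of x] permutes_in_image[OF \<sigma>\<tau>(1), of x] permutes_in_image[OF \<sigma>\<tau>(2), of x]
            permutes_not_in[OF \<sigma>\<tau>(1), of x] permutes_not_in[OF \<sigma>\<tau>(2), of x] by (cases "x < n") auto
      qed
    qed
    show "(\<lambda>\<sigma>. column n r \<circ> \<sigma>) ` row_stabilizer n r = aligned n r r"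
    proof (intro equalityI subsetI)
      fix s assume "s \<in> (\<lambda>\<sigma>. column n r \<circ> \<sigma>) ` row_stabilizer n r"
      then obtain \<sigma> where \<sigma>: "\<sigma> permutes {..<n}" "r \<circ> \<sigma> = r" and s: "s = column n r \<circ> \<sigma>" by (auto simp: row_stabilizer_def)
      have rs: "r (\<sigma> x) = r x" for x using fun_cong[OF \<sigma>(2), of x] by simp
      have "s \<in> state_orbit n (column n r)" using \<sigma>(1) s by (auto simp: state_orbit_def)
      moreover have "fst (s x) = fst (r x)" for x by (simp add: s column_def rs)
      moreover have sn: "\<sigma> x < n" if "x < n" for x using permutes_in_image[OF \<sigma>(1), of x] that by simp
      moreover have "inj_on (\<lambda>x. (r x, s x)) {..<n}"
      proof (rule inj_onI)
        fix x y assume "x \<in> {..<n}" "y \<in> {..<n}" "(r x, s x) = (r y, s y)"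
        then have "\<sigma> x = \<sigma> y" by (intro row_column_inj[of _ n _ r] sn) (simp_all add: s rs)
        then show "x = y" using permutes_inj[OF \<sigma>(1)] by (auto dest: injD)
      qed
      ultimately show "s \<in> aligned n r r" by (simp add: aligned_def)
    next
      fix s assume "s \<in> aligned n r r"
      then have s: "s \<in> state_orbit n (column n r)" "\<forall>x<n. fst (s x) = fst (r x)" "inj_on (\<lambda>x. (r x, s x)) {..<n}"
        by (auto simp: aligned_def)
      have ex: "\<exists>y. y < n \<and> r y = r x \<and> column n r y = s x" if x: "x < n" for x
      proof -
        have "snd (s x) \<in> row_index r ` {y. y < n \<and> r y = r x}"
          using dominance_tight[OF s x] row_index_bij[of r n "r x"] by (auto simp: bij_betw_def)
        then obtain y where y: "y < n" "r y = r x" "row_index r y = snd (s x)" by auto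
        then have "column n r y = s x" using s(2) x by (auto simp: column_def intro: prod_eqI)
        then show ?thesis using y by blast
      qed
      then obtain p where p: "\<And>x. x < n \<Longrightarrow> p x < n \<and> r (p x) = r x \<and> column n r (p x) = s x" by metis
      define \<sigma> where "\<sigma> x = (if x < n then p x else x)" for x
      have "inj_on \<sigma> {..<n}"
        using p inj_onD[OF s(3)] by (intro inj_onI) (auto simp: \<sigma>_def, metis lessThan_iff)
      then have "bij_betw \<sigma> {..<n} {..<n}"
        using p endo_inj_surj[of "{..<n}" \<sigma>] by (auto simp: bij_betw_def \<sigma>_def subset_eq)
      then have \<sigma>: "\<sigma> permutes {..<n}" by (rule bij_imp_permutes) (auto simp: \<sigma>_def)
      have "r \<circ> \<sigma> = r" using p by (auto simp: \<sigma>_def fun_eq_iff)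
      moreover have "s = column n r \<circ> \<sigma>"
        using p state_orbitD(1)[OF s(1)] by (auto simp: \<sigma>_def fun_eq_iff)
      ultimately show "s \<in> (\<lambda>\<sigma>. column n r \<circ> \<sigma>) ` row_stabilizer n r" using \<sigma> by (auto simp: row_stabilizer_def)
    qed
  qed
  then show ?thesis by (simp add: bij_betw_same_card)
qed

text \<open>
  Each row with more than \<open>k\<close> letters has exactly one letter in column
  \<open>k\<close>.
\<close>

lemma card_rows_longer:
  "card {\<rho> \<in> r ` {..<n}. fst \<rho> = c \<and> k < card {x. x < n \<and> r x = \<rho>}} = dominance n r c (Suc k) - dominance n r c k"
proof -
  have "dominance n r c (Suc k) = card ({x. x < n \<and> fst (r x) = c \<and> row_index r x < k} \<union> {x. x < n \<and> fst (r x) = c \<and> row_index r x = k})"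
    unfolding dominance_def by (rule arg_cong[where f = card]) auto
  also have "\<dots> = dominance n r c k + card {x. x < n \<and> fst (r x) = c \<and> row_index r x = k}"
    unfolding dominance_def by (rule card_Un_disjoint) auto
  finally have "dominance n r c (Suc k) - dominance n r c k = card {x. x < n \<and> fst (r x) = c \<and> row_index r x = k}" by simp
  also have "\<dots> = card {\<rho> \<in> r ` {..<n}. fst \<rho> = c \<and> k < card {x. x < n \<and> r x = \<rho>}}"
  proof (rule bij_betw_same_card[of r])
    show "bij_betw r {x. x < n \<and> fst (r x) = c \<and> row_index r x = k} {\<rho> \<in> r ` {..<n}. fst \<rho> = c \<and> k < card {x. x < n \<and> r x = \<rho>}}"
      unfolding bij_betw_def
    proof
      show "inj_on r {x. x < n \<and> fst (r x) = c \<and> row_index r x = k}" by (rule inj_onI, rule row_index_inj[of r]) auto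
      show "r ` {x. x < n \<and> fst (r x) = c \<and> row_index r x = k} = {\<rho> \<in> r ` {..<n}. fst \<rho> = c \<and> k < card {x. x < n \<and> r x = \<rho>}}"
      proof (intro equalityI subsetI)
        fix \<rho> assume "\<rho> \<in> r ` {x. x < n \<and> fst (r x) = c \<and> row_index r x = k}"
        then obtain x where x: "x < n" "\<rho> = r x" "fst (r x) = c" "row_index r x = k" by auto
        then have "k \<in> {..<card {y. y < n \<and> r y = \<rho>}}" using bij_betw_apply[OF row_index_bij[of r n \<rho>], of x] by simp
        then show "\<rho> \<in> {\<rho> \<in> r ` {..<n}. fst \<rho> = c \<and> k < card {x. x < n \<and> r x = \<rho>}}" using x by auto
      next
        fix \<rho> assume "\<rho> \<in> {\<rho> \<in> r ` {..<n}. fst \<rho> = c \<and> k < card {x. x < n \<and> r x = \<rho>}}"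
        then have \<rho>: "fst \<rho> = c" "k \<in> row_index r ` {x. x < n \<and> r x = \<rho>}"
          using row_index_bij[of r n \<rho>] by (auto simp: bij_betw_def)
        then show "\<rho> \<in> r ` {x. x < n \<and> fst (r x) = c \<and> row_index r x = k}" by auto
      qed
    qed
  qed
  finally show ?thesis by simp
qed

lemma card_rows_of_length:
  fixes q :: "nat \<Rightarrow> 'c \<times> 'i"
  shows "card {\<rho> \<in> q ` {..<n}. fst \<rho> = c \<and> card {x. x < n \<and> q x = \<rho>} = l} =
    (if l = 0 then 0 else card {\<rho> \<in> q ` {..<n}. fst \<rho> = c \<and> l - 1 < card {x. x < n \<and> q x = \<rho>}} -
       card {\<rho> \<in> q ` {..<n}. fst \<rho> = c \<and> l < card {x. x < n \<and> q x = \<rho>}})"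
proof (cases "l = 0")
  let ?len = "\<lambda>\<rho>. card {x. x < n \<and> q x = \<rho>}"
  case True
  have "?len \<rho> \<noteq> 0" if "\<rho> \<in> q ` {..<n}" for \<rho>
  proof -
    have "{x. x < n \<and> q x = \<rho>} \<noteq> {}" using that by blast
    then show ?thesis by (simp only: card_eq_0_iff) simp
  qed
  then have none: "{\<rho> \<in> q ` {..<n}. fst \<rho> = c \<and> ?len \<rho> = l} = {}" unfolding True by blast
  show ?thesis unfolding none using True by simp
next
  let ?len = "\<lambda>\<rho>. card {x. x < n \<and> q x = \<rho>}"
  case False
  have "k = l \<longleftrightarrow> l - 1 < k \<and> \<not> l < k" for k using False by linarith
  then have e: "{\<rho> \<in> q ` {..<n}. fst \<rho> = c \<and> ?len \<rho> = l} =
      {\<rho> \<in> q ` {..<n}. fst \<rho> = c \<and> l - 1 < ?len \<rho>} - {\<rho> \<in> q ` {..<n}. fst \<rho> = c \<and> l < ?len \<rho>}" by blast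
  show ?thesis unfolding if_not_P[OF False] e
  proof (rule card_Diff_subset)
    have "l < k \<Longrightarrow> l - 1 < k" for k by linarith
    then show "{\<rho> \<in> q ` {..<n}. fst \<rho> = c \<and> l < ?len \<rho>} \<subseteq> {\<rho> \<in> q ` {..<n}. fst \<rho> = c \<and> l - 1 < ?len \<rho>}" by blast
  qed simp
qed

text \<open>
  The dominance numbers determine how many rows of each length and character there are. Hence the
  rows can be matched, and then the letters inside matched rows.
\<close>

lemma dominance_eq_imp_relabel:
  assumes D: "\<And>c k. k \<le> n \<Longrightarrow> dominance n r c k = dominance n r' c k"
  obtains \<theta> \<sigma> where "\<sigma> permutes {..<n}" "inj_on \<theta> (r ` {..<n})" "\<And>x. x < n \<Longrightarrow> r' (\<sigma> x) = \<theta> (r x)" "\<And>x. x < n \<Longrightarrow> fst (\<theta> (r x)) = fst (r x)"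
proof -
  let ?len = "\<lambda>r \<rho>. card {x. x < n \<and> r x = \<rho>}"
  have longer: "card {\<rho> \<in> r ` {..<n}. fst \<rho> = c \<and> k < ?len r \<rho>} = card {\<rho> \<in> r' ` {..<n}. fst \<rho> = c \<and> k < ?len r' \<rho>}" for c k
  proof (cases "k < n")
    case True
    then show ?thesis unfolding card_rows_longer using D by simp
  next
    case False
    have "card {x. x < n \<and> P x} \<le> n" for P using card_mono[of "{..<n}" "{x. x < n \<and> P x}"] by auto
    then have "\<not> k < card {x. x < n \<and> P x}" for P using False by (meson le_trans not_le)
    then show ?thesis by simp
  qed
  have "\<exists>\<theta>. bij_betw \<theta> (r ` {..<n}) (r' ` {..<n}) \<and> (\<forall>\<rho>\<in>r ` {..<n}. (fst (\<theta> \<rho>), ?len r' (\<theta> \<rho>)) = (fst \<rho>, ?len r \<rho>))"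
  proof (rule ex_fiberwise_bij)
    fix l :: "'a \<times> nat"
    show "card {\<rho> \<in> r ` {..<n}. (fst \<rho>, ?len r \<rho>) = l} = card {\<rho> \<in> r' ` {..<n}. (fst \<rho>, ?len r' \<rho>) = l}"
      using card_rows_of_length[where q = r and c = "fst l" and l = "snd l" and n = n]
        card_rows_of_length[where q = r' and c = "fst l" and l = "snd l" and n = n] longer by (simp add: prod_eq_iff)
  qed simp_all
  then obtain \<theta> where \<theta>: "bij_betw \<theta> (r ` {..<n}) (r' ` {..<n})" "\<And>x. x < n \<Longrightarrow> fst (\<theta> (r x)) = fst (r x)"
    "\<And>x. x < n \<Longrightarrow> ?len r' (\<theta> (r x)) = ?len r (r x)" by auto
  have inj: "inj_on \<theta> (r ` {..<n})" using \<theta>(1) by (rule bij_betw_imp_inj_on)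
  have "\<exists>p. bij_betw p {..<n} {..<n} \<and> (\<forall>x\<in>{..<n}. r' (p x) = \<theta> (r x))"
  proof (rule ex_fiberwise_bij)
    fix l
    show "card {x \<in> {..<n}. \<theta> (r x) = l} = card {x \<in> {..<n}. r' x = l}"
    proof (cases "\<exists>x<n. \<theta> (r x) = l")
      case True
      then obtain z where z: "z < n" "l = \<theta> (r z)" by blast
      have "\<theta> (r x) = \<theta> (r z) \<longleftrightarrow> r x = r z" if "x < n" for x using inj_on_eq_iff[OF inj] that z by simp
      then have "{x \<in> {..<n}. \<theta> (r x) = l} = {x. x < n \<and> r x = r z}" using z by auto
      then show ?thesis using \<theta>(3)[OF z(1)] z by simp
    next
      case False
      then have "l \<notin> \<theta> ` r ` {..<n}" by auto
      then have "l \<notin> r' ` {..<n}" using bij_betw_imp_surj_on[OF \<theta>(1)] by simp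
      then have "{x \<in> {..<n}. \<theta> (r x) = l} = {}" "{x \<in> {..<n}. r' x = l} = {}" using False by auto
      then show ?thesis by (simp only:)
    qed
  qed simp_all
  then obtain p where p: "bij_betw p {..<n} {..<n}" "\<And>x. x < n \<Longrightarrow> r' (p x) = \<theta> (r x)" by auto
  define \<sigma> where "\<sigma> x = (if x < n then p x else x)" for x
  have "bij_betw \<sigma> {..<n} {..<n}" using p(1) by (rule bij_betw_cong[THEN iffD1, rotated]) (simp add: \<sigma>_def)
  then have "\<sigma> permutes {..<n}" by (rule bij_imp_permutes) (auto simp: \<sigma>_def)
  then show ?thesis using inj p(2) \<theta>(2) by (intro that[of \<sigma> \<theta>]) (auto simp: \<sigma>_def)
qed

section \<open>Permutations with the same orbits\<close>

text \<open>
  Powers of a permutation act on an orbit through the integers modulo its length.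
\<close>

lemma funpow_eq_iff_least_power:
  assumes p: "permutation p"
  shows "(p ^^ i) x = (p ^^ j) x \<longleftrightarrow> i mod least_power p x = j mod least_power p x"
proof (induction i j rule: linorder_wlog)
  case (le i j)
  have "(p ^^ i) x = (p ^^ j) x \<longleftrightarrow> (p ^^ (j - i)) x = x"
  proof
    assume "(p ^^ i) x = (p ^^ j) x"
    then show "(p ^^ (j - i)) x = x"
      using funpow_diff[of p i j x] le p by (auto simp: permutation bij_is_inj)
  next
    assume "(p ^^ (j - i)) x = x"
    moreover have "(p ^^ j) x = (p ^^ i) ((p ^^ (j - i)) x)" using le by (metis funpow_add le_add_diff_inverse o_apply)
    ultimately show "(p ^^ i) x = (p ^^ j) x" by simp
  qed
  also have "\<dots> \<longleftrightarrow> least_power p x dvd j - i" by (rule least_power_dvd[OF p, symmetric])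
  also have "\<dots> \<longleftrightarrow> i mod least_power p x = j mod least_power p x" using mod_eq_dvd_iff_nat[OF le] by metis
  finally show ?case .
qed (simp add: eq_commute)

lemma card_orbit_least_power:
  assumes p: "permutation p"
  shows "card (range (\<lambda>i. (p ^^ i) x)) = least_power p x"
  using distinct_card[OF cycle_of_permutation[OF p, of x]] unfolding support_set[OF p] by simp

lemma orbit_eqI:
  assumes p: "permutation p" and y: "y \<in> range (\<lambda>i. (p ^^ i) x)"
  shows "range (\<lambda>i. (p ^^ i) y) = range (\<lambda>i. (p ^^ i) x)"
proof (rule ccontr)
  assume ne: "\<not> ?thesis"
  have "set (support p y) \<noteq> set (support p x)" unfolding support_set[OF p] by (rule ne)
  then have "set (support p y) \<inter> set (support p x) = {}"
    by (rule disjointD[OF disjoint_support[OF p] rangeI[of "\<lambda>a. set (support p a)" y] rangeI[of "\<lambda>a. set (support p a)" x]])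
  moreover have "y \<in> set (support p y)" unfolding support_set[OF p] by (rule range_eqI[of _ _ 0]) simp
  moreover have "y \<in> set (support p x)" unfolding support_set[OF p] by (rule y)
  ultimately show False by (metis IntI empty_iff)
qed

text \<open>
  Choose a base point \<open>m x\<close> in every orbit and send \<open>\<sigma>\<^sup>i (m
  x)\<close> to \<open>\<tau>\<^sup>i (m x)\<close>. This is well defined since the orbits have
  the same length.
\<close>

lemma same_orbits_conjugate:
  assumes \<sigma>: "\<sigma> permutes {..<n}" and \<tau>: "\<tau> permutes {..<n :: nat}"
    and orb: "\<And>x. range (\<lambda>i. (\<sigma> ^^ i) x) = range (\<lambda>i. (\<tau> ^^ i) x)"
  obtains \<alpha> where "\<alpha> permutes {..<n}" "\<alpha> \<circ> \<sigma> = \<tau> \<circ> \<alpha>" "\<And>x. \<alpha> x \<in> range (\<lambda>i. (\<sigma> ^^ i) x)"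
proof -
  define C where "C x = range (\<lambda>i. (\<sigma> ^^ i) x)" for x
  have ps: "permutation \<sigma>" "permutation \<tau>" using \<sigma> \<tau> by (auto simp: permutation_permutes)
  have C_self: "x \<in> C x" for x unfolding C_def by (rule range_eqI[of _ _ 0]) simp
  have C_eq: "C y = C x" if "y \<in> C x" for x y using orbit_eqI[OF ps(1)] that by (simp add: C_def)
  have same: "(\<sigma> ^^ i) x = (\<sigma> ^^ j) x \<longleftrightarrow> (\<tau> ^^ i) x = (\<tau> ^^ j) x" for i j x
    using card_orbit_least_power[OF ps(1), of x] card_orbit_least_power[OF ps(2), of x] orb[of x]
    by (simp add: funpow_eq_iff_least_power[OF ps(1)] funpow_eq_iff_least_power[OF ps(2)])
  define m where "m x = (LEAST y. y \<in> C x)" for x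
  have mC: "m x \<in> C x" for x unfolding m_def by (rule LeastI[of _ x]) (rule C_self)
  have m_eq: "m y = m x" if "y \<in> C x" for x y using C_eq[OF that] by (simp add: m_def)
  define k where "k x = (SOME i. x = (\<sigma> ^^ i) (m x))" for x
  have k: "x = (\<sigma> ^^ k x) (m x)" for x
    unfolding k_def by (rule someI_ex) (use C_eq[OF mC[of x]] C_self[of x] in \<open>auto simp: C_def\<close>)
  define \<alpha> where "\<alpha> x = (\<tau> ^^ k x) (m x)" for x
  have \<alpha>C: "\<alpha> x \<in> C x" for x
  proof -
    have "\<alpha> x \<in> range (\<lambda>i. (\<tau> ^^ i) (m x))" by (simp add: \<alpha>_def)
    then show ?thesis using orb[of "m x"] C_eq[OF mC[of x]] by (simp add: C_def)
  qed
  have comm: "\<alpha> (\<sigma> x) = \<tau> (\<alpha> x)" for x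
  proof -
    have "\<sigma> x \<in> C x" unfolding C_def by (rule range_eqI[of _ _ 1]) simp
    then have mm: "m (\<sigma> x) = m x" by (rule m_eq)
    have "(\<sigma> ^^ k (\<sigma> x)) (m x) = (\<sigma> ^^ Suc (k x)) (m x)" using k[of "\<sigma> x"] k[of x] mm by simp
    then have "(\<tau> ^^ k (\<sigma> x)) (m x) = (\<tau> ^^ Suc (k x)) (m x)" unfolding same .
    then show ?thesis by (simp add: \<alpha>_def mm)
  qed
  have inj: "x = y" if e: "\<alpha> x = \<alpha> y" for x y
  proof -
    have "C x = C y" using C_eq[OF \<alpha>C[of x]] C_eq[OF \<alpha>C[of y]] e by simp
    then have mm: "m x = m y" by (simp add: m_def)
    then have "(\<tau> ^^ k x) (m y) = (\<tau> ^^ k y) (m y)" using e by (simp add: \<alpha>_def)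
    then have "(\<sigma> ^^ k x) (m y) = (\<sigma> ^^ k y) (m y)" unfolding same .
    then show "x = y" using k[of x] k[of y] mm by simp
  qed
  have out: "\<alpha> x = x" if "x \<notin> {..<n}" for x
  proof -
    have "(\<sigma> ^^ i) x = x" for i using permutes_not_in[OF \<sigma> that] by (induction i) simp_all
    then show ?thesis using \<alpha>C[of x] by (auto simp: C_def)
  qed
  have "\<alpha> ` {..<n} \<subseteq> {..<n}"
  proof (rule image_subsetI)
    fix x assume "x \<in> {..<n}"
    from orbit_facts(1)[OF \<sigma> finite_lessThan this] show "\<alpha> x \<in> {..<n}" using \<alpha>C[of x] unfolding C_def by (rule subsetD)
  qed
  moreover have io: "inj_on \<alpha> {..<n}" by (rule inj_onI) (rule inj)
  ultimately have "\<alpha> ` {..<n} = {..<n}" by (rule endo_inj_surj[OF finite_lessThan])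
  then have "bij_betw \<alpha> {..<n} {..<n}" using io by (simp add: bij_betw_def)
  then have "\<alpha> permutes {..<n}" using out by (rule bij_imp_permutes)
  moreover have "\<alpha> \<circ> \<sigma> = \<tau> \<circ> \<alpha>" using comm by (simp add: fun_eq_iff)
  ultimately show ?thesis by (rule that) (rule \<alpha>C[unfolded C_def])
qed

section \<open>Fourier coefficients of class functions\<close>

definition class_function :: "('h, 'm) monoid_scheme \<Rightarrow> ('h \<Rightarrow> 'k) \<Rightarrow> bool" where
  "class_function H \<phi> \<longleftrightarrow> (\<forall>g\<in>carrier H. \<forall>h\<in>carrier H. \<phi> (h \<otimes>\<^bsub>H\<^esub> g \<otimes>\<^bsub>H\<^esub> inv\<^bsub>H\<^esub> h) = \<phi> g)"

text \<open>
  The Fourier coefficient of \<open>\<phi>\<close> on the coset \<open>G\<^sup>n \<sigma>\<close>,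
  up to the factor \<open>1 / |G|\<^sup>n\<close>.
\<close>

definition fourier :: "('g, 'm) monoid_scheme \<Rightarrow> nat \<Rightarrow> (nat \<Rightarrow> 'g \<Rightarrow> 'k::field) \<Rightarrow> (nat \<Rightarrow> nat) \<Rightarrow> ((nat \<Rightarrow> 'g) \<times> (nat \<Rightarrow> nat) \<Rightarrow> 'k) \<Rightarrow> 'k" where
  "fourier G n \<chi> \<sigma> \<phi> = (\<Sum>f\<in>{..<n} \<rightarrow>\<^sub>E carrier G. \<phi> (f, \<sigma>) * (\<Prod>x<n. inverse (\<chi> x (f x))))"

lemma wreath_conj:
  assumes G: "group G" and h: "(g, \<alpha>) \<in> carrier (wreath G I)" and x: "(f, \<sigma>) \<in> carrier (wreath G I)"
  shows "(g, \<alpha>) \<otimes>\<^bsub>wreath G I\<^esub> (f, \<sigma>) \<otimes>\<^bsub>wreath G I\<^esub> inv\<^bsub>wreath G I\<^esub> (g, \<alpha>) =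
    ((\<lambda>i\<in>I. g i \<otimes>\<^bsub>G\<^esub> f (Hilbert_Choice.inv \<alpha> i) \<otimes>\<^bsub>G\<^esub> inv\<^bsub>G\<^esub> g (\<alpha> (Hilbert_Choice.inv \<sigma> (Hilbert_Choice.inv \<alpha> i)))), \<alpha> \<circ> \<sigma> \<circ> Hilbert_Choice.inv \<alpha>)"
proof -
  have pm: "\<alpha> permutes I" "\<sigma> permutes I" using h x by (auto simp: wreath_carrier_iff)
  have i: "Hilbert_Choice.inv (\<alpha> \<circ> \<sigma>) i = Hilbert_Choice.inv \<sigma> (Hilbert_Choice.inv \<alpha> i)" for i
    using o_inv_distrib[OF permutes_bij[OF pm(1)] permutes_bij[OF pm(2)]] by simp
  have mem: "Hilbert_Choice.inv \<sigma> (Hilbert_Choice.inv \<alpha> i) \<in> I" if "i \<in> I" for i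
    using that permutes_in_image[OF permutes_inv[OF pm(1)]] permutes_in_image[OF permutes_inv[OF pm(2)]] by simp
  show ?thesis unfolding wreath_inv[OF G h] wreath_mult i using mem by (auto intro!: restrict_ext)
qed

lemma sum_permute_functions:
  assumes \<alpha>: "\<alpha> permutes {..<n}"
  shows "(\<Sum>f\<in>{..<n} \<rightarrow>\<^sub>E C. h (\<lambda>i\<in>{..<n}. f (\<alpha> i))) = (\<Sum>f\<in>{..<n} \<rightarrow>\<^sub>E C. h f)"
proof (rule sum.reindex_bij_witness[of _ "\<lambda>f. \<lambda>i\<in>{..<n}. f (Hilbert_Choice.inv \<alpha> i)" "\<lambda>f. \<lambda>i\<in>{..<n}. f (\<alpha> i)"])
  note inv = permutes_inv[OF \<alpha>]
  have m: "\<alpha> i < n \<longleftrightarrow> i < n" "Hilbert_Choice.inv \<alpha> i < n \<longleftrightarrow> i < n" for i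
    using permutes_in_image[OF \<alpha>, of i] permutes_in_image[OF inv, of i] by simp_all
  have b: "\<alpha> (Hilbert_Choice.inv \<alpha> i) = i" "Hilbert_Choice.inv \<alpha> (\<alpha> i) = i" for i
    using permutes_inverses[OF \<alpha>] by simp_all
  fix f assume f: "f \<in> {..<n} \<rightarrow>\<^sub>E C"
  have u: "f i = undefined" if "\<not> i < n" for i using f that by (auto simp: PiE_def extensional_def)
  have c: "f i \<in> C" if "i < n" for i using f that by auto
  show "(\<lambda>i\<in>{..<n}. (\<lambda>i\<in>{..<n}. f (\<alpha> i)) (Hilbert_Choice.inv \<alpha> i)) = f" "(\<lambda>i\<in>{..<n}. (\<lambda>i\<in>{..<n}. f (Hilbert_Choice.inv \<alpha> i)) (\<alpha> i)) = f"
    using u by (auto simp: fun_eq_iff m b)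
  show "(\<lambda>i\<in>{..<n}. f (\<alpha> i)) \<in> {..<n} \<rightarrow>\<^sub>E C" "(\<lambda>i\<in>{..<n}. f (Hilbert_Choice.inv \<alpha> i)) \<in> {..<n} \<rightarrow>\<^sub>E C"
    using c by (simp_all add: m)
qed simp

lemma fourier_conj:
  assumes G: "group G" and \<phi>: "class_function (wreath G {..<n}) \<phi>"
    and \<alpha>: "\<alpha> permutes {..<n}" and \<sigma>: "\<sigma> permutes {..<n}" and \<chi>: "\<And>x. x < n \<Longrightarrow> \<chi>' (\<alpha> x) = \<chi> x"
  shows "fourier G n \<chi>' (\<alpha> \<circ> \<sigma> \<circ> Hilbert_Choice.inv \<alpha>) \<phi> = fourier G n \<chi> \<sigma> \<phi>"
proof -
  interpret G: group G by fact
  let ?t = "\<alpha> \<circ> \<sigma> \<circ> Hilbert_Choice.inv \<alpha>" and ?F = "{..<n} \<rightarrow>\<^sub>E carrier G"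
  have one: "((\<lambda>i\<in>{..<n}. \<one>\<^bsub>G\<^esub>), \<alpha>) \<in> carrier (wreath G {..<n})" using \<alpha> by (simp add: wreath_carrier_iff)
  have b: "Hilbert_Choice.inv \<alpha> (\<alpha> i) = i" for i using permutes_inverses[OF \<alpha>] by simp
  have m: "\<alpha> i < n \<longleftrightarrow> i < n" "Hilbert_Choice.inv \<sigma> i < n \<longleftrightarrow> i < n" "Hilbert_Choice.inv \<alpha> i < n \<longleftrightarrow> i < n" for i
    using permutes_in_image[OF \<alpha>, of i] permutes_in_image[OF permutes_inv[OF \<sigma>], of i] permutes_in_image[OF permutes_inv[OF \<alpha>], of i] by simp_all
  have "fourier G n \<chi> \<sigma> \<phi> = (\<Sum>f\<in>?F. \<phi> ((\<lambda>i\<in>{..<n}. f (\<alpha> i)), \<sigma>) * (\<Prod>x<n. inverse (\<chi> x ((\<lambda>i\<in>{..<n}. f (\<alpha> i)) x))))"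
    unfolding fourier_def by (rule sum_permute_functions[OF \<alpha>, symmetric])
  also have "\<dots> = fourier G n \<chi>' ?t \<phi>"
    unfolding fourier_def
  proof (rule sum.cong[OF refl])
    fix f assume f: "f \<in> ?F"
    let ?f = "\<lambda>i\<in>{..<n}. f (\<alpha> i)"
    have fc: "f i \<in> carrier G" if "i < n" for i using f that by auto
    have u: "f i = undefined" if "\<not> i < n" for i using f that by (auto simp: PiE_def extensional_def)
    have fm: "(?f, \<sigma>) \<in> carrier (wreath G {..<n})" using fc \<sigma> by (simp add: wreath_carrier_iff m)
    have "\<phi> (?f, \<sigma>) = \<phi> (((\<lambda>i\<in>{..<n}. \<one>\<^bsub>G\<^esub>), \<alpha>) \<otimes>\<^bsub>wreath G {..<n}\<^esub> (?f, \<sigma>) \<otimes>\<^bsub>wreath G {..<n}\<^esub> inv\<^bsub>wreath G {..<n}\<^esub> ((\<lambda>i\<in>{..<n}. \<one>\<^bsub>G\<^esub>), \<alpha>))"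
      using \<phi> one fm unfolding class_function_def by metis
    also have "\<dots> = \<phi> (f, ?t)"
      unfolding wreath_conj[OF G one fm] using fc u permutes_inverses[OF \<alpha>] by (intro arg_cong[of _ _ \<phi>]) (auto simp: fun_eq_iff m)
    finally have e: "\<phi> (?f, \<sigma>) = \<phi> (f, ?t)" .
    have "(\<Prod>x<n. inverse (\<chi> x (?f x))) = (\<Prod>x<n. inverse (\<chi>' (\<alpha> x) (f (\<alpha> x))))" by (intro prod.cong) (simp_all add: \<chi>)
    also have "\<dots> = (\<Prod>x<n. inverse (\<chi>' x (f x)))" using prod.permute[OF \<alpha>, of "\<lambda>x. inverse (\<chi>' x (f x))"] by (simp add: o_def)
    finally show "\<phi> (?f, \<sigma>) * (\<Prod>x<n. inverse (\<chi> x (?f x))) = \<phi> (f, ?t) * (\<Prod>x<n. inverse (\<chi>' x (f x)))" by (simp only: e)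
  qed
  finally show ?thesis by simp
qed

text \<open>
  Conjugation by \<open>g \<in> G\<^sup>n\<close> translates \<open>f\<close> and multiplies the
  coefficient by a scalar \<open>K\<close>. When \<open>g\<close> is supported at \<open>y\<close>
  this scalar is a quotient of values of \<open>\<chi> (\<sigma> y)\<close> and \<open>\<chi>
  y\<close>, which can be made different from \<open>1\<close>.
\<close>

lemma fourier_not_invariant:
  fixes \<chi> :: "nat \<Rightarrow> 'g \<Rightarrow> 'k::field"
  assumes G: "comm_group G" and \<phi>: "class_function (wreath G {..<n}) \<phi>"
    and \<sigma>: "\<sigma> permutes {..<n}" and \<chi>: "\<And>x. x < n \<Longrightarrow> \<chi> x \<in> dual G" and y: "y < n" "\<chi> (\<sigma> y) \<noteq> \<chi> y"
  shows "fourier G n \<chi> \<sigma> \<phi> = 0"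
proof -
  interpret G: comm_group G by fact
  have Gg: "group G" by (rule G.is_group)
  let ?W = "wreath G {..<n}" and ?F = "{..<n} \<rightarrow>\<^sub>E carrier G"
  have m: "\<sigma> i < n \<longleftrightarrow> i < n" "Hilbert_Choice.inv \<sigma> i < n \<longleftrightarrow> i < n" for i
    using permutes_in_image[OF \<sigma>, of i] permutes_in_image[OF permutes_inv[OF \<sigma>], of i] by simp_all
  have ch: "\<chi> x \<in> characters G" "\<chi> x \<in> extensional (carrier G)" if "x < n" for x using \<chi>[OF that] by (auto simp: dual_def)
  have mult: "\<chi> x (a \<otimes>\<^bsub>G\<^esub> b) = \<chi> x a * \<chi> x b" if "x < n" "a \<in> carrier G" "b \<in> carrier G" for x a b
    using ch(1)[OF that(1)] that by (simp add: characters_iff)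
  have nz: "\<chi> x a \<noteq> 0" if "x < n" "a \<in> carrier G" for x a using ch(1)[OF that(1)] that by (simp add: characters_iff)
  obtain a where a: "a \<in> carrier G" "\<chi> (\<sigma> y) a \<noteq> \<chi> y a"
    using y extensionalityI[OF ch(2) ch(2), of "\<sigma> y" y] m by metis
  define g where "g = (\<lambda>i\<in>{..<n}. if i = y then a else \<one>\<^bsub>G\<^esub>)"
  define c where "c i = g i \<otimes>\<^bsub>G\<^esub> inv\<^bsub>G\<^esub> g (Hilbert_Choice.inv \<sigma> i)" for i
  have gc: "g i \<in> carrier G" if "i < n" for i using that a by (simp add: g_def)
  have cc: "c i \<in> carrier G" if "i < n" for i using that gc by (simp add: c_def m)
  have h: "(g, id) \<in> carrier ?W" using gc by (simp add: wreath_carrier_iff g_def permutes_id)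
  (* The factor by which conjugation by g rescales the Fourier coefficient. *)
  define K where "K = (\<Prod>x<n. inverse (\<chi> x (c x)))"
  have step: "\<phi> ((\<lambda>i\<in>{..<n}. c i \<otimes>\<^bsub>G\<^esub> f i), \<sigma>) = \<phi> (f, \<sigma>)" if f: "f \<in> ?F" for f
  proof -
    have fc: "f i \<in> carrier G" if "i < n" for i using f that by auto
    have fm: "(f, \<sigma>) \<in> carrier ?W" using f \<sigma> by (simp add: wreath_carrier_iff)
    have "\<phi> (f, \<sigma>) = \<phi> ((g, id) \<otimes>\<^bsub>?W\<^esub> (f, \<sigma>) \<otimes>\<^bsub>?W\<^esub> inv\<^bsub>?W\<^esub> (g, id))" using \<phi> h fm unfolding class_function_def by metis
    also have "\<dots> = \<phi> ((\<lambda>i\<in>{..<n}. c i \<otimes>\<^bsub>G\<^esub> f i), \<sigma>)"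
      unfolding wreath_conj[OF Gg h fm] using fc gc
      by (intro arg_cong[of _ _ \<phi>]) (auto simp: c_def m inv_id G.m_ac intro!: restrict_ext)
    finally show ?thesis by simp
  qed
  have K: "K = inverse (\<chi> y a) * \<chi> (\<sigma> y) a"
  proof -
    have "K = (\<Prod>x<n. inverse (\<chi> x (g x)) * \<chi> x (g (Hilbert_Choice.inv \<sigma> x)))"
      unfolding K_def
    proof (rule prod.cong[OF refl])
      fix x assume "x \<in> {..<n}"
      then show "inverse (\<chi> x (c x)) = inverse (\<chi> x (g x)) * \<chi> x (g (Hilbert_Choice.inv \<sigma> x))"
        using mult[of x "g x" "inv\<^bsub>G\<^esub> g (Hilbert_Choice.inv \<sigma> x)"] character_inv[OF Gg ch(1), of x "g (Hilbert_Choice.inv \<sigma> x)"] gc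
        by (simp add: c_def m)
    qed
    also have "\<dots> = (\<Prod>x<n. inverse (\<chi> x (g x))) * (\<Prod>x<n. \<chi> x (g (Hilbert_Choice.inv \<sigma> x)))" by (rule prod.distrib)
    also have "(\<Prod>x<n. \<chi> x (g (Hilbert_Choice.inv \<sigma> x))) = (\<Prod>x<n. \<chi> (\<sigma> x) (g x))"
      using prod.permute[OF \<sigma>, of "\<lambda>x. \<chi> x (g (Hilbert_Choice.inv \<sigma> x))"] permutes_inverses[OF \<sigma>] by (simp add: o_def)
    also have "(\<Prod>x<n. \<chi> (\<sigma> x) (g x)) = (\<Prod>x<n. if x = y then \<chi> (\<sigma> y) a else 1)"
      using character_one[OF Gg ch(1)] m by (intro prod.cong) (auto simp: g_def)
    also have "(\<Prod>x<n. inverse (\<chi> x (g x))) = (\<Prod>x<n. if x = y then inverse (\<chi> y a) else 1)"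
      using character_one[OF Gg ch(1)] by (intro prod.cong) (auto simp: g_def)
    finally show ?thesis using y by simp
  qed
  have "fourier G n \<chi> \<sigma> \<phi> = (\<Sum>f\<in>?F. \<phi> ((\<lambda>i\<in>{..<n}. c i \<otimes>\<^bsub>G\<^esub> f i), \<sigma>) * (\<Prod>x<n. inverse (\<chi> x ((\<lambda>i\<in>{..<n}. c i \<otimes>\<^bsub>G\<^esub> f i) x))))"
    unfolding fourier_def
  proof (rule sum.reindex_bij_witness[of _ "\<lambda>f. \<lambda>i\<in>{..<n}. c i \<otimes>\<^bsub>G\<^esub> f i" "\<lambda>f. \<lambda>i\<in>{..<n}. inv\<^bsub>G\<^esub> c i \<otimes>\<^bsub>G\<^esub> f i"])
    fix f assume f: "f \<in> ?F"
    have fc: "f i \<in> carrier G" if "i < n" for i using f that by auto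
    have u: "f i = undefined" if "\<not> i < n" for i using f that by (auto simp: PiE_def extensional_def)
    show "(\<lambda>i\<in>{..<n}. inv\<^bsub>G\<^esub> c i \<otimes>\<^bsub>G\<^esub> f i) \<in> ?F" "(\<lambda>i\<in>{..<n}. c i \<otimes>\<^bsub>G\<^esub> f i) \<in> ?F" using fc cc by simp_all
    show "(\<lambda>i\<in>{..<n}. c i \<otimes>\<^bsub>G\<^esub> (\<lambda>i\<in>{..<n}. inv\<^bsub>G\<^esub> c i \<otimes>\<^bsub>G\<^esub> f i) i) = f" "(\<lambda>i\<in>{..<n}. inv\<^bsub>G\<^esub> c i \<otimes>\<^bsub>G\<^esub> (\<lambda>i\<in>{..<n}. c i \<otimes>\<^bsub>G\<^esub> f i) i) = f"
      using fc cc u by (auto simp: fun_eq_iff G.m_assoc[symmetric])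
    then show "\<phi> ((\<lambda>i\<in>{..<n}. c i \<otimes>\<^bsub>G\<^esub> (\<lambda>i\<in>{..<n}. inv\<^bsub>G\<^esub> c i \<otimes>\<^bsub>G\<^esub> f i) i), \<sigma>) *
         (\<Prod>x<n. inverse (\<chi> x ((\<lambda>i\<in>{..<n}. c i \<otimes>\<^bsub>G\<^esub> (\<lambda>i\<in>{..<n}. inv\<^bsub>G\<^esub> c i \<otimes>\<^bsub>G\<^esub> f i) i) x))) =
       \<phi> (f, \<sigma>) * (\<Prod>x<n. inverse (\<chi> x (f x)))" by (simp only:)
  qed
  also have "\<dots> = (\<Sum>f\<in>?F. K * (\<phi> (f, \<sigma>) * (\<Prod>x<n. inverse (\<chi> x (f x)))))"
  proof (rule sum.cong[OF refl])
    fix f assume f: "f \<in> ?F"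
    have "(\<Prod>x<n. inverse (\<chi> x ((\<lambda>i\<in>{..<n}. c i \<otimes>\<^bsub>G\<^esub> f i) x))) = (\<Prod>x<n. inverse (\<chi> x (c x)) * inverse (\<chi> x (f x)))"
    proof (rule prod.cong[OF refl])
      fix x assume x: "x \<in> {..<n}"
      then have "f x \<in> carrier G" using f by blast
      then show "inverse (\<chi> x ((\<lambda>i\<in>{..<n}. c i \<otimes>\<^bsub>G\<^esub> f i) x)) = inverse (\<chi> x (c x)) * inverse (\<chi> x (f x))"
        using mult[of x "c x" "f x"] cc[of x] x by simp
    qed
    then show "\<phi> ((\<lambda>i\<in>{..<n}. c i \<otimes>\<^bsub>G\<^esub> f i), \<sigma>) * (\<Prod>x<n. inverse (\<chi> x ((\<lambda>i\<in>{..<n}. c i \<otimes>\<^bsub>G\<^esub> f i) x))) =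
        K * (\<phi> (f, \<sigma>) * (\<Prod>x<n. inverse (\<chi> x (f x))))"
      by (simp only: step[OF f] K_def prod.distrib mult.left_commute)
  qed
  also have "\<dots> = K * fourier G n \<chi> \<sigma> \<phi>" by (simp only: fourier_def sum_distrib_left)
  finally have "(K - 1) * fourier G n \<chi> \<sigma> \<phi> = 0" by (simp add: left_diff_distrib)
  moreover have "K \<noteq> 1" unfolding K using a nz[OF y(1) a(1)] by (simp add: field_simps)
  ultimately show ?thesis by simp
qed

lemma fourier_inversion:
  fixes \<phi> :: "(nat \<Rightarrow> 'g) \<times> (nat \<Rightarrow> nat) \<Rightarrow> 'k::{alg_closed_field, field_char_0}"
  assumes G: "comm_group G" and fin: "finite (carrier G)" and f: "f \<in> {..<n} \<rightarrow>\<^sub>E carrier G"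
    and zero: "\<And>\<chi>. \<chi> \<in> {..<n} \<rightarrow>\<^sub>E dual G \<Longrightarrow> fourier G n \<chi> \<sigma> \<phi> = 0"
  shows "\<phi> (f, \<sigma>) = 0"
proof -
  interpret G: comm_group G by fact
  have Gg: "group G" by (rule G.is_group)
  let ?F = "{..<n} \<rightarrow>\<^sub>E carrier G" and ?D = "dual G :: ('g \<Rightarrow> 'k) set"
  have fD: "finite ?D" by (rule finite_dual[OF Gg fin])
  have ne: "?D \<noteq> {}" using dual_nonempty[OF Gg] by blast
  have fc: "f i \<in> carrier G" if "i < n" for i using f that by auto
  have inner: "(\<Sum>\<chi>\<in>?D. \<chi> (f x) * inverse (\<chi> (f' x))) = (if f' x = f x then of_nat (card ?D) else 0)"
    if f': "f' \<in> ?F" and x: "x < n" for f' x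
  proof -
    have c: "f x \<in> carrier G" "f' x \<in> carrier G" using f f' x by auto
    have "(\<Sum>\<chi>\<in>?D. \<chi> (f x) * inverse (\<chi> (f' x))) = (\<Sum>\<chi>\<in>?D. \<chi> (f x \<otimes>\<^bsub>G\<^esub> inv\<^bsub>G\<^esub> f' x))"
    proof (rule sum.cong[OF refl])
      fix \<chi> :: "'g \<Rightarrow> 'k" assume "\<chi> \<in> ?D"
      then have "\<chi> \<in> characters G" by (simp add: dual_def)
      then show "\<chi> (f x) * inverse (\<chi> (f' x)) = \<chi> (f x \<otimes>\<^bsub>G\<^esub> inv\<^bsub>G\<^esub> f' x)"
        using c character_inv[OF Gg _ c(2), of \<chi>] by (simp add: characters_iff)
    qed
    also have "\<dots> = (if f x \<otimes>\<^bsub>G\<^esub> inv\<^bsub>G\<^esub> f' x = \<one>\<^bsub>G\<^esub> then of_nat (card ?D) else 0)" using c by (intro sum_over_dual[OF G fin]) simp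
    also have "f x \<otimes>\<^bsub>G\<^esub> inv\<^bsub>G\<^esub> f' x = \<one>\<^bsub>G\<^esub> \<longleftrightarrow> f' x = f x" using c G.inv_equality G.r_inv by (metis G.inv_closed G.inv_inv)
    finally show ?thesis .
  qed
  have "0 = (\<Sum>\<chi>\<in>{..<n} \<rightarrow>\<^sub>E ?D. fourier G n \<chi> \<sigma> \<phi> * (\<Prod>x<n. \<chi> x (f x)))" using zero by simp
  also have "\<dots> = (\<Sum>\<chi>\<in>{..<n} \<rightarrow>\<^sub>E ?D. \<Sum>f'\<in>?F. \<phi> (f', \<sigma>) * (\<Prod>x<n. \<chi> x (f x) * inverse (\<chi> x (f' x))))"
    unfolding fourier_def sum_distrib_right by (intro sum.cong refl) (simp only: prod.distrib mult_ac)
  also have "\<dots> = (\<Sum>f'\<in>?F. \<phi> (f', \<sigma>) * (\<Sum>\<chi>\<in>{..<n} \<rightarrow>\<^sub>E ?D. \<Prod>x<n. \<chi> x (f x) * inverse (\<chi> x (f' x))))"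
    by (subst sum.swap) (simp only: sum_distrib_left)
  also have "\<dots> = (\<Sum>f'\<in>?F. \<phi> (f', \<sigma>) * (\<Prod>x<n. \<Sum>\<chi>\<in>?D. \<chi> (f x) * inverse (\<chi> (f' x))))"
    by (subst prod_sum_PiE) (simp_all add: fD)
  also have "\<dots> = (\<Sum>f'\<in>?F. if f' = f then \<phi> (f, \<sigma>) * of_nat (card ?D) ^ n else 0)"
  proof (rule sum.cong[OF refl])
    fix f' assume f': "f' \<in> ?F"
    have "(\<Prod>x<n. \<Sum>\<chi>\<in>?D. \<chi> (f x) * inverse (\<chi> (f' x))) = (\<Prod>x<n. if f' x = f x then of_nat (card ?D) else (0 :: 'k))"
      by (rule prod.cong[OF refl]) (rule inner[OF f'], simp)
    also have "\<dots> = (if f' = f then of_nat (card ?D) ^ n else 0)"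
    proof (cases "f' = f")
      case False
      then obtain x where "x < n" "f' x \<noteq> f x" using PiE_ext[OF f' f] by (metis lessThan_iff)
      then have "(\<Prod>x<n. if f' x = f x then of_nat (card ?D) else (0 :: 'k)) = 0" by (intro prod_zero) auto
      then show ?thesis using False by simp
    qed simp
    finally show "\<phi> (f', \<sigma>) * (\<Prod>x<n. \<Sum>\<chi>\<in>?D. \<chi> (f x) * inverse (\<chi> (f' x))) = (if f' = f then \<phi> (f, \<sigma>) * of_nat (card ?D) ^ n else 0)"
      by simp
  qed
  also have "\<dots> = \<phi> (f, \<sigma>) * of_nat (card ?D) ^ n" using f fin by (simp add: finite_PiE)
  finally show ?thesis using ne fD by simp
qed

text \<open>
  The multiplicity of the linear character given by \<open>r\<close> in the restriction to
  \<open>G\<^sup>n\<close> extended by the row stabilizer.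
\<close>

definition pairing :: "('g, 'm) monoid_scheme \<Rightarrow> nat \<Rightarrow> (nat \<Rightarrow> ('g \<Rightarrow> 'k::field) \<times> 'i) \<Rightarrow> ((nat \<Rightarrow> 'g) \<times> (nat \<Rightarrow> nat) \<Rightarrow> 'k) \<Rightarrow> 'k" where
  "pairing G n r \<phi> = (\<Sum>\<sigma>\<in>row_stabilizer n r. fourier G n (\<lambda>x. fst (r x)) \<sigma> \<phi>) /
     of_nat (card ({..<n} \<rightarrow>\<^sub>E carrier G) * card (row_stabilizer n r))"

lemma finite_row_stabilizer [simp]: "finite (row_stabilizer n r)"
  unfolding row_stabilizer_def by (rule finite_subset[OF _ finite_permutations[OF finite_lessThan]]) auto

lemma id_in_row_stabilizer: "id \<in> row_stabilizer n r"
  by (simp add: row_stabilizer_def permutes_id)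

lemma row_stabilizer_iff: "\<sigma> \<in> row_stabilizer n r \<longleftrightarrow> \<sigma> permutes {..<n} \<and> (\<forall>x<n. r (\<sigma> x) = r x)"
proof -
  have "r (\<sigma> x) = r x" if "\<sigma> permutes {..<n}" "\<not> x < n" for x using permutes_not_in[OF that(1), of x] that(2) by simp
  then show ?thesis unfolding row_stabilizer_def fun_eq_iff o_apply mem_Collect_eq by blast
qed

lemma pairing_diff:
  "pairing G n r (\<lambda>g. \<phi> g - c * \<psi> g) = pairing G n r \<phi> - c * pairing G n r \<psi>"
  by (simp add: pairing_def fourier_def left_diff_distrib sum_subtractf sum_distrib_left mult.assoc diff_divide_distrib)

text \<open>
  Labellings of the same shape give conjugate subgroups with corresponding characters.
\<close>

lemma pairing_relabel:
  assumes G: "group G" and \<phi>: "class_function (wreath G {..<n}) \<phi>" and \<alpha>: "\<alpha> permutes {..<n}"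
    and rows: "\<And>x y. x < n \<Longrightarrow> y < n \<Longrightarrow> r' (\<alpha> x) = r' (\<alpha> y) \<longleftrightarrow> r x = r y"
    and fst: "\<And>x. x < n \<Longrightarrow> fst (r' (\<alpha> x)) = fst (r x)"
  shows "pairing G n r' \<phi> = pairing G n r \<phi>"
proof -
  let ?c = "\<lambda>\<sigma>. \<alpha> \<circ> \<sigma> \<circ> Hilbert_Choice.inv \<alpha>"
  have m: "\<alpha> x < n \<longleftrightarrow> x < n" for x using permutes_in_image[OF \<alpha>, of x] by simp
  have b: "\<alpha> (Hilbert_Choice.inv \<alpha> x) = x" "Hilbert_Choice.inv \<alpha> (\<alpha> x) = x" for x using permutes_inverses[OF \<alpha>] by simp_all
  have bij: "bij_betw ?c (row_stabilizer n r) (row_stabilizer n r')"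
  proof (rule bij_betw_byWitness[of _ "\<lambda>\<sigma>. Hilbert_Choice.inv \<alpha> \<circ> \<sigma> \<circ> \<alpha>"])
    show "\<forall>\<sigma>\<in>row_stabilizer n r. Hilbert_Choice.inv \<alpha> \<circ> ?c \<sigma> \<circ> \<alpha> = \<sigma>" by (simp add: fun_eq_iff b)
    show "\<forall>\<sigma>\<in>row_stabilizer n r'. ?c (Hilbert_Choice.inv \<alpha> \<circ> \<sigma> \<circ> \<alpha>) = \<sigma>" by (simp add: fun_eq_iff b)
    show "?c ` row_stabilizer n r \<subseteq> row_stabilizer n r'"
    proof (intro image_subsetI)
      fix \<sigma> assume "\<sigma> \<in> row_stabilizer n r"
      then have \<sigma>: "\<sigma> permutes {..<n}" "\<And>x. x < n \<Longrightarrow> r (\<sigma> x) = r x" by (auto simp: row_stabilizer_iff)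
      have "r' (?c \<sigma> x) = r' x" if "x < n" for x
      proof -
        let ?y = "Hilbert_Choice.inv \<alpha> x"
        have y: "?y < n" using m[of ?y] b that by simp
        moreover have "\<sigma> ?y < n" using permutes_in_image[OF \<sigma>(1), of ?y] y by simp
        ultimately have "r' (\<alpha> (\<sigma> ?y)) = r' (\<alpha> ?y)" using rows \<sigma>(2) by simp
        then show ?thesis by (simp add: b)
      qed
      moreover have "?c \<sigma> permutes {..<n}" using \<alpha> \<sigma>(1) by (intro permutes_compose permutes_inv)
      ultimately show "?c \<sigma> \<in> row_stabilizer n r'" by (simp add: row_stabilizer_iff)
    qed
    show "(\<lambda>\<sigma>. Hilbert_Choice.inv \<alpha> \<circ> \<sigma> \<circ> \<alpha>) ` row_stabilizer n r' \<subseteq> row_stabilizer n r"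
    proof (intro image_subsetI)
      fix \<sigma> assume "\<sigma> \<in> row_stabilizer n r'"
      then have \<sigma>: "\<sigma> permutes {..<n}" "\<And>x. x < n \<Longrightarrow> r' (\<sigma> x) = r' x" by (auto simp: row_stabilizer_iff)
      have "r ((Hilbert_Choice.inv \<alpha> \<circ> \<sigma> \<circ> \<alpha>) x) = r x" if "x < n" for x
      proof -
        let ?y = "Hilbert_Choice.inv \<alpha> (\<sigma> (\<alpha> x))"
        have "\<sigma> (\<alpha> x) < n" using permutes_in_image[OF \<sigma>(1), of "\<alpha> x"] m that by simp
        then have "?y < n" using m[of ?y] b by simp
        moreover have "r' (\<alpha> ?y) = r' (\<alpha> x)" using \<sigma>(2) m that by (simp add: b)
        ultimately show ?thesis using rows that by simp
      qed
      moreover have "Hilbert_Choice.inv \<alpha> \<circ> \<sigma> \<circ> \<alpha> permutes {..<n}" using \<alpha> \<sigma>(1) by (intro permutes_compose permutes_inv)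
      ultimately show "Hilbert_Choice.inv \<alpha> \<circ> \<sigma> \<circ> \<alpha> \<in> row_stabilizer n r" by (simp add: row_stabilizer_iff)
    qed
  qed
  have "(\<Sum>\<sigma>\<in>row_stabilizer n r'. fourier G n (\<lambda>x. fst (r' x)) \<sigma> \<phi>) = (\<Sum>\<sigma>\<in>row_stabilizer n r. fourier G n (\<lambda>x. fst (r' x)) (?c \<sigma>) \<phi>)"
    by (rule sum.reindex_bij_betw[OF bij, symmetric])
  also have "\<dots> = (\<Sum>\<sigma>\<in>row_stabilizer n r. fourier G n (\<lambda>x. fst (r x)) \<sigma> \<phi>)"
    by (intro sum.cong refl fourier_conj[OF G \<phi> \<alpha>]) (auto simp: row_stabilizer_iff fst)
  finally show ?thesis using bij_betw_same_card[OF bij] by (simp add: pairing_def)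
qed

text \<open>
  The linear character is invariant under the row stabilizer, so it extends to the semidirect
  product.
\<close>

lemma pairing_integral:
  fixes \<phi> :: "(nat \<Rightarrow> 'g) \<times> (nat \<Rightarrow> nat) \<Rightarrow> 'k::field_char_0"
  assumes G: "group G" and fin: "finite (carrier G)" and \<phi>: "\<phi> \<in> virtual_characters (wreath G {..<n})"
    and r: "\<And>x. x < n \<Longrightarrow> fst (r x) \<in> characters G"
  shows "\<exists>m :: int. pairing G n r \<phi> = of_int m"
proof -
  interpret G: group G by fact
  let ?W = "wreath G {..<n}" and ?F = "{..<n} \<rightarrow>\<^sub>E carrier G"
  interpret W: group ?W by (rule group_wreath[OF G])
  let ?Y = "?F \<times> row_stabilizer n r" and ?\<psi> = "\<lambda>p. \<Prod>x<n. fst (r x) (fst p x)"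
  have mem: "(f, \<sigma>) \<in> ?Y \<longleftrightarrow> (f, \<sigma>) \<in> carrier ?W \<and> r \<circ> \<sigma> = r" for f \<sigma>
    unfolding wreath_carrier_iff row_stabilizer_def by blast
  have Yc: "?Y \<subseteq> carrier ?W"
  proof
    fix p assume p: "p \<in> ?Y"
    obtain f \<sigma> where "p = (f, \<sigma>)" by (cases p)
    then show "p \<in> carrier ?W" using p mem by blast
  qed
  have sub: "subgroup ?Y ?W"
  proof (rule W.subgroupI[OF Yc])
    have "((\<lambda>i\<in>{..<n}. \<one>\<^bsub>G\<^esub>), id) \<in> ?Y" unfolding mem using W.one_closed by (simp add: wreath_one)
    then show "?Y \<noteq> {}" by blast
    fix p assume "p \<in> ?Y"
    then obtain f \<sigma> where p: "p = (f, \<sigma>)" "(f, \<sigma>) \<in> carrier ?W" "r \<circ> \<sigma> = r" using mem by (cases p) blast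
    have "\<sigma> permutes {..<n}" using p(2) by (simp add: wreath_carrier_iff)
    then have "r \<circ> Hilbert_Choice.inv \<sigma> = r" using p(3) by (metis comp_assoc comp_id permutes_inv_o(1))
    then show "inv\<^bsub>?W\<^esub> p \<in> ?Y" using W.inv_closed[OF p(2)] unfolding p(1) wreath_inv[OF G p(2)] mem by simp
    fix q assume "q \<in> ?Y"
    then obtain g \<tau> where q: "q = (g, \<tau>)" "(g, \<tau>) \<in> carrier ?W" "r \<circ> \<tau> = r" using mem by (cases q) blast
    have "r \<circ> (\<sigma> \<circ> \<tau>) = r" using p(3) q(3) by (metis comp_assoc)
    then show "p \<otimes>\<^bsub>?W\<^esub> q \<in> ?Y" using W.m_closed[OF p(2) q(2)] unfolding p(1) q(1) wreath_mult mem by simp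
  qed
  have "\<exists>m :: int. (\<Sum>y\<in>?Y. inverse (?\<psi> y) * \<phi> y) = of_nat (card ?Y) * of_int m"
  proof (rule virtual_character_multiplicity[OF group_wreath[OF G] finite_wreath[OF fin finite_lessThan] sub \<phi>])
    show "?\<psi> p \<noteq> 0" if p: "p \<in> ?Y" for p
    proof -
      have "fst (r x) (fst p x) \<noteq> 0" if "x < n" for x
      proof -
        have "fst p \<in> ?F" using p by (simp only: mem_Times_iff)
        then have "fst p x \<in> carrier G" using PiE_mem[of "fst p" "{..<n}" "\<lambda>_. carrier G" x] that by simp
        then show ?thesis using r[OF that] by (simp add: characters_iff)
      qed
      then show ?thesis by simp
    qed
    fix p q assume "p \<in> ?Y" "q \<in> ?Y"
    then obtain f \<sigma> g \<tau> where pq: "p = (f, \<sigma>)" "q = (g, \<tau>)" and f: "f \<in> ?F" and g: "g \<in> ?F" and \<sigma>': "\<sigma> \<in> row_stabilizer n r"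
      by blast
    have \<sigma>: "\<sigma> permutes {..<n}" "r \<circ> \<sigma> = r" using \<sigma>' unfolding row_stabilizer_def by blast+
    have m: "Hilbert_Choice.inv \<sigma> i < n \<longleftrightarrow> i < n" for i using permutes_in_image[OF permutes_inv[OF \<sigma>(1)], of i] by simp
    have rs: "r (\<sigma> x) = r x" for x using fun_cong[OF \<sigma>(2), of x] by simp
    have "?\<psi> (p \<otimes>\<^bsub>?W\<^esub> q) = (\<Prod>x<n. fst (r x) (f x) * fst (r x) (g (Hilbert_Choice.inv \<sigma> x)))"
    proof -
      have "fst (r x) (f x \<otimes>\<^bsub>G\<^esub> g (Hilbert_Choice.inv \<sigma> x)) = fst (r x) (f x) * fst (r x) (g (Hilbert_Choice.inv \<sigma> x))" if "x < n" for x
      proof -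
        have "f x \<in> carrier G" "g (Hilbert_Choice.inv \<sigma> x) \<in> carrier G" using f g that m by auto
        then show ?thesis using r[OF that] by (simp add: characters_iff)
      qed
      then show ?thesis by (simp add: pq wreath_mult)
    qed
    also have "\<dots> = (\<Prod>x<n. fst (r x) (f x)) * (\<Prod>x<n. fst (r x) (g (Hilbert_Choice.inv \<sigma> x)))" by (rule prod.distrib)
    also have "(\<Prod>x<n. fst (r x) (g (Hilbert_Choice.inv \<sigma> x))) = (\<Prod>x<n. fst (r x) (g x))"
      using prod.permute[OF \<sigma>(1), of "\<lambda>x. fst (r x) (g (Hilbert_Choice.inv \<sigma> x))"]
      by (simp only: o_def rs permutes_inverses(2)[OF \<sigma>(1)])
    finally show "?\<psi> (p \<otimes>\<^bsub>?W\<^esub> q) = ?\<psi> p * ?\<psi> q" by (simp add: pq)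
  qed
  then obtain k :: int where k: "(\<Sum>y\<in>?Y. inverse (?\<psi> y) * \<phi> y) = of_nat (card ?Y) * of_int k" by blast
  have "(\<Sum>y\<in>?Y. inverse (?\<psi> y) * \<phi> y) = (\<Sum>f\<in>?F. \<Sum>\<sigma>\<in>row_stabilizer n r. \<phi> (f, \<sigma>) * (\<Prod>x<n. inverse (fst (r x) (f x))))"
  proof -
    have "inverse (?\<psi> (f, \<sigma>)) * \<phi> (f, \<sigma>) = \<phi> (f, \<sigma>) * (\<Prod>x<n. inverse (fst (r x) (f x)))" for f \<sigma>
      using prod_inversef[of "\<lambda>x. fst (r x) (f x)" "{..<n}"] by (simp add: o_def mult.commute)
    then show ?thesis unfolding sum.cartesian_product by (intro sum.cong refl) (simp only: split_paired_all prod.case)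
  qed
  also have "\<dots> = (\<Sum>\<sigma>\<in>row_stabilizer n r. fourier G n (\<lambda>x. fst (r x)) \<sigma> \<phi>)" unfolding fourier_def by (rule sum.swap)
  finally have s: "(\<Sum>\<sigma>\<in>row_stabilizer n r. fourier G n (\<lambda>x. fst (r x)) \<sigma> \<phi>) = of_nat (card ?Y) * of_int k" using k by simp
  have "card ?Y \<noteq> 0"
  proof -
    have "finite ?Y" using fin by (auto intro: finite_PiE)
    moreover have "\<one>\<^bsub>?W\<^esub> \<in> ?Y" by (rule subgroup.one_closed[OF sub])
    ultimately show ?thesis by (auto simp: card_eq_0_iff)
  qed
  moreover have "pairing G n r \<phi> = of_nat (card ?Y) * of_int k / of_nat (card ?Y)" unfolding pairing_def s card_cartesian_product ..
  ultimately show ?thesis by (intro exI[of _ k]) simp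
qed

section \<open>The pairings separate class functions\<close>

text \<open>
  Label a letter by its character and the least element of its \<open>\<sigma>\<close>-orbit. The
  row stabilizer then consists of the permutations whose orbits refine those of
  \<open>\<sigma>\<close>. Proper refinements have vanishing coefficients by induction, and all
  others are conjugate to \<open>\<sigma>\<close> by a permutation that fixes
  \<open>\<chi>\<close>; so the pairing is a nonzero multiple of the coefficient at
  \<open>\<sigma>\<close>.
\<close>

lemma fourier_vanishes:
  fixes \<phi> :: "(nat \<Rightarrow> 'g) \<times> (nat \<Rightarrow> nat) \<Rightarrow> 'k::field_char_0"
  assumes G: "comm_group G" and fin: "finite (carrier G)" and \<phi>: "class_function (wreath G {..<n}) \<phi>"
    and zero: "\<And>r. r \<in> {..<n} \<rightarrow>\<^sub>E dual G \<times> {..<n} \<Longrightarrow> pairing G n r \<phi> = 0"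
    and \<chi>: "\<chi> \<in> {..<n} \<rightarrow>\<^sub>E dual G" and \<sigma>: "\<sigma> permutes {..<n}"
  shows "fourier G n \<chi> \<sigma> \<phi> = 0"
  using \<sigma>
proof (induction "card {(x, y). x < n \<and> y \<in> range (\<lambda>i. (\<sigma> ^^ i) x)}" arbitrary: \<sigma> rule: less_induct)
  case less
  interpret G: comm_group G by fact
  have Gg: "group G" by (rule G.is_group)
  note \<sigma> = less.prems
  have \<chi>D: "\<chi> x \<in> dual G" if "x < n" for x using \<chi> that by auto
  let ?C = "\<lambda>(\<tau> :: nat \<Rightarrow> nat) x. range (\<lambda>i. (\<tau> ^^ i) x)"
  let ?E = "\<lambda>\<tau>. {(x, y). x < n \<and> y \<in> ?C \<tau> x}"
  have perm: "permutation \<tau>" if "\<tau> permutes {..<n}" for \<tau> using that by (auto simp: permutation_permutes)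
  have C_self: "x \<in> ?C \<tau> x" for \<tau> x by (rule range_eqI[of _ _ 0]) simp
  have C_sub: "?C \<tau> x \<subseteq> {..<n}" if "\<tau> permutes {..<n}" "x < n" for \<tau> x using orbit_facts(1)[OF that(1) finite_lessThan] that(2) by blast
  have finE: "finite (?E \<tau>)" if "\<tau> permutes {..<n}" for \<tau>
    by (rule finite_subset[of _ "{..<n} \<times> {..<n}"]) (use C_sub[OF that] in blast, simp)
  show ?case
  proof (cases "\<exists>y<n. \<chi> (\<sigma> y) \<noteq> \<chi> y")
    case True
    then obtain y where y: "y < n" "\<chi> (\<sigma> y) \<noteq> \<chi> y" by blast
    show ?thesis by (rule fourier_not_invariant[where \<chi> = \<chi>, OF G \<phi> \<sigma> _ y]) (rule \<chi>D)
  next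
    case False
    then have inv: "\<chi> (\<sigma> y) = \<chi> y" if "y < n" for y using that by blast
    have \<chi>C: "\<chi> y = \<chi> x" if "x < n" "y \<in> ?C \<sigma> x" for x y
    proof -
      have "\<chi> ((\<sigma> ^^ i) x) = \<chi> x" for i
      proof (induction i)
        case (Suc i)
        have "(\<sigma> ^^ i) x < n" using C_sub[OF \<sigma> that(1)] by blast
        then show ?case using inv Suc by simp
      qed simp
      then show ?thesis using that(2) by blast
    qed
    define m where "m x = (LEAST y. y \<in> ?C \<sigma> x)" for x
    have mC: "m x \<in> ?C \<sigma> x" for x unfolding m_def by (rule LeastI[of _ x]) (rule C_self)
    (* Rows are the orbits of sigma, named by their least elements; chi is constant on them. *)
    define r where "r = (\<lambda>x\<in>{..<n}. (\<chi> x, m x))"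
    have rJ: "r \<in> {..<n} \<rightarrow>\<^sub>E dual G \<times> {..<n}"
    proof -
      have "m x < n" if "x < n" for x using C_sub[OF \<sigma> that] mC[of x] by blast
      then show ?thesis using \<chi>D by (simp add: r_def)
    qed
    have \<sigma>r: "\<sigma> \<in> row_stabilizer n r"
      unfolding row_stabilizer_iff
    proof (intro conjI allI impI \<sigma>)
      fix x assume x: "x < n"
      have s: "\<sigma> x < n" using permutes_in_image[OF \<sigma>, of x] x by simp
      have "\<sigma> x \<in> ?C \<sigma> x" by (rule range_eqI[of _ _ 1]) simp
      from orbit_eqI[OF perm[OF \<sigma>] this] have "m (\<sigma> x) = m x" by (simp add: m_def)
      then show "r (\<sigma> x) = r x" using x s inv by (simp add: r_def)
    qed
    have finer: "?C \<tau> x \<subseteq> ?C \<sigma> x" if \<tau>: "\<tau> \<in> row_stabilizer n r" and x: "x < n" for \<tau> x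
    proof -
      have t: "\<tau> permutes {..<n}" "\<And>y. y < n \<Longrightarrow> r (\<tau> y) = r y" using \<tau> by (auto simp: row_stabilizer_iff)
      have "(\<tau> ^^ i) x \<in> ?C \<sigma> x" for i
      proof (induction i)
        case 0
        then show ?case using C_self[of x \<sigma>] by simp
      next
        case (Suc i)
        let ?y = "(\<tau> ^^ i) x"
        have y: "?y < n" using C_sub[OF t(1) x] by blast
        have "\<tau> ?y < n" using permutes_in_image[OF t(1), of ?y] y by simp
        then have mm: "m (\<tau> ?y) = m ?y" using t(2)[OF y] y by (simp add: r_def)
        have "?C \<sigma> (\<tau> ?y) = ?C \<sigma> ?y"
          using orbit_eqI[OF perm[OF \<sigma>] mC[of "\<tau> ?y"]] orbit_eqI[OF perm[OF \<sigma>] mC[of ?y]] mm by simp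
        then have "\<tau> ?y \<in> ?C \<sigma> x" using orbit_eqI[OF perm[OF \<sigma>] Suc] C_self[of "\<tau> ?y" \<sigma>] by simp
        then show ?case by simp
      qed
      then show ?thesis by blast
    qed
    let ?S = "{\<tau> \<in> row_stabilizer n r. ?E \<tau> = ?E \<sigma>}"
    have val: "fourier G n \<chi> \<tau> \<phi> = (if ?E \<tau> = ?E \<sigma> then fourier G n \<chi> \<sigma> \<phi> else 0)" if \<tau>: "\<tau> \<in> row_stabilizer n r" for \<tau>
    proof -
      have t: "\<tau> permutes {..<n}" using \<tau> by (simp add: row_stabilizer_iff)
      show ?thesis
      proof (cases "?E \<tau> = ?E \<sigma>")
        case True
        have "?C \<sigma> x = ?C \<tau> x" for x
        proof (cases "x < n")
          case x: True
          have "y \<in> ?C \<sigma> x \<longleftrightarrow> y \<in> ?C \<tau> x" for y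
            using arg_cong[OF True, of "\<lambda>E. (x, y) \<in> E"] x by simp
          then show ?thesis by blast
        next
          case False
          have "(\<sigma> ^^ i) x = x" "(\<tau> ^^ i) x = x" for i
            using permutes_not_in[OF \<sigma>, of x] permutes_not_in[OF t, of x] False by (induction i) simp_all
          then show ?thesis by simp
        qed
        then obtain \<alpha> where \<alpha>: "\<alpha> permutes {..<n}" "\<alpha> \<circ> \<sigma> = \<tau> \<circ> \<alpha>" "\<And>x. \<alpha> x \<in> ?C \<sigma> x"
          using same_orbits_conjugate[OF \<sigma> t] by blast
        have e: "\<alpha> \<circ> \<sigma> \<circ> Hilbert_Choice.inv \<alpha> = \<tau>" unfolding \<alpha>(2) comp_assoc using permutes_inv_o(1)[OF \<alpha>(1)] by simp
        have "fourier G n \<chi> (\<alpha> \<circ> \<sigma> \<circ> Hilbert_Choice.inv \<alpha>) \<phi> = fourier G n \<chi> \<sigma> \<phi>"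
          by (rule fourier_conj[OF Gg \<phi> \<alpha>(1) \<sigma>]) (rule \<chi>C[OF _ \<alpha>(3)])
        then show ?thesis using True unfolding e by simp
      next
        case False
        have "?E \<tau> \<subseteq> ?E \<sigma>" using finer[OF \<tau>] by blast
        then have "card (?E \<tau>) < card (?E \<sigma>)" using False finE[OF \<sigma>] by (intro psubset_card_mono) auto
        from less.hyps[OF this t] show ?thesis using False by simp
      qed
    qed
    have F: "fourier G n (\<lambda>x. fst (r x)) \<tau> \<phi> = fourier G n \<chi> \<tau> \<phi>" for \<tau>
      unfolding fourier_def by (intro sum.cong refl arg_cong[of _ _ "\<lambda>x. _ * x"] prod.cong) (simp add: r_def)
    have cF: "of_nat (card ({..<n} \<rightarrow>\<^sub>E carrier G) * card (row_stabilizer n r)) \<noteq> (0 :: 'k)"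
    proof -
      have "carrier G \<noteq> {}" using G.one_closed by blast
      then have "card (carrier G) \<noteq> 0" using fin by simp
      moreover have "card (row_stabilizer n r) \<noteq> 0" using \<sigma>r by (auto simp: card_eq_0_iff)
      ultimately show ?thesis by (simp add: card_PiE)
    qed
    have "0 = (\<Sum>\<tau>\<in>row_stabilizer n r. fourier G n \<chi> \<tau> \<phi>)" using zero[OF rJ] cF by (simp add: pairing_def F)
    also have "\<dots> = (\<Sum>\<tau>\<in>row_stabilizer n r. if ?E \<tau> = ?E \<sigma> then fourier G n \<chi> \<sigma> \<phi> else 0)" by (rule sum.cong[OF refl val])
    also have "\<dots> = (\<Sum>\<tau>\<in>?S. fourier G n \<chi> \<sigma> \<phi>)" by (rule sum.inter_filter[symmetric]) simp
    also have "\<dots> = of_nat (card ?S) * fourier G n \<chi> \<sigma> \<phi>" by simp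
    finally have "of_nat (card ?S) * fourier G n \<chi> \<sigma> \<phi> = 0" by simp
    moreover have "card ?S \<noteq> 0"
    proof -
      have "finite ?S" "\<sigma> \<in> ?S" using \<sigma>r by simp_all
      then show ?thesis unfolding card_eq_0_iff by blast
    qed
    ultimately show ?thesis by simp
  qed
qed

theorem pairings_separate:
  fixes \<phi> :: "(nat \<Rightarrow> 'g) \<times> (nat \<Rightarrow> nat) \<Rightarrow> 'k::{alg_closed_field, field_char_0}"
  assumes G: "comm_group G" and fin: "finite (carrier G)" and \<phi>: "class_function (wreath G {..<n}) \<phi>"
    and zero: "\<And>r. r \<in> {..<n} \<rightarrow>\<^sub>E dual G \<times> {..<n} \<Longrightarrow> pairing G n r \<phi> = 0" and p: "p \<in> carrier (wreath G {..<n})"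
  shows "\<phi> p = 0"
proof -
  obtain f \<sigma> where p': "p = (f, \<sigma>)" by (cases p)
  then have f: "f \<in> {..<n} \<rightarrow>\<^sub>E carrier G" "\<sigma> permutes {..<n}" using p by (auto simp: wreath_carrier_iff)
  show ?thesis unfolding p'
    by (rule fourier_inversion[OF G fin f(1)]) (rule fourier_vanishes[OF G fin \<phi> zero _ f(2)])
qed

section \<open>Pairings of the signed orbit characters\<close>

text \<open>
  All colours are odd, and the colours are the columns.
\<close>

abbreviation signed_orbit_char :: "nat \<Rightarrow> (nat \<Rightarrow> ('g \<Rightarrow> 'k::field) \<times> 'i) \<Rightarrow> (nat \<Rightarrow> 'g) \<times> (nat \<Rightarrow> nat) \<Rightarrow> 'k" where
  "signed_orbit_char n r \<equiv> orbit_char n fst (\<lambda>_. True) (column n r)"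

text \<open>
  Two letters with the same row and the same label can be interchanged, and this reverses the
  sign.
\<close>

lemma sign_sum_common_stabilizer:
  assumes s: "\<And>x. x \<ge> n \<Longrightarrow> s x = u"
  shows "(\<Sum>\<sigma> | \<sigma> \<in> row_stabilizer n r \<and> s \<circ> \<sigma> = s. sign \<sigma>) = (if inj_on (\<lambda>x. (r x, s x)) {..<n} then 1 else 0)"
proof -
  let ?S = "{\<sigma>. \<sigma> \<in> row_stabilizer n r \<and> s \<circ> \<sigma> = s}"
  have fin: "finite ?S" by (rule finite_subset[OF _ finite_row_stabilizer[of n r]]) auto
  show ?thesis
  proof (cases "inj_on (\<lambda>x. (r x, s x)) {..<n}")
    case True
    have "?S = {id}"
    proof (intro equalityI subsetI)
      fix \<sigma> assume "\<sigma> \<in> ?S"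
      then have \<sigma>: "\<sigma> permutes {..<n}" "r \<circ> \<sigma> = r" "s \<circ> \<sigma> = s" by (auto simp: row_stabilizer_def)
      have "\<sigma> x = x" for x
      proof (cases "x < n")
        case x: True
        have "\<sigma> x < n" using permutes_in_image[OF \<sigma>(1), of x] x by simp
        then show ?thesis using inj_onD[OF True, of "\<sigma> x" x] fun_cong[OF \<sigma>(2), of x] fun_cong[OF \<sigma>(3), of x] x by simp
      qed (use permutes_not_in[OF \<sigma>(1), of x] in simp)
      then show "\<sigma> \<in> {id}" by (simp add: fun_eq_iff)
    next
      fix \<sigma> :: "nat \<Rightarrow> nat" assume "\<sigma> \<in> {id}"
      then show "\<sigma> \<in> ?S" using id_in_row_stabilizer[of n r] by simp
    qed
    then show ?thesis using True by simp
  next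
    case False
    then obtain x y where xy: "x < n" "y < n" "x \<noteq> y" "r x = r y" "s x = s y" unfolding inj_on_def by auto
    let ?t = "transpose x y"
    have t: "?t permutes {..<n}" using xy by (intro permutes_swap_id) auto
    have rt: "r \<circ> ?t = r" "s \<circ> ?t = s" using xy by (auto simp: fun_eq_iff transpose_def)
    have tS: "?t \<circ> \<sigma> \<in> ?S" if "\<sigma> \<in> ?S" for \<sigma>
      using that permutes_compose[OF _ t, of \<sigma>] rt by (simp add: row_stabilizer_def comp_assoc[symmetric])
    have "(\<Sum>\<sigma>\<in>?S. sign \<sigma>) = (\<Sum>\<sigma>\<in>?S. sign (?t \<circ> \<sigma>))"
      by (rule sum.reindex_bij_witness[of _ "\<lambda>\<sigma>. ?t \<circ> \<sigma>" "\<lambda>\<sigma>. ?t \<circ> \<sigma>"]) (use tS in \<open>simp_all add: comp_assoc[symmetric]\<close>)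
    also have "\<dots> = (\<Sum>\<sigma>\<in>?S. - sign \<sigma>)"
    proof (rule sum.cong[OF refl])
      fix \<sigma> assume "\<sigma> \<in> ?S"
      then have "permutation \<sigma>" by (auto simp: row_stabilizer_def permutation_permutes)
      then show "sign (?t \<circ> \<sigma>) = - sign \<sigma>" using xy(3) by (simp add: sign_compose permutation_swap_id sign_swap_id)
    qed
    finally have "(\<Sum>\<sigma>\<in>?S. sign \<sigma>) = 0" by (simp add: sum_negf)
    then show ?thesis using False by simp
  qed
qed

text \<open>
  First orthogonality relation in each coordinate.
\<close>

lemma fourier_state_char:
  fixes \<chi> :: "nat \<Rightarrow> 'g \<Rightarrow> 'k::field"
  assumes G: "comm_group G" and fin: "finite (carrier G)" and \<sigma>: "\<sigma> permutes {..<n}"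
    and \<chi>: "\<And>x. x < n \<Longrightarrow> \<chi> x \<in> dual G" and s: "\<And>x. x < n \<Longrightarrow> fst (s x) \<in> dual G"
  shows "fourier G n \<chi> \<sigma> (state_char n fst (\<lambda>_. True) s) =
    (if s \<circ> \<sigma> = s \<and> (\<forall>x<n. fst (s x) = \<chi> x) then of_nat (card ({..<n} \<rightarrow>\<^sub>E carrier G)) * of_int (sign \<sigma>) else 0)"
proof (cases "s \<circ> \<sigma> = s")
  case True
  have so: "sign_on {x \<in> {..<n}. True} \<sigma> = sign \<sigma>"
  proof -
    have e: "restrict_id \<sigma> {..<n} = \<sigma>" using permutes_not_in[OF \<sigma>] by (auto simp: restrict_id_def fun_eq_iff)
    have "{x \<in> {..<n}. True} = {..<n}" by blast
    then show ?thesis unfolding sign_on_def by (simp only: e)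
  qed
  have "fourier G n \<chi> \<sigma> (state_char n fst (\<lambda>_. True) s) =
     (\<Sum>f\<in>{..<n} \<rightarrow>\<^sub>E carrier G. of_int (sign \<sigma>) * (\<Prod>x<n. inverse (\<chi> x (f x)) * fst (s x) (f x)))"
    unfolding fourier_def state_char_def prod.case if_P[OF True] so by (simp only: prod.distrib mult_ac)
  also have "\<dots> = of_int (sign \<sigma>) * (\<Prod>x<n. \<Sum>a\<in>carrier G. inverse (\<chi> x a) * fst (s x) a)"
    by (subst prod_sum_PiE) (simp_all add: fin sum_distrib_left)
  also have "(\<Prod>x<n. \<Sum>a\<in>carrier G. inverse (\<chi> x a) * fst (s x) a) = (\<Prod>x<n. if fst (s x) = \<chi> x then of_nat (card (carrier G)) else 0)"
    by (intro prod.cong refl sum_dual_quotient[OF G fin] s \<chi>) auto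
  also have "\<dots> = (if \<forall>x<n. fst (s x) = \<chi> x then of_nat (card ({..<n} \<rightarrow>\<^sub>E carrier G)) else 0)"
  proof (cases "\<forall>x<n. fst (s x) = \<chi> x")
    case True
    then have "(\<Prod>x<n. if fst (s x) = \<chi> x then of_nat (card (carrier G)) else (0 :: 'k)) = (\<Prod>x<n. of_nat (card (carrier G)))"
      by (intro prod.cong) simp_all
    then show ?thesis using True by (simp add: card_PiE)
  next
    case False
    then obtain x where "x < n" "fst (s x) \<noteq> \<chi> x" by blast
    then have "(\<Prod>x<n. if fst (s x) = \<chi> x then of_nat (card (carrier G)) else (0 :: 'k)) = 0" by (intro prod_zero) auto
    then show ?thesis using False by (simp only: if_False)
  qed
  finally have e: "fourier G n \<chi> \<sigma> (state_char n fst (\<lambda>_. True) s) = of_int (sign \<sigma>) * (if \<forall>x<n. fst (s x) = \<chi> x then of_nat (card ({..<n} \<rightarrow>\<^sub>E carrier G)) else 0)" .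
  define C where "C \<longleftrightarrow> (\<forall>x<n. fst (s x) = \<chi> x)"
  show ?thesis unfolding e C_def[symmetric] using True by (cases C) (simp_all add: mult.commute)
next
  case False
  then show ?thesis by (simp add: fourier_def state_char_def)
qed

text \<open>
  Orthogonality keeps the states with matching characters, and the signs cancel for those that
  repeat a label in a row.
\<close>

lemma pairing_signed_orbit_char:
  fixes r r' :: "nat \<Rightarrow> ('g \<Rightarrow> 'k::field_char_0) \<times> 'i"
  assumes G: "comm_group G" and fin: "finite (carrier G)"
    and r: "r \<in> {..<n} \<rightarrow>\<^sub>E dual G \<times> I" and r': "r' \<in> {..<n} \<rightarrow>\<^sub>E dual G \<times> I'"
  shows "pairing G n r' (signed_orbit_char n r) = of_nat (card (aligned n r' r)) / of_nat (card (row_stabilizer n r'))"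
proof -
  interpret G: comm_group G by fact
  let ?O = "state_orbit n (column n r)" and ?Y = "row_stabilizer n r'" and ?F = "{..<n} \<rightarrow>\<^sub>E carrier G"
  let ?c = "\<lambda>s :: nat \<Rightarrow> ('g \<Rightarrow> 'k) \<times> nat. \<forall>x<n. fst (s x) = fst (r' x)"
  have rd: "fst (r x) \<in> dual G" "fst (r' x) \<in> dual G" if "x < n" for x
    using PiE_mem[OF r, of x] PiE_mem[OF r', of x] that by auto
  have out: "r x = undefined" if "x \<ge> n" for x using r that by (auto simp: PiE_def extensional_def)
  have sd: "fst (s x) \<in> dual G" if s: "s \<in> ?O" and x: "x < n" for s x
  proof -
    have "s x \<in> column n r ` {..<n}" using state_orbitD(3)[OF s] x by blast
    then show ?thesis using rd(1) by (auto simp: column_def)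
  qed
  have "(\<Sum>\<sigma>\<in>?Y. fourier G n (\<lambda>x. fst (r' x)) \<sigma> (signed_orbit_char n r)) =
      (\<Sum>\<sigma>\<in>?Y. \<Sum>s\<in>?O. fourier G n (\<lambda>x. fst (r' x)) \<sigma> (state_char n fst (\<lambda>_. True) s))"
    unfolding fourier_def orbit_char_def sum_distrib_right by (intro sum.cong refl sum.swap)
  also have "\<dots> = (\<Sum>\<sigma>\<in>?Y. \<Sum>s\<in>?O. if s \<circ> \<sigma> = s \<and> ?c s then of_nat (card ?F) * of_int (sign \<sigma>) else 0)"
    by (intro sum.cong refl fourier_state_char[OF G fin]) (auto simp: row_stabilizer_iff rd sd)
  also have "\<dots> = (\<Sum>s\<in>?O. \<Sum>\<sigma>\<in>?Y. if s \<circ> \<sigma> = s \<and> ?c s then of_nat (card ?F) * of_int (sign \<sigma>) else 0)" by (rule sum.swap)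
  also have "\<dots> = (\<Sum>s\<in>?O. if s \<in> aligned n r' r then of_nat (card ?F) else 0)"
  proof (rule sum.cong[OF refl])
    fix s assume s: "s \<in> ?O"
    have su: "s x = (fst (undefined :: ('g \<Rightarrow> 'k) \<times> 'i), n)" if "x \<ge> n" for x using state_orbitD(1)[OF s that] out[OF that] that by (simp add: column_def)
    show "(\<Sum>\<sigma>\<in>?Y. if s \<circ> \<sigma> = s \<and> ?c s then of_nat (card ?F) * of_int (sign \<sigma>) else 0) = (if s \<in> aligned n r' r then of_nat (card ?F) else (0 :: 'k))"
    proof (cases "?c s")
      case True
      have "(\<Sum>\<sigma>\<in>?Y. if s \<circ> \<sigma> = s \<and> ?c s then of_nat (card ?F) * of_int (sign \<sigma>) else 0) =
          (\<Sum>\<sigma>\<in>?Y. if s \<circ> \<sigma> = s then of_nat (card ?F) * of_int (sign \<sigma>) else (0 :: 'k))" using True by simp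
      also have "\<dots> = (\<Sum>\<sigma>\<in>{\<sigma> \<in> ?Y. s \<circ> \<sigma> = s}. of_nat (card ?F) * of_int (sign \<sigma>))" by (rule sum.inter_filter[symmetric]) simp
      also have "\<dots> = of_nat (card ?F) * of_int (\<Sum>\<sigma>\<in>{\<sigma> \<in> ?Y. s \<circ> \<sigma> = s}. sign \<sigma>)" by (simp add: sum_distrib_left)
      also have "(\<Sum>\<sigma>\<in>{\<sigma> \<in> ?Y. s \<circ> \<sigma> = s}. sign \<sigma>) = (if inj_on (\<lambda>x. (r' x, s x)) {..<n} then 1 else 0)"
        by (rule sign_sum_common_stabilizer[OF su])
      finally have e: "(\<Sum>\<sigma>\<in>?Y. if s \<circ> \<sigma> = s \<and> ?c s then of_nat (card ?F) * of_int (sign \<sigma>) else (0 :: 'k)) =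
          of_nat (card ?F) * of_int (if inj_on (\<lambda>x. (r' x, s x)) {..<n} then 1 else 0)" .
      have "s \<in> aligned n r' r \<longleftrightarrow> inj_on (\<lambda>x. (r' x, s x)) {..<n}" using True s by (simp add: aligned_def)
      then show ?thesis unfolding e by simp
    next
      case False
      then have na: "s \<notin> aligned n r' r" unfolding aligned_def by blast
      have "(\<Sum>\<sigma>\<in>?Y. if s \<circ> \<sigma> = s \<and> ?c s then of_nat (card ?F) * of_int (sign \<sigma>) else (0 :: 'k)) = 0"
        by (intro sum.neutral ballI) (simp only: False simp_thms if_False)
      then show ?thesis using na by (simp only: if_False)
    qed
  qed
  also have "\<dots> = of_nat (card ?F) * of_nat (card (aligned n r' r))"
  proof -
    have "{s \<in> ?O. s \<in> aligned n r' r} = aligned n r' r" by (auto simp: aligned_def)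
    then show ?thesis by (simp add: sum.inter_filter[symmetric] mult.commute)
  qed
  finally have e: "(\<Sum>\<sigma>\<in>?Y. fourier G n (\<lambda>x. fst (r' x)) \<sigma> (signed_orbit_char n r)) = of_nat (card ?F) * of_nat (card (aligned n r' r))" .
  have "carrier G \<noteq> {}" using G.one_closed by blast
  then have "card ?F \<noteq> 0" using fin by (simp add: card_PiE)
  then show ?thesis unfolding pairing_def e by simp
qed

text \<open>
  The columns are encoded as positive natural numbers, which leaves the label \<open>0\<close> for
  the numbers that are not letters.
\<close>

lemma signed_orbit_char_generated:
  fixes r :: "nat \<Rightarrow> ('g \<Rightarrow> 'k::field_char_0) \<times> 'i"
  assumes G: "group G" and A: "character_subring (wreath G {..<n}) A"
    and gen: "\<And>\<chi> d. \<chi> \<in> characters G \<Longrightarrow> subset_char n \<chi> True d \<in> A"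
    and r: "r \<in> {..<n} \<rightarrow>\<^sub>E dual G \<times> I"
  shows "signed_orbit_char n r \<in> A"
proof -
  interpret G: group G by fact
  interpret character_subring "wreath G {..<n}" A by fact
  have rd: "fst (r x) \<in> characters G" if "x < n" for x using PiE_mem[OF r, of x] that by (auto simp: dual_def)
  have out: "r x = undefined" if "x \<ge> n" for x using r that by (auto simp: PiE_def extensional_def)
  let ?L = "column n r ` {..<n}"
  obtain e :: "('g \<Rightarrow> 'k) \<times> nat \<Rightarrow> nat" where e: "inj_on e ?L" using finite_imp_inj_to_nat_seg[of ?L] by auto
  define \<theta> where "\<theta> l = (if l \<in> ?L then Suc (e l) else 0)" for l
  (* The character carried by an encoded column; numbers that encode no column carry the trivial one. *)
  define w where "w t = (if \<exists>l\<in>?L. t = Suc (e l) then fst (THE l. l \<in> ?L \<and> t = Suc (e l)) else (\<lambda>_. 1))" for t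
  have w\<theta>: "w (Suc (e l)) = fst l" if "l \<in> ?L" for l
  proof -
    have "(THE l'. l' \<in> ?L \<and> Suc (e l) = Suc (e l')) = l" using that inj_onD[OF e] by (intro the_equality) auto
    then show ?thesis using that by (auto simp: w_def)
  qed
  have wc: "w t \<in> characters G" for t
  proof (cases "\<exists>l\<in>?L. t = Suc (e l)")
    case True
    then obtain l where l: "l \<in> ?L" "t = Suc (e l)" by blast
    then obtain x where "x < n" "l = column n r x" by auto
    then show ?thesis using w\<theta>[OF l(1)] l(2) rd by (simp add: column_def)
  next
    case False
    then show ?thesis by (simp add: w_def characters_iff)
  qed
  have cn: "column n r x \<notin> ?L" if "x \<ge> n" for x
  proof
    assume "column n r x \<in> ?L"
    then obtain y where y: "y < n" "column n r x = column n r y" by auto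
    have "row_index r y \<le> card {..<y}" unfolding row_index_def by (rule card_mono) auto
    then show False using y that by (simp add: column_def)
  qed
  have "orbit_char n w (\<lambda>t. t \<noteq> 0) (\<theta> \<circ> column n r) \<in> A"
  proof (rule orbit_chars_generated[OF A, of n "characters G"])
    show "\<sigma> permutes {..<n}" if "(f, \<sigma>) \<in> carrier (wreath G {..<n})" for f \<sigma> using that by (simp add: wreath_carrier_iff)
    show "(\<lambda>_. 1) \<in> characters G" by (simp add: characters_iff)
    show "(\<lambda>a. \<chi> a * \<chi>' a) \<in> characters G" if "\<chi> \<in> characters G" "\<chi>' \<in> characters G" for \<chi> \<chi>' :: "'g \<Rightarrow> 'k"
      using that by (simp add: characters_iff)
    show "w 0 = (\<lambda>_. 1)" by (simp add: w_def)
    show "(\<theta> \<circ> column n r) x = 0" if "x \<ge> n" for x using cn[OF that] by (simp add: \<theta>_def)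
  qed (use gen wc in simp_all)
  moreover have "orbit_char n w (\<lambda>t. t \<noteq> 0) (\<theta> \<circ> column n r) = signed_orbit_char n r"
  proof
    fix p show "orbit_char n w (\<lambda>t. t \<noteq> 0) (\<theta> \<circ> column n r) p = signed_orbit_char n r p"
    proof (rule orbit_char_relabel)
      show "inj_on \<theta> (range (column n r))"
      proof (rule inj_onI)
        fix l l' assume l: "l \<in> range (column n r)" "l' \<in> range (column n r)" and eq: "\<theta> l = \<theta> l'"
        have u: "l = (fst (undefined :: ('g \<Rightarrow> 'k) \<times> 'i), n)" if lu: "l \<in> range (column n r)" "l \<notin> ?L" for l
        proof -
          obtain x where x: "l = column n r x" using lu(1) by blast
          then have "\<not> x < n" using lu(2) by blast
          then show ?thesis using out[of x] x by (simp add: column_def)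
        qed
        show "l = l'"
        proof (cases "l \<in> ?L")
          case True
          then have "l' \<in> ?L" using eq by (simp add: \<theta>_def split: if_splits)
          then show ?thesis using True eq inj_onD[OF e, of l l'] by (simp add: \<theta>_def)
        next
          case False
          then have "l' \<notin> ?L" using eq by (auto simp: \<theta>_def split: if_splits)
          then show ?thesis using u[OF l(1) False] u[OF l(2)] by simp
        qed
      qed
      show "w (\<theta> (column n r x)) = fst (column n r x)" if "x < n" for x using that w\<theta>[of "column n r x"] by (simp add: \<theta>_def)
      show "(\<theta> (column n r x) \<noteq> 0) = True" if "x < n" for x using that by (simp add: \<theta>_def)
    qed
  qed
  ultimately show ?thesis by simp
qed

section \<open>Elimination\<close>

lemma virtual_characters_diff:
  assumes "f \<in> virtual_characters H" "f' \<in> virtual_characters H"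
  shows "(\<lambda>g. f g - f' g) \<in> virtual_characters H"
proof -
  obtain x y where x: "Poly_Mapping.keys x \<subseteq> reps H" "\<And>g. g \<in> carrier H \<Longrightarrow> f g = frag_char x g"
    and y: "Poly_Mapping.keys y \<subseteq> reps H" "\<And>g. g \<in> carrier H \<Longrightarrow> f' g = frag_char y g"
    using assms by (auto simp: virtual_characters_def)
  have "Poly_Mapping.keys (x - y) \<subseteq> reps H" using keys_diff[of x y] x(1) y(1) by blast
  moreover have "f g - f' g = frag_char (x - y) g" if "g \<in> carrier H" for g using x(2)[OF that] y(2)[OF that] by simp
  ultimately show ?thesis unfolding virtual_characters_def by blast
qed

text \<open>
  A linear refinement of the dominance order.
\<close>

definition rank :: "'c set \<Rightarrow> nat \<Rightarrow> (nat \<Rightarrow> 'c \<times> 'i) \<Rightarrow> nat" where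
  "rank D n r = (\<Sum>c\<in>D. \<Sum>k\<le>n. dominance n r c k)"

text \<open>
  The pairings are triangular; equality of ranks forces equality of all dominance numbers and
  hence of the functionals on class functions.
\<close>

lemma pairing_triangular:
  fixes r r' :: "nat \<Rightarrow> ('g \<Rightarrow> 'k::field_char_0) \<times> nat"
  assumes G: "comm_group G" and fin: "finite (carrier G)"
    and r: "r \<in> {..<n} \<rightarrow>\<^sub>E dual G \<times> {..<n}" and r': "r' \<in> {..<n} \<rightarrow>\<^sub>E dual G \<times> {..<n}"
    and nz: "pairing G n r' (signed_orbit_char n r) \<noteq> 0"
  shows "rank (dual G) n r \<le> rank (dual G) n r'"
    and "rank (dual G) n r' = rank (dual G) n r \<Longrightarrow> class_function (wreath G {..<n}) \<phi> \<Longrightarrow> pairing G n r' \<phi> = pairing G n r \<phi>"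
proof -
  interpret G: comm_group G by fact
  have Gg: "group G" by (rule G.is_group)
  let ?D = "dual G :: ('g \<Rightarrow> 'k) set"
  have fD: "finite ?D" by (rule finite_dual[OF Gg fin])
  have "card (aligned n r' r) \<noteq> 0" using nz unfolding pairing_signed_orbit_char[OF G fin r r'] by auto
  then obtain s where "s \<in> aligned n r' r" by (metis card.empty equals0I)
  then have s: "s \<in> state_orbit n (column n r)" "\<forall>x<n. fst (s x) = fst (r' x)" "inj_on (\<lambda>x. (r' x, s x)) {..<n}"
    by (auto simp: aligned_def)
  have le: "dominance n r c k \<le> dominance n r' c k" for c k by (rule dominance_mono[OF s])
  show "rank ?D n r \<le> rank ?D n r'" unfolding rank_def by (intro sum_mono le)
  assume eq: "rank ?D n r' = rank ?D n r" and \<phi>: "class_function (wreath G {..<n}) \<phi>"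
  have "dominance n r c k = dominance n r' c k" if k: "k \<le> n" for c k
  proof (cases "c \<in> ?D")
    case True
    have "(\<Sum>k\<le>n. dominance n r c k) = (\<Sum>k\<le>n. dominance n r' c k)"
      by (rule sum_mono_inv[OF eq[unfolded rank_def, symmetric] _ True fD]) (intro sum_mono le)
    then show ?thesis by (rule sum_mono_inv[OF _ le]) (use k in simp_all)
  next
    case False
    have "fst (r x) \<noteq> c" "fst (r' x) \<noteq> c" if "x < n" for x using PiE_mem[OF r, of x] PiE_mem[OF r', of x] that False by auto
    then have "{x. x < n \<and> fst (r x) = c \<and> row_index r x < k} = {}" "{x. x < n \<and> fst (r' x) = c \<and> row_index r' x < k} = {}" by blast+
    then show ?thesis by (simp only: dominance_def)
  qed
  then obtain \<theta> \<sigma> where \<theta>: "\<sigma> permutes {..<n}" "inj_on \<theta> (r ` {..<n})" "\<And>x. x < n \<Longrightarrow> r' (\<sigma> x) = \<theta> (r x)"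
      "\<And>x. x < n \<Longrightarrow> fst (\<theta> (r x)) = fst (r x)"
    using dominance_eq_imp_relabel[of n r r'] by metis
  show "pairing G n r' \<phi> = pairing G n r \<phi>"
  proof (rule pairing_relabel[OF Gg \<phi> \<theta>(1)])
    show "fst (r' (\<sigma> x)) = fst (r x)" if "x < n" for x using \<theta>(3,4)[OF that] by simp
    show "r' (\<sigma> x) = r' (\<sigma> y) \<longleftrightarrow> r x = r y" if "x < n" "y < n" for x y
      unfolding \<theta>(3)[OF that(1)] \<theta>(3)[OF that(2)] using inj_on_eq_iff[OF \<theta>(2)] that by simp
  qed
qed

text \<open>
  Let \<open>Z \<psi>\<close> be the set of labellings with nonzero pairing with
  \<open>\<psi>\<close>. Subtracting an integral multiple of the signed orbit character of a
  labelling of minimal rank in this set removes that labelling, and all labellings of the same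
  shape with it; by triangularity only labellings of larger rank can appear. So the upward closure
  \<open>U \<psi>\<close> shrinks, and it is empty only when all pairings vanish.
\<close>

theorem virtual_characters_generated:
  fixes A :: "((nat \<Rightarrow> 'g) \<times> (nat \<Rightarrow> nat) \<Rightarrow> 'k::{alg_closed_field, field_char_0}) set"
  assumes G: "comm_group G" and fin: "finite (carrier G)" and A: "character_subring (wreath G {..<n}) A"
    and gen: "\<And>\<chi> d. \<chi> \<in> characters G \<Longrightarrow> subset_char n \<chi> True d \<in> A"
    and \<phi>: "\<phi> \<in> virtual_characters (wreath G {..<n})"
  shows "\<phi> \<in> A"
proof -
  interpret G: comm_group G by fact
  have Gg: "group G" by (rule G.is_group)
  let ?W = "wreath G {..<n}"
  have W: "group ?W" by (rule group_wreath[OF Gg])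
  interpret character_subring ?W A by fact
  define J where "J = ({..<n} \<rightarrow>\<^sub>E (dual G :: ('g \<Rightarrow> 'k) set) \<times> {..<n})"
  have finJ: "finite J" unfolding J_def by (intro finite_PiE) (simp_all add: finite_dual[OF Gg fin])
  define rk where "rk = (rank (dual G) n :: (nat \<Rightarrow> ('g \<Rightarrow> 'k) \<times> nat) \<Rightarrow> nat)"
  define N where "N r = signed_orbit_char n r" for r :: "nat \<Rightarrow> ('g \<Rightarrow> 'k) \<times> nat"
  have NA: "N r \<in> A" if "r \<in> J" for r
    unfolding N_def by (rule signed_orbit_char_generated[OF Gg A gen]) (use that in \<open>simp_all add: J_def\<close>)
  have cf: "class_function ?W \<psi>" if "\<psi> \<in> virtual_characters ?W" for \<psi> :: "(nat \<Rightarrow> 'g) \<times> (nat \<Rightarrow> nat) \<Rightarrow> 'k"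
    unfolding class_function_def using virtual_character_conj[OF W that] by blast
  have tri: "rk r \<le> rk r'" "rk r' = rk r \<Longrightarrow> class_function ?W \<psi> \<Longrightarrow> pairing G n r' \<psi> = pairing G n r \<psi>"
    if "r \<in> J" "r' \<in> J" "pairing G n r' (N r) \<noteq> 0" for r r' and \<psi> :: "(nat \<Rightarrow> 'g) \<times> (nat \<Rightarrow> nat) \<Rightarrow> 'k"
    using pairing_triangular(1)[OF G fin, of r n r'] pairing_triangular(2)[OF G fin, of r n r' \<psi>] that
    by (simp_all add: J_def rk_def N_def)
  have diag: "pairing G n r (N r) = 1" if "r \<in> J" for r
  proof -
    have "card (row_stabilizer n r) \<noteq> 0" using id_in_row_stabilizer[of n r] by (auto simp: card_eq_0_iff)
    then show ?thesis
      using pairing_signed_orbit_char[OF G fin, of r n "{..<n}" r "{..<n}"] that by (simp add: N_def J_def card_aligned_self)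
  qed
  define Z where "Z \<psi> = {r \<in> J. pairing G n r \<psi> \<noteq> 0}" for \<psi> :: "(nat \<Rightarrow> 'g) \<times> (nat \<Rightarrow> nat) \<Rightarrow> 'k"
  define U where "U \<psi> = {r \<in> J. \<exists>r'\<in>Z \<psi>. rk r' < rk r \<or> r' = r}" for \<psi> :: "(nat \<Rightarrow> 'g) \<times> (nat \<Rightarrow> nat) \<Rightarrow> 'k"
  show ?thesis using \<phi>
  proof (induction "card (U \<phi>)" arbitrary: \<phi> rule: less_induct)
    case less
    note \<phi> = less.prems
    show ?case
    proof (cases "Z \<phi> = {}")
      case True
      have "\<phi> p = 0" if "p \<in> carrier ?W" for p
        by (rule pairings_separate[OF G fin cf[OF \<phi>] _ that]) (use True in \<open>auto simp: Z_def J_def\<close>)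
      then show ?thesis using zero by (rule cong[rotated])
    next
      case False
      obtain r where r: "r \<in> Z \<phi>" "\<And>r'. r' \<in> Z \<phi> \<Longrightarrow> rk r \<le> rk r'"
        using ex_has_least_nat[of "\<lambda>r. r \<in> Z \<phi>" _ rk] False by blast
      have rJ: "r \<in> J" using r(1) by (simp add: Z_def)
      have "fst (r x) \<in> characters G" if "x < n" for x
      proof -
        have "r x \<in> dual G \<times> {..<n}" by (rule PiE_mem[OF rJ[unfolded J_def]]) (simp add: that)
        then show ?thesis by (simp add: mem_Times_iff dual_def)
      qed
      then obtain m :: int where m: "pairing G n r \<phi> = of_int m" using pairing_integral[OF Gg fin \<phi>] by blast
      define \<psi> where "\<psi> = (\<lambda>g. \<phi> g - of_int m * N r g)"
      have pr: "pairing G n r' \<psi> = pairing G n r' \<phi> - of_int m * pairing G n r' (N r)" for r'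
        unfolding \<psi>_def by (rule pairing_diff)
      have mN: "(\<lambda>g. of_int m * N r g) \<in> A" by (rule of_int_mult[OF NA[OF rJ]])
      have \<psi>: "\<psi> \<in> virtual_characters ?W"
        unfolding \<psi>_def by (rule virtual_characters_diff[OF \<phi>]) (use mN virtual in blast)
      (* A labelling enters only where the pairing with N r is nonzero; at equal rank triangularity
         identifies its pairing with phi with that of r, so it has been in Z phi already. *)
      have low: "rk r < rk r' \<or> r' \<in> Z \<phi>" if r': "r' \<in> Z \<psi>" for r'
      proof (rule ccontr)
        assume c: "\<not> ?thesis"
        have r'J: "r' \<in> J" and p: "pairing G n r' \<psi> \<noteq> 0" using r' by (auto simp: Z_def)
        have p0: "pairing G n r' \<phi> = 0" using c r'J by (auto simp: Z_def)
        then have "pairing G n r' (N r) \<noteq> 0" using p pr[of r'] by auto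
        from tri[OF rJ r'J this] have "pairing G n r' \<phi> = pairing G n r \<phi>" using c cf[OF \<phi>] by simp
        then show False using p0 r(1) by (simp add: Z_def)
      qed
      have "U \<psi> \<subset> U \<phi>"
      proof
        show "U \<psi> \<subseteq> U \<phi>"
        proof
          fix q assume "q \<in> U \<psi>"
          then obtain r' where q: "q \<in> J" "r' \<in> Z \<psi>" "rk r' < rk q \<or> r' = q" by (auto simp: U_def)
          from low[OF q(2)] show "q \<in> U \<phi>"
          proof
            assume "rk r < rk r'"
            then have "rk r < rk q" using q(3) by auto
            then show ?thesis using q(1) r(1) by (auto simp: U_def)
          next
            assume "r' \<in> Z \<phi>"
            then show ?thesis using q(1,3) by (auto simp: U_def)
          qed
        qed
        have "r \<in> U \<phi>" using r(1) rJ by (auto simp: U_def)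
        moreover have "r \<notin> U \<psi>"
        proof
          assume "r \<in> U \<psi>"
          then obtain r' where r': "r' \<in> Z \<psi>" "rk r' < rk r \<or> r' = r" by (auto simp: U_def)
          have "pairing G n r \<psi> = 0" using pr[of r] m diag[OF rJ] by simp
          then have "r' \<noteq> r" using r'(1) by (auto simp: Z_def)
          then show False using low[OF r'(1)] r'(2) r(2)[of r'] by auto
        qed
        ultimately show "U \<psi> \<noteq> U \<phi>" by blast
      qed
      then have "card (U \<psi>) < card (U \<phi>)" using finJ by (intro psubset_card_mono) (auto simp: U_def)
      from less.hyps[OF this \<psi>] have "\<psi> \<in> A" .
      from add[OF this mN] show ?thesis by (rule cong) (simp add: \<psi>_def)
    qed
  qed
qed

section \<open>Generators of the representation ring\<close>

text \<open>
  The trivial character induces the permutation representation, which is not among the generators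
  but reduces to exterior powers of the reflection representation.
\<close>

lemma subset_char_trivial:
  assumes n: "n \<ge> 1" and \<chi>: "\<And>a. a \<in> carrier G \<Longrightarrow> \<chi> a = (1 :: 'k::field)" and p: "(f, \<sigma>) \<in> carrier (wreath G {..<n})"
  shows "subset_char n \<chi> True k (f, \<sigma>) = mat_trace (exterior_power_mat k (reflection_rep n \<sigma>)) +
    (if k = 0 then 0 else mat_trace (exterior_power_mat (k - 1) (reflection_rep n \<sigma>)))"
proof -
  have f: "f \<in> {..<n} \<rightarrow>\<^sub>E carrier G" and \<sigma>: "\<sigma> permutes {..<n}" using p by (auto simp: wreath_carrier_iff)
  have one: "(\<Prod>x\<in>S. \<chi> (f x)) = 1" if "S \<subseteq> {..<n}" for S
  proof (rule prod.neutral, rule ballI)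
    fix x assume "x \<in> S"
    then have "x \<in> {..<n}" using that by blast
    then show "\<chi> (f x) = 1" by (intro \<chi> PiE_mem[OF f])
  qed
  have eq: "subset_char n \<chi> True k (f, \<sigma>) = subset_char n (\<lambda>_. 1) True k (f, \<sigma>)"
    unfolding subset_char_def prod.case by (rule sum.cong[OF refl]) (simp add: one)
  show ?thesis
    by (rule trans[OF eq trans[OF trace_exterior_power_permutation[OF \<sigma>, symmetric] trace_exterior_power_reflection[OF n \<sigma>]]])
qed

theorem theorem4p2:
  fixes G :: "('g, 'm) monoid_scheme" and n :: nat
  assumes "comm_group G" and "finite (carrier G)" and "n \<ge> 1"
  shows "generate_ring (rep_ring TYPE('k::{alg_closed_field, field_char_0}) (wreath G {..<n}))
           (classes_of_exterior_powers (wreath G {..<n})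
              ((reflection_rep n :: _ \<Rightarrow> 'k mat) \<circ> snd) \<union>
            (\<Union>\<chi> \<in> {\<chi> \<in> characters G. \<exists>a\<in>carrier G. \<chi> a \<noteq> 1}.
               classes_of_exterior_powers (wreath G {..<n})
                 (wreath_induced_rep G n (\<chi> :: 'g \<Rightarrow> 'k))))
         = carrier (rep_ring TYPE('k) (wreath G {..<n}))"
proof -
  interpret G: comm_group G by fact
  have Gg: "group G" by (rule G.is_group)
  let ?W = "wreath G {..<n}"
  have W: "group ?W" by (rule group_wreath[OF Gg])
  have finW: "finite (carrier ?W)" by (rule finite_wreath[OF assms(2) finite_lessThan])
  define R :: "(nat \<Rightarrow> 'g) \<times> (nat \<Rightarrow> nat) \<Rightarrow> 'k mat" where "R = reflection_rep n \<circ> snd"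
  define Nt where "Nt = {\<chi> \<in> characters G. \<exists>a\<in>carrier G. \<chi> a \<noteq> (1 :: 'k)}"
  define E where "E \<rho> = insert \<rho> {exterior_power_rep k \<rho> | k. True}" for \<rho> :: "(nat \<Rightarrow> 'g) \<times> (nat \<Rightarrow> nat) \<Rightarrow> 'k mat"
  define \<Gamma> where "\<Gamma> = E R \<union> (\<Union>\<chi>\<in>Nt. E (wreath_induced_rep G n \<chi>))"
  have cl: "classes_of_exterior_powers ?W \<rho> = rep_class ?W ` E \<rho>" for \<rho> :: "(nat \<Rightarrow> 'g) \<times> (nat \<Rightarrow> nat) \<Rightarrow> 'k mat"
    unfolding classes_of_exterior_powers_def E_def by auto
  have rE: "E \<rho> \<subseteq> reps ?W" if "is_rep ?W d \<rho>" for \<rho> d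
    using that is_rep_exterior_power_rep[OF W that] unfolding E_def reps_def by blast
  have \<Gamma>: "\<Gamma> \<subseteq> reps ?W"
    using rE[OF is_rep_reflection[OF assms(3) Gg, where 'k = 'k]] rE[OF is_rep_wreath_induced[OF Gg assms(3)]]
    unfolding \<Gamma>_def R_def Nt_def by blast
  have "generate_ring (rep_ring TYPE('k) ?W) (rep_class ?W ` \<Gamma>) = carrier (rep_ring TYPE('k) ?W)"
  proof (rule rep_ring_generated[OF W finW \<Gamma>])
    fix A :: "((nat \<Rightarrow> 'g) \<times> (nat \<Rightarrow> nat) \<Rightarrow> 'k) set" and \<rho> :: "(nat \<Rightarrow> 'g) \<times> (nat \<Rightarrow> nat) \<Rightarrow> 'k mat"
    assume A: "character_subring ?W A" and gen: "\<And>\<gamma>. \<gamma> \<in> \<Gamma> \<Longrightarrow> (\<lambda>g. mat_trace (\<gamma> g)) \<in> A" and \<rho>: "\<rho> \<in> reps ?W"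
    interpret character_subring ?W A by fact
    show "(\<lambda>g. mat_trace (\<rho> g)) \<in> A"
    proof (rule virtual_characters_generated[OF assms(1,2) A])
      show "(\<lambda>g. mat_trace (\<rho> g)) \<in> virtual_characters ?W"
        unfolding virtual_characters_def using \<rho> by (intro CollectI exI[of _ "frag_of \<rho>"]) simp
      fix \<chi> :: "'g \<Rightarrow> 'k" and d assume \<chi>: "\<chi> \<in> characters G"
      show "subset_char n \<chi> True d \<in> A"
      proof (cases "\<chi> \<in> Nt")
        case True
        then have "(\<lambda>g. mat_trace (exterior_power_rep d (wreath_induced_rep G n \<chi>) g)) \<in> A"
          by (intro gen) (auto simp: \<Gamma>_def E_def)
        then show ?thesis
          by (rule cong) (simp add: exterior_power_rep_def trace_exterior_power_wreath_induced[OF Gg assms(3) \<chi>])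
      next
        case False
        then have \<chi>1: "\<chi> a = 1" if "a \<in> carrier G" for a using \<chi> that by (auto simp: Nt_def)
        have r: "(\<lambda>g. mat_trace (exterior_power_rep k R g)) \<in> A" for k by (intro gen) (auto simp: \<Gamma>_def E_def)
        have e: "(\<lambda>g. mat_trace (exterior_power_rep d R g) + (if d = 0 then 0 else mat_trace (exterior_power_rep (d - 1) R g))) \<in> A"
          using r[of d] add[OF r[of d] r[of "d - 1"]] by (cases "d = 0") simp_all
        show ?thesis
        proof (rule cong[OF e])
          fix g assume g: "g \<in> carrier ?W"
          obtain f \<sigma> where fs: "g = (f, \<sigma>)" by (cases g)
          show "subset_char n \<chi> True d g = mat_trace (exterior_power_rep d R g) + (if d = 0 then 0 else mat_trace (exterior_power_rep (d - 1) R g))"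
            using subset_char_trivial[OF assms(3) \<chi>1 g[unfolded fs]] by (simp add: fs R_def exterior_power_rep_def)
        qed
      qed
    qed
  qed
  moreover have "rep_class ?W ` \<Gamma> = classes_of_exterior_powers ?W (reflection_rep n \<circ> snd) \<union>
      (\<Union>\<chi>\<in>{\<chi> \<in> characters G. \<exists>a\<in>carrier G. \<chi> a \<noteq> 1}. classes_of_exterior_powers ?W (wreath_induced_rep G n \<chi>))"
    unfolding \<Gamma>_def cl Nt_def R_def image_Un image_UN ..
  ultimately show ?thesis by simp
qed

end
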